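(* Let $L(\lambda)$ be a regular $n\times n$ $\top$-alternating (i.e. $\top$-even or $\top$-odd) matrix pencil and let $\lambda_1,\dots,\lambda_\kappa$ denote the pairwise distinct eigenvalues of $L(\lambda)$ (finite or infinite), having the partial multiplicities $n_{i,1}\geq\dots\geq n_{i,g_i}>0$ for $i=1,\dots,\kappa$, respectively. Furthermore, let $r$ be a positive integer and let $\Phi$ be the map on $\mathbb C^{\lfloor 3r/2\rfloor n}$ defined in the context for the structure ($\top$-even or $\top$-odd) of $L$. Let (P) be the following property (for the index $i$): $$n_{i,r}=n_{i,r+1}=\cdots=n_{i,r+d}>n_{i,r+d+1}\quad\text{with } d \text{ odd}.$$ Then there exists a generic set $\mathcal G$ in $\mathbb C^{\lfloor 3r/2\rfloor n}$ such that, for all $E(\lambda)\in\Phi(\mathcal G)$, the perturbed pencil $L+E$ is regular and the partial multiplicities of $L+E$ at $\lambda_i$, for $i=1,\dots,\kappa$, are the following. If $L$ is $\top$-even: - $\lambda_i=0$: $(n_{i,r+1}+1,n_{i,r+2},\dots,n_{i,g_i})$ if $n_{i,r+1}$ is odd and (P) holds; $(n_{i,r+1},n_{i,r+2},\dots,n_{i,g_i})$ otherwise. - $\lambda_i=\infty$ and $r$ even: $(n_{i,r+1}+1,n_{i,r+2},\dots,n_{i,g_i})$ if $n_{i,r+1}$ is even and (P) holds; $(n_{i,r+1},n_{i,r+2},\dots,n_{i,g_i})$ otherwise. - $\lambda_i=\infty$ and $r$ odd: $(n_{i,r+1}+1,n_{i,r+2},\dots,n_{i,g_i},1)$ if $n_{i,r+1}$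 is even and (P) holds; $(n_{i,r+1},n_{i,r+2},\dots,n_{i,g_i},1)$ otherwise. - $\lambda_i\in\mathbb C\setminus\{0\}$: $(n_{i,r+1},n_{i,r+2},\dots,n_{i,g_i})$. If $L$ is $\top$-odd: - $\lambda_i=0$ and $r$ even: $(n_{i,r+1}+1,n_{i,r+2},\dots,n_{i,g_i})$ if $n_{i,r+1}$ is even and (P) holds; $(n_{i,r+1},n_{i,r+2},\dots,n_{i,g_i})$ otherwise. - $\lambda_i=0$ and $r$ odd: $(n_{i,r+1}+1,n_{i,r+2},\dots,n_{i,g_i},1)$ if $n_{i,r+1}$ is even and (P) holds; $(n_{i,r+1},n_{i,r+2},\dots,n_{i,g_i},1)$ otherwise. - $\lambda_i=\infty$: $(n_{i,r+1}+1,n_{i,r+2},\dots,n_{i,g_i})$ if $n_{i,r+1}$ is odd and (P) holds; $(n_{i,r+1},n_{i,r+2},\dots,n_{i,g_i})$ otherwise. - $\lambda_i\in\mathbb C\setminus\{0\}$: $(n_{i,r+1},n_{i,r+2},\dots,n_{i,g_i})$. In particular, if $r\geq g_i$ then $\lambda_i$ is not an eigenvalue of $L+E$. Furthermore, all eigenvalues of $L+E$ that are different from those of $L$ are simple.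
   Context: A matrix pencil $L(\lambda)=A+\lambda B$ with $A,B\in\mathbb C^{n\times n}$ is $\top$-even if $A^\top=A$, $B^\top=-B$, and $\top$-odd if $A^\top=-A$, $B^\top=B$; it is regular if $\det L(\lambda)\not\equiv 0$. For a regular pencil, a finite eigenvalue is a root of $\det L(\lambda)$; $\infty$ is an eigenvalue if $0$ is an eigenvalue of the reversal $\operatorname{rev}L(\lambda)=B+\lambda A$. The partial multiplicities of a regular pencil at an eigenvalue are the sizes of the corresponding Jordan blocks in its Weierstrass canonical form (at $\infty$: the partial multiplicities of $\operatorname{rev}L$ at $0$); the algebraic multiplicity is their sum, and an eigenvalue is simple if its algebraic multiplicity is $1$. In property (P), $n_{i,j}$ is read as $0$ for $j>g_i$. The map $\Phi$: put $s=\lfloor r/2\rfloor$. A point of $\mathbb C^{\lfloor 3r/2\rfloor n}$ consists of vectors $v_1,\dots,v_s,\gamma_1,\dots,\gamma_s,\delta_1,\dots,\delta_s\in\mathbb C^n$ and, if $r$ is odd, one additional vector $u\in\mathbb C^n$. With $w_j(\lambda)=\gamma_j+\lambda\delta_j$, it is mapped by $\Phi$ to the following pencil. In the $\top$-even case: $\sum_{j=1}^s\big(v_jw_j(\lambda)^\top+w_j(-\lambda)v_j^\top\big)$ if $r$ is even, and $uu^\top+\sum_{j=1}^s\big(v_jw_j(\lambda)^\top+w_j(-\lambda)v_j^\top\big)$ if $r$ is odd. In the $\top$-odd case: $\sum_{j=1}^s\big(v_jw_j(\lambda)^\top-w_j(-\lambda)v_j^\top\big)$ if $r$ is even, and $\lambda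 uu^\top+\sum_{j=1}^s\big(v_jw_j(\lambda)^\top-w_j(-\lambda)v_j^\top\big)$ if $r$ is odd. Here $w_j(\lambda)^\top=\gamma_j^\top+\lambda\delta_j^\top$. Genericity: a subset of $\mathbb C^m$ is generic if its complement is contained in a proper algebraic set, i.e., in a set of common zeros of finitely many complex polynomials in $m$ variables that is not all of $\mathbb C^m$.
   Formalization: At infinity (T-even) or 0 (T-odd), where the stated claims fail: if g_i<r and n, r differ in parity, the list is (1) for n odd and empty for n even instead of the tabulated one; and "r>=g_i implies not an eigenvalue" is not claimed there for n odd. *)

theory Defs
  imports
    "Jordan_Normal_Form.Jordan_Normal_Form"
    "HOL-Library.Poly_Mapping"
begin

subsection \<open>Matrix pencils\<close>

text \<open>A pencil is represented by its polynomial matrix \<open>A + \<lambda>B\<close>.\<close>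

definition pencil :: "complex mat \<Rightarrow> complex mat \<Rightarrow> complex poly mat" where
  "pencil A B = map_mat (\<lambda>a. [:a:]) A + map_mat (\<lambda>b. [:0, b:]) B"

definition rev_pencil :: "complex poly mat \<Rightarrow> complex poly mat" where
  "rev_pencil L = map_mat (\<lambda>p. [:coeff p 1, coeff p 0:]) L"

definition regular_pencil :: "complex poly mat \<Rightarrow> bool" where
  "regular_pencil L \<longleftrightarrow> det L \<noteq> 0"

datatype alternation = T_even | T_odd

definition alternating_pencil :: "alternation \<Rightarrow> nat \<Rightarrow> complex poly mat \<Rightarrow> bool" where
  "alternating_pencil \<sigma> n L \<longleftrightarrow>
     (\<exists>A \<in> carrier_mat n n. \<exists>B \<in> carrier_mat n n. L = pencil A B \<and>
        (case \<sigma> of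
           T_even \<Rightarrow> transpose_mat A = A \<and> transpose_mat B = - B
         | T_odd \<Rightarrow> transpose_mat A = - A \<and> transpose_mat B = B))"

datatype eigval = Fin complex | Infty

fun pencil_eigenvalue :: "complex poly mat \<Rightarrow> eigval \<Rightarrow> bool" where
  "pencil_eigenvalue L (Fin \<mu>) \<longleftrightarrow> poly (det L) \<mu> = 0"
| "pencil_eigenvalue L Infty \<longleftrightarrow> poly (det (rev_pencil L)) 0 = 0"


subsection \<open>Weierstrass canonical form and partial multiplicities\<close>

text \<open>The block diagonal pencil \<open>diag (\<lambda>I - J, \<lambda>N - I)\<close>, where \<open>J\<close> is the Jordan matrix with
  the (size, eigenvalue) pairs \<open>js\<close> and \<open>N\<close> the nilpotent Jordan matrix with block sizes \<open>ks\<close>.\<close>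

definition weierstrass_pencil :: "(nat \<times> complex) list \<Rightarrow> nat list \<Rightarrow> complex poly mat" where
  "weierstrass_pencil js ks = diag_block_mat
     [pencil (- jordan_matrix js) (1\<^sub>m (sum_list (map fst js))),
      pencil (- 1\<^sub>m (sum_list ks)) (jordan_matrix (map (\<lambda>k. (k, 0)) ks))]"

definition weierstrass_form ::
    "complex poly mat \<Rightarrow> (nat \<times> complex) list \<Rightarrow> nat list \<Rightarrow> bool" where
  "weierstrass_form L js ks \<longleftrightarrow>
     0 \<notin> fst ` set js \<and> 0 \<notin> set ks \<and>
     (\<exists>P \<in> carrier_mat (dim_row L) (dim_row L). \<exists>Q \<in> carrier_mat (dim_col L) (dim_col L).
        invertible_mat P \<and> invertible_mat Q \<and>
        map_mat (\<lambda>a. [:a:]) P * L * map_mat (\<lambda>a. [:a:]) Q = weierstrass_pencil js ks)"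

text \<open>Partial multiplicities are listed in non-increasing order; the list is well defined for a
  regular pencil, because its Weierstrass form exists and is unique up to the order of the blocks.
  It is empty iff the point is not an eigenvalue.\<close>

definition finite_partial_mults :: "complex poly mat \<Rightarrow> complex \<Rightarrow> nat list" where
  "finite_partial_mults L \<mu> = (THE ns. \<exists>js ks. weierstrass_form L js ks \<and>
     ns = rev (sort (map fst (filter (\<lambda>(k, a). a = \<mu>) js))))"

fun partial_mults :: "complex poly mat \<Rightarrow> eigval \<Rightarrow> nat list" where
  "partial_mults L (Fin \<mu>) = finite_partial_mults L \<mu>"
| "partial_mults L Infty = finite_partial_mults (rev_pencil L) 0"

definition simple_eigenvalue :: "complex poly mat \<Rightarrow> eigval \<Rightarrow> bool" where
  "simple_eigenvalue L z \<longleftrightarrow> pencil_eigenvalue L z \<and> sum_list (partial_mults L z) = 1"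


subsection \<open>The parametrization of the perturbations\<close>

definition block :: "nat \<Rightarrow> nat \<Rightarrow> complex vec \<Rightarrow> complex vec" where
  "block n k x = vec n (\<lambda>a. x $ (k * n + a))"

text \<open>With \<open>s = r div 2\<close>, the point \<open>x\<close> is the concatenation of
  \<open>v\<^sub>1, \<dots>, v\<^sub>s, \<gamma>\<^sub>1, \<dots>, \<gamma>\<^sub>s, \<delta>\<^sub>1, \<dots>, \<delta>\<^sub>s\<close> and, if \<open>r\<close> is odd, \<open>u\<close>; indices start at 0 here.
  The entries of \<open>w\<^sub>j(\<lambda>)\<close> and \<open>w\<^sub>j(-\<lambda>)\<close> are \<open>[:\<gamma> $ a, \<delta> $ a:]\<close> and \<open>[:\<gamma> $ a, - \<delta> $ a:]\<close>.\<close>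

definition Phi :: "alternation \<Rightarrow> nat \<Rightarrow> nat \<Rightarrow> complex vec \<Rightarrow> complex poly mat" where
  "Phi \<sigma> n r x =
     (let s = r div 2;
          v = (\<lambda>j. block n j x);
          \<gamma> = (\<lambda>j. block n (s + j) x);
          \<delta> = (\<lambda>j. block n (2 * s + j) x);
          u = block n (3 * s) x;
          w = (\<lambda>j a. [:\<gamma> j $ a, \<delta> j $ a:]);
          w_neg = (\<lambda>j a. [:\<gamma> j $ a, - (\<delta> j $ a):])
      in mat n n (\<lambda>(a, b).
           case \<sigma> of
             T_even \<Rightarrow> (if odd r then [:u $ a * u $ b:] else 0) +
               (\<Sum>j<s. [:v j $ a:] * w j b + w_neg j a * [:v j $ b:])
           | T_odd \<Rightarrow> (if odd r then [:0, u $ a * u $ b:] else 0) +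
               (\<Sum>j<s. [:v j $ a:] * w j b - w_neg j a * [:v j $ b:])))"


subsection \<open>Generic sets\<close>

text \<open>Polynomials in the variables \<open>X\<^sub>0, X\<^sub>1, \<dots>\<close> are finitely supported maps from
  monomials (finitely supported exponent maps) to coefficients.\<close>

type_synonym cmpoly = "(nat \<Rightarrow>\<^sub>0 nat) \<Rightarrow>\<^sub>0 complex"

definition cmpoly_in_vars :: "nat \<Rightarrow> cmpoly \<Rightarrow> bool" where
  "cmpoly_in_vars m p \<longleftrightarrow> (\<forall>e \<in> Poly_Mapping.keys p. Poly_Mapping.keys e \<subseteq> {..<m})"

definition cmpoly_eval :: "cmpoly \<Rightarrow> complex vec \<Rightarrow> complex" where
  "cmpoly_eval p x = (\<Sum>e \<in> Poly_Mapping.keys p. Poly_Mapping.lookup p e *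
     (\<Prod>i \<in> Poly_Mapping.keys e. (x $ i) ^ Poly_Mapping.lookup e i))"

definition algebraic_set :: "nat \<Rightarrow> complex vec set \<Rightarrow> bool" where
  "algebraic_set m Z \<longleftrightarrow> (\<exists>S. finite S \<and> (\<forall>p \<in> S. cmpoly_in_vars m p) \<and>
     Z = {x \<in> carrier_vec m. \<forall>p \<in> S. cmpoly_eval p x = 0})"

definition generic :: "nat \<Rightarrow> complex vec set \<Rightarrow> bool" where
  "generic m G \<longleftrightarrow> G \<subseteq> carrier_vec m \<and>
     (\<exists>Z. algebraic_set m Z \<and> Z \<noteq> carrier_vec m \<and> carrier_vec m - G \<subseteq> Z)"


subsection \<open>The partial multiplicities after perturbation\<close>

text \<open>\<open>mult_at ns j\<close> is the \<open>j\<close>-th partial multiplicity (counted from 1), read as 0 beyond the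
  end of the list.\<close>

definition mult_at :: "nat list \<Rightarrow> nat \<Rightarrow> nat" where
  "mult_at ns j = (if 1 \<le> j \<and> j \<le> length ns then ns ! (j - 1) else 0)"

definition property_P :: "nat list \<Rightarrow> nat \<Rightarrow> bool" where
  "property_P ns r \<longleftrightarrow> (\<exists>d. odd d \<and> (\<forall>j \<in> {r..r + d}. mult_at ns j = mult_at ns r) \<and>
     mult_at ns (r + d) > mult_at ns (r + d + 1))"

definition remaining_mults :: "bool \<Rightarrow> nat list \<Rightarrow> nat \<Rightarrow> nat list" where
  "remaining_mults parity ns r =
     (if parity \<and> property_P ns r then (mult_at ns (r + 1) + 1) # drop (r + 1) ns
      else drop r ns)"

fun perturbed_mults :: "alternation \<Rightarrow> nat \<Rightarrow> eigval \<Rightarrow> nat list \<Rightarrow> nat list" where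
  "perturbed_mults T_even r (Fin \<mu>) ns =
     (if \<mu> = 0 then remaining_mults (odd (mult_at ns (r + 1))) ns r else drop r ns)"
| "perturbed_mults T_even r Infty ns =
     (if even r then remaining_mults (even (mult_at ns (r + 1))) ns r
      else remaining_mults (even (mult_at ns (r + 1))) ns r @ [1])"
| "perturbed_mults T_odd r (Fin \<mu>) ns =
     (if \<mu> = 0 then
        (if even r then remaining_mults (even (mult_at ns (r + 1))) ns r
         else remaining_mults (even (mult_at ns (r + 1))) ns r @ [1])
      else drop r ns)"
| "perturbed_mults T_odd r Infty ns = remaining_mults (odd (mult_at ns (r + 1))) ns r"

text \<open>The point at which an alternating pencil evaluates to its skew-symmetric coefficient. If the
  size \<open>n\<close> is odd, that coefficient is singular, so \<open>skew_point \<sigma>\<close> is an eigenvalue of every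
  alternating pencil, however large the rank of a structured perturbation. In general the number
  of partial multiplicities at \<open>skew_point \<sigma>\<close> has the same parity as \<open>n\<close>. Hence the formulas of
  \<open>perturbed_mults\<close> cannot hold at this point when there are fewer than \<open>r\<close> partial
  multiplicities and \<open>n\<close> and \<open>r\<close> have different parity.\<close>

fun skew_point :: "alternation \<Rightarrow> eigval" where
  "skew_point T_even = Infty"
| "skew_point T_odd = Fin 0"

end

theory Submission
 imports Defs "Jordan_Normal_Form.Jordan_Normal_Form_Existence"
begin

text \<open>Fix a point and let \<open>\<nu> k\<close> be the number of partial multiplicities of \<open>L\<close> at that point that are at least
\<open>k\<close> (\<open>blocks_ge\<close>). These numbers determine the list, and their sum over \<open>k\<close> is the order of \<open>det L\<close> there. A
perturbation of rank at most \<open>r\<close> lowers each of them by at most \<open>r\<close> (\<open>blocks_ge_perturbed\<close>), because one linear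
functional destroys at most one chain. So the order of the perturbed determinant is at least the sum of
the \<open>\<nu> k - r\<close>, and whenever this order is attained, the perturbed numbers are \<open>\<nu> k - r\<close>.

At a point \<open>\<mu> \<noteq> 0\<close> this is the whole story. At \<open>0\<close> an alternating pencil obeys a parity constraint
(\<open>alternating_parity\<close>): for the multiplicities \<open>k\<close> of one parity, the number of those equal to \<open>k\<close> is even; in
the \<open>\<top>\<close>-odd case, moreover, the number of all of them has the parity of \<open>n\<close>. Thus \<open>\<nu>\<close> comes in pairs
\<open>\<nu> k\<close>, \<open>\<nu> (k + 1)\<close> of equal parity, and where \<open>\<nu> k - r\<close>, \<open>\<nu> (k + 1) - r\<close> would violate this, the least possible
repair adds one (\<open>target\<close>). This happens if \<open>\<nu> (k + 1) < r < \<nu> k\<close> with \<open>\<nu> k - r\<close> odd, which is property (P), and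
in the first entry of the \<open>\<top>\<close>-odd case, which is the additional multiplicity 1. Parity alone does not tell which
member of a pair is repaired. That it is the second one is forced by an entry of the adjugate of small order,
since the largest partial multiplicity is the difference of the orders of the determinant and of the adjugate
(\<open>blocks_ge_adj\<close>). The point \<open>\<infinity>\<close> is the point \<open>0\<close> of the reversed pencil, which is alternating of the
other kind and which is perturbed by the same family with \<open>\<gamma>\<^sub>j\<close> and \<open>\<delta>\<^sub>j\<close> exchanged.

All these are upper semicontinuity statements: the least order and a nonvanishing adjugate coefficient are
conditions of the form ``a polynomial in the parameters does not vanish'' (\<open>meets_open\<close>). Hence a generic set
exists as soon as, for each point separately, one perturbation does what is claimed. Such perturbations are
found for \<open>r = 1\<close> and \<open>r = 2\<close> from the formulas for the determinant and the adjugate after an update of low rank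
(\<open>plain_step\<close>, \<open>zero_step\<close>, \<open>pair_zero_step\<close>), and they are composed, since \<open>target\<close> for \<open>r + 2\<close> is \<open>target\<close>
for \<open>r\<close> followed by \<open>target\<close> for 2.

The new eigenvalues are treated by the same induction. Moving \<open>w\<^sub>j\<close> in the direction of \<open>v\<^sub>j\<close> changes
\<open>det (L + E)\<close> along a line \<open>q\<^sub>0 + t q\<^sub>1\<close> of polynomials, where \<open>q\<^sub>1\<close> depends on \<open>v\<^sub>j\<close> alone. If the two ends have
no common root away from the prescribed points, only finitely many members of this line have a multiple root
there (\<open>multiple_roots_in_family\<close>). So one perturbation has only simple new eigenvalues (\<open>good_exists\<close>). After
division by the prescribed factors, the determinant has constant degree, and the nonvanishing of a
discriminant makes simplicity generic as well (\<open>good_generic\<close>).\<close>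

abbreviation Mat :: "nat => 'a mat set" where
 "Mat n \<equiv> carrier_mat n n"

abbreviation Vec :: "nat => 'a vec set" where
 "Vec n \<equiv> carrier_vec n"

section \<open>Rank-one updates of determinant and adjugate\<close>

definition outer :: "'a :: semiring_1 vec => 'a vec => 'a mat" where
 "outer u v = mat (dim_vec u) (dim_vec v) (\<lambda>(i,j). u $ i * v $ j)"

lemma outer_carrier [simp]:
 "u \<in> Vec n ==> v \<in> carrier_vec m ==> outer u v \<in> carrier_mat n m"
 unfolding outer_def by auto

lemma outer_index [simp]:
 "i < dim_vec u ==> j < dim_vec v ==> outer u v $$ (i,j) = u $ i * v $ j"
 "dim_row (outer u v) = dim_vec u" "dim_col (outer u v) = dim_vec v"
 unfolding outer_def by auto

lemma outer_mult_vec: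
 fixes u :: "'a :: comm_ring_1 vec"
 assumes "u \<in> Vec n" "v \<in> Vec n" "x \<in> Vec n"
 shows "outer u v *\<^sub>v x = (v \<bullet> x) \<cdot>\<^sub>v u"
 using assms by (intro eq_vecI) (auto simp: scalar_prod_def sum_distrib_left sum_distrib_right
   mult.assoc mult.left_commute intro!: sum.cong)

lemma mult_outer:
 fixes u :: "'a :: comm_ring_1 vec"
 assumes "A \<in> Mat n" "u \<in> Vec n" "v \<in> Vec n"
 shows "A * outer u v = outer (A *\<^sub>v u) v"
 using assms by (intro eq_matI) (auto simp: scalar_prod_def sum_distrib_left sum_distrib_right
   mult.assoc intro!: sum.cong)

lemma outer_mult:
 fixes u :: "'a :: comm_ring_1 vec"
 assumes "A \<in> Mat n" "u \<in> Vec n" "v \<in> Vec n"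
 shows "outer u v * A = outer u (A\<^sup>T *\<^sub>v v)"
 using assms by (intro eq_matI) (auto simp: scalar_prod_def sum_distrib_left sum_distrib_right
   mult.assoc mult.commute mult.left_commute intro!: sum.cong)

lemma outer_mult_outer:
 fixes u :: "'a :: comm_ring_1 vec"
 assumes "u \<in> Vec n" "v \<in> Vec n" "x \<in> Vec n" "y \<in> Vec n"
 shows "outer u v * outer x y = (v \<bullet> x) \<cdot>\<^sub>m outer u y"
 using assms by (intro eq_matI) (auto simp: scalar_prod_def sum_distrib_left sum_distrib_right
   mult.assoc mult.commute mult.left_commute intro!: sum.cong)

lemma scalar_prod_mult_mat_vec:
 fixes u :: "'a :: comm_ring_1 vec"
 assumes "A \<in> Mat n" "u \<in> Vec n" "v \<in> Vec n"
 shows "v \<bullet> (A *\<^sub>v u) = (A\<^sup>T *\<^sub>v v) \<bullet> u"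
 using transpose_vec_mult_scalar[OF assms(1,2,3)] assms
 by simp

lemma adj_carrier [simp]: "A \<in> Mat n ==> adj_mat A \<in> Mat n"
 by (rule adj_mat(1))

lemma smult_one_mult_mat_vec:
 fixes u :: "'a :: comm_ring_1 vec"
 assumes "u \<in> Vec n"
 shows "(c \<cdot>\<^sub>m 1\<^sub>m n) *\<^sub>v u = c \<cdot>\<^sub>v u"
proof (rule eq_vecI)
 fix i assume "i < dim_vec (c \<cdot>\<^sub>v u)"
 hence i: "i < n" using assms by simp
 have "((c \<cdot>\<^sub>m 1\<^sub>m n) *\<^sub>v u) $ i = (\<Sum>j = 0..<n. (if i = j then c else 0) * u $ j)"
  using i assms by (auto simp: scalar_prod_def intro!: sum.cong)
 also have "\<dots> = (\<Sum>j = 0..<n. if j = i then c * u $ i else 0)"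
  by (intro sum.cong) auto
 finally show "((c \<cdot>\<^sub>m 1\<^sub>m n) *\<^sub>v u) $ i = (c \<cdot>\<^sub>v u) $ i"
  using i assms by simp
qed (use assms in auto)

lemma dim_adj_mat [simp]: "dim_row (adj_mat A) = dim_row A" "dim_col (adj_mat A) = dim_col A"
 unfolding adj_mat_def by auto

lemma mult_mat_vec_sum:
 "A \<in> carrier_mat n m ==> x \<in> carrier_vec m ==> i < n ==>
  (A *\<^sub>v x) $ i = (\<Sum>j<m. A $$ (i,j) * x $ j)"
 by (auto simp: scalar_prod_def atLeast0LessThan)

lemma mult_mat_sum:
 "A \<in> carrier_mat n m ==> B \<in> carrier_mat m k ==> i < n ==> j < k ==>
  (A * B) $$ (i,j) = (\<Sum>l<m. A $$ (i,l) * B $$ (l,j))"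
 by (auto simp: scalar_prod_def atLeast0LessThan)

lemma mult_mat_smult_vec:
 fixes A :: "'a :: comm_ring_1 mat"
 assumes "A \<in> carrier_mat n m" "x \<in> carrier_vec m"
 shows "A *\<^sub>v (c \<cdot>\<^sub>v x) = c \<cdot>\<^sub>v (A *\<^sub>v x)"
 using assms by (intro eq_vecI) (auto simp: scalar_prod_def sum_distrib_left mult_ac intro!: sum.cong)

lemma mult_square_carrier [simp]:
 "A \<in> Mat n ==> B \<in> Mat n ==> A * B \<in> Mat n"
 by (rule mult_carrier_mat)

lemma mult_vec_square_carrier [simp]:
 "A \<in> Mat n ==> x \<in> Vec n ==> A *\<^sub>v x \<in> Vec n"
 by (rule mult_mat_vec_carrier)

lemma mat_mult_cancel_left:
 fixes A :: "'a :: idom mat"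
 assumes A: "A \<in> Mat n" and D: "det A ~= 0"
  and X: "X \<in> carrier_mat n m" and Y: "Y \<in> carrier_mat n m" and eq: "A * X = A * Y"
 shows "X = Y"
proof -
 have *: "det A \<cdot>\<^sub>m Z = adj_mat A * (A * Z)" if "Z \<in> carrier_mat n m" for Z
  using that A by (simp flip: assoc_mult_mat[of _ n n _ n _ m] add: adj_mat(3)[OF A] mult_smult_assoc_mat[of _ n n _ m])
 have "det A \<cdot>\<^sub>m X = det A \<cdot>\<^sub>m Y"
  using *[OF X] *[OF Y] eq by simp
 hence "(det A \<cdot>\<^sub>m X) $$ (i,j) = (det A \<cdot>\<^sub>m Y) $$ (i,j)" for i j by simp
 hence "X $$ (i,j) = Y $$ (i,j)" if "i < n" "j < m" for i j
  using X Y D that by (metis carrier_matD index_smult_mat(1) mult_cancel_left)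
 thus ?thesis using X Y by (intro eq_matI) auto
qed

text \<open>The bordered matrix with blocks \<open>A\<close>, \<open>u\<close>, \<open>- v\<close>, \<open>1\<close> is reduced once by clearing its last
 row with a unipotent factor and once by clearing its last column with the adjugate.\<close>

lemma det_rank_one_update:
 fixes A :: "'a :: idom mat"
 assumes A: "A \<in> Mat n" and D: "det A ~= 0"
  and u: "u \<in> Vec n" and v: "v \<in> Vec n"
 shows "det (A + outer u v) = det A + v \<bullet> (adj_mat A *\<^sub>v u)"
proof -
 define D' where "D' = det A"
 define w where "w = adj_mat A *\<^sub>v u"
 define cu where "cu = mat n 1 (\<lambda>(i,j). u $ i)"
 define cw where "cw = mat n 1 (\<lambda>(i,j). - w $ i)"
 define rv where "rv = mat 1 n (\<lambda>(i,j). v $ j)"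
 define rv' where "rv' = mat 1 n (\<lambda>(i,j). - v $ j)"
 have w: "w \<in> Vec n" unfolding w_def using A u by (metis adj_carrier mult_mat_vec_carrier)
 have bc [simp]: "cu \<in> carrier_mat n 1" "cw \<in> carrier_mat n 1" "rv \<in> carrier_mat 1 n"
  "rv' \<in> carrier_mat 1 n" unfolding cu_def cw_def rv_def rv'_def by auto
 have [simp]: "cu \<in> carrier_mat n (Suc 0)" "cw \<in> carrier_mat n (Suc 0)" "rv \<in> carrier_mat (Suc 0) n"
  "rv' \<in> carrier_mat (Suc 0) n" unfolding cu_def cw_def rv_def rv'_def by auto
 note A [simp] carrier_matD[OF A, simp]
 define F where "F = four_block_mat A cu rv' (1\<^sub>m 1)"
 have F: "F \<in> carrier_mat (n+1) (n+1)" unfolding F_def by (intro four_block_carrier_mat) auto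
 define G1 where "G1 = four_block_mat (1\<^sub>m n) (0\<^sub>m n 1) rv (1\<^sub>m 1)"
 have G1: "G1 \<in> carrier_mat (n+1) (n+1)" unfolding G1_def by (intro four_block_carrier_mat) auto
 define G2 where "G2 = four_block_mat (D' \<cdot>\<^sub>m 1\<^sub>m n) cw (0\<^sub>m 1 n) (D' \<cdot>\<^sub>m 1\<^sub>m 1)"
 have G2: "G2 \<in> carrier_mat (n+1) (n+1)" unfolding G2_def by (intro four_block_carrier_mat) auto
 have Aw: "A *\<^sub>v w = D' \<cdot>\<^sub>v u"
  using A u unfolding w_def D'_def
  by (simp flip: assoc_mult_mat_vec[of A n n _ n] add: adj_mat(2)[OF A] smult_one_mult_mat_vec)
 have 1: "F * G1 = four_block_mat (A + outer u v) cu (0\<^sub>m 1 n) (1\<^sub>m 1)"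
 proof -
  have a: "A * 1\<^sub>m n + cu * rv = A + outer u v"
   unfolding right_mult_one_mat[OF A]
   using A u v by (intro eq_matI) (auto simp: cu_def rv_def scalar_prod_def)
  have b: "A * 0\<^sub>m n 1 + cu * 1\<^sub>m 1 = cu"
   unfolding right_mult_zero_mat[OF A] by (intro eq_matI) (auto simp: cu_def)
  have c: "rv' * 1\<^sub>m n + 1\<^sub>m 1 * rv = 0\<^sub>m 1 n"
   unfolding right_mult_one_mat[OF bc(4)] left_mult_one_mat[OF bc(3)]
   by (intro eq_matI) (auto simp: rv'_def rv_def)
  have d: "rv' * 0\<^sub>m n 1 + 1\<^sub>m 1 * 1\<^sub>m 1 = (1\<^sub>m 1 :: 'a mat)"
   unfolding right_mult_zero_mat[OF bc(4)] by auto
  show ?thesis unfolding F_def G1_def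
   by (subst mult_four_block_mat[of _ n n _ 1 _ 1 _ _ n _ 1])
    (use a b c d in \<open>simp_all only: A one_carrier_mat zero_carrier_mat bc(1) bc(3) bc(4)\<close>)
 qed
 have cA: "A * cw = - (D' \<cdot>\<^sub>m cu)"
 proof (rule eq_matI)
  fix i j assume "i < dim_row (- (D' \<cdot>\<^sub>m cu))" "j < dim_col (- (D' \<cdot>\<^sub>m cu))"
  hence i: "i < n" "j = 0" unfolding cu_def by auto
  have "(A *\<^sub>v w) $ i = D' * u $ i" using Aw u i by simp
  thus "(A * cw) $$ (i,j) = (- (D' \<cdot>\<^sub>m cu)) $$ (i,j)"
   using A w u i by (auto simp: cw_def cu_def scalar_prod_def sum_negf)
 qed (use A in \<open>auto simp: cw_def cu_def\<close>)
 have 2: "F * G2 = four_block_mat (D' \<cdot>\<^sub>m A) (0\<^sub>m n 1) (D' \<cdot>\<^sub>m rv') ((v \<bullet> w + D') \<cdot>\<^sub>m 1\<^sub>m 1)"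
  unfolding F_def G2_def
 proof (subst mult_four_block_mat[of _ n n _ 1 _ 1 _ _ n _ 1], simp_all add: cA)
  have a: "A * (D' \<cdot>\<^sub>m 1\<^sub>m n) + cu * 0\<^sub>m (Suc 0) n = D' \<cdot>\<^sub>m A"
   using A by (intro eq_matI) (auto simp: cu_def scalar_prod_def one_mat_def sum.delta' sum.delta
     if_distrib cong: if_cong)
  have b: "- (D' \<cdot>\<^sub>m cu) + cu * (D' \<cdot>\<^sub>m 1\<^sub>m (Suc 0)) = 0\<^sub>m n (Suc 0)"
   by (intro eq_matI) (auto simp: cu_def scalar_prod_def)
  have c: "rv' * (D' \<cdot>\<^sub>m 1\<^sub>m n) + 0\<^sub>m (Suc 0) n = D' \<cdot>\<^sub>m rv'"
   by (intro eq_matI) (auto simp: rv'_def scalar_prod_def one_mat_def sum.delta' sum.delta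
     if_distrib cong: if_cong)
  have d: "rv' * cw + D' \<cdot>\<^sub>m 1\<^sub>m (Suc 0) = (v \<bullet> w + D') \<cdot>\<^sub>m 1\<^sub>m (Suc 0)"
   using v w by (intro eq_matI) (auto simp: rv'_def cw_def scalar_prod_def)
  show "four_block_mat (A * (D' \<cdot>\<^sub>m 1\<^sub>m n) + cu * 0\<^sub>m (Suc 0) n)
   (- (D' \<cdot>\<^sub>m cu) + cu * (D' \<cdot>\<^sub>m 1\<^sub>m (Suc 0))) (rv' * (D' \<cdot>\<^sub>m 1\<^sub>m n) + 0\<^sub>m (Suc 0) n)
   (rv' * cw + D' \<cdot>\<^sub>m 1\<^sub>m (Suc 0)) =
  four_block_mat (D' \<cdot>\<^sub>m A) (0\<^sub>m n (Suc 0)) (D' \<cdot>\<^sub>m rv') ((v \<bullet> w + D') \<cdot>\<^sub>m 1\<^sub>m (Suc 0))"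
   unfolding a b c d ..
 qed
 have d1: "det F * det G1 = det (A + outer u v)"
  unfolding det_mult[OF F G1, symmetric] 1
  by (subst det_four_block_mat_lower_left_zero[of _ n _ 1]) (use A u v in auto)
 have g1: "det G1 = 1" unfolding G1_def
  by (subst det_four_block_mat_upper_right_zero[of _ n _ 1]) auto
 have d2: "det F * det G2 = D' ^ n * D' * (v \<bullet> w + D')"
  unfolding det_mult[OF F G2, symmetric] 2
  by (subst det_four_block_mat_upper_right_zero[of _ n _ 1]) (use A D'_def in auto)
 have g2: "det G2 = D' ^ n * D'" unfolding G2_def
  by (subst det_four_block_mat_lower_left_zero[of _ n _ 1]) auto
 have "D' ~= 0" using D D'_def by simp
 with d2 g2 have "det F = v \<bullet> w + D'" by (auto simp: mult.commute)
 with d1 g1 show ?thesis unfolding w_def D'_def by (simp add: add.commute)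
qed

text \<open>Both sides agree after multiplication by \<open>A + uv\<^sup>T\<close>. The scalar \<open>det A\<close> is kept on the left, so that
 the identity makes sense over polynomials and orders can be read off from it.\<close>

lemma adj_rank_one_update:
 fixes A :: "'a :: idom mat"
 assumes A: "A \<in> Mat n" and D: "det A ~= 0"
  and u: "u \<in> Vec n" and v: "v \<in> Vec n" and D': "det (A + outer u v) ~= 0"
 shows "det A \<cdot>\<^sub>m adj_mat (A + outer u v) =
  det (A + outer u v) \<cdot>\<^sub>m adj_mat A - outer (adj_mat A *\<^sub>v u) ((adj_mat A)\<^sup>T *\<^sub>v v)"
proof -
 let ?J = "adj_mat A" let ?A' = "A + outer u v"
 define z where "z = ?J\<^sup>T *\<^sub>v v"
 define w where "w = ?J *\<^sub>v u"
 define d where "d = det A"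
 define d' where "d' = det ?A'"
 have J: "?J \<in> Mat n" using A by simp
 have A': "?A' \<in> Mat n" using A u v by auto
 have z: "z \<in> Vec n" and w: "w \<in> Vec n"
  unfolding z_def w_def using J u v by (auto intro!: mult_mat_vec_carrier)
 have vw: "v \<bullet> w = d' - d"
  unfolding d'_def d_def w_def det_rank_one_update[OF A D u v] by simp
 have Aw: "A *\<^sub>v w = d \<cdot>\<^sub>v u"
  using A u unfolding w_def d_def
  by (simp flip: assoc_mult_mat_vec[of A n n _ n] add: adj_mat(2)[OF A] smult_one_mult_mat_vec)
 have 1: "?A' * ?J = d \<cdot>\<^sub>m 1\<^sub>m n + outer u z"
  using A J u v by (simp add: add_mult_distrib_mat[of A n n _ ?J n] adj_mat(2)[OF A] outer_mult[OF J u v] z_def d_def)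
 have 2: "?A' * outer w z = d' \<cdot>\<^sub>m outer u z"
  using A J u v w z
  by (simp add: add_mult_distrib_mat[of A n n _ _ n] mult_outer outer_mult_outer Aw vw)
   (intro eq_matI, auto simp: algebra_simps)
 have "?A' * (d' \<cdot>\<^sub>m ?J - outer w z) = d' \<cdot>\<^sub>m (?A' * ?J) - ?A' * outer w z"
  using A' J w z by (simp add: mult_minus_distrib_mat[of _ n n _ n] mult_smult_distrib[of _ n n _ n])
 also have "\<dots> = (d * d') \<cdot>\<^sub>m 1\<^sub>m n"
  unfolding 1 2 using u z by (intro eq_matI) (auto simp: algebra_simps)
 also have "\<dots> = ?A' * (d \<cdot>\<^sub>m adj_mat ?A')"
  using A' by (simp add: mult_smult_distrib[of _ n n _ n] adj_mat(2)[OF A'] d'_def)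
   (intro eq_matI, auto simp: algebra_simps)
 finally have "d \<cdot>\<^sub>m adj_mat ?A' = d' \<cdot>\<^sub>m ?J - outer w z"
  using mat_mult_cancel_left[OF A' D' minus_carrier_mat[OF outer_carrier[OF w z]]
    smult_carrier_mat[OF adj_carrier[OF A']]] by metis
 thus ?thesis unfolding d_def d'_def w_def z_def .
qed

section \<open>Local Smith forms\<close>

lemma comm_ring_hom_poly: "comm_ring_hom (\<lambda>p :: complex poly. poly p \<mu>)"
 by unfold_locales auto

lemma poly_det: "poly (det (A :: complex poly mat)) \<mu> = det (map_mat (\<lambda>p. poly p \<mu>) A)"
 by (rule comm_ring_hom.hom_det[OF comm_ring_hom_poly, symmetric])

lemma lin_dvd_iff: "[:-\<mu>,1:] dvd (p :: complex poly) \<longleftrightarrow> poly p \<mu> = 0"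
 by (simp add: poly_eq_0_iff_dvd)

lemma lin_power_dvd_cancel:
 assumes "poly p \<mu> ~= 0" "[:-\<mu>,1:] ^ k dvd p * (q :: complex poly)"
 shows "[:-\<mu>,1:] ^ k dvd q"
proof (cases "q = 0")
 case False
 have "p ~= 0" using assms(1) by auto
 with False assms show ?thesis
  by (auto simp: order_divides order_mult order_0I)
qed auto

definition smith_diag :: "complex => nat list => complex poly mat" where
 "smith_diag \<mu> ms = mat (length ms) (length ms)
   (\<lambda>(i,j). if i = j then [:-\<mu>,1:] ^ (ms ! i) else 0)"

lemma smith_diag_carrier [simp]: "length ms = n ==> smith_diag \<mu> ms \<in> Mat n"
 unfolding smith_diag_def by auto

text \<open>\<open>L V = U D\<close>, where \<open>D\<close> is the diagonal matrix of the powers of \<open>\<lambda> - \<mu>\<close> and \<open>U\<close>, \<open>V\<close> are invertible at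
 \<open>\<mu>\<close>. The column \<open>j\<close> of \<open>V\<close> is thus a chain of length \<open>ms ! j\<close>: \<open>L\<close> maps it to a multiple of that power.\<close>

definition local_smith ::
 "nat => complex => complex poly mat => complex poly mat => complex poly mat => nat list => bool" where
 "local_smith n \<mu> L U V ms \<longleftrightarrow> L \<in> Mat n \<and> U \<in> Mat n \<and> V \<in> Mat n \<and>
   length ms = n \<and> poly (det U) \<mu> ~= 0 \<and> poly (det V) \<mu> ~= 0 \<and> L * V = U * smith_diag \<mu> ms"

lemma mult_smith_diag:
 assumes "U \<in> Mat n" "length ms = n" "i < n" "j < n"
 shows "(U * smith_diag \<mu> ms) $$ (i,j) = U $$ (i,j) * [:-\<mu>,1:] ^ (ms ! j)"
 using assms by (auto simp: smith_diag_def scalar_prod_def if_distrib sum.delta cong: if_cong)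

lemma det_smith_diag: "det (smith_diag \<mu> ms) = [:-\<mu>,1:] ^ sum_list ms"
proof -
 have "det (smith_diag \<mu> ms) = prod_list (diag_mat (smith_diag \<mu> ms))"
  by (rule det_upper_triangular[of _ "length ms"]) (auto simp: smith_diag_def)
 also have "diag_mat (smith_diag \<mu> ms) = map (\<lambda>m. [:-\<mu>,1:] ^ m) ms"
  by (auto simp: diag_mat_def smith_diag_def intro!: nth_equalityI)
 also have "prod_list \<dots> = [:-\<mu>,1:] ^ sum_list ms"
  by (induction ms) (auto simp: power_add)
 finally show ?thesis .
qed

lemma local_smith_det:
 assumes "local_smith n \<mu> L U V ms"
 shows "det L * det V = det U * [:-\<mu>,1:] ^ sum_list ms"
 using assms det_mult[of L n V] det_mult[of U n "smith_diag \<mu> ms"] det_smith_diag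
 unfolding local_smith_def by (metis smith_diag_carrier)

lemma local_smith_regular:
 assumes "local_smith n \<mu> L U V ms"
 shows "det L ~= 0"
proof
 assume "det L = 0"
 hence "det U * [:-\<mu>,1:] ^ sum_list ms = 0" using local_smith_det[OF assms] by simp
 thus False using assms unfolding local_smith_def by auto
qed

lemma order_lin_power: "order \<mu> ([:-\<mu>,1:] ^ k :: complex poly) = k"
 by (rule order_power_n_n)

lemma local_smith_order:
 assumes "local_smith n \<mu> L U V ms"
 shows "order \<mu> (det L) = sum_list ms"
proof -
 have UV: "poly (det U) \<mu> ~= 0" "poly (det V) \<mu> ~= 0"
  using assms unfolding local_smith_def by auto
 have "order \<mu> (det L * det V) = order \<mu> (det L)"
  using local_smith_regular[OF assms] UV(2)
  by (subst order_mult) (auto simp: order_0I)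
 moreover have "order \<mu> (det U * [:-\<mu>,1:] ^ sum_list ms) = sum_list ms"
  using UV by (subst order_mult) (auto simp: order_0I order_lin_power)
 ultimately show ?thesis using local_smith_det[OF assms] by simp
qed

text \<open>A chain of length \<open>k\<close>, that is, a polynomial vector that \<open>L\<close> maps to a multiple of
 \<open>[:-\<mu>,1:] ^ k\<close>, is, at \<open>\<mu>\<close>, a combination of those columns of \<open>V\<close> whose exponent is at least \<open>k\<close>: the other
 coordinates vanish there.\<close>

lemma local_smith_chain:
 assumes ls: "local_smith n \<mu> L U V ms" and x: "x \<in> Vec n"
  and chain: "!!i. i < n ==> [:-\<mu>,1:] ^ k dvd (L *\<^sub>v x) $ i"
  and j: "j < n" "ms ! j < k"
 shows "poly ((adj_mat V *\<^sub>v x) $ j) \<mu> = 0"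
proof -
 let ?s = "[:-\<mu>,1:]"
 note ls' = ls[unfolded local_smith_def]
 define y where "y = adj_mat V *\<^sub>v x"
 have [simp]: "L \<in> Mat n" "U \<in> Mat n" "V \<in> Mat n" "length ms = n"
  using ls' by auto
 have y: "y \<in> Vec n" unfolding y_def using x by (auto intro!: mult_mat_vec_carrier)
 have Lx: "L *\<^sub>v x \<in> Vec n" using x by (auto intro!: mult_mat_vec_carrier)
 have Vy: "V *\<^sub>v y = det V \<cdot>\<^sub>v x"
  unfolding y_def using x
  by (simp flip: assoc_mult_mat_vec[of V n n _ n] add: adj_mat(2)[of V n] smult_one_mult_mat_vec)
 define z where "z = smith_diag \<mu> ms *\<^sub>v y"
 have z: "z \<in> Vec n" unfolding z_def using y by (auto intro!: mult_mat_vec_carrier[of _ n n])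
 have zi: "z $ j = ?s ^ (ms ! j) * y $ j"
  unfolding z_def using y j
  by (auto simp: smith_diag_def scalar_prod_def if_distrib if_distribR cong: if_cong)
 have "det V \<cdot>\<^sub>v (L *\<^sub>v x) = L *\<^sub>v (V *\<^sub>v y)"
  unfolding Vy using x by (simp add: mult_mat_smult_vec[of L n n])
 also have "\<dots> = U *\<^sub>v z"
  using ls' y unfolding z_def by (simp flip: assoc_mult_mat_vec[of _ n n _ n])
 finally have Uz: "U *\<^sub>v z = det V \<cdot>\<^sub>v (L *\<^sub>v x)" ..
 have "det U \<cdot>\<^sub>v z = adj_mat U *\<^sub>v (U *\<^sub>v z)"
  using z by (simp flip: assoc_mult_mat_vec[of _ n n _ n] add: adj_mat(3)[of U n] smult_one_mult_mat_vec)
 hence "det U * z $ j = (adj_mat U *\<^sub>v (det V \<cdot>\<^sub>v (L *\<^sub>v x))) $ j"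
  unfolding Uz using z j by (metis carrier_vecD index_smult_vec(1))
 also have "?s ^ k dvd \<dots>"
 proof -
  have "det V \<cdot>\<^sub>v (L *\<^sub>v x) \<in> Vec n" using Lx by simp
  moreover have "?s ^ k dvd (det V \<cdot>\<^sub>v (L *\<^sub>v x)) $ i" if "i < n" for i
   using chain[OF that] Lx that by (metis carrier_vecD dvd_mult index_smult_vec(1))
  ultimately show ?thesis
   using mult_mat_vec_sum[of "adj_mat U" n n "det V \<cdot>\<^sub>v (L *\<^sub>v x)" j] j
   by (auto simp del: index_smult_vec intro!: dvd_sum dvd_mult)
 qed
 finally have "?s ^ k dvd det U * z $ j" .
 hence "?s ^ k dvd z $ j" using lin_power_dvd_cancel ls' by blast
 hence "?s ^ (Suc (ms ! j)) dvd ?s ^ (ms ! j) * y $ j"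
  unfolding zi using j(2) by (meson Suc_leI dvd_trans le_imp_power_dvd)
 hence "?s ^ (ms ! j) * ?s dvd ?s ^ (ms ! j) * y $ j" by (simp only: power_Suc2)
 hence "?s dvd y $ j"
  using dvd_times_left_cancel_iff[of "?s ^ (ms ! j)" ?s "y $ j"] by (simp only: power_eq_0_iff) auto
 thus ?thesis unfolding y_def lin_dvd_iff .
qed

text \<open>The numbers \<open>\<nu> k\<close>. They are additive, monotone and insensitive to zero exponents and to the order of
 the list, and their changes are easier to control than those of the list itself.\<close>

definition exponents_ge :: "nat list => nat => nat" where
 "exponents_ge ms k = length (filter (\<lambda>m. k <= m) ms)"

lemma exponents_ge_card: "exponents_ge ms k = card {i. i < length ms \<and> k <= ms ! i}"
 unfolding exponents_ge_def by (rule length_filter_conv_card)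

text \<open>Maximality: a family of chains of length \<open>k\<close> that is part of a matrix \<open>X\<close> invertible at \<open>\<mu>\<close>
 has at most \<open>exponents_ge ms k\<close> members. A nonzero term of the Leibniz expansion of
 \<open>det (adj V * X)\<close> at \<open>\<mu>\<close> matches each chain with a different exponent that is at least \<open>k\<close>.\<close>

lemma local_smith_chain_bound:
 assumes ls: "local_smith n \<mu> L U V ms" and X: "X \<in> Mat n" and dX: "poly (det X) \<mu> ~= 0"
  and S: "S \<subseteq> {..<n}"
  and chain: "!!i j. j \<in> S ==> i < n ==> [:-\<mu>,1:] ^ k dvd (L * X) $$ (i,j)"
 shows "card S <= exponents_ge ms k"
proof -
 note ls' = ls[unfolded local_smith_def]
 have [simp]: "L \<in> Mat n" "V \<in> Mat n" "length ms = n" using ls' by auto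
 have dV: "dim_row V = n" "dim_col V = n"
  using ls unfolding local_smith_def carrier_mat_def by auto
 define Y where "Y = map_mat (\<lambda>p. poly p \<mu>) (adj_mat V * X)"
 have Y: "Y \<in> Mat n" unfolding Y_def using X by auto
 have "det V * det (adj_mat V) = det V ^ n"
  by (subst det_mult[symmetric, of _ n]) (auto simp: adj_mat(2)[of V n])
 hence "poly (det (adj_mat V)) \<mu> ~= 0" using ls'
  by (metis mult_zero_right poly_mult poly_power power_not_zero)
 hence "det Y ~= 0"
  unfolding Y_def poly_det[symmetric] using X dX by (subst det_mult[of _ n]) auto
 hence "(\<Sum>p \<in> {p. p permutes {0..<n}}. signof p * (\<Prod>i = 0..<n. Y $$ (i, p i))) ~= 0"
  unfolding det_def'[OF Y] by simp
 then obtain p where p: "p permutes {0..<n}" and "(\<Prod>i = 0..<n. Y $$ (i, p i)) ~= 0"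
  by (metis (mono_tags, lifting) mem_Collect_eq mult_zero_right sum.neutral)
 hence nz: "Y $$ (i, p i) ~= 0" if "i < n" for i using that by auto
 have "Hilbert_Choice.inv p ` S \<subseteq> {i. i < length ms \<and> k <= ms ! i}"
 proof safe
  fix j assume jS: "j \<in> S"
  let ?i = "Hilbert_Choice.inv p j"
  have jn: "j < n" using jS S by auto
  have i: "?i < n" using permutes_in_image[OF permutes_inv[OF p], of j] jn by auto
  thus "?i < length ms" by simp
  have pi: "p ?i = j" using permutes_inverses[OF p] by auto
  show "k <= ms ! ?i"
  proof (rule ccontr)
   assume "\<not> k <= ms ! ?i"
   moreover have "(L *\<^sub>v col X j) $ i' = (L * X) $$ (i', j)" if "i' < n" for i'
    using that jn X carrier_matD[of L n n] ls' by (auto simp: local_smith_def)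
   ultimately have "poly ((adj_mat V *\<^sub>v col X j) $ ?i) \<mu> = 0"
    using local_smith_chain[OF ls, of "col X j" k ?i] chain[OF jS] i jn X by auto
   moreover have "(adj_mat V *\<^sub>v col X j) $ ?i = (adj_mat V * X) $$ (?i, j)"
    using i jn X dV by simp
   ultimately have "Y $$ (?i, j) = 0" unfolding Y_def using i jn X dV by simp
   thus False using nz[OF i] pi by simp
  qed
 qed
 moreover have "inj_on (Hilbert_Choice.inv p) S" using permutes_inj[OF permutes_inv[OF p]] by (metis inj_on_subset subset_UNIV)
 ultimately show ?thesis unfolding exponents_ge_card
  by (intro card_inj_on_le[of "Hilbert_Choice.inv p"]) auto
qed

lemma local_smith_chains_exist:
 fixes k :: nat
 assumes ls: "local_smith n \<mu> L U V ms"
 defines "S \<equiv> {i. i < length ms \<and> k <= ms ! i}"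
 shows "S \<subseteq> {..<n}" "card S = exponents_ge ms k"
  "!!i j. j \<in> S ==> i < n ==> [:-\<mu>,1:] ^ k dvd (L * V) $$ (i,j)"
proof -
 note ls' = ls[unfolded local_smith_def]
 show "S \<subseteq> {..<n}" using ls' unfolding S_def by auto
 show "card S = exponents_ge ms k" unfolding S_def exponents_ge_card ..
 fix i j assume j: "j \<in> S" and i: "i < n"
 have Uc: "U \<in> Mat n" and len: "length ms = n" and eq: "L * V = U * smith_diag \<mu> ms"
  using ls' by blast+
 have jn: "j < n" and k: "k <= ms ! j" using j len unfolding S_def by simp_all
 show "[:-\<mu>,1:] ^ k dvd (L * V) $$ (i,j)"
  unfolding eq mult_smith_diag[OF Uc len i jn] by (rule dvd_mult[OF le_imp_power_dvd[OF k]])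
qed

lemma local_smith_exponents_unique:
 assumes "local_smith n \<mu> L U V ms" "local_smith n \<mu> L U' V' ms'"
 shows "exponents_ge ms k = exponents_ge ms' k"
proof -
 have "exponents_ge ms k <= exponents_ge ms' k"
  if "local_smith n \<mu> L U V ms" "local_smith n \<mu> L U' V' ms'" for U V ms U' V' ms'
 proof -
  note ex = local_smith_chains_exist[OF that(1), where k = k]
  have V: "V \<in> Mat n" "poly (det V) \<mu> ~= 0"
   using that(1) unfolding local_smith_def by blast+
  show ?thesis
   unfolding ex(2)[symmetric]
   by (rule local_smith_chain_bound[OF that(2) V ex(1)]) (rule ex(3))
 qed
 thus ?thesis using assms by (meson le_antisym)
qed

lemma local_smith_invertible_point:
 assumes L: "L \<in> Mat n" and d: "poly (det L) \<mu> ~= 0"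
 shows "local_smith n \<mu> L L (1\<^sub>m n) (replicate n 0)"
proof -
 have "smith_diag \<mu> (replicate n 0) = 1\<^sub>m n"
  by (intro eq_matI) (auto simp: smith_diag_def)
 thus ?thesis using L d unfolding local_smith_def by auto
qed

lemma local_smith_diag_sum:
 assumes 1: "local_smith n1 \<mu> L1 U1 V1 ms1" and 2: "local_smith n2 \<mu> L2 U2 V2 ms2"
 shows "\<exists>U V. local_smith (n1 + n2) \<mu> (four_block_mat L1 (0\<^sub>m n1 n2) (0\<^sub>m n2 n1) L2) U V (ms1 @ ms2)"
proof -
 note 1 = 1[unfolded local_smith_def] and 2 = 2[unfolded local_smith_def]
 have [simp]: "L1 \<in> carrier_mat n1 n1" "U1 \<in> carrier_mat n1 n1" "V1 \<in> carrier_mat n1 n1"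
  "length ms1 = n1" "L2 \<in> carrier_mat n2 n2" "U2 \<in> carrier_mat n2 n2" "V2 \<in> carrier_mat n2 n2"
  "length ms2 = n2" using 1 2 by auto
 define B where "B = (\<lambda>X Y :: complex poly mat. four_block_mat X (0\<^sub>m n1 n2) (0\<^sub>m n2 n1) Y)"
 have Bc: "B X Y \<in> carrier_mat (n1 + n2) (n1 + n2)"
  if "X \<in> carrier_mat n1 n1" "Y \<in> carrier_mat n2 n2" for X Y
  using that unfolding B_def by auto
 have Bm: "B X Y * B X' Y' = B (X * X') (Y * Y')"
  if "X \<in> carrier_mat n1 n1" "Y \<in> carrier_mat n2 n2" "X' \<in> carrier_mat n1 n1" "Y' \<in> carrier_mat n2 n2"
  for X Y X' Y'
  unfolding B_def using that
  by (subst mult_four_block_mat[of _ n1 n1 _ n2 _ n2 _ _ n1 _ n2]) auto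
 have Bd: "det (B X Y) = det X * det Y"
  if "X \<in> carrier_mat n1 n1" "Y \<in> carrier_mat n2 n2" for X Y
  unfolding B_def using that by (subst det_four_block_mat_upper_right_zero[of _ n1 _ n2]) auto
 have sd: "smith_diag \<mu> (ms1 @ ms2) = B (smith_diag \<mu> ms1) (smith_diag \<mu> ms2)"
  by (intro eq_matI) (auto simp: smith_diag_def B_def nth_append)
 have "local_smith (n1 + n2) \<mu> (B L1 L2) (B U1 U2) (B V1 V2) (ms1 @ ms2)"
  unfolding local_smith_def sd using 1 2 by (auto simp: Bc Bm Bd)
 thus ?thesis unfolding B_def by blast
qed

lemma pencil_carrier [simp]: "A \<in> Mat n ==> B \<in> Mat n ==> pencil A B \<in> Mat n"
 unfolding pencil_def by auto

lemma pencil_index: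
 assumes "A \<in> Mat n" "B \<in> Mat n" "i < n" "j < n"
 shows "pencil A B $$ (i,j) = [:A $$ (i,j), B $$ (i,j):]"
 using assms unfolding pencil_def by auto

text \<open>The vector \<open>(1, s, \<dots>, s\<^sup>k\<^sup>-\<^sup>1)\<close> with \<open>s = \<lambda> - \<mu>\<close> is mapped by \<open>sI - N\<close> to \<open>s\<^sup>k\<close> times the last unit
 vector, so it is a chain of length \<open>k\<close>. The other columns are unit vectors and have exponent 0.\<close>

lemma local_smith_jordan_block_same:
 assumes "k > 0"
 shows "\<exists>U V. local_smith k \<mu> (pencil (- jordan_block k \<mu>) (1\<^sub>m k)) U V (k # replicate (k - 1) 0)"
proof -
 let ?s = "[:-\<mu>,1:]"
 define L where "L = pencil (- jordan_block k \<mu>) (1\<^sub>m k)"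
 define V where "V = mat k k (\<lambda>(i,j). if j = 0 then ?s ^ i else if i = j then 1 else 0)"
 define U where "U = mat k k (\<lambda>(i,j). if j = 0 then (if Suc i = k then 1 else 0) else
   if i = j then ?s else if Suc i = j then - 1 else 0)"
 define ms where "ms = k # replicate (k - 1) 0"
 have len: "length ms = k" unfolding ms_def using assms by simp
 have Lc: "L \<in> carrier_mat k k" unfolding L_def by auto
 have Vc: "V \<in> carrier_mat k k" and Uc: "U \<in> carrier_mat k k" unfolding V_def U_def by auto
 have Li: "L $$ (i,j) = (if i = j then ?s else if Suc i = j then -1 else 0)" if "i < k" "j < k" for i j
  unfolding L_def using that by (subst pencil_index[of _ k]) (auto simp: jordan_block_def one_pCons)
 have eq: "L * V = U * smith_diag \<mu> ms"
 proof (rule eq_matI)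
  fix i j assume "i < dim_row (U * smith_diag \<mu> ms)" "j < dim_col (U * smith_diag \<mu> ms)"
  hence i: "i < k" and j: "j < k" using len by (auto simp: U_def smith_diag_def)
  have "(L * V) $$ (i,j) = (\<Sum>l = 0..<k. L $$ (i,l) * V $$ (l,j))"
   using i j Lc Vc by (auto simp: scalar_prod_def)
  also have "\<dots> = (\<Sum>l = 0..<k. (if l = i then ?s * V $$ (l,j) else 0) + (if l = Suc i then - V $$ (l,j) else 0))"
   using i j by (intro sum.cong) (auto simp: Li)
  also have "\<dots> = ?s * V $$ (i,j) + (if Suc i < k then - V $$ (Suc i,j) else 0)"
   unfolding sum.distrib using i by simp
  also have "\<dots> = U $$ (i,j) * ?s ^ (ms ! j)"
   using i j unfolding V_def U_def ms_def
   by (cases j) (auto simp: simp flip: power_Suc)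
  finally show "(L * V) $$ (i,j) = (U * smith_diag \<mu> ms) $$ (i,j)"
   using mult_smith_diag[OF Uc len i j] by simp
 qed (use Lc Uc Vc len in \<open>auto simp: smith_diag_def\<close>)
 have "det V = prod_list (diag_mat V)"
  by (rule det_lower_triangular[of k, OF _ Vc]) (auto simp: V_def)
 also have "diag_mat V = replicate k 1"
  by (intro nth_equalityI) (auto simp: diag_mat_def V_def)
 finally have dV: "det V = 1" by simp
 have "det L = prod_list (diag_mat L)"
  by (rule det_upper_triangular[OF _ Lc]) (use Lc in \<open>auto simp: Li\<close>)
 also have "diag_mat L = replicate k ?s"
  using Lc by (intro nth_equalityI) (auto simp: diag_mat_def Li)
 finally have dL: "det L = ?s ^ k" by simp
 have sl: "sum_list ms = k" unfolding ms_def by (simp add: sum_list_replicate)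
 have "?s ^ k = det U * ?s ^ k"
  using arg_cong[OF eq, of det] det_mult[OF Lc Vc] det_mult[OF Uc smith_diag_carrier[OF len]]
  by (simp add: dV dL det_smith_diag sl)
 hence "det U = 1" by simp
 hence "local_smith k \<mu> L U V ms" unfolding local_smith_def using Lc Uc Vc len eq dV by auto
 thus ?thesis unfolding L_def ms_def by blast
qed

lemma pencil_diag_sum:
 assumes "A \<in> carrier_mat k k" "D \<in> Mat n"
 shows "pencil (- four_block_mat A (0\<^sub>m k n) (0\<^sub>m n k) D) (1\<^sub>m (k + n)) =
  four_block_mat (pencil (- A) (1\<^sub>m k)) (0\<^sub>m k n) (0\<^sub>m n k) (pencil (- D) (1\<^sub>m n))"
 using assms by (intro eq_matI) (auto simp: pencil_def)

lemma local_smith_jordan_matrix: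
 assumes "0 \<notin> fst ` set js"
 shows "\<exists>U V ms. local_smith (sum_list (map fst js)) \<mu>
   (pencil (- jordan_matrix js) (1\<^sub>m (sum_list (map fst js)))) U V ms \<and>
  filter (\<lambda>m. 0 < m) ms = map fst (filter (\<lambda>(k, a). a = \<mu>) js)"
 using assms
proof (induction js)
 case Nil
 let ?L = "pencil (- jordan_matrix []) (1\<^sub>m 0)"
 have L: "?L \<in> carrier_mat 0 0"
  by (intro pencil_carrier) (auto simp: jordan_matrix_def)
 show ?case
  using local_smith_invertible_point[OF L, of \<mu>] det_dim_zero[OF L]
  by (intro exI[of _ ?L] exI[of _ "1\<^sub>m 0"] exI[of _ "[]"]) (auto simp: jordan_matrix_def)
next
 case (Cons x js)
 obtain k a where x: "x = (k,a)" by force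
 have k: "k > 0" using Cons.prems x by (cases k) auto
 let ?n = "sum_list (map fst js)"
 let ?L1 = "pencil (- jordan_block k a) (1\<^sub>m k)" and ?L2 = "pencil (- jordan_matrix js) (1\<^sub>m ?n)"
 obtain U2 V2 ms2 where 2: "local_smith ?n \<mu> ?L2 U2 V2 ms2"
  "filter (\<lambda>m. 0 < m) ms2 = map fst (filter (\<lambda>(k, a). a = \<mu>) js)"
  using Cons by auto
 have "\<exists>U V ms. local_smith k \<mu> ?L1 U V ms \<and> filter (\<lambda>m. 0 < m) ms = (if a = \<mu> then [k] else [])"
 proof (cases "a = \<mu>")
  case True
  obtain U V where "local_smith k a ?L1 U V (k # replicate (k - 1) 0)"
   using local_smith_jordan_block_same[OF k] by blast
  thus ?thesis using True k
   by (intro exI[of _ U] exI[of _ V] exI[of _ "k # replicate (k - 1) 0"]) simp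
 next
  case False
  have c: "?L1 \<in> carrier_mat k k" by auto
  have "det ?L1 = prod_list (diag_mat ?L1)"
   by (rule det_upper_triangular[OF _ c]) (auto simp: pencil_def jordan_block_def)
  also have "diag_mat ?L1 = replicate k [:-a,1:]"
   by (intro nth_equalityI) (auto simp: diag_mat_def pencil_def jordan_block_def)
  finally have "poly (det ?L1) \<mu> ~= 0" using False by simp
  from local_smith_invertible_point[OF c this] False show ?thesis
   by (intro exI[of _ ?L1] exI[of _ "1\<^sub>m k"] exI[of _ "replicate k 0"]) auto
 qed
 then obtain U1 V1 ms1 where 1: "local_smith k \<mu> ?L1 U1 V1 ms1"
  "filter (\<lambda>m. 0 < m) ms1 = (if a = \<mu> then [k] else [])" by (elim exE conjE) (rule that)
 have dims: "jordan_matrix js \<in> carrier_mat ?n ?n" by simp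
 have eq: "pencil (- jordan_matrix (x # js)) (1\<^sub>m (k + ?n)) =
   four_block_mat ?L1 (0\<^sub>m k ?n) (0\<^sub>m ?n k) ?L2"
  unfolding x jordan_matrix_Cons by (rule pencil_diag_sum[OF jordan_block_carrier dims])
 obtain U V where
  "local_smith (k + ?n) \<mu> (pencil (- jordan_matrix (x # js)) (1\<^sub>m (k + ?n))) U V (ms1 @ ms2)"
  using local_smith_diag_sum[OF 1(1) 2(1), folded eq] by (elim exE) (rule that)
 thus ?case using 1(2) 2(2) x by (intro exI[of _ U] exI[of _ V] exI[of _ "ms1 @ ms2"]) auto
qed

lemma local_smith_weierstrass_pencil:
 assumes "0 \<notin> fst ` set js"
 shows "\<exists>U V ms. local_smith (sum_list (map fst js) + sum_list ks) \<mu> (weierstrass_pencil js ks) U V ms \<and>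
  filter (\<lambda>m. 0 < m) ms = map fst (filter (\<lambda>(k, a). a = \<mu>) js)"
proof -
 let ?n = "sum_list (map fst js)" and ?m = "sum_list ks"
 let ?N = "jordan_matrix (map (\<lambda>k. (k, 0::complex)) ks)"
 let ?L1 = "pencil (- jordan_matrix js) (1\<^sub>m ?n)" and ?L2 = "pencil (- 1\<^sub>m ?m) ?N"
 have s: "sum_list (map (fst \<circ> (\<lambda>k. (k, 0::complex))) ks) = ?m" by (simp add: o_def)
 have N: "?N \<in> carrier_mat ?m ?m"
  using jordan_matrix_carrier[of "map (\<lambda>k. (k, 0::complex)) ks"] by (simp add: s)
 have diag0: "?N $$ (i,i) = 0" if "i < ?m" for i using that
 proof (induction ks arbitrary: i)
  case (Cons k ks)
  have s: "sum_list (map (fst \<circ> (\<lambda>k. (k, 0::complex))) ks) = sum_list ks" for ks :: "nat list" by (simp add: o_def)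
  show ?case using Cons.prems Cons.IH[of "i - k"]
   by (auto simp: jordan_matrix_Cons s jordan_block_def)
 qed auto
 have c2: "?L2 \<in> carrier_mat ?m ?m" using N by simp
 have c1: "?L1 \<in> carrier_mat ?n ?n" by simp
 have "det ?L2 = prod_list (diag_mat ?L2)"
  using N jordan_matrix_upper_triangular[of _ "map (\<lambda>k. (k, 0::complex)) ks"]
  by (intro det_upper_triangular[OF _ c2]) (auto simp: pencil_def s)
 also have "diag_mat ?L2 = replicate ?m (-1)"
  using N diag0 by (intro nth_equalityI) (auto simp: diag_mat_def pencil_def one_pCons)
 finally have "poly (det ?L2) \<mu> ~= 0" by simp
 note 2 = local_smith_invertible_point[OF c2 this]
 obtain U1 V1 ms1 where 1: "local_smith ?n \<mu> ?L1 U1 V1 ms1"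
  "filter (\<lambda>m. 0 < m) ms1 = map fst (filter (\<lambda>(k, a). a = \<mu>) js)"
  using local_smith_jordan_matrix[OF assms] by blast
 have "weierstrass_pencil js ks = four_block_mat ?L1 (0\<^sub>m ?n ?m) (0\<^sub>m ?m ?n) ?L2"
  unfolding weierstrass_pencil_def diag_block_mat.simps(2)[of _ "[_]"] diag_block_mat_singleton Let_def
  using carrier_matD[OF c1] carrier_matD[OF c2] by simp
 with local_smith_diag_sum[OF 1(1) 2] obtain U V where
  "local_smith (?n + ?m) \<mu> (weierstrass_pencil js ks) U V (ms1 @ replicate ?m 0)" by metis
 with 1(2) show ?thesis
  by (intro exI[of _ U] exI[of _ V] exI[of _ "ms1 @ replicate ?m 0"]) auto
qed

lemma invertible_mat_inverse:
 assumes "invertible_mat P" "P \<in> Mat n"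
 obtains P' where "P' \<in> Mat n" "P * P' = 1\<^sub>m n" "P' * P = 1\<^sub>m n"
proof -
 obtain B where B: "inverts_mat P B" "inverts_mat B P" using assms unfolding invertible_mat_def by auto
 hence *: "P * B = 1\<^sub>m n" "B * P = 1\<^sub>m (dim_row B)" using assms unfolding inverts_mat_def by auto
 from arg_cong[OF *(1), of dim_col] have "dim_col B = n" by simp
 moreover from arg_cong[OF *(2), of dim_col] assms have "dim_row B = n" by simp
 ultimately show ?thesis using that[of B] * by auto
qed

abbreviation const_mat :: "complex mat => complex poly mat" where
 "const_mat \<equiv> map_mat (\<lambda>a. [:a:])"

lemma semiring_hom_const: "semiring_hom (\<lambda>a :: complex. [:a:])"
 by unfold_locales (auto simp: one_pCons)

lemma const_mat_mult:
 assumes "A \<in> carrier_mat n m" "B \<in> carrier_mat m k"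
 shows "const_mat (A * B) = const_mat A * const_mat B"
 by (rule semiring_hom.mat_hom_mult[OF semiring_hom_const assms])

lemma const_mat_one: "const_mat (1\<^sub>m n) = 1\<^sub>m n"
 by (intro eq_matI) (auto simp: one_pCons)

text \<open>Strict equivalence only multiplies \<open>U\<close> and \<open>V\<close> by constant invertible matrices. The blocks
 \<open>\<lambda>N - I\<close> are invertible everywhere and contribute exponents 0.\<close>

lemma local_smith_weierstrass_form:
 assumes wf: "weierstrass_form L js ks" and L: "L \<in> Mat n"
 shows "\<exists>U V ms. local_smith n \<mu> L U V ms \<and>
  filter (\<lambda>m. 0 < m) ms = map fst (filter (\<lambda>(k, a). a = \<mu>) js)"
proof -
 obtain P Q where P: "P \<in> Mat n" "invertible_mat P" and Q: "Q \<in> Mat n" "invertible_mat Q"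
  and eq: "const_mat P * L * const_mat Q = weierstrass_pencil js ks" and js: "0 \<notin> fst ` set js"
  using wf L unfolding weierstrass_form_def by auto
 obtain P' where P': "P' \<in> Mat n" "P' * P = 1\<^sub>m n"
  using invertible_mat_inverse P by metis
 obtain Q' where Q': "Q' \<in> Mat n" "Q' * Q = 1\<^sub>m n"
  using invertible_mat_inverse Q by metis
 let ?P = "const_mat P" and ?P' = "const_mat P'" and ?Q = "const_mat Q" and ?Q' = "const_mat Q'"
 have PP: "?P' * ?P = 1\<^sub>m n" using const_mat_mult[of P' n n P n] P P' const_mat_one by simp
 have QQ: "?Q' * ?Q = 1\<^sub>m n" using const_mat_mult[of Q' n n Q n] Q Q' const_mat_one by simp
 have cPQ [simp]: "?P \<in> Mat n" "?P' \<in> Mat n" "?Q \<in> Mat n" "?Q' \<in> Mat n"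
  using P Q P' Q' by auto
 have dP: "poly (det ?P') \<mu> ~= 0"
  using arg_cong[OF PP, of "\<lambda>X. poly (det X) \<mu>"] det_mult[OF cPQ(2) cPQ(1)] by auto
 have dQ: "poly (det ?Q) \<mu> ~= 0"
  using arg_cong[OF QQ, of "\<lambda>X. poly (det X) \<mu>"] det_mult[OF cPQ(4) cPQ(3)] by auto
 obtain U V ms where ls: "local_smith (sum_list (map fst js) + sum_list ks) \<mu> (weierstrass_pencil js ks) U V ms"
  and ms: "filter (\<lambda>m. 0 < m) ms = map fst (filter (\<lambda>(k, a). a = \<mu>) js)"
  using local_smith_weierstrass_pencil[OF js] by blast
 have "weierstrass_pencil js ks \<in> Mat n"
  unfolding eq[symmetric] using L cPQ by (meson mult_square_carrier)
 with ls have n: "sum_list (map fst js) + sum_list ks = n" unfolding local_smith_def by auto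
 note ls' = ls[unfolded n local_smith_def eq[symmetric]]
 have [simp]: "U \<in> Mat n" "V \<in> Mat n" "length ms = n" using ls' by auto
 have "L * (?Q * V) = (?P' * ?P) * (L * (?Q * V))" unfolding PP using L by auto
 also have "\<dots> = ?P' * (?P * L * ?Q * V)"
  using L P P' Q ls' by (simp add: assoc_mult_mat[of _ n n _ n _ n])
 also have "\<dots> = ?P' * U * smith_diag \<mu> ms"
  using ls' P' by (simp add: assoc_mult_mat[of _ n n _ n _ n])
 finally have "L * (?Q * V) = ?P' * U * smith_diag \<mu> ms" .
 hence "local_smith n \<mu> L (?P' * U) (?Q * V) ms"
  unfolding local_smith_def using L ls' dP dQ P' Q by (auto simp: det_mult[of _ n])
 thus ?thesis using ms by blast
qed

section \<open>Existence of the Weierstrass form and well-definedness of partial multiplicities\<close>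

abbreviation diag2 :: "'a :: zero mat => 'a mat => 'a mat" where
 "diag2 A D \<equiv> four_block_mat A (0\<^sub>m (dim_row A) (dim_col D)) (0\<^sub>m (dim_row D) (dim_col A)) D"

lemma diag2_carrier [simp]:
 "A \<in> Mat n ==> D \<in> carrier_mat m m ==> diag2 A D \<in> carrier_mat (n + m) (n + m)"
 by auto

lemma diag2_mult:
 fixes A :: "'a :: comm_ring_1 mat"
 assumes "A \<in> Mat n" "D \<in> carrier_mat m m" "A' \<in> Mat n" "D' \<in> carrier_mat m m"
 shows "diag2 A D * diag2 A' D' = diag2 (A * A') (D * D')"
 using assms by (subst mult_four_block_mat[of _ n n _ m _ m _ _ n _ m]) auto

lemma similar_mat_diag2:
 fixes A :: "complex mat"
 assumes "similar_mat A A'" "similar_mat D D'"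
 shows "similar_mat (diag2 A D) (diag2 A' D')"
proof -
 have "similar_mat (diag_block_mat (map fst [(A,A'),(D,D')])) (diag_block_mat (map snd [(A,A'),(D,D')]))"
  by (rule similar_diag_mat_block_mat) (use assms in auto)
 thus ?thesis by (simp only: list.map fst_conv snd_conv diag_block_mat.simps(2)[of _ "[_]"]
   diag_block_mat_singleton Let_def)
qed

lemma similar_mat_diag2_swap:
 fixes A :: "complex mat"
 assumes A: "A \<in> Mat n" and D: "D \<in> carrier_mat m m"
 shows "similar_mat (diag2 A D) (diag2 D A)"
proof -
 define P where "P = four_block_mat (0\<^sub>m n m) (1\<^sub>m n) (1\<^sub>m m) (0\<^sub>m m n :: complex mat)"
 define Q where "Q = four_block_mat (0\<^sub>m m n) (1\<^sub>m m) (1\<^sub>m n) (0\<^sub>m n m :: complex mat)"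
 have Pc: "P \<in> carrier_mat (n + m) (n + m)" unfolding P_def carrier_mat_def by auto
 have Qc: "Q \<in> carrier_mat (n + m) (n + m)" unfolding Q_def carrier_mat_def by auto
 have PQ: "P * Q = 1\<^sub>m (n + m)" unfolding P_def Q_def
  by (subst mult_four_block_mat[of _ n m _ n _ m _ _ n _ m]) auto
 have QP: "Q * P = 1\<^sub>m (n + m)" unfolding P_def Q_def
  by (subst mult_four_block_mat[of _ m n _ m _ n _ _ m _ n]) (auto simp: add.commute)
 have 1: "P * diag2 D A = four_block_mat (0\<^sub>m n m) A D (0\<^sub>m m n)"
  unfolding P_def using A D by (subst mult_four_block_mat[of _ n m _ n _ m _ _ m _ n]) auto
 have 2: "four_block_mat (0\<^sub>m n m) A D (0\<^sub>m m n) * Q = diag2 A D"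
  unfolding Q_def using A D by (subst mult_four_block_mat[of _ n m _ n _ m _ _ n _ m]) auto
 have "similar_mat_wit (diag2 A D) (diag2 D A) P Q"
  unfolding similar_mat_wit_def Let_def
  using A D Pc Qc PQ QP 1 2 by (auto simp: add.commute)
 thus ?thesis unfolding similar_mat_def by blast
qed

lemma jordan_matrix_append: "jordan_matrix (xs @ ys) = diag2 (jordan_matrix xs) (jordan_matrix ys)"
 unfolding jordan_matrix_def map_append diag_block_mat_append Let_def ..

lemma jordan_matrix_sort_zero:
 fixes l :: "(nat \<times> complex) list"
 shows "\<exists>js ks. similar_mat (jordan_matrix l) (jordan_matrix (js @ ks)) \<and>
  set js \<subseteq> {x \<in> set l. snd x ~= 0} \<and> set ks \<subseteq> {x \<in> set l. snd x = 0}"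
proof (induction l)
 case Nil
 show ?case by (intro exI[of _ "[]"]) (auto intro!: similar_mat_refl jordan_matrix_carrier)
next
 case (Cons x l)
 then obtain js ks where IH: "similar_mat (jordan_matrix l) (jordan_matrix (js @ ks))"
  "set js \<subseteq> {x \<in> set l. snd x ~= 0}" "set ks \<subseteq> {x \<in> set l. snd x = 0}" by blast
 have sim: "similar_mat (jordan_matrix (x # l)) (jordan_matrix (x # js @ ks))"
  using similar_mat_diag2[OF similar_mat_refl[OF jordan_matrix_carrier[of "[x]"]] IH(1)]
  unfolding jordan_matrix_append[symmetric] by simp
 show ?case
 proof (cases "snd x = 0")
  case False
  thus ?thesis using sim IH by (intro exI[of _ "x # js"] exI[of _ ks]) auto
 next
  case True
  have "similar_mat (jordan_matrix ([x] @ (js @ ks))) (jordan_matrix ((js @ ks) @ [x]))"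
   unfolding jordan_matrix_append[of "[x]" "js @ ks"] jordan_matrix_append[of "js @ ks" "[x]"]
   by (rule similar_mat_diag2_swap[OF jordan_matrix_carrier jordan_matrix_carrier])
  with sim have "similar_mat (jordan_matrix (x # l)) (jordan_matrix (js @ ks @ [x]))"
   using similar_mat_trans by fastforce
  thus ?thesis using True IH by (intro exI[of _ js] exI[of _ "ks @ [x]"]) auto
 qed
qed

lemma complex_jordan_nf_exists:
 assumes "A \<in> Mat n"
 shows "\<exists>js. jordan_nf (A :: complex mat) js"
proof -
 obtain as where "char_poly A = (\<Prod>a\<leftarrow>as. [:- a, 1:])"
  using char_poly_factorized[OF assms] by blast
 from jordan_nf_exists[OF assms this] show ?thesis .
qed

text \<open>Sort the Jordan blocks so that those with eigenvalue 0 come last.\<close>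

lemma invertible_nilpotent_splitting:
 assumes M: "M \<in> Mat n"
 obtains n1 n2 J N where "n = n1 + n2" "J \<in> carrier_mat n1 n1" "N \<in> carrier_mat n2 n2"
  "similar_mat M (diag2 J N)" "det (J :: complex mat) ~= 0"
  "!!i j. i < n2 ==> j <= i ==> N $$ (i,j) = 0"
proof -
 obtain l where l: "jordan_nf M l" using complex_jordan_nf_exists[OF M] by blast
 obtain js ks where jk: "similar_mat (jordan_matrix l) (jordan_matrix (js @ ks))"
  "set js \<subseteq> {x \<in> set l. snd x ~= 0}" "set ks \<subseteq> {x \<in> set l. snd x = 0}"
  using jordan_matrix_sort_zero by blast
 have sim: "similar_mat M (diag2 (jordan_matrix js) (jordan_matrix ks))"
  using l jk(1) similar_mat_trans unfolding jordan_nf_def jordan_matrix_append by blast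
 have "n = sum_list (map fst js) + sum_list (map fst ks)"
 proof -
  obtain k where k: "M \<in> carrier_mat k k" "diag2 (jordan_matrix js) (jordan_matrix ks) \<in> carrier_mat k k"
   using similar_matD[OF sim] by blast
  thus ?thesis
   using carrier_matD(1)[OF M] carrier_matD(1)[OF k(1)] carrier_matD(1)[OF k(2)]
    carrier_matD(1)[OF diag2_carrier[OF jordan_matrix_carrier[of js] jordan_matrix_carrier[of ks]]]
   by (simp only:)
 qed
 moreover have "det (jordan_matrix js) ~= 0"
 proof -
  have d: "jordan_matrix js $$ (i,i) ~= 0" if "i < sum_list (map fst js)" for i
   using that jk(2)
  proof (induction js arbitrary: i)
   case (Cons x js)
   thus ?case by (cases x) (auto simp: jordan_matrix_Cons jordan_block_def)
  qed auto
  have "det (jordan_matrix js) = prod_list (diag_mat (jordan_matrix js))"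
   by (rule det_upper_triangular[OF _ jordan_matrix_carrier]) (auto simp: jordan_matrix_upper_triangular)
  thus ?thesis using d by (auto simp: prod_list_zero_iff diag_mat_def)
 qed
 moreover have "jordan_matrix ks $$ (i,j) = 0" if "i < sum_list (map fst ks)" "j <= i" for i j
 proof -
  have d: "jordan_matrix ks $$ (i,i) = 0" if "i < sum_list (map fst ks)" for i
   using that jk(3)
  proof (induction ks arbitrary: i)
   case (Cons x js)
   thus ?case by (cases x) (auto simp: jordan_matrix_Cons jordan_block_def)
  qed auto
  thus ?thesis using that jordan_matrix_upper_triangular[of i ks j] by (cases "j = i") auto
 qed
 ultimately show ?thesis using sim that[OF _ jordan_matrix_carrier jordan_matrix_carrier] by blast
qed

lemma det_nonzero_inverse:
 assumes A: "(A :: complex mat) \<in> Mat n" and d: "det A ~= 0"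
 obtains B where "B \<in> Mat n" "A * B = 1\<^sub>m n" "B * A = 1\<^sub>m n"
proof -
 let ?B = "inverse (det A) \<cdot>\<^sub>m adj_mat A"
 have "A * ?B = 1\<^sub>m n"
  using A d by (simp add: mult_smult_distrib[of _ n n _ n] adj_mat(2)[OF A])
   (intro eq_matI, auto)
 moreover have "?B * A = 1\<^sub>m n"
  using A d by (simp add: mult_smult_assoc_mat[of _ n n _ n] adj_mat(3)[OF A])
   (intro eq_matI, auto)
 ultimately show ?thesis using that[of ?B] A by auto
qed

lemma invertible_matI:
 assumes "A \<in> Mat n" "B \<in> Mat n" "A * B = 1\<^sub>m n" "B * A = 1\<^sub>m n"
 shows "invertible_mat A"
 using assms unfolding invertible_mat_def inverts_mat_def by auto

lemma pencil_diag2: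
 assumes "A \<in> Mat n" "D \<in> carrier_mat m m" "A' \<in> Mat n" "D' \<in> carrier_mat m m"
 shows "pencil (diag2 A D) (diag2 A' D') = diag2 (pencil A A') (pencil D D')"
 using assms by (intro eq_matI) (auto simp: pencil_def)

lemma const_mat_mult_pencil:
 assumes P: "P \<in> Mat n" and Q: "Q \<in> Mat n"
  and A: "A \<in> Mat n" and B: "B \<in> Mat n"
 shows "const_mat P * pencil A B * const_mat Q = pencil (P * A * Q) (P * B * Q)"
proof -
 have eq: "pencil X Y = const_mat X + [:0,1:] \<cdot>\<^sub>m const_mat Y" for X Y
  unfolding pencil_def by (intro eq_matI) auto
 have c: "const_mat P \<in> Mat n" "const_mat Q \<in> Mat n"
  "const_mat A \<in> Mat n" "const_mat B \<in> Mat n" using assms by auto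
 have "const_mat P * pencil A B * const_mat Q =
   const_mat P * const_mat A * const_mat Q + [:0,1:] \<cdot>\<^sub>m (const_mat P * const_mat B * const_mat Q)"
 proof -
  have "const_mat P * pencil A B = const_mat P * const_mat A + [:0,1:] \<cdot>\<^sub>m (const_mat P * const_mat B)"
   unfolding eq using mult_add_distrib_mat[OF c(1) c(3) smult_carrier_mat[OF c(4)]]
    mult_smult_distrib[OF c(1) c(4)] by metis
  moreover have "\<dots> * const_mat Q = const_mat P * const_mat A * const_mat Q + ([:0,1:] \<cdot>\<^sub>m (const_mat P * const_mat B)) * const_mat Q"
   by (rule add_mult_distrib_mat[OF mult_square_carrier[OF c(1,3)] smult_carrier_mat[OF mult_square_carrier[OF c(1,4)]] c(2)])
  moreover have "([:0,1:] \<cdot>\<^sub>m (const_mat P * const_mat B)) * const_mat Q = [:0,1:] \<cdot>\<^sub>m (const_mat P * const_mat B * const_mat Q)"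
   by (rule mult_smult_assoc_mat[OF mult_square_carrier[OF c(1,4)] c(2)])
  ultimately show ?thesis by metis
 qed
 thus ?thesis unfolding eq
  using const_mat_mult[OF P A] const_mat_mult[OF P B] const_mat_mult[OF mult_square_carrier[OF P A] Q]
   const_mat_mult[OF mult_square_carrier[OF P B] Q] by metis
qed

definition strictly_equivalent ::
 "nat => complex mat => complex mat => complex mat => complex mat => bool" where
 "strictly_equivalent n A B A' B' \<longleftrightarrow> (\<exists>P \<in> Mat n. \<exists>Q \<in> Mat n.
   invertible_mat P \<and> invertible_mat Q \<and> P * A * Q = A' \<and> P * B * Q = B')"

lemma invertible_mat_mult_closed:
 assumes "invertible_mat P" "P \<in> Mat n" "invertible_mat Q" "Q \<in> Mat n"
 shows "invertible_mat (P * Q :: complex mat)"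
proof -
 obtain P' where P': "P' \<in> Mat n" "P * P' = 1\<^sub>m n" "P' * P = 1\<^sub>m n"
  using invertible_mat_inverse assms by blast
 obtain Q' where Q': "Q' \<in> Mat n" "Q * Q' = 1\<^sub>m n" "Q' * Q = 1\<^sub>m n"
  using invertible_mat_inverse assms by blast
 note P = assms(2) and Q = assms(4)
 have "(P * Q) * (Q' * P') = P * ((Q * Q') * P')"
  using P Q P'(1) Q'(1) by (simp add: assoc_mult_mat[of _ n n _ n _ n])
 also have "\<dots> = 1\<^sub>m n" unfolding Q'(2) using P' by simp
 finally have 1: "(P * Q) * (Q' * P') = 1\<^sub>m n" .
 have "(Q' * P') * (P * Q) = Q' * ((P' * P) * Q)"
  using P Q P'(1) Q'(1) by (simp add: assoc_mult_mat[of _ n n _ n _ n])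
 also have "\<dots> = 1\<^sub>m n" unfolding P'(3) using Q Q' by simp
 finally have 2: "(Q' * P') * (P * Q) = 1\<^sub>m n" .
 show ?thesis
  by (rule invertible_matI[OF mult_square_carrier[OF P Q] mult_square_carrier[OF Q'(1) P'(1)] 1 2])
qed

lemma strictly_equivalent_trans:
 assumes 1: "strictly_equivalent n A B A' B'" and 2: "strictly_equivalent n A' B' A'' B''"
  and A: "A \<in> Mat n" and B: "B \<in> Mat n"
 shows "strictly_equivalent n A B A'' B''"
proof -
 obtain P Q where P: "P \<in> Mat n" "invertible_mat P" and Q: "Q \<in> Mat n" "invertible_mat Q"
  and e1: "P * A * Q = A'" "P * B * Q = B'" using 1 unfolding strictly_equivalent_def by blast
 obtain R S where R: "R \<in> Mat n" "invertible_mat R" and S: "S \<in> Mat n" "invertible_mat S"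
  and e2: "R * A' * S = A''" "R * B' * S = B''" using 2 unfolding strictly_equivalent_def by blast
 have "(R * P) * X * (Q * S) = R * (P * X * Q) * S" if "X \<in> Mat n" for X
  using P Q R S that by (simp add: assoc_mult_mat[of _ n n _ n _ n])
 with A B e1 e2 have "(R * P) * A * (Q * S) = A''" "(R * P) * B * (Q * S) = B''" by metis+
 thus ?thesis unfolding strictly_equivalent_def
  using invertible_mat_mult_closed[OF R(2,1) P(2,1)] invertible_mat_mult_closed[OF Q(2,1) S(2,1)]
   mult_square_carrier[OF R(1) P(1)] mult_square_carrier[OF Q(1) S(1)] by blast
qed

lemma strictly_equivalent_similar:
 assumes "similar_mat_wit C D P Q" and C: "C \<in> Mat n"
  and A: "A \<in> Mat n" and B: "B \<in> Mat n"
 shows "strictly_equivalent n A B (Q * A * P) (Q * B * P)"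
 using similar_mat_witD2[OF C assms(1)] invertible_matI[of P n Q] invertible_matI[of Q n P]
 unfolding strictly_equivalent_def by blast

text \<open>With \<open>poly (det L) \<mu>\<^sub>0 \<noteq> 0\<close>, the pencil is equivalent to \<open>I + (\<lambda> - \<mu>\<^sub>0) M\<close>. On the invertible part
 of \<open>M\<close> multiply by its inverse, on the nilpotent part \<open>N\<close> by \<open>-(I - \<mu>\<^sub>0 N)\<inverse>\<close>.\<close>

lemma regular_pencil_splitting:
 assumes A: "A \<in> Mat n" and B: "B \<in> Mat n" and reg: "det (pencil A B) ~= 0"
 obtains n1 n2 G N where "n = n1 + n2" "G \<in> carrier_mat n1 n1" "N \<in> carrier_mat n2 n2"
  "strictly_equivalent n A B (diag2 (- G) (- 1\<^sub>m n2)) (diag2 (1\<^sub>m n1) N)"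
  "!!a. eigenvalue N a ==> a = 0"
proof -
 obtain \<mu> where \<mu>: "poly (det (pencil A B)) \<mu> ~= 0" using reg poly_all_0_iff_0 by blast
 define L where "L = A + \<mu> \<cdot>\<^sub>m B"
 have L: "L \<in> Mat n" unfolding L_def using A B by auto
 have "map_mat (\<lambda>p. poly p \<mu>) (pencil A B) = L"
  unfolding L_def pencil_def using A B by (intro eq_matI) auto
 hence "det L ~= 0" using \<mu> by (simp add: poly_det)
 then obtain X where X: "X \<in> Mat n" "L * X = 1\<^sub>m n" "X * L = 1\<^sub>m n"
  using det_nonzero_inverse[OF L] by blast
 define M where "M = X * B"
 have M: "M \<in> Mat n" unfolding M_def using X B by auto
 have XA: "X * A = 1\<^sub>m n - \<mu> \<cdot>\<^sub>m M"
 proof -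
  have "A = L - \<mu> \<cdot>\<^sub>m B" unfolding L_def using A B by (intro eq_matI) auto
  hence "X * A = X * L - X * (\<mu> \<cdot>\<^sub>m B)"
   using X(1) L B by (simp add: mult_minus_distrib_mat[of _ n n _ n])
  thus ?thesis unfolding X(3) M_def mult_smult_distrib[OF X(1) B] .
 qed
 have e1: "strictly_equivalent n A B (1\<^sub>m n - \<mu> \<cdot>\<^sub>m M) M"
  unfolding strictly_equivalent_def
  using X A B L invertible_matI[OF X(1) L X(3) X(2)] invertible_matI[of "1\<^sub>m n" n "1\<^sub>m n"] M XA M_def
  by (intro bexI[of _ X] bexI[of _ "1\<^sub>m n"]) auto
 obtain n1 n2 J N where n: "n = n1 + n2" and J: "J \<in> carrier_mat n1 n1" and N: "N \<in> carrier_mat n2 n2"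
  and sim: "similar_mat M (diag2 J N)" and dJ: "det J ~= 0"
  and N0: "!!i j. i < n2 ==> j <= i ==> N $$ (i,j) = 0"
  using invertible_nilpotent_splitting[OF M] by blast
 let ?D = "diag2 J N"
 have D: "?D \<in> Mat n" unfolding n using J N by (rule diag2_carrier)
 obtain P Q where wit: "similar_mat_wit M ?D P Q" using sim unfolding similar_mat_def by blast
 note w = similar_mat_witD2[OF M wit]
 have QMP: "Q * M * P = ?D"
 proof -
  have "Q * M * P = (Q * P) * ?D * (Q * P)"
   using w(6,7) D by (subst w(3)) (simp add: assoc_mult_mat[of _ n n _ n _ n])
  thus ?thesis unfolding w(2) left_mult_one_mat[OF D] right_mult_one_mat[OF D] .
 qed
 have "Q * (1\<^sub>m n - \<mu> \<cdot>\<^sub>m M) * P = Q * P - \<mu> \<cdot>\<^sub>m (Q * M * P)"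
  using w M by (simp add: mult_minus_distrib_mat[of _ n n _ n] minus_mult_distrib_mat[of _ n n _ _ n]
    mult_smult_distrib[of _ n n _ n] mult_smult_assoc_mat[of _ n n _ n])
 with strictly_equivalent_similar[OF wit M, of "1\<^sub>m n - \<mu> \<cdot>\<^sub>m M" M] M
 have e2: "strictly_equivalent n (1\<^sub>m n - \<mu> \<cdot>\<^sub>m M) M (1\<^sub>m n - \<mu> \<cdot>\<^sub>m ?D) ?D"
  unfolding QMP w(2) by (metis minus_carrier_mat smult_carrier_mat)
 obtain Ji where Ji: "Ji \<in> carrier_mat n1 n1" "J * Ji = 1\<^sub>m n1" "Ji * J = 1\<^sub>m n1"
  using det_nonzero_inverse[OF J dJ] by blast
 define T where "T = 1\<^sub>m n2 - \<mu> \<cdot>\<^sub>m N"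
 have T: "T \<in> carrier_mat n2 n2" unfolding T_def using N by auto
 have tri: "det K = c ^ n2" if "K \<in> carrier_mat n2 n2"
  "!!i j. i < n2 ==> j <= i ==> K $$ (i,j) = (if i = j then c else 0)" for K :: "complex mat" and c
 proof -
  have "det K = prod_list (diag_mat K)" by (rule det_upper_triangular[OF _ that(1)]) (use that in auto)
  also have "diag_mat K = replicate n2 c" using that by (intro nth_equalityI) (auto simp: diag_mat_def)
  finally show ?thesis by simp
 qed
 have "det T = 1 ^ n2" by (rule tri) (use T N N0 in \<open>auto simp: T_def\<close>)
 then obtain Ti where Ti: "Ti \<in> carrier_mat n2 n2" "T * Ti = 1\<^sub>m n2" "Ti * T = 1\<^sub>m n2"
  using det_nonzero_inverse[OF T] by auto
 define G where "G = \<mu> \<cdot>\<^sub>m 1\<^sub>m n1 - Ji"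
 define N' where "N' = - (Ti * N)"
 have G: "G \<in> carrier_mat n1 n1" unfolding G_def using Ji by auto
 have N': "N' \<in> carrier_mat n2 n2" unfolding N'_def using Ti N by auto
 define R where "R = diag2 Ji (- Ti)"
 define Ri where "Ri = diag2 J (- T)"
 have nTi: "- Ti \<in> carrier_mat n2 n2" and nT: "- T \<in> carrier_mat n2 n2" using Ti T by auto
 have R: "R \<in> Mat n" "Ri \<in> Mat n"
  unfolding R_def Ri_def n using diag2_carrier[OF Ji(1) nTi] diag2_carrier[OF J nT] by auto
 have neg: "(- X) * (- Y) = X * Y" if "X \<in> carrier_mat n2 n2" "Y \<in> carrier_mat n2 n2" for X Y :: "complex mat"
  using that by auto
 have one: "diag2 (1\<^sub>m n1) (1\<^sub>m n2 :: complex mat) = 1\<^sub>m n" unfolding n by auto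
 have "R * Ri = 1\<^sub>m n" "Ri * R = 1\<^sub>m n"
  unfolding R_def Ri_def using Ji T Ti J nT nTi by (simp_all only: diag2_mult neg one)
 hence Rinv: "invertible_mat R" using invertible_matI[OF R] by blast
 have RD: "R * ?D = diag2 (1\<^sub>m n1) N'"
  unfolding R_def diag2_mult[OF Ji(1) nTi J N] Ji N'_def using Ti N by auto
 have IJ: "1\<^sub>m n - \<mu> \<cdot>\<^sub>m ?D = diag2 (1\<^sub>m n1 - \<mu> \<cdot>\<^sub>m J) T"
  unfolding T_def n using J N by (intro eq_matI) auto
 have JJ: "Ji * (1\<^sub>m n1 - \<mu> \<cdot>\<^sub>m J) = - G"
 proof -
  have "Ji * (1\<^sub>m n1 - \<mu> \<cdot>\<^sub>m J) = Ji - \<mu> \<cdot>\<^sub>m 1\<^sub>m n1"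
   using Ji J by (simp add: mult_minus_distrib_mat[of _ n1 n1 _ n1] mult_smult_distrib[of _ n1 n1 _ n1])
  also have "\<dots> = - G" unfolding G_def using Ji by (intro eq_matI) auto
  finally show ?thesis .
 qed
 have TT: "- Ti * T = - 1\<^sub>m n2" using Ti T by auto
 have c1: "1\<^sub>m n1 - \<mu> \<cdot>\<^sub>m J \<in> carrier_mat n1 n1" using J by auto
 have RI: "R * (1\<^sub>m n - \<mu> \<cdot>\<^sub>m ?D) = diag2 (- G) (- 1\<^sub>m n2)"
  unfolding IJ unfolding R_def diag2_mult[OF Ji(1) nTi c1 T] JJ TT ..
 have ID: "1\<^sub>m n - \<mu> \<cdot>\<^sub>m ?D \<in> Mat n"
  by (rule minus_carrier_mat[OF smult_carrier_mat[OF D]])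
 have e3: "strictly_equivalent n (1\<^sub>m n - \<mu> \<cdot>\<^sub>m ?D) ?D (diag2 (- G) (- 1\<^sub>m n2)) (diag2 (1\<^sub>m n1) N')"
  unfolding strictly_equivalent_def RI[symmetric] RD[symmetric]
  using Rinv R invertible_matI[of "1\<^sub>m n" n "1\<^sub>m n"]
   right_mult_one_mat[OF mult_square_carrier[OF R(1) ID]] right_mult_one_mat[OF mult_square_carrier[OF R(1) D]]
  by (intro bexI[of _ R] bexI[of _ "1\<^sub>m n"]) auto
 have ev: "a = 0" if "eigenvalue N' a" for a
 proof -
  have c: "N' - a \<cdot>\<^sub>m 1\<^sub>m n2 \<in> carrier_mat n2 n2" using N' by auto
  have "n2 ~= 0" using that N' unfolding eigenvalue_def eigenvector_def by auto
  have "N' + (- a) \<cdot>\<^sub>m 1\<^sub>m n2 = N' - a \<cdot>\<^sub>m 1\<^sub>m n2" using N' by (intro eq_matI) auto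
  hence "det (N' - a \<cdot>\<^sub>m 1\<^sub>m n2) = 0"
   using that N' unfolding eigenvalue_det[OF N'] char_matrix_def by auto
  hence "det (T * (N' - a \<cdot>\<^sub>m 1\<^sub>m n2)) = 0" using det_mult[OF T c] by simp
  moreover have "T * (N' - a \<cdot>\<^sub>m 1\<^sub>m n2) = - N - a \<cdot>\<^sub>m T"
  proof -
   have "T * N' = - (T * Ti * N)" unfolding N'_def using T Ti(1) N
    by (simp add: assoc_mult_mat[of _ n2 n2 _ n2 _ n2])
   hence "T * N' = - N" unfolding Ti(2) left_mult_one_mat[OF N] .
   moreover have "T * (a \<cdot>\<^sub>m 1\<^sub>m n2) = a \<cdot>\<^sub>m T" using T by (simp add: mult_smult_distrib[of _ n2 n2 _ n2])
   ultimately show ?thesis using T N' by (simp add: mult_minus_distrib_mat[of _ n2 n2 _ n2])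
  qed
  moreover have "det (- N - a \<cdot>\<^sub>m T) = (- a) ^ n2"
   by (rule tri) (use T N N0 in \<open>auto simp: T_def\<close>)
  ultimately show ?thesis using \<open>n2 ~= 0\<close> by simp
 qed
 have "strictly_equivalent n A B (diag2 (- G) (- 1\<^sub>m n2)) (diag2 (1\<^sub>m n1) N')"
  by (rule strictly_equivalent_trans[OF e1 strictly_equivalent_trans[OF e2 e3
     minus_carrier_mat[OF smult_carrier_mat[OF M]] M] A B])
 from that[OF n G N' this ev] show ?thesis by blast
qed

theorem weierstrass_form_exists:
 assumes A: "A \<in> Mat n" and B: "B \<in> Mat n" and reg: "det (pencil A B) ~= 0"
 shows "\<exists>js ks. weierstrass_form (pencil A B) js ks"
proof -
 obtain n1 n2 G N where n: "n = n1 + n2" and G: "G \<in> carrier_mat n1 n1" and N: "N \<in> carrier_mat n2 n2"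
  and e: "strictly_equivalent n A B (diag2 (- G) (- 1\<^sub>m n2)) (diag2 (1\<^sub>m n1) N)"
  and ev: "!!a. eigenvalue N a ==> a = 0"
  using regular_pencil_splitting[OF assms] by metis
 obtain js where js: "jordan_nf G js" using complex_jordan_nf_exists[OF G] by blast
 obtain ks where ks: "jordan_nf N ks" using complex_jordan_nf_exists[OF N] by blast
 have ks0: "a = 0" if "(k,a) \<in> set ks" for k a
 proof -
  have "k > 0" using ks that unfolding jordan_nf_def by (cases k) force+
  hence "poly (char_poly N) a = 0"
   unfolding jordan_nf_char_poly[OF ks] using that
   by (force simp: poly_prod_list prod_list_zero_iff)
  thus ?thesis using ev eigenvalue_root_char_poly[OF N] by blast
 qed
 have ksm: "map (\<lambda>k. (k,0)) (map fst ks) = ks"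
  using ks0 by (induction ks) auto
 obtain P1 Q1 where wG: "similar_mat_wit G (jordan_matrix js) P1 Q1"
  using js unfolding jordan_nf_def similar_mat_def by blast
 obtain P2 Q2 where wN: "similar_mat_wit N (jordan_matrix ks) P2 Q2"
  using ks unfolding jordan_nf_def similar_mat_def by blast
 note w1 = similar_mat_witD2[OF G wG] and w2 = similar_mat_witD2[OF N wN]
 have n1: "sum_list (map fst js) = n1" and n2: "sum_list (map fst ks) = n2"
  using carrier_matD(1)[OF w1(5)] carrier_matD(1)[OF w2(5)] jordan_matrix_dim(1) by metis+
 have conj: "Q * (P * D * Q) * P = D" if "P * Q = 1\<^sub>m m" "Q * P = 1\<^sub>m m" "P \<in> carrier_mat m m"
  "Q \<in> carrier_mat m m" "D \<in> carrier_mat m m" for P Q D :: "complex mat" and m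
 proof -
  have "Q * (P * D * Q) * P = (Q * P) * D * (Q * P)"
   using that(3-5) by (simp add: assoc_mult_mat[of _ m m _ m _ m])
  thus ?thesis unfolding that(2) using that(5) by simp
 qed
 have G1: "Q1 * G * P1 = jordan_matrix js" unfolding w1(3) by (rule conj[OF w1(1,2,6,7,5)])
 have N1: "Q2 * N * P2 = jordan_matrix ks" unfolding w2(3) by (rule conj[OF w2(1,2,6,7,5)])
 let ?A = "diag2 (- G) (- 1\<^sub>m n2)" and ?B = "diag2 (1\<^sub>m n1) N"
 let ?Q = "diag2 Q1 Q2" and ?P = "diag2 P1 P2"
 have nG: "- G \<in> carrier_mat n1 n1" and no: "- 1\<^sub>m n2 \<in> carrier_mat n2 n2" using G by auto
 have one: "diag2 (1\<^sub>m n1) (1\<^sub>m n2 :: complex mat) = 1\<^sub>m n" unfolding n by auto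
 have PQ: "?P * ?Q = 1\<^sub>m n" "?Q * ?P = 1\<^sub>m n"
  unfolding diag2_mult[OF w1(6) w2(6) w1(7) w2(7)] diag2_mult[OF w1(7) w2(7) w1(6) w2(6)] w1(1,2) w2(1,2) one
  by (rule refl)+
 have Pc: "?P \<in> Mat n" and Qc: "?Q \<in> Mat n"
  unfolding n using diag2_carrier[OF w1(6) w2(6)] diag2_carrier[OF w1(7) w2(7)] by auto
 have 1: "?Q * ?A * ?P = diag2 (- jordan_matrix js) (- 1\<^sub>m n2)"
 proof -
  have "Q1 * (- G) * P1 = - jordan_matrix js" using w1 G G1 by auto
  moreover have "Q2 * (- 1\<^sub>m n2) * P2 = - 1\<^sub>m n2" using w2 by auto
  ultimately show ?thesis
   unfolding diag2_mult[OF w1(7) w2(7) nG no] diag2_mult[OF mult_square_carrier[OF w1(7) nG]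
     mult_square_carrier[OF w2(7) no] w1(6) w2(6)] by simp
 qed
 have 2: "?Q * ?B * ?P = diag2 (1\<^sub>m n1) (jordan_matrix ks)"
 proof -
  have "Q1 * 1\<^sub>m n1 * P1 = 1\<^sub>m n1" using w1 by auto
  thus ?thesis
   unfolding diag2_mult[OF w1(7) w2(7) one_carrier_mat N] diag2_mult[OF mult_square_carrier[OF w1(7) one_carrier_mat]
     mult_square_carrier[OF w2(7) N] w1(6) w2(6)] N1 by simp
 qed
 have "strictly_equivalent n ?A ?B (diag2 (- jordan_matrix js) (- 1\<^sub>m n2)) (diag2 (1\<^sub>m n1) (jordan_matrix ks))"
  unfolding strictly_equivalent_def 1[symmetric] 2[symmetric]
  using Pc Qc invertible_matI[OF Pc Qc PQ] invertible_matI[OF Qc Pc PQ(2,1)] by blast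
 from strictly_equivalent_trans[OF e this A B] obtain P Q where
  P: "P \<in> Mat n" "invertible_mat P" and Q: "Q \<in> Mat n" "invertible_mat Q"
  and eq: "P * A * Q = diag2 (- jordan_matrix js) (- 1\<^sub>m n2)" "P * B * Q = diag2 (1\<^sub>m n1) (jordan_matrix ks)"
  unfolding strictly_equivalent_def by blast
 have cs: "- jordan_matrix js \<in> carrier_mat n1 n1" "jordan_matrix ks \<in> carrier_mat n2 n2"
  using w1(5) w2(5) by auto
 have "const_mat P * pencil A B * const_mat Q = weierstrass_pencil js (map fst ks)"
  unfolding const_mat_mult_pencil[OF P(1) Q(1) A B] eq pencil_diag2[OF cs(1) no one_carrier_mat cs(2)]
   weierstrass_pencil_def diag_block_mat.simps(2)[of _ "[_]"] diag_block_mat_singleton Let_def ksm n1 n2 ..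
 moreover have "dim_row (pencil A B) = n" "dim_col (pencil A B) = n" using A B unfolding pencil_def by auto
 ultimately have "weierstrass_form (pencil A B) js (map fst ks)"
  unfolding weierstrass_form_def using js ks P Q unfolding jordan_nf_def by auto
 thus ?thesis by blast
qed

lemma exponents_ge_antimono: "k <= k' ==> exponents_ge ms k' <= exponents_ge ms k"
 unfolding exponents_ge_def by (induction ms) auto

lemma exponents_ge_Suc: "exponents_ge ms k = exponents_ge ms (Suc k) + count_list ms k"
 unfolding exponents_ge_def by (induction ms) auto

lemma exponents_ge_filter_pos: "1 <= k ==> exponents_ge (filter (\<lambda>m. 0 < m) ms) k = exponents_ge ms k"
 unfolding exponents_ge_def by (induction ms) auto

lemma exponents_ge_sort: "exponents_ge (rev (sort ms)) k = exponents_ge ms k"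
proof -
 have "length (filter P ms) = size (filter_mset P (mset ms))" for P and ms :: "nat list"
  by (simp flip: mset_filter)
 thus ?thesis unfolding exponents_ge_def by simp
qed

lemma sorted_desc_unique:
 assumes "!!k. 1 <= k ==> exponents_ge xs k = exponents_ge ys k"
  and "\<forall>x \<in> set xs. 0 < x" "\<forall>x \<in> set ys. 0 < x"
  and "sorted (rev xs)" "sorted (rev ys)"
 shows "xs = ys"
proof -
 have "count (mset xs) k = count (mset ys) k" for k
 proof (cases "k = 0")
  case True
  have "count (mset xs) 0 = 0" "count (mset ys) 0 = 0"
   using assms(2,3) by (auto simp: not_in_iff[symmetric])
  thus ?thesis unfolding True by (rule trans[OF _ sym])
 next
  case False
  hence "exponents_ge xs k = exponents_ge ys k" "exponents_ge xs (Suc k) = exponents_ge ys (Suc k)"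
   using assms(1) by auto
  hence "count_list xs k = count_list ys k"
   using exponents_ge_Suc[of xs k] exponents_ge_Suc[of ys k] by linarith
  thus ?thesis by (simp add: count_mset)
 qed
 hence "mset (rev xs) = mset (rev ys)" by (simp add: multiset_eq_iff)
 hence "rev xs = rev ys" using assms(4,5) by (metis properties_for_sort)
 thus ?thesis by simp
qed

definition is_pencil :: "nat => complex poly mat => bool" where
 "is_pencil n L \<longleftrightarrow> L \<in> Mat n \<and> (\<forall>i<n. \<forall>j<n. degree (L $$ (i,j)) <= 1)"

lemma is_pencil_carrier: "is_pencil n L ==> L \<in> Mat n"
 unfolding is_pencil_def by simp

lemma poly_deg1: "degree (p :: complex poly) <= 1 ==> p = [:coeff p 0, coeff p 1:]"
 by (rule poly_eqI) (auto simp: coeff_pCons coeff_eq_0 split: nat.splits)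

lemma is_pencil_eq_pencil:
 assumes "is_pencil n L"
 shows "L = pencil (map_mat (\<lambda>p. coeff p 0) L) (map_mat (\<lambda>p. coeff p 1) L)"
 using assms unfolding is_pencil_def pencil_def
 by (intro eq_matI) (auto intro!: poly_deg1[unfolded One_nat_def])

lemma weierstrass_form_exists':
 assumes "is_pencil n L" "det L ~= 0"
 shows "\<exists>js ks. weierstrass_form L js ks"
 using weierstrass_form_exists[of "map_mat (\<lambda>p. coeff p 0) L" n "map_mat (\<lambda>p. coeff p 1) L"]
  is_pencil_eq_pencil[OF assms(1)] assms unfolding is_pencil_def by auto

text \<open>The definite description is resolved: a Weierstrass form exists, and every such form yields a local
 Smith form, whose exponents are unique.\<close>

lemma finite_partial_mults_local_smith:
 assumes L: "is_pencil n L" and reg: "det L ~= 0"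
 obtains U V ms where "local_smith n \<mu> L U V ms"
  "finite_partial_mults L \<mu> = rev (sort (filter (\<lambda>m. 0 < m) ms))"
proof -
 note Lc = is_pencil_carrier[OF L]
 obtain js ks where wf: "weierstrass_form L js ks" using weierstrass_form_exists'[OF assms] by blast
 obtain U V ms where ls: "local_smith n \<mu> L U V ms"
  and ms: "filter (\<lambda>m. 0 < m) ms = map fst (filter (\<lambda>(k, a). a = \<mu>) js)"
  using local_smith_weierstrass_form[OF wf Lc] by blast
 let ?S = "\<lambda>ms. rev (sort (filter (\<lambda>m. 0 < (m :: nat)) ms))"
 have "finite_partial_mults L \<mu> = ?S ms"
  unfolding finite_partial_mults_def
 proof (rule the_equality)
  show "\<exists>js ks. weierstrass_form L js ks \<and> ?S ms = rev (sort (map fst (filter (\<lambda>(k, a). a = \<mu>) js)))"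
   using wf ms by metis
 next
  fix ns
  assume "\<exists>js ks. weierstrass_form L js ks \<and> ns = rev (sort (map fst (filter (\<lambda>(k, a). a = \<mu>) js)))"
  then obtain js' ks' where wf': "weierstrass_form L js' ks'"
   and ns: "ns = rev (sort (map fst (filter (\<lambda>(k, a). a = \<mu>) js')))" by blast
  obtain U' V' ms' where ls': "local_smith n \<mu> L U' V' ms'"
   and ms': "filter (\<lambda>m. 0 < m) ms' = map fst (filter (\<lambda>(k, a). a = \<mu>) js')"
   using local_smith_weierstrass_form[OF wf' Lc] by blast
  have "?S ms' = ?S ms"
   by (rule sorted_desc_unique)
    (use local_smith_exponents_unique[OF ls' ls] in \<open>auto simp: exponents_ge_sort exponents_ge_filter_pos\<close>)
  thus "ns = ?S ms" unfolding ns ms'[symmetric] .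
 qed
 with ls show ?thesis using that by blast
qed

lemma finite_partial_mults_props:
 assumes "is_pencil n L" "det L ~= 0"
 shows "sorted (rev (finite_partial_mults L \<mu>))" "\<forall>m \<in> set (finite_partial_mults L \<mu>). 0 < m"
  "sum_list (finite_partial_mults L \<mu>) = order \<mu> (det L)"
proof -
 obtain U V ms where ls: "local_smith n \<mu> L U V ms"
  and ms: "finite_partial_mults L \<mu> = rev (sort (filter (\<lambda>m. 0 < m) ms))"
  by (rule finite_partial_mults_local_smith[OF assms])
 show "sorted (rev (finite_partial_mults L \<mu>))" "\<forall>m \<in> set (finite_partial_mults L \<mu>). 0 < m"
  unfolding ms by auto
 have "sum_list (finite_partial_mults L \<mu>) = sum_mset (mset (filter (\<lambda>m. 0 < m) ms))"
  unfolding ms by (simp flip: sum_mset_sum_list)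
 also have "\<dots> = sum_list (filter (\<lambda>m. 0 < m) ms)" by (simp only: sum_mset_sum_list)
 also have "\<dots> = sum_list ms" by (induction ms) auto
 finally show "sum_list (finite_partial_mults L \<mu>) = order \<mu> (det L)"
  using local_smith_order[OF ls] by simp
qed

abbreviation blocks_ge :: "complex poly mat => complex => nat => nat" where
 "blocks_ge L \<mu> k \<equiv> exponents_ge (finite_partial_mults L \<mu>) k"

lemma blocks_ge_local_smith:
 assumes "is_pencil n L" "local_smith n \<mu> L U V ms" "1 <= k"
 shows "blocks_ge L \<mu> k = exponents_ge ms k"
proof -
 obtain U' V' ms' where ls: "local_smith n \<mu> L U' V' ms'"
  and ms: "finite_partial_mults L \<mu> = rev (sort (filter (\<lambda>m. 0 < m) ms'))"
  by (rule finite_partial_mults_local_smith[OF assms(1) local_smith_regular[OF assms(2)]])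
 show ?thesis unfolding ms exponents_ge_sort exponents_ge_filter_pos[OF assms(3)]
  by (rule local_smith_exponents_unique[OF ls assms(2)])
qed

section \<open>Perturbations of bounded rank\<close>

lemma map_poly_mat_mult:
 assumes "A \<in> carrier_mat n m" "B \<in> carrier_mat m k"
 shows "map_mat (\<lambda>p. poly p \<mu>) (A * B) = map_mat (\<lambda>p. poly p \<mu>) A * map_mat (\<lambda>p. poly p (\<mu> :: complex)) B"
proof -
 have "semiring_hom (\<lambda>p :: complex poly. poly p \<mu>)" by unfold_locales auto
 from semiring_hom.mat_hom_mult[OF this assms] show ?thesis .
qed

text \<open>One linear functional costs at most one chain. Among the chains, the one on which the functional has
 the least order serves as a pivot. Multiples of it are subtracted from the others, which keeps them chains
 and keeps the matrix invertible at \<open>\<mu>\<close>.\<close>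

lemma chains_annihilated_by_functional:
 fixes b :: "complex poly vec"
 assumes X: "X \<in> Mat n" and dX: "poly (det X) \<mu> ~= 0" and S: "S \<subseteq> {..<n}"
  and b: "b \<in> Vec n"
 obtains C T where "C \<in> Mat n" "poly (det (X * C)) \<mu> ~= 0" "T \<subseteq> S" "card S <= card T + 1"
  "!!j. j \<in> T ==> b \<bullet> col (X * C) j = 0"
  "!!j l. j \<in> T ==> l < n ==> l \<notin> S ==> C $$ (l,j) = 0"
proof (cases "\<forall>j \<in> S. b \<bullet> col X j = 0")
 case True
 show ?thesis
  by (rule that[of "1\<^sub>m n" S]) (use True X dX S in \<open>auto simp: right_mult_one_mat[OF X]\<close>)
next
 case False
 define f where "f = (\<lambda>j. b \<bullet> col X j)"
 define o' where "o' = (LEAST o'. \<exists>j \<in> S. f j ~= 0 \<and> order \<mu> (f j) = o')"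
 have "\<exists>o'. \<exists>j \<in> S. f j ~= 0 \<and> order \<mu> (f j) = o'" using False unfolding f_def by blast
 from LeastI_ex[OF this] obtain i where i: "i \<in> S" "f i ~= 0" "order \<mu> (f i) = o'"
  unfolding o'_def by blast
 have dvd: "[:-\<mu>,1:] ^ o' dvd f j" if "j \<in> S" for j
 proof (cases "f j = 0")
  case False
  hence "o' <= order \<mu> (f j)" unfolding o'_def using that by (intro Least_le) blast
  thus ?thesis by (simp add: order_divides)
 qed auto
 define h where "h = (\<lambda>j. f j div [:-\<mu>,1:] ^ o')"
 have fh: "f j = [:-\<mu>,1:] ^ o' * h j" if "j \<in> S" for j
  unfolding h_def using dvd[OF that] by (simp only: dvd_mult_div_cancel)
 have hi: "poly (h i) \<mu> ~= 0"
 proof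
  assume "poly (h i) \<mu> = 0"
  hence "[:-\<mu>,1:] dvd h i" by (simp add: lin_dvd_iff)
  hence "[:-\<mu>,1:] ^ o' * [:-\<mu>,1:] dvd f i" unfolding fh[OF i(1)] by (intro mult_dvd_mono) auto
  hence "[:-\<mu>,1:] ^ Suc o' dvd f i" by (simp only: power_Suc2)
  thus False using i order_divides by (metis Suc_n_not_le_n)
 qed
 define T where "T = S - {i}"
 define C where "C = mat n n (\<lambda>(l,j). if j \<in> T then (if l = j then h i else if l = i then - h j else 0)
   else if l = j then 1 else 0)"
 have C: "C \<in> Mat n" unfolding C_def by auto
 have iT: "i \<notin> T" "i < n" using i S unfolding T_def by auto
 let ?C = "map_mat (\<lambda>p. poly p \<mu>) C"
 have Cm: "?C \<in> Mat n" using C by auto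
 have "det ?C ~= 0"
 proof
  assume "det ?C = 0"
  then obtain v where v: "v \<in> Vec n" "v ~= 0\<^sub>v n" "?C *\<^sub>v v = 0\<^sub>v n"
   using det_0_iff_vec_prod_zero[OF Cm] by auto
  have row: "(\<Sum>j<n. poly (C $$ (l,j)) \<mu> * v $ j) = 0" if "l < n" for l
   using arg_cong[OF v(3), of "\<lambda>w. w $ l"] mult_mat_vec_sum[OF Cm v(1) that] that C by auto
  have z: "v $ l = 0" if l: "l < n" "l ~= i" for l
  proof -
   have "(\<Sum>j<n. poly (C $$ (l,j)) \<mu> * v $ j) = (\<Sum>j<n. if j = l then poly (C $$ (l,l)) \<mu> * v $ l else 0)"
    using l by (intro sum.cong) (auto simp: C_def)
   hence "poly (C $$ (l,l)) \<mu> * v $ l = 0" using row[OF l(1)] l by simp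
   thus ?thesis using l hi by (auto simp: C_def split: if_splits)
  qed
  have "(\<Sum>j<n. poly (C $$ (i,j)) \<mu> * v $ j) = (\<Sum>j<n. if j = i then v $ i else 0)"
   using z iT by (intro sum.cong) (auto simp: C_def)
  hence "v $ i = 0" using row[of i] iT by simp
  hence "v = 0\<^sub>v n" using z v(1) by (intro eq_vecI) auto
  thus False using v by blast
 qed
 hence dXC: "poly (det (X * C)) \<mu> ~= 0" using dX det_mult[OF X C] by (simp add: poly_det)
 have XCj: "b \<bullet> col (X * C) j = 0" if j: "j \<in> T" for j
 proof -
  have jn: "j < n" and jS: "j \<in> S" and ji: "j ~= i" using j S unfolding T_def by auto
  have "b \<bullet> col (X * C) j = (\<Sum>l<n. b $ l * (X * C) $$ (l,j))"
   using jn X C b by (auto simp: scalar_prod_def atLeast0LessThan)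
  also have "\<dots> = (\<Sum>l<n. b $ l * (h i * X $$ (l,j) - h j * X $$ (l,i)))"
  proof (intro sum.cong refl arg_cong2[where f = "(*)"])
   fix l assume l: "l \<in> {..<n}"
   have "(X * C) $$ (l,j) = (\<Sum>m<n. X $$ (l,m) * C $$ (m,j))" using l jn by (intro mult_mat_sum[OF X C]) auto
   also have "\<dots> = (\<Sum>m<n. (if m = j then X $$ (l,j) * h i else 0) + (if m = i then - X $$ (l,i) * h j else 0))"
    using j jn ji iT by (intro sum.cong) (auto simp: C_def)
   also have "\<dots> = h i * X $$ (l,j) - h j * X $$ (l,i)"
    unfolding sum.distrib using jn iT by simp
   finally show "(X * C) $$ (l,j) = h i * X $$ (l,j) - h j * X $$ (l,i)" .
  qed
  also have "\<dots> = h i * (\<Sum>l<n. b $ l * X $$ (l,j)) - h j * (\<Sum>l<n. b $ l * X $$ (l,i))"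
   by (simp add: sum_subtractf sum_distrib_left algebra_simps)
  also have "\<dots> = h i * f j - h j * f i"
   unfolding f_def using jn iT X b by (auto simp: scalar_prod_def atLeast0LessThan)
  also have "\<dots> = 0" unfolding fh[OF jS] fh[OF i(1)] by (simp only: mult_ac diff_self)
  finally show ?thesis .
 qed
 have fS: "finite S" using S finite_subset by blast
 show ?thesis
 proof (rule that[OF C dXC _ _ XCj])
  show "T \<subseteq> S" unfolding T_def by auto
  show "card S <= card T + 1" unfolding T_def using fS i by (simp add: card_Diff_singleton)
  fix j l assume "j \<in> T" "l < n" "l \<notin> S"
  thus "C $$ (l,j) = 0" using S i unfolding C_def T_def by (auto split: if_splits)
 qed
qed

text \<open>The chains that survive all \<open>r\<close> functionals are chains of the same length for the perturbed pencil,
 since the two pencils agree on them.\<close>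

lemma blocks_ge_perturbed:
 assumes L: "is_pencil n L" "det L ~= 0" and L': "is_pencil n L'" "det L' ~= 0"
  and b: "!!l. l < r ==> b l \<in> Vec n"
  and eq: "!!x. x \<in> Vec n ==> (!!l. l < r ==> b l \<bullet> x = 0) ==> L' *\<^sub>v x = L *\<^sub>v x"
  and k: "1 <= k"
 shows "blocks_ge L \<mu> k <= blocks_ge L' \<mu> k + r"
proof -
 let ?s = "[:-\<mu>,1:]"
 obtain U V ms where ls: "local_smith n \<mu> L U V ms"
  by (rule finite_partial_mults_local_smith[OF L])
 obtain U' V' ms' where ls': "local_smith n \<mu> L' U' V' ms'"
  by (rule finite_partial_mults_local_smith[OF L'])
 note Lc = is_pencil_carrier[OF L(1)] and Lc' = is_pencil_carrier[OF L'(1)]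
 have "\<exists>X S. X \<in> Mat n \<and> poly (det X) \<mu> ~= 0 \<and> S \<subseteq> {..<n} \<and> exponents_ge ms k <= card S + q \<and>
   (\<forall>j \<in> S. (\<forall>i<n. ?s ^ k dvd (L * X) $$ (i,j)) \<and> (\<forall>l<q. b l \<bullet> col X j = 0))" if "q <= r" for q
  using that
 proof (induction q)
  case 0
  let ?S = "{i. i < length ms \<and> k <= ms ! i}"
  have V: "V \<in> Mat n" "poly (det V) \<mu> ~= 0"
   using ls unfolding local_smith_def by blast+
  note ex = local_smith_chains_exist[OF ls, where k = k]
  show ?case
   using V ex by (intro exI[of _ V] exI[of _ ?S] conjI ballI) (auto simp del: mem_Collect_eq)
 next
  case (Suc q)
  then obtain X S where X: "X \<in> Mat n" "poly (det X) \<mu> ~= 0" "S \<subseteq> {..<n}"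
   and card: "exponents_ge ms k <= card S + q"
   and ch: "!!i j. j \<in> S ==> i < n ==> ?s ^ k dvd (L * X) $$ (i,j)"
   and ann: "!!j l. j \<in> S ==> l < q ==> b l \<bullet> col X j = 0" by auto
  obtain C T where C: "C \<in> Mat n" "poly (det (X * C)) \<mu> ~= 0" "T \<subseteq> S" "card S <= card T + 1"
   and bT: "!!j. j \<in> T ==> b q \<bullet> col (X * C) j = 0"
   and supp: "!!j l. j \<in> T ==> l < n ==> l \<notin> S ==> C $$ (l,j) = 0"
   by (rule chains_annihilated_by_functional[OF X(1-3) b[of q]]) (use Suc.prems in auto)
  have ch': "?s ^ k dvd (L * (X * C)) $$ (i,j)" if j: "j \<in> T" and i: "i < n" for i j
  proof -
   have jn: "j < n" using j C(3) X(3) by auto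
   have "(L * (X * C)) $$ (i,j) = ((L * X) * C) $$ (i,j)"
    using Lc X(1) C(1) by (simp add: assoc_mult_mat[of _ n n _ n _ n])
   also have "\<dots> = (\<Sum>l<n. (L * X) $$ (i,l) * C $$ (l,j))"
    by (rule mult_mat_sum[OF mult_square_carrier[OF Lc X(1)] C(1) i jn])
   also have "?s ^ k dvd \<dots>"
   proof (rule dvd_sum)
    fix l assume l: "l \<in> {..<n}"
    show "?s ^ k dvd (L * X) $$ (i,l) * C $$ (l,j)"
    proof (cases "l \<in> S")
     case True
     show ?thesis by (rule dvd_mult2[OF ch[OF True i]])
    qed (use supp[OF j] l in auto)
   qed
   finally show ?thesis .
  qed
  have ann': "b l \<bullet> col (X * C) j = 0" if j: "j \<in> T" and l: "l < Suc q" for j l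
  proof (cases "l = q")
   case False
   hence lq: "l < q" using l by simp
   have jn: "j < n" using j C(3) X(3) by auto
   have bl: "b l \<in> Vec n" using b lq Suc.prems by auto
   have "b l \<bullet> col (X * C) j = (\<Sum>i<n. b l $ i * (\<Sum>m<n. X $$ (i,m) * C $$ (m,j)))"
    using jn X C bl by (auto simp: scalar_prod_def atLeast0LessThan)
   also have "\<dots> = (\<Sum>m<n. (\<Sum>i<n. b l $ i * X $$ (i,m)) * C $$ (m,j))"
    by (simp add: sum_distrib_left sum_distrib_right mult.assoc) (rule sum.swap)
   also have "\<dots> = (\<Sum>m<n. (b l \<bullet> col X m) * C $$ (m,j))"
    using X bl by (auto simp: scalar_prod_def atLeast0LessThan intro!: sum.cong)
   also have "\<dots> = 0"
    by (rule sum.neutral) (use ann lq supp[OF j] in auto)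
   finally show ?thesis .
  qed (use bT j in auto)
  have "T \<subseteq> {..<n}" "exponents_ge ms k <= card T + Suc q" using C X card by auto
  thus ?case using mult_square_carrier[OF X(1) C(1)] C(2) ch' ann' by blast
 qed
 from this[of r] obtain X S where X: "X \<in> Mat n" "poly (det X) \<mu> ~= 0" "S \<subseteq> {..<n}"
   and card: "exponents_ge ms k <= card S + r"
   and ch: "!!i j. j \<in> S ==> i < n ==> ?s ^ k dvd (L * X) $$ (i,j)"
   and ann: "!!j l. j \<in> S ==> l < r ==> b l \<bullet> col X j = 0" by auto
 have "card S <= exponents_ge ms' k"
 proof (rule local_smith_chain_bound[OF ls' X])
  fix i j assume j: "j \<in> S" and i: "i < n"
  have jn: "j < n" using j X by auto
  have "(L' * X) $$ (i,j) = (L' *\<^sub>v col X j) $ i" using i jn X Lc' by auto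
  also have "\<dots> = (L *\<^sub>v col X j) $ i" using eq[of "col X j"] ann[OF j] jn X by auto
  also have "\<dots> = (L * X) $$ (i,j)" using i jn X Lc by auto
  finally show "?s ^ k dvd (L' * X) $$ (i,j)" using ch[OF j i] by simp
 qed
 with card show ?thesis
  using blocks_ge_local_smith[OF L(1) ls k] blocks_ge_local_smith[OF L'(1) ls' k] by simp
qed

section \<open>The adjugate and the largest partial multiplicity\<close>

lemma adj_nonzero:
 assumes L: "L \<in> Mat n" and reg: "det (L :: complex poly mat) ~= 0" and n: "0 < n"
 obtains i j where "i < n" "j < n" "adj_mat L $$ (i,j) ~= 0"
proof -
 have "\<exists>i<n. adj_mat L $$ (i,0) ~= 0"
 proof (rule ccontr)
  assume "\<not> ?thesis"
  hence "(L * adj_mat L) $$ (0,0) = 0"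
   using mult_mat_sum[OF L adj_carrier[OF L] n n] by simp
  thus False using reg n by (simp add: adj_mat(2)[OF L])
 qed
 thus ?thesis using that n by blast
qed

text \<open>Divide the adjugate by the highest power of \<open>[:-\<mu>,1:]\<close> that divides all its entries.\<close>

lemma adj_factorization:
 assumes L: "L \<in> Mat n" and reg: "det (L :: complex poly mat) ~= 0" and n: "0 < n"
 obtains e C where "C \<in> Mat n" "adj_mat L = [:-\<mu>,1:] ^ e \<cdot>\<^sub>m C"
  "\<exists>i<n. \<exists>j<n. poly (C $$ (i,j)) \<mu> ~= 0"
  "!!i j. i < n ==> j < n ==> adj_mat L $$ (i,j) ~= 0 ==> e <= order \<mu> (adj_mat L $$ (i,j))"
proof -
 let ?s = "[:-\<mu>,1:]" and ?J = "adj_mat L"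
 define P where "P = (\<lambda>e. \<exists>i<n. \<exists>j<n. ?J $$ (i,j) ~= 0 \<and> order \<mu> (?J $$ (i,j)) = e)"
 define e where "e = (LEAST e. P e)"
 have "\<exists>e. P e" unfolding P_def using adj_nonzero[OF assms] by metis
 hence "P e" unfolding e_def by (rule LeastI_ex)
 then obtain i j where ij: "i < n" "j < n" "?J $$ (i,j) ~= 0" "order \<mu> (?J $$ (i,j)) = e"
  unfolding P_def by blast
 have le: "e <= order \<mu> (?J $$ (k,l))" if "k < n" "l < n" "?J $$ (k,l) ~= 0" for k l
  unfolding e_def using that by (intro Least_le) (auto simp: P_def)
 have dvd: "?s ^ e dvd ?J $$ (k,l)" if "k < n" "l < n" for k l
  using le[OF that] by (cases "?J $$ (k,l) = 0") (auto simp: order_divides)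
 define C where "C = mat n n (\<lambda>(k,l). ?J $$ (k,l) div ?s ^ e)"
 have C: "C \<in> Mat n" unfolding C_def by auto
 have CJ: "?J $$ (k,l) = ?s ^ e * C $$ (k,l)" if "k < n" "l < n" for k l
  using that dvd[OF that] unfolding C_def by (simp del: power.simps)
 have "poly (C $$ (i,j)) \<mu> ~= 0"
 proof
  assume "poly (C $$ (i,j)) \<mu> = 0"
  hence "?s ^ e * ?s dvd ?J $$ (i,j)"
   unfolding CJ[OF ij(1,2)] by (intro mult_dvd_mono) (auto simp: lin_dvd_iff)
  hence "?s ^ Suc e dvd ?J $$ (i,j)" by (simp only: power_Suc2)
  thus False using ij order_divides by (metis Suc_n_not_le_n)
 qed
 moreover have "?J = ?s ^ e \<cdot>\<^sub>m C"
  using L C CJ by (intro eq_matI) auto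
 ultimately show ?thesis using that[OF C] ij le by blast
qed

lemma smult_mat_cancel:
 assumes "A \<in> carrier_mat n m" "B \<in> carrier_mat n m" "c ~= 0" "c \<cdot>\<^sub>m A = c \<cdot>\<^sub>m (B :: complex poly mat)"
 shows "A = B"
proof (rule eq_matI)
 fix i j assume "i < dim_row B" "j < dim_col B"
 hence "i < n" "j < m" using assms by auto
 hence "c * A $$ (i,j) = c * B $$ (i,j)"
  using arg_cong[OF assms(4), of "\<lambda>M. M $$ (i,j)"] assms(1,2)
  by (metis carrier_matD index_smult_mat(1))
 thus "A $$ (i,j) = B $$ (i,j)" using assms(3) by simp
qed (use assms in auto)

text \<open>\<open>L C\<close> and \<open>C L\<close> are \<open>[:-\<mu>,1:] ^ (a - e)\<close> times a scalar matrix, where \<open>a\<close> and \<open>e\<close> are the orders of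
 the determinant and of the adjugate.\<close>

lemma adj_mult_reduced:
 fixes L :: "complex poly mat"
 assumes L: "L \<in> Mat n" and reg: "det L ~= 0"
  and C: "C \<in> Mat n" and adj: "adj_mat L = [:-\<mu>,1:] ^ e \<cdot>\<^sub>m C"
  and nz: "\<exists>i<n. \<exists>j<n. poly (C $$ (i,j)) \<mu> ~= 0"
 obtains d where "poly d \<mu> ~= 0" "det L = [:-\<mu>,1:] ^ order \<mu> (det L) * d" "e <= order \<mu> (det L)"
  "L * C = ([:-\<mu>,1:] ^ (order \<mu> (det L) - e) * d) \<cdot>\<^sub>m 1\<^sub>m n"
  "C * L = ([:-\<mu>,1:] ^ (order \<mu> (det L) - e) * d) \<cdot>\<^sub>m 1\<^sub>m n"
proof -
 let ?s = "[:-\<mu>,1:]" and ?a = "order \<mu> (det L)"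
 obtain d where d: "det L = ?s ^ ?a * d" "\<not> ?s dvd d"
  using order_decomp[OF reg, of \<mu>] by blast
 have d0: "poly d \<mu> ~= 0" using d(2) unfolding lin_dvd_iff .
 have LC: "?s ^ e \<cdot>\<^sub>m (L * C) = det L \<cdot>\<^sub>m 1\<^sub>m n"
  using adj_mat(2)[OF L] L C unfolding adj by (simp add: mult_smult_distrib[of _ n n _ n] del: power.simps)
 have CL: "?s ^ e \<cdot>\<^sub>m (C * L) = det L \<cdot>\<^sub>m 1\<^sub>m n"
  using adj_mat(3)[OF L] L C unfolding adj by (simp add: mult_smult_assoc_mat[of _ n n _ n] del: power.simps)
 have ea: "e <= ?a"
 proof -
  obtain i j where "i < n" "j < n" using nz by blast
  hence "(?s ^ e \<cdot>\<^sub>m (L * C)) $$ (i,i) = det L" unfolding LC by simp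
  moreover have "(?s ^ e \<cdot>\<^sub>m (L * C)) $$ (i,i) = ?s ^ e * (L * C) $$ (i,i)"
   using L C \<open>i < n\<close> by (simp del: power.simps)
  ultimately have "?s ^ e dvd det L" by (metis dvd_triv_left)
  thus ?thesis using reg by (simp add: order_divides)
 qed
 have D: "det L \<cdot>\<^sub>m 1\<^sub>m n = ?s ^ e \<cdot>\<^sub>m ((?s ^ (?a - e) * d) \<cdot>\<^sub>m 1\<^sub>m n)"
 proof -
  have "det L = ?s ^ e * (?s ^ (?a - e) * d)"
   using d(1) ea by (metis le_add_diff_inverse mult.assoc power_add)
  thus ?thesis by (intro eq_matI) auto
 qed
 have "L * C = (?s ^ (?a - e) * d) \<cdot>\<^sub>m 1\<^sub>m n"
  by (rule smult_mat_cancel[of _ n n _ "?s ^ e"]) (use L C LC D in auto)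
 moreover have "C * L = (?s ^ (?a - e) * d) \<cdot>\<^sub>m 1\<^sub>m n"
  by (rule smult_mat_cancel[of _ n n _ "?s ^ e"]) (use L C CL D in auto)
 ultimately show ?thesis using that[OF d0 d(1) ea] by blast
qed

lemma local_smith_column_chain:
 assumes ls: "local_smith n \<mu> L U V ms" and x: "x \<in> Vec n"
  and chain: "!!i. i < n ==> [:-\<mu>,1:] ^ k dvd (L *\<^sub>v x) $ i"
  and nz: "i < n" "poly (x $ i) \<mu> ~= 0"
 shows "0 < exponents_ge ms k"
proof (rule ccontr)
 assume "\<not> ?thesis"
 hence "exponents_ge ms k = 0" by simp
 hence lt: "ms ! j < k" if "j < n" for j
  using that ls unfolding exponents_ge_def local_smith_def
  by (auto simp: filter_empty_conv) (metis linorder_not_le nth_mem)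
 have V: "V \<in> Mat n" "poly (det V) \<mu> ~= 0" using ls unfolding local_smith_def by blast+
 have "V *\<^sub>v (adj_mat V *\<^sub>v x) = det V \<cdot>\<^sub>v x"
  using assoc_mult_mat_vec[OF V(1) adj_carrier[OF V(1)] x, symmetric] x
  by (simp add: adj_mat(2)[OF V(1)] smult_one_mult_mat_vec)
 hence "det V * x $ i = (V *\<^sub>v (adj_mat V *\<^sub>v x)) $ i" using x nz by simp
 also have "\<dots> = (\<Sum>j<n. V $$ (i,j) * (adj_mat V *\<^sub>v x) $ j)"
  using x V nz by (intro mult_mat_vec_sum) auto
 finally have "poly (det V) \<mu> * poly (x $ i) \<mu> = (\<Sum>j<n. poly (V $$ (i,j)) \<mu> * poly ((adj_mat V *\<^sub>v x) $ j) \<mu>)"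
  by (metis (mono_tags, lifting) poly_mult poly_sum sum.cong)
 also have "\<dots> = 0"
  by (rule sum.neutral) (use local_smith_chain[OF ls x chain] lt in auto)
 finally show False using V nz by simp
qed

text \<open>The largest partial multiplicity is \<open>a - e\<close>, the difference between the orders of the determinant and
 of the adjugate: the columns of \<open>C\<close> are chains of that length, and no chain is longer, as \<open>C * L\<close> is
 the same scalar multiple of the identity.\<close>

lemma blocks_ge_adj:
 assumes L: "is_pencil n L" and reg: "det L ~= 0"
  and C: "C \<in> Mat n" and adj: "adj_mat L = [:-\<mu>,1:] ^ e \<cdot>\<^sub>m C"
  and nz: "\<exists>i<n. \<exists>j<n. poly (C $$ (i,j)) \<mu> ~= 0" and k: "1 <= k"
 shows "0 < blocks_ge L \<mu> k \<longleftrightarrow> k <= order \<mu> (det L) - e"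
proof -
 let ?s = "[:-\<mu>,1:]" and ?a = "order \<mu> (det L)"
 note Lc = is_pencil_carrier[OF L]
 obtain d where d: "poly d \<mu> ~= 0" "det L = ?s ^ ?a * d" "e <= ?a"
  and LC: "L * C = (?s ^ (?a - e) * d) \<cdot>\<^sub>m 1\<^sub>m n" and CL: "C * L = (?s ^ (?a - e) * d) \<cdot>\<^sub>m 1\<^sub>m n"
  by (rule adj_mult_reduced[OF Lc reg C adj nz])
 obtain U V ms where ls: "local_smith n \<mu> L U V ms"
  by (rule finite_partial_mults_local_smith[OF L reg])
 note bg = blocks_ge_local_smith[OF L ls k]
 show ?thesis
 proof
  assume kle: "k <= ?a - e"
  obtain i j where ij: "i < n" "j < n" "poly (C $$ (i,j)) \<mu> ~= 0" using nz by blast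
  have "0 < exponents_ge ms k"
  proof (rule local_smith_column_chain[OF ls])
   show "col C j \<in> Vec n" using C by auto
   show "i < n" "poly (col C j $ i) \<mu> ~= 0" using ij C by auto
   fix l assume l: "l < n"
   have "(L *\<^sub>v col C j) $ l = (L * C) $$ (l,j)" using l ij C Lc by auto
   also have "\<dots> = ?s ^ (?a - e) * d * (if l = j then 1 else 0)"
    unfolding LC using l ij by (auto simp del: power.simps)
   finally show "?s ^ k dvd (L *\<^sub>v col C j) $ l"
    using le_imp_power_dvd[OF kle, of ?s] by (metis dvd_mult2)
  qed
  thus "0 < blocks_ge L \<mu> k" using bg by simp
 next
  assume "0 < blocks_ge L \<mu> k"
  hence "0 < exponents_ge ms k" using bg by simp
  hence "{i. i < length ms \<and> k <= ms ! i} ~= {}" unfolding exponents_ge_card by (metis card.empty less_irrefl)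
  then obtain j where j: "j < length ms" "k <= ms ! j" by auto
  have V: "V \<in> Mat n" "poly (det V) \<mu> ~= 0" and U: "U \<in> Mat n"
   and len: "length ms = n" and eq: "L * V = U * smith_diag \<mu> ms"
   using ls unfolding local_smith_def by blast+
  have jn: "j < n" using j len by simp
  show "k <= ?a - e"
  proof (rule ccontr)
   assume "\<not> ?thesis"
   hence lt: "?a - e < k" by simp
   have dvd: "?s ^ k dvd (L * V) $$ (i,j)" if "i < n" for i
    unfolding eq mult_smith_diag[OF U len that jn] by (rule dvd_mult[OF le_imp_power_dvd[OF j(2)]])
   have z: "poly (V $$ (i,j)) \<mu> = 0" if i: "i < n" for i
   proof -
    have "C * (L * V) = (?s ^ (?a - e) * d) \<cdot>\<^sub>m V"
     using assoc_mult_mat[OF C Lc V(1), symmetric] V unfolding CL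
     by (simp add: mult_smult_assoc_mat[of _ n n _ n] del: power.simps)
    hence "?s ^ (?a - e) * d * V $$ (i,j) = (C * (L * V)) $$ (i,j)"
     using V i jn by (simp del: power.simps)
    also have "\<dots> = (\<Sum>l<n. C $$ (i,l) * (L * V) $$ (l,j))"
     by (rule mult_mat_sum[OF C mult_square_carrier[OF Lc V(1)] i jn])
    also have "?s ^ k dvd \<dots>" using dvd by (intro dvd_sum dvd_mult) auto
    finally have "?s ^ Suc (?a - e) dvd ?s ^ (?a - e) * (d * V $$ (i,j))"
     using lt by (metis (no_types, lifting) Suc_leI dvd_trans le_imp_power_dvd mult.assoc)
    hence "?s ^ (?a - e) * ?s dvd ?s ^ (?a - e) * (d * V $$ (i,j))" by (simp only: power_Suc2)
    hence "?s dvd d * V $$ (i,j)"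
     using dvd_times_left_cancel_iff[of "?s ^ (?a - e)" ?s "d * V $$ (i,j)"]
     by (simp only: power_eq_0_iff) auto
    thus ?thesis using d(1) by (simp add: lin_dvd_iff)
   qed
   have Vm: "map_mat (\<lambda>p. poly p \<mu>) V \<in> Mat n" using V by auto
   have "map_mat (\<lambda>p. poly p \<mu>) V *\<^sub>v unit_vec n j = 0\<^sub>v n"
    using V z jn by (intro eq_vecI) auto
   moreover have "unit_vec n j ~= (0\<^sub>v n :: complex vec)" using jn by simp
   ultimately have "det (map_mat (\<lambda>p. poly p \<mu>) V) = 0"
    using det_0_iff_vec_prod_zero[OF Vm] by (metis unit_vec_carrier)
   thus False using V(2) by (simp add: poly_det)
  qed
 qed
qed

section \<open>Alternating pencils: parity of the partial multiplicities at zero\<close>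

text \<open>The substitution of \<open>-\<lambda>\<close> for \<open>\<lambda>\<close>.\<close>

definition flip :: "complex poly => complex poly" where
 "flip p = p \<circ>\<^sub>p [:0,-1:]"

lemma flip_simps [simp]:
 "flip (p + q) = flip p + flip q" "flip (p - q) = flip p - flip q" "flip (- p) = - flip p"
 "flip (p * q) = flip p * flip q" "flip 0 = 0" "flip 1 = 1" "flip [:a:] = [:a:]" "flip [:0,1:] = - [:0,1:]"
 "flip (sum f A) = (\<Sum>x\<in>A. flip (f x))"
 unfolding flip_def by (auto simp: pcompose_add pcompose_diff pcompose_uminus pcompose_mult pcompose_1
   pcompose_pCons pcompose_sum)

lemma flip_power [simp]: "flip (p ^ k) = flip p ^ k"
 by (induction k) auto

lemma flip_flip [simp]: "flip (flip p) = p"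
 unfolding flip_def by (simp add: pcompose_assoc[symmetric] pcompose_pCons)

lemma poly_flip: "poly (flip p) x = poly p (- x)"
 unfolding flip_def by (simp add: poly_pcompose)

lemma flip_lin: "flip [:a, b:] = [:a, - b:]"
 unfolding flip_def by (simp add: pcompose_pCons)

lemma flip_eq_0_iff [simp]: "flip p = 0 \<longleftrightarrow> p = 0"
 by (metis flip_flip flip_simps(5))

lemma comm_ring_hom_flip: "comm_ring_hom flip"
 by unfold_locales auto

lemma flip_mat_mult:
 assumes "A \<in> carrier_mat n m" "B \<in> carrier_mat m k"
 shows "map_mat flip (A * B) = map_mat flip A * map_mat flip B"
proof -
 have "semiring_hom flip" by unfold_locales auto
 from semiring_hom.mat_hom_mult[OF this assms] show ?thesis .
qed

lemma flip_det: "flip (det A) = det (map_mat flip A)"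
 by (rule comm_ring_hom.hom_det[OF comm_ring_hom_flip, symmetric])

definition alternating :: "complex => nat => complex poly mat => bool" where
 "alternating \<epsilon> n L \<longleftrightarrow> L \<in> Mat n \<and> (\<forall>i<n. \<forall>j<n. flip (L $$ (j,i)) = [:\<epsilon>:] * L $$ (i,j))"

text \<open>If a matrix is skew-symmetric on an index set \<open>S\<close> of odd size and vanishes outside the square
 \<open>S \<times> S\<close>, it has a kernel vector supported on \<open>S\<close>: filled up with an identity
 outside \<open>S\<close>, it has the same determinant as its transpose, which arises by negating
 an odd number of columns.\<close>

lemma skew_block_kernel:
 fixes Q :: "complex mat"
 assumes Q: "Q \<in> Mat n" and S: "S \<subseteq> {..<n}" and odd: "odd (card S)"
  and skew: "!!i j. i \<in> S ==> j \<in> S ==> Q $$ (j,i) = - Q $$ (i,j)"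
 obtains v where "v \<in> Vec n" "v ~= 0\<^sub>v n" "!!i. i < n ==> i \<notin> S ==> v $ i = 0"
  "!!i. i \<in> S ==> (\<Sum>j\<in>S. Q $$ (i,j) * v $ j) = 0"
proof -
 define R where "R = mat n n (\<lambda>(i,j). if i \<in> S \<and> j \<in> S then Q $$ (i,j) else if i = j then 1 else 0)"
 define c where "c = (\<lambda>j. if j \<in> S then -1 else 1 :: complex)"
 define D where "D = mat n n (\<lambda>(i,j). if i = j then c j else 0)"
 have R: "R \<in> Mat n" and D: "D \<in> Mat n" unfolding R_def D_def by auto
 have RD: "(R * D) $$ (i,j) = R $$ (i,j) * c j" if "i < n" "j < n" for i j
 proof -
  have "(R * D) $$ (i,j) = (\<Sum>l<n. R $$ (i,l) * D $$ (l,j))" by (rule mult_mat_sum[OF R D that])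
  also have "\<dots> = (\<Sum>l<n. if l = j then R $$ (i,j) * c j else 0)"
   using that by (intro sum.cong) (auto simp: D_def)
  finally show ?thesis using that by simp
 qed
 have "transpose_mat R = R * D"
 proof (rule eq_matI)
  fix i j assume "i < dim_row (R * D)" "j < dim_col (R * D)"
  hence ij: "i < n" "j < n" using R D by auto
  have "transpose_mat R $$ (i,j) = R $$ (j,i)" using R ij by simp
  also have "\<dots> = R $$ (i,j) * c j" using ij skew[of i j] unfolding R_def c_def by auto
  finally show "transpose_mat R $$ (i,j) = (R * D) $$ (i,j)" using RD[OF ij] by simp
 qed (use R D in auto)
 hence "det R = det R * det D" using det_transpose[OF R] det_mult[OF R D] by simp
 moreover have "det D = prod_list (diag_mat D)"
  by (rule det_upper_triangular[OF _ D]) (auto simp: D_def)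
 moreover have "diag_mat D = map c [0..<n]"
  by (intro nth_equalityI) (auto simp: diag_mat_def D_def)
 moreover have "prod_list (map c [0..<n]) = (\<Prod>j \<in> {..<n}. c j)"
  by (induction n) (auto simp: lessThan_Suc mult.commute)
 moreover have "(\<Prod>j \<in> {..<n}. c j) = (\<Prod>j \<in> {..<n} \<inter> S. -1) * (\<Prod>j \<in> {..<n} - S. 1)"
  unfolding c_def by (subst prod.If_cases) (auto simp: Diff_eq)
 ultimately have "det R = 0" using odd S by (simp add: Int_absorb1)
 then obtain v where v: "v \<in> Vec n" "v ~= 0\<^sub>v n" "R *\<^sub>v v = 0\<^sub>v n"
  using det_0_iff_vec_prod_zero[OF R] by auto
 have row: "(\<Sum>j<n. R $$ (i,j) * v $ j) = 0" if "i < n" for i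
  using arg_cong[OF v(3), of "\<lambda>w. w $ i"] mult_mat_vec_sum[OF R v(1) that] that by auto
 have z: "v $ i = 0" if i: "i < n" "i \<notin> S" for i
 proof -
  have "(\<Sum>j<n. R $$ (i,j) * v $ j) = (\<Sum>j<n. if j = i then v $ i else 0)"
   using i by (intro sum.cong) (auto simp: R_def)
  thus ?thesis using row[OF i(1)] i by simp
 qed
 have "(\<Sum>j\<in>S. Q $$ (i,j) * v $ j) = 0" if i: "i \<in> S" for i
 proof -
  have "(\<Sum>j\<in>S. Q $$ (i,j) * v $ j) = (\<Sum>j\<in>S. R $$ (i,j) * v $ j)"
   using i S by (intro sum.cong) (auto simp: R_def subset_iff)
  also have "\<dots> = (\<Sum>j<n. R $$ (i,j) * v $ j)"
   using S z by (intro sum.mono_neutral_left) auto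
  finally show ?thesis using row i S by auto
 qed
 with v(1,2) z show ?thesis using that by blast
qed

text \<open>The matrix \<open>R = V(-\<lambda>)\<^sup>T U\<close> satisfies \<open>R D = V(-\<lambda>)\<^sup>T L V\<close>, which is alternating. Hence
 \<open>R(0)\<close> is block triangular with respect to the exponents, and its diagonal block for the
 exponent \<open>k\<close> is symmetric up to the sign \<open>\<epsilon> (-1)\<^sup>k\<close>.\<close>

lemma alternating_parity:
 assumes ls: "local_smith n 0 L U V ms" and alt: "alternating \<epsilon> n L" and sgn: "\<epsilon> * (-1) ^ k = -1"
 shows "even (card {i. i < n \<and> ms ! i = k})"
proof (rule ccontr)
 assume odd: "odd (card {i. i < n \<and> ms ! i = k})"
 define S where "S = {i. i < n \<and> ms ! i = k}"
 let ?s = "[:0,1:] :: complex poly"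
 have L: "L \<in> Mat n" and U: "U \<in> Mat n" and V: "V \<in> Mat n"
  and len: "length ms = n" and dU: "poly (det U) 0 ~= 0" and dV: "poly (det V) 0 ~= 0"
  and eq: "L * V = U * smith_diag 0 ms"
  using ls unfolding local_smith_def by blast+
 have e1: "\<epsilon> * \<epsilon> = 1"
  using sgn by (metis (no_types, opaque_lifting) minus_mult_minus mult.left_commute mult.right_neutral
    mult_minus1_right power_mult_distrib power_one mult.commute mult_minus_left power2_eq_square power_even_eq power_minus1_even power_minus)
 define Vm where "Vm = transpose_mat (map_mat flip V)"
 have Vm: "Vm \<in> Mat n" unfolding Vm_def using V by auto
 define R where "R = Vm * U"
 have R: "R \<in> Mat n" unfolding R_def using Vm U by simp
 define F where "F = Vm * (L * V)"
 have F: "F \<in> Mat n" unfolding F_def using Vm L V by simp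
 have "F = R * smith_diag 0 ms" unfolding F_def eq R_def
  by (rule assoc_mult_mat[symmetric, OF Vm U smith_diag_carrier[OF len]])
 hence FR: "F $$ (i,j) = R $$ (i,j) * ?s ^ (ms ! j)" if "i < n" "j < n" for i j
  using mult_smith_diag[OF R len that, of 0] by simp
 have Fsum: "F $$ (i,j) = (\<Sum>l<n. \<Sum>m<n. flip (V $$ (l,i)) * L $$ (l,m) * V $$ (m,j))"
  if "i < n" "j < n" for i j
 proof -
  have "F $$ (i,j) = (\<Sum>l<n. Vm $$ (i,l) * (\<Sum>m<n. L $$ (l,m) * V $$ (m,j)))"
   unfolding F_def mult_mat_sum[OF Vm mult_square_carrier[OF L V] that]
   by (intro sum.cong refl arg_cong2[where f = "(*)"] mult_mat_sum[OF L V]) (use that in auto)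
  also have "\<dots> = (\<Sum>l<n. \<Sum>m<n. flip (V $$ (l,i)) * L $$ (l,m) * V $$ (m,j))"
   unfolding sum_distrib_left using that V by (intro sum.cong) (auto simp: Vm_def mult.assoc)
  finally show ?thesis .
 qed
 have Fflip: "flip (F $$ (j,i)) = [:\<epsilon>:] * F $$ (i,j)" if "i < n" "j < n" for i j
 proof -
  have "flip (F $$ (j,i)) = (\<Sum>l<n. \<Sum>m<n. V $$ (l,j) * flip (L $$ (l,m)) * flip (V $$ (m,i)))"
   unfolding Fsum[OF that(2,1)] by simp
  also have "\<dots> = (\<Sum>l<n. \<Sum>m<n. V $$ (l,j) * ([:\<epsilon>:] * L $$ (m,l)) * flip (V $$ (m,i)))"
   using alt unfolding alternating_def by (intro sum.cong) auto
  also have "\<dots> = (\<Sum>m<n. \<Sum>l<n. V $$ (l,j) * ([:\<epsilon>:] * L $$ (m,l)) * flip (V $$ (m,i)))"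
   by (rule sum.swap)
  also have "\<dots> = [:\<epsilon>:] * F $$ (i,j)"
   unfolding Fsum[OF that] sum_distrib_left by (intro sum.cong) (auto simp: mult_ac)
  finally show ?thesis .
 qed
 have key: "flip (R $$ (j,i)) * (- 1) ^ (ms ! i) * ?s ^ (ms ! i) = [:\<epsilon>:] * R $$ (i,j) * ?s ^ (ms ! j)"
  if "i < n" "j < n" for i j
 proof -
  have "flip (R $$ (j,i)) * ((- 1) * ?s) ^ (ms ! i) = [:\<epsilon>:] * (R $$ (i,j) * ?s ^ (ms ! j))"
   using Fflip[OF that] unfolding FR[OF that] FR[OF that(2,1)] by simp
  thus ?thesis by (simp only: power_mult_distrib mult.assoc)
 qed
 define R0 where "R0 = map_mat (\<lambda>p. poly p 0) R"
 have R0: "R0 \<in> Mat n" unfolding R0_def using R by auto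
 have eps0: "\<epsilon> ~= 0" using e1 by auto
 have tri: "R0 $$ (i,j) = 0" if ij: "i < n" "j < n" "ms ! j < ms ! i" for i j
 proof -
  have "[:\<epsilon>:] * R $$ (i,j) * ?s ^ (ms ! j) = (flip (R $$ (j,i)) * (- 1) ^ (ms ! i) * ?s ^ (ms ! i - ms ! j)) * ?s ^ (ms ! j)"
  proof -
   have "?s ^ (ms ! i) = ?s ^ (ms ! i - ms ! j) * ?s ^ (ms ! j)"
    unfolding power_add[symmetric] using ij(3) by simp
   thus ?thesis using key[OF ij(1,2)] by (simp only: mult.assoc)
  qed
  hence "[:\<epsilon>:] * R $$ (i,j) = flip (R $$ (j,i)) * (- 1) ^ (ms ! i) * ?s ^ (ms ! i - ms ! j)"
   by (simp only: mult_cancel_right power_eq_0_iff) auto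
  hence "poly ([:\<epsilon>:] * R $$ (i,j)) 0 = poly (flip (R $$ (j,i)) * (- 1) ^ (ms ! i) * ?s ^ (ms ! i - ms ! j)) 0"
   by simp
  hence "\<epsilon> * poly (R $$ (i,j)) 0 = 0" using ij(3) by (simp add: poly_power)
  thus ?thesis unfolding R0_def using eps0 ij R by auto
 qed
 have sym: "R0 $$ (j,i) = - R0 $$ (i,j)" if "i \<in> S" "j \<in> S" for i j
 proof -
  have ij: "i < n" "j < n" "ms ! i = k" "ms ! j = k" using that unfolding S_def by auto
  have "flip (R $$ (j,i)) * (- 1) ^ k = [:\<epsilon>:] * R $$ (i,j)"
   using key[OF ij(1,2)] unfolding ij by (simp only: mult_cancel_right power_eq_0_iff) auto
  hence "poly (flip (R $$ (j,i)) * (- 1) ^ k) 0 = poly ([:\<epsilon>:] * R $$ (i,j)) 0" by simp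
  hence "poly (R $$ (j,i)) 0 * (- 1) ^ k = \<epsilon> * poly (R $$ (i,j)) 0" by (simp add: poly_flip poly_power)
  hence "poly (R $$ (j,i)) 0 * (\<epsilon> * (- 1) ^ k) = (\<epsilon> * \<epsilon>) * poly (R $$ (i,j)) 0"
   by (simp add: mult_ac)
  thus ?thesis unfolding R0_def sgn e1 using ij R by simp (metis add.inverse_inverse)
 qed
 have odd': "odd (card S)" using odd unfolding S_def .
 obtain v where v: "v \<in> Vec n" "v ~= 0\<^sub>v n" "!!i. i < n ==> i \<notin> S ==> v $ i = 0"
  "!!i. i \<in> S ==> (\<Sum>j\<in>S. R0 $$ (i,j) * v $ j) = 0"
  by (rule skew_block_kernel[OF R0 _ odd' sym]) (auto simp: S_def)
 define B where "B = mat n n (\<lambda>(i,j). if ms ! i = ms ! j then R0 $$ (i,j) else 0)"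
 have B: "B \<in> Mat n" unfolding B_def by auto
 have "B *\<^sub>v v = 0\<^sub>v n"
 proof (rule eq_vecI)
  fix i assume "i < dim_vec (0\<^sub>v n :: complex vec)"
  hence i: "i < n" by simp
  have "(B *\<^sub>v v) $ i = (\<Sum>j<n. B $$ (i,j) * v $ j)" by (rule mult_mat_vec_sum[OF B v(1) i])
  also have "\<dots> = (\<Sum>j\<in>S. B $$ (i,j) * v $ j)"
   using v(3) by (intro sum.mono_neutral_right) (auto simp: S_def)
  also have "\<dots> = 0"
  proof (cases "i \<in> S")
   case True
   have "(\<Sum>j\<in>S. B $$ (i,j) * v $ j) = (\<Sum>j\<in>S. R0 $$ (i,j) * v $ j)"
    using True by (intro sum.cong) (auto simp: B_def S_def)
   thus ?thesis using v(4)[OF True] by simp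
  next
   case False
   thus ?thesis using i by (intro sum.neutral) (auto simp: B_def S_def)
  qed
  finally show "(B *\<^sub>v v) $ i = 0\<^sub>v n $ i" using i by simp
 qed (use B in auto)
 hence "det B = 0" using det_0_iff_vec_prod_zero[OF B] v by blast
 moreover have "det B = det R0"
  unfolding det_def'[OF B] det_def'[OF R0]
 proof (intro sum.cong refl arg_cong2[where f = "(*)"])
  fix p assume "p \<in> {p. p permutes {0..<n}}"
  hence p: "p permutes {0..<n}" by simp
  have pn: "p i < n" if "i < n" for i using permutes_in_image[OF p, of i] that by auto
  show "(\<Prod>i = 0..<n. B $$ (i, p i)) = (\<Prod>i = 0..<n. R0 $$ (i, p i))"
  proof (cases "\<forall>i<n. ms ! i <= ms ! (p i)")
   case True
   have "(\<Sum>i = 0..<n. ms ! (p i)) = (\<Sum>i = 0..<n. ms ! i)"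
    by (rule sum.permute[OF p, of "\<lambda>i. ms ! i", unfolded o_def, symmetric])
   hence "ms ! i = ms ! (p i)" if "i < n" for i
    using sum_mono_inv[of "\<lambda>i. ms ! i" "{0..<n}" "\<lambda>i. ms ! (p i)" i] True that by auto
   thus ?thesis using pn by (intro prod.cong) (auto simp: B_def)
  next
   case False
   then obtain i where i: "i < n" "ms ! (p i) < ms ! i" by auto
   have "B $$ (i, p i) = 0" "R0 $$ (i, p i) = 0"
    using i pn tri[of i "p i"] by (auto simp: B_def)
   hence "(\<Prod>i = 0..<n. B $$ (i, p i)) = 0" "(\<Prod>i = 0..<n. R0 $$ (i, p i)) = 0"
    using i by (auto intro!: prod_zero)
   thus ?thesis by (simp only:)
  qed
 qed
 moreover have "det R0 = poly (det Vm) 0 * poly (det U) 0"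
  unfolding R0_def poly_det[symmetric] R_def det_mult[OF Vm U] by simp
 moreover have "poly (det Vm) 0 = poly (det V) 0"
 proof -
  have "det Vm = flip (det V)" unfolding Vm_def flip_det using V by (intro det_transpose) auto
  thus ?thesis by (simp add: poly_flip)
 qed
 ultimately show False using dU dV by simp
qed

section \<open>The target multiplicities\<close>

text \<open>The parity constraint on the numbers \<open>\<nu> k\<close> of an alternating pencil at \<open>0\<close>: the indices \<open>k\<close>, \<open>k + 1\<close> form a
 pair if \<open>k\<close> is odd in the \<open>\<top>\<close>-even case, and if \<open>k\<close> is even in the \<open>\<top>\<close>-odd case, where \<open>\<nu> 1\<close> is
 paired with \<open>n\<close>.\<close>

fun admissible :: "alternation => nat => (nat => nat) => bool" where
 "admissible T_even n \<nu> \<longleftrightarrow> (\<forall>k\<ge>1. \<nu> (Suc k) <= \<nu> k) \<and> (\<forall>k. odd k \<longrightarrow> even (\<nu> k) = even (\<nu> (Suc k)))"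
| "admissible T_odd n \<nu> \<longleftrightarrow> (\<forall>k\<ge>1. \<nu> (Suc k) <= \<nu> k) \<and> even (\<nu> 1) = even n \<and>
   (\<forall>k\<ge>1. even k \<longrightarrow> even (\<nu> k) = even (\<nu> (Suc k)))"

lemma admissible_mono: "admissible \<sigma> n \<nu> ==> 1 <= k ==> \<nu> (Suc k) <= \<nu> k"
 by (cases \<sigma>) (metis admissible.simps(1), metis admissible.simps(2))

lemma admissible_pair:
 "admissible \<sigma> n \<nu> ==> 1 <= k ==> (\<sigma> = T_even) = odd k ==> even (\<nu> k) = even (\<nu> (Suc k))"
 by (cases \<sigma>) (metis admissible.simps(1), metis admissible.simps(2) alternation.distinct(1))

lemma admissible_first: "admissible T_odd n \<nu> ==> even (\<nu> 1) = even n"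
 by (metis admissible.simps(2))

text \<open>A wrong parity is repaired in the second member \<open>y\<close> of a pair. Applied to the pairs of the sequence
 \<open>\<lambda>k. \<nu> k - r\<close>, this gives an admissible sequence above it with the smallest possible sum.\<close>

definition repair :: "nat => nat => nat" where
 "repair x y = (if odd (x + y) then y + 1 else y)"

fun target :: "alternation => nat => nat => (nat => nat) => nat => nat" where
 "target T_even n r \<nu> k = (if even k then repair (\<nu> (k - 1) - r) (\<nu> k - r) else \<nu> k - r)"
| "target T_odd n r \<nu> k = (if k = 1 then repair n (\<nu> 1 - r)
   else if odd k then repair (\<nu> (k - 1) - r) (\<nu> k - r) else \<nu> k - r)"

fun repaired :: "alternation => nat => (nat => nat) => nat => bool" where
 "repaired \<sigma> r \<nu> k \<longleftrightarrow> 2 <= k \<and> (\<sigma> = T_even) = even k \<and> \<nu> k < r \<and> r < \<nu> (k - 1) \<and> odd (\<nu> (k - 1) - r)"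

lemma pair_parity:
 assumes "y <= x" "even x = even (y :: nat)"
 shows "odd ((x - r) + (y - r)) \<longleftrightarrow> y < r \<and> r < x \<and> odd (x - r)"
 using assms by (cases "y < r"; cases "r < x") (auto simp: even_diff_nat)

lemma repair_compose:
 assumes "y <= x" "even x = even y" "1 <= q"
 shows "repair (x - r - q) (repair (x - r) (y - r) - q) = repair (x - (r + q)) (y - (r + q))"
proof (cases "odd (x - r + (y - r))")
 case True
 hence "y < r" unfolding pair_parity[OF assms(1,2)] by simp
 hence "repair (x - r) (y - r) - q = 0" "y - (r + q) = 0" using assms(3) True unfolding repair_def by auto
 thus ?thesis by simp
next
 case False
 thus ?thesis unfolding repair_def[of "x - r"] by (simp only: if_False diff_diff_left)
qed

lemma repair_compose_first:
 "even x = even n ==> repair n (repair n (x - r) - 2) = repair n (x - (r + 2))"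
 unfolding repair_def by presburger

lemma repair_le: "x <= x' ==> y <= y' ==> even x' = even y' ==> x + repair x y <= x' + y'"
 unfolding repair_def by presburger

lemma repair_le_right: "y <= y' ==> even x = even y' ==> repair x y <= y'"
 unfolding repair_def by presburger

text \<open>A truncated pair has the wrong parity only if its second member is truncated to 0 and its first member
 is not. Then the repaired entry is 1.\<close>

lemma target_eq_repaired:
 assumes adm: "admissible \<sigma> n \<nu>" and k: "2 <= k"
 shows "target \<sigma> n r \<nu> k = (if repaired \<sigma> r \<nu> k then 1 else \<nu> k - r)"
proof -
 have mono: "\<nu> k <= \<nu> (k - 1)" using admissible_mono[OF adm, of "k - 1"] k by simp
 show ?thesis
 proof (cases "(\<sigma> = T_even) = even k")
  case True
  have par: "even (\<nu> (k - 1)) = even (\<nu> k)"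
   using admissible_pair[OF adm, of "k - 1"] k True by simp
  have "odd ((\<nu> (k - 1) - r) + (\<nu> k - r)) \<longleftrightarrow> repaired \<sigma> r \<nu> k"
   using pair_parity[OF mono par, of r] k True by auto
  moreover have "repaired \<sigma> r \<nu> k ==> \<nu> k - r = 0" by simp
  moreover have "target \<sigma> n r \<nu> k = repair (\<nu> (k - 1) - r) (\<nu> k - r)"
   using True k by (cases \<sigma>) auto
  ultimately show ?thesis unfolding repair_def by (simp del: repaired.simps)
 next
  case False
  thus ?thesis using k by (cases \<sigma>) auto
 qed
qed

text \<open>The repair of a first step is undone by a second step of rank \<open>q\<close>, which truncates it to 0 and then finds
 the parity of \<open>\<nu>\<close> again. In the \<open>\<top>\<close>-odd case \<open>q = 1\<close> is excluded: each step of rank one leaves an additional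
 multiplicity 1, so two of them may leave the first entry as it was.\<close>

lemma target_compose:
 assumes adm: "admissible \<sigma> n \<nu>" and k: "1 <= k" and q: "q = 2 \<or> \<sigma> = T_even \<and> q = 1"
 shows "target \<sigma> n q (target \<sigma> n r \<nu>) k = target \<sigma> n (r + q) \<nu> k"
proof (cases "k = 1")
 case True
 show ?thesis
 proof (cases \<sigma>)
  case T_odd
  have "even (\<nu> 1) = even n" using admissible_first adm unfolding T_odd by blast
  thus ?thesis using q repair_compose_first[of "\<nu> 1" n r] unfolding T_odd True by auto
 qed (simp add: True)
next
 case False
 note rc = repair_compose[OF admissible_mono[OF adm, of "k - 1"] admissible_pair[OF adm, of "k - 1"], of q r]
 have k1: "odd k ==> k - Suc 0 ~= Suc 0" using k by presburger
 show ?thesis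
  using rc False k q k1 by (cases \<sigma>) auto
qed

lemma target_0:
 assumes "admissible \<sigma> n \<nu>" "1 <= k"
 shows "target \<sigma> n 0 \<nu> k = \<nu> k"
proof (cases "k = 1")
 case True
 thus ?thesis using admissible_first[of n \<nu>] assms
  by (cases \<sigma>) (simp_all del: admissible.simps add: repair_def)
next
 case False
 thus ?thesis using target_eq_repaired[OF assms(1), of k 0] assms(2) by auto
qed

lemma target_cong:
 assumes "!!k. 1 <= k ==> \<nu> k = \<nu>' k" "1 <= k"
 shows "target \<sigma> n r \<nu> k = target \<sigma> n r \<nu>' k"
proof (cases \<sigma>)
 case T_even
 have "even k ==> 1 <= k - 1" using assms(2) by presburger
 thus ?thesis using assms unfolding T_even by auto
next
 case T_odd
 have "k ~= 1 ==> 1 <= k - 1" using assms(2) by presburger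
 thus ?thesis using assms unfolding T_odd by auto
qed

text \<open>An admissible sequence above \<open>\<nu> k - r\<close> is above the target, provided that it does not vanish where the
 target has been repaired.\<close>

lemma target_le:
 assumes adm: "admissible \<sigma> n \<nu>" and adm': "admissible \<sigma> n \<nu>'"
  and lower: "!!k. 1 <= k ==> \<nu> k <= \<nu>' k + r"
  and rep: "!!k. repaired \<sigma> r \<nu> k ==> 0 < \<nu>' k" and k: "1 <= k"
 shows "target \<sigma> n r \<nu> k <= \<nu>' k"
proof (cases "k = 1")
 case True
 have l: "\<nu> 1 - r <= \<nu>' 1" using lower[of 1] by simp
 show ?thesis
 proof (cases \<sigma>)
  case T_even
  thus ?thesis using True l by simp
 next
  case T_odd
  have "even n = even (\<nu>' 1)" using admissible_first adm' unfolding T_odd by blast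
  thus ?thesis unfolding T_odd True using repair_le_right[OF l] by simp
 qed
next
 case False
 thus ?thesis using target_eq_repaired[OF adm, of k r] k lower[OF k] rep[of k]
  by (auto simp del: repaired.simps)
qed

text \<open>An index beyond which all numbers vanish and at which a pair ends, so that sums up to it are sums over
 pairs.\<close>

fun pair_bound :: "alternation => nat => nat" where
 "pair_bound T_even n = 2 * (n + 1)"
| "pair_bound T_odd n = 2 * (n + 1) + 1"

text \<open>Without any knowledge of the repaired entry, the sum is still bounded below, since a pair has
 an even sum that is at least \<open>(\<nu> (k - 1) - r) + (\<nu> k - r)\<close>.\<close>

lemma target_sum_le:
 assumes adm: "admissible \<sigma> n \<nu>" and adm': "admissible \<sigma> n \<nu>'"
  and lower: "!!k. 1 <= k ==> \<nu> k <= \<nu>' k + r"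
 shows "(\<Sum>k = 1..pair_bound \<sigma> n. target \<sigma> n r \<nu> k) <= (\<Sum>k = 1..pair_bound \<sigma> n. \<nu>' k)"
proof -
 have low: "\<nu> k - r <= \<nu>' k" if "1 <= k" for k using lower[OF that] by simp
 have pair: "target \<sigma> n r \<nu> k + target \<sigma> n r \<nu> (Suc k) <= \<nu>' k + \<nu>' (Suc k)"
  if k: "1 <= k" "(\<sigma> = T_even) = odd k" for k
 proof -
  have "target \<sigma> n r \<nu> k = \<nu> k - r" "target \<sigma> n r \<nu> (Suc k) = repair (\<nu> k - r) (\<nu> (Suc k) - r)"
   using k by (cases \<sigma>; auto)+
  thus ?thesis using repair_le[OF low low admissible_pair[OF adm' k]] k by simp
 qed
 show ?thesis
 proof (cases \<sigma>)
  case T_even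
  have "(\<Sum>k = 1..2 * m. target \<sigma> n r \<nu> k) <= (\<Sum>k = 1..2 * m. \<nu>' k)" for m
  proof (induction m)
   case (Suc m)
   have e: "{1..2 * Suc m} = insert (Suc (2 * m + 1)) (insert (2 * m + 1) {1..2 * m})" by auto
   show ?case using Suc pair[of "2 * m + 1"] unfolding e T_even by (simp del: target.simps)
  qed auto
  thus ?thesis unfolding T_even by (simp only: pair_bound.simps)
 next
  case T_odd
  have "(\<Sum>k = 1..2 * m + 1. target \<sigma> n r \<nu> k) <= (\<Sum>k = 1..2 * m + 1. \<nu>' k)" for m
  proof (induction m)
   case 0
   have "even n = even (\<nu>' 1)" using admissible_first adm' unfolding T_odd by blast
   hence "target \<sigma> n r \<nu> 1 <= \<nu>' 1" using repair_le_right[OF low[of 1]] unfolding T_odd by simp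
   thus ?case by (simp del: target.simps)
  next
   case (Suc m)
   have e: "{1..2 * Suc m + 1} = insert (Suc (2 * m + 2)) (insert (2 * m + 2) {1..2 * m + 1})" by auto
   show ?case using Suc pair[of "2 * m + 2"] unfolding e T_odd by (simp del: target.simps)
  qed
  thus ?thesis unfolding T_odd by (simp only: pair_bound.simps)
 qed
qed

text \<open>The sum, which is the order of a determinant, cannot be smaller than that of the target, and it is equal
 only for the target.\<close>

lemma target_unique:
 assumes adm: "admissible \<sigma> n \<nu>" and adm': "admissible \<sigma> n \<nu>'"
  and lower: "!!k. 1 <= k ==> \<nu> k <= \<nu>' k + r"
  and rep: "!!k. repaired \<sigma> r \<nu> k ==> 0 < \<nu>' k"
  and sum: "(\<Sum>k = 1..K. \<nu>' k) <= (\<Sum>k = 1..K. target \<sigma> n r \<nu> k)"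
  and k: "1 <= k" "k <= K"
 shows "\<nu>' k = target \<sigma> n r \<nu> k"
proof -
 have le: "target \<sigma> n r \<nu> k <= \<nu>' k" if "1 <= k" for k
  by (rule target_le[OF adm adm' lower rep that])
 have "(\<Sum>k = 1..K. target \<sigma> n r \<nu> k) = (\<Sum>k = 1..K. \<nu>' k)"
  using le by (intro antisym sum sum_mono) auto
 thus ?thesis
  using sum_mono_inv[of "target \<sigma> n r \<nu>" "{1..K}" \<nu>' k] le k by auto
qed

section \<open>Lists with the target multiplicities\<close>

lemma exponents_ge_drop:
 assumes "sorted (rev ns)"
 shows "exponents_ge (drop r ns) k = exponents_ge ns k - r"
 using assms
proof (induction ns arbitrary: r)
 case (Cons x ns)
 show ?case
 proof (cases r)
  case (Suc r')
  have s: "sorted (rev ns)" "\<forall>y \<in> set ns. y <= x" using Cons.prems by (auto simp: sorted_append)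
  show ?thesis
  proof (cases "k <= x")
   case True
   thus ?thesis using Cons.IH[OF s(1), of r'] Suc by (simp add: exponents_ge_def)
  next
   case False
   hence "exponents_ge ns k = 0" using s(2) unfolding exponents_ge_def
    by (auto simp: filter_empty_conv)
   thus ?thesis using Cons.IH[OF s(1), of r'] Suc False by (simp add: exponents_ge_def)
  qed
 qed simp
qed (simp add: exponents_ge_def)

lemma le_mult_at_iff:
 assumes s: "sorted (rev ns)" and "1 <= j" "1 <= k"
 shows "k <= mult_at ns j \<longleftrightarrow> j <= exponents_ge ns k"
proof (cases "j <= length ns")
 case False
 have "exponents_ge ns k <= length ns" unfolding exponents_ge_def by simp
 thus ?thesis using False assms unfolding mult_at_def by auto
next
 case True
 have d: "drop (j - 1) ns = mult_at ns j # drop j ns"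
  using True assms(2) unfolding mult_at_def by (cases j) (auto simp: Cons_nth_drop_Suc)
 have "exponents_ge ns k - (j - 1) = (if k <= mult_at ns j then 1 else 0) + (exponents_ge ns k - j)"
  using arg_cong[OF d, of "\<lambda>l. exponents_ge l k"] exponents_ge_drop[OF s, of "j - 1" k]
   exponents_ge_drop[OF s, of j k] by (auto simp: exponents_ge_def)
 thus ?thesis using assms(2) by (auto split: if_splits)
qed

text \<open>The multiplicity \<open>m\<close> with index \<open>r + 1\<close> is repeated from index \<open>r\<close> to \<open>r + d\<close>, and \<open>r + d\<close> is the number of
 multiplicities that are at least \<open>m\<close>. So (P) speaks about the parity of \<open>\<nu> m - r\<close>.\<close>

lemma property_P_iff:
 assumes s: "sorted (rev ns)" and r: "1 <= r"
 defines "m \<equiv> mult_at ns (r + 1)"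
 shows "property_P ns r \<longleftrightarrow> 1 <= m \<and> exponents_ge ns (Suc m) < r \<and> r < exponents_ge ns m \<and>
  odd (exponents_ge ns m - r)"
proof
 assume "property_P ns r"
 then obtain d where d: "odd d" "\<forall>j \<in> {r..r + d}. mult_at ns j = mult_at ns r"
  "mult_at ns (r + d) > mult_at ns (r + d + 1)" unfolding property_P_def by blast
 have "d \<ge> 1" using d(1) by presburger
 hence "r + 1 \<in> {r..r + d}" "r + d \<in> {r..r + d}" by auto
 hence eq: "mult_at ns r = m" "mult_at ns (r + d) = m" using d(2) unfolding m_def by metis+
 have m1: "1 <= m" using d(3) eq by simp
 have "r + d <= exponents_ge ns m" using le_mult_at_iff[OF s, of "r + d" m] r m1 eq by simp
 moreover have "\<not> r + d + 1 <= exponents_ge ns m"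
  using le_mult_at_iff[OF s, of "r + d + 1" m] m1 eq d(3) by simp
 ultimately have e: "exponents_ge ns m = r + d" by simp
 have "\<not> r <= exponents_ge ns (Suc m)" using le_mult_at_iff[OF s, of r "Suc m"] r eq by simp
 thus "1 <= m \<and> exponents_ge ns (Suc m) < r \<and> r < exponents_ge ns m \<and> odd (exponents_ge ns m - r)"
  using m1 e d(1) by (auto elim: oddE)
next
 assume a: "1 <= m \<and> exponents_ge ns (Suc m) < r \<and> r < exponents_ge ns m \<and> odd (exponents_ge ns m - r)"
 define d where "d = exponents_ge ns m - r"
 have m: "mult_at ns j = m" if "j \<in> {r..r + d}" for j
 proof -
  have "m <= mult_at ns j" using le_mult_at_iff[OF s, of j m] that r a unfolding d_def by auto
  moreover have "\<not> Suc m <= mult_at ns j" using le_mult_at_iff[OF s, of j "Suc m"] that r a by auto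
  ultimately show ?thesis by simp
 qed
 have "\<not> m <= mult_at ns (r + d + 1)" using le_mult_at_iff[OF s, of "r + d + 1" m] a unfolding d_def by auto
 thus "property_P ns r" unfolding property_P_def using a m
  by (intro exI[of _ d]) (auto simp: d_def[symmetric])
qed

text \<open>The prescribed list at the point zero; at infinity it is the list for the reversed pencil.\<close>

fun zero_mults :: "alternation => nat => nat => nat list => nat list" where
 "zero_mults T_even n r ns = remaining_mults (odd (mult_at ns (r + 1))) ns r"
| "zero_mults T_odd n r ns =
  (if length ns < r \<and> even n ~= even r then (if odd n then [1] else [])
   else if even r then remaining_mults (even (mult_at ns (r + 1))) ns r
   else remaining_mults (even (mult_at ns (r + 1))) ns r @ [1])"

lemma remaining_mults_exponents:
 assumes s: "sorted (rev ns)" and pos: "\<forall>x \<in> set ns. 0 < x" and r: "1 <= r"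
  and adm: "admissible \<sigma> n (exponents_ge ns)" and k: "1 <= k"
 defines "R \<equiv> remaining_mults ((\<sigma> = T_even) = odd (mult_at ns (r + 1))) ns r"
 shows "exponents_ge R k = (if repaired \<sigma> r (exponents_ge ns) k then 1 else exponents_ge ns k - r)"
  "sorted (rev R)" "\<forall>x \<in> set R. 0 < x"
proof -
 let ?\<nu> = "exponents_ge ns"
 define m where "m = mult_at ns (r + 1)"
 have key: "repaired \<sigma> r ?\<nu> k \<longleftrightarrow> ((\<sigma> = T_even) = odd m \<and> property_P ns r \<and> k = Suc m)"
 proof
  assume a: "repaired \<sigma> r ?\<nu> k"
  have k2: "2 <= k" using a by simp
  have "1 <= k - 1" using k2 by simp
  hence "k - 1 <= m" unfolding m_def using le_mult_at_iff[OF s, of "r + 1" "k - 1"] a by simp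
  moreover have "\<not> k <= m" unfolding m_def using le_mult_at_iff[OF s, of "r + 1" k] a by simp
  ultimately have km: "k = Suc m" using k2 by simp
  thus "(\<sigma> = T_even) = odd m \<and> property_P ns r \<and> k = Suc m"
   unfolding property_P_iff[OF s r] m_def[symmetric] using a by auto
 next
  assume a: "(\<sigma> = T_even) = odd m \<and> property_P ns r \<and> k = Suc m"
  thus "repaired \<sigma> r ?\<nu> k" using a unfolding property_P_iff[OF s r] m_def[symmetric] by auto
 qed
 show "exponents_ge R k = (if repaired \<sigma> r ?\<nu> k then 1 else ?\<nu> k - r)"
 proof (cases "(\<sigma> = T_even) = odd m \<and> property_P ns r")
  case True
  have P: "1 <= m" "?\<nu> (Suc m) < r" "r < ?\<nu> m" using True unfolding property_P_iff[OF s r] m_def by auto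
  have R: "R = (m + 1) # drop (r + 1) ns" unfolding R_def remaining_mults_def m_def[symmetric] using True by simp
  have e: "exponents_ge R k = (if k <= m + 1 then 1 else 0) + (?\<nu> k - (r + 1))"
   unfolding R using exponents_ge_drop[OF s, of "r + 1" k] by (simp add: exponents_ge_def)
  show ?thesis
  proof (cases "k = Suc m")
   case True
   thus ?thesis using key P e \<open>(\<sigma> = T_even) = odd m \<and> property_P ns r\<close> by (simp del: repaired.simps)
  next
   case False
   have "k <= m \<longleftrightarrow> r + 1 <= ?\<nu> k" using le_mult_at_iff[OF s, of "r + 1" k] k unfolding m_def by simp
   thus ?thesis using key e False by (auto simp del: repaired.simps)
  qed
 next
  case False
  hence "R = drop r ns" unfolding R_def remaining_mults_def m_def[symmetric] by auto
  thus ?thesis using key False exponents_ge_drop[OF s] by (auto simp del: repaired.simps)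
 qed
 have sd: "sorted (rev (drop q ns))" for q
  using s by (metis sorted_wrt_drop sorted_wrt_rev)
 have "y <= mult_at ns (r + 1)" if "y \<in> set (drop (r + 1) ns)" for y
 proof -
  have len: "r < length ns" using that by (cases "r < length ns") auto
  have "drop r ns = mult_at ns (r + 1) # drop (r + 1) ns"
   using len unfolding mult_at_def by (simp add: Cons_nth_drop_Suc)
  thus ?thesis using sd[of r] that by (auto simp: sorted_append)
 qed
 hence sc: "sorted (rev ((mult_at ns (r + 1) + 1) # drop (r + 1) ns))"
  using sd[of "r + 1"] by (auto simp: sorted_append intro: le_SucI)
 show "sorted (rev R)"
 proof (cases "((\<sigma> = T_even) = odd (mult_at ns (r + 1))) \<and> property_P ns r")
  case True
  show ?thesis unfolding R_def remaining_mults_def if_P[OF True] by (rule sc)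
 next
  case False
  show ?thesis unfolding R_def remaining_mults_def if_not_P[OF False] by (rule sd)
 qed
 show "\<forall>x \<in> set R. 0 < x" unfolding R_def remaining_mults_def
  using pos by (auto dest: in_set_dropD)
qed

lemma exponents_ge_append_one: "1 <= k ==> exponents_ge (R @ [1]) k = exponents_ge R k + (if k = 1 then 1 else 0)"
 unfolding exponents_ge_def by simp

text \<open>The list of the statement has the target numbers. If \<open>\<nu> 1 < r\<close>, the \<open>\<top>\<close>-odd list is empty or a single
 multiplicity 1, as \<open>n\<close> demands.\<close>

lemma zero_mults_exponents:
 assumes s: "sorted (rev ns)" and pos: "\<forall>x \<in> set ns. 0 < x" and r: "1 <= r"
  and adm: "admissible \<sigma> n (exponents_ge ns)"
 shows "!!k. 1 <= k ==> exponents_ge (zero_mults \<sigma> n r ns) k = target \<sigma> n r (exponents_ge ns) k"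
  "sorted (rev (zero_mults \<sigma> n r ns))" "\<forall>x \<in> set (zero_mults \<sigma> n r ns). 0 < x"
proof -
 let ?\<nu> = "exponents_ge ns"
 note rm = remaining_mults_exponents[OF s pos r adm]
 have len: "?\<nu> 1 = length ns" unfolding exponents_ge_def
  using pos by (metis One_nat_def Suc_leI filter_True)
 have "(\<forall>k\<ge>1. exponents_ge (zero_mults \<sigma> n r ns) k = target \<sigma> n r (exponents_ge ns) k) \<and>
  sorted (rev (zero_mults \<sigma> n r ns)) \<and> (\<forall>x \<in> set (zero_mults \<sigma> n r ns). 0 < x)"
 proof (cases \<sigma>)
  case T_even
  have "exponents_ge (zero_mults \<sigma> n r ns) k = target \<sigma> n r ?\<nu> k" if k: "1 <= k" for k
  proof (cases "k = 1")
   case True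
   thus ?thesis using rm(1)[OF k] unfolding T_even by simp
  next
   case False
   thus ?thesis using rm(1)[OF k] target_eq_repaired[OF adm, of k r] k unfolding T_even by simp
  qed
  thus ?thesis using rm(2,3)[of 1] unfolding T_even by simp
 next
  case T_odd
  have par: "even (?\<nu> 1) = even n" using admissible_first adm unfolding T_odd by blast
  let ?R = "remaining_mults (even (mult_at ns (r + 1))) ns r"
  have eqv: "((\<sigma> = T_even) = odd (mult_at ns (r + 1))) = even (mult_at ns (r + 1))" unfolding T_odd by simp
  note rm = rm[unfolded eqv]
  have R1: "exponents_ge ?R 1 = ?\<nu> 1 - r" using rm(1)[of 1] by simp
  have Rk: "exponents_ge ?R k = target \<sigma> n r ?\<nu> k" if "2 <= k" for k
   using rm(1)[of k] target_eq_repaired[OF adm that, of r] that by simp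
  have small: "target \<sigma> n r ?\<nu> k = 0" if "length ns < r" "2 <= k" for k
  proof -
   have "?\<nu> (k - 1) <= ?\<nu> 1" "?\<nu> k <= ?\<nu> 1" using that by (auto intro: exponents_ge_antimono)
   thus ?thesis using target_eq_repaired[OF adm that(2), of r] that len by simp
  qed
  show ?thesis
  proof (cases "length ns < r \<and> even n ~= even r")
   case True
   have "exponents_ge (zero_mults \<sigma> n r ns) k = target \<sigma> n r ?\<nu> k" if k: "1 <= k" for k
   proof (cases "k = 1")
    case True
    thus ?thesis using \<open>length ns < r \<and> even n ~= even r\<close> len unfolding T_odd
     by (simp add: exponents_ge_def repair_def)
   next
    case False
    thus ?thesis using True small[of k] k unfolding T_odd by (simp add: exponents_ge_def)
   qed
   thus ?thesis using True unfolding T_odd by simp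
  next
   case nexc: False
   show ?thesis
   proof (cases "even r")
    case True
    have z: "zero_mults \<sigma> n r ns = ?R" using nexc True unfolding T_odd by auto
    have "exponents_ge ?R k = target \<sigma> n r ?\<nu> k" if k: "1 <= k" for k
    proof (cases "k = 1")
     case k1: True
     have "even (?\<nu> 1 - r) = even n" using nexc True par len by (cases "length ns < r") auto
     thus ?thesis using R1 unfolding T_odd k1 by (simp add: repair_def)
    qed (use Rk k in auto)
    thus ?thesis unfolding z using rm(2,3)[of 1] by simp
   next
    case False
    have z: "zero_mults \<sigma> n r ns = ?R @ [1]" using nexc False unfolding T_odd by auto
    have "exponents_ge (?R @ [1]) k = target \<sigma> n r ?\<nu> k" if k: "1 <= k" for k
    proof (cases "k = 1")
     case k1: True
     have "even (?\<nu> 1 - r) ~= even n" using nexc False par len by (cases "length ns < r") auto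
     thus ?thesis using R1 exponents_ge_append_one[of 1 ?R] unfolding T_odd k1 by (simp add: repair_def)
    qed (use Rk k exponents_ge_append_one[of k ?R] in auto)
    moreover have "sorted (rev (?R @ [1]))" using rm(2,3)[of 1]
     by (auto simp: Suc_le_eq)
    ultimately show ?thesis unfolding z using rm(3)[of 1] by simp
   qed
  qed
 qed
 thus "!!k. 1 <= k ==> exponents_ge (zero_mults \<sigma> n r ns) k = target \<sigma> n r (exponents_ge ns) k"
  "sorted (rev (zero_mults \<sigma> n r ns))" "\<forall>x \<in> set (zero_mults \<sigma> n r ns). 0 < x" by blast+
qed

section \<open>Bounded rank, parity and the order of the determinant\<close>

fun eps :: "alternation => complex" where
 "eps T_even = 1"
| "eps T_odd = -1"

lemma eps_square: "eps \<sigma> * eps \<sigma> = 1"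
 by (cases \<sigma>) auto

text \<open>The symmetry of \<open>A\<close> and \<open>B\<close> is the single identity \<open>L(-\<lambda>)\<^sup>T = \<plusminus> L(\<lambda>)\<close>.\<close>

definition alt_pencil :: "alternation => nat => complex poly mat => bool" where
 "alt_pencil \<sigma> n L \<longleftrightarrow> is_pencil n L \<and> alternating (eps \<sigma>) n L"

lemma alt_pencilD:
 assumes "alt_pencil \<sigma> n L"
 shows "is_pencil n L" "L \<in> Mat n" "alternating (eps \<sigma>) n L"
  "!!i j. i < n ==> j < n ==> flip (L $$ (j,i)) = [:eps \<sigma>:] * L $$ (i,j)"
  "!!i j. i < n ==> j < n ==> degree (L $$ (i,j)) <= 1"
 using assms unfolding alt_pencil_def is_pencil_def alternating_def by auto

lemma alternating_pencil_imp_alt_pencil: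
 assumes "alternating_pencil \<sigma> n L"
 shows "alt_pencil \<sigma> n L"
proof -
 obtain A B where A: "A \<in> Mat n" and B: "B \<in> Mat n" and L: "L = pencil A B"
  and sym: "case \<sigma> of T_even => transpose_mat A = A \<and> transpose_mat B = - B
     | T_odd => transpose_mat A = - A \<and> transpose_mat B = B"
  using assms unfolding alternating_pencil_def by blast
 have Lc: "L \<in> Mat n" unfolding L using A B by simp
 have Li: "L $$ (i,j) = [:A $$ (i,j), B $$ (i,j):]" if "i < n" "j < n" for i j
  unfolding L by (rule pencil_index[OF A B that])
 have tr: "A $$ (j,i) = eps \<sigma> * A $$ (i,j)" "B $$ (j,i) = - eps \<sigma> * B $$ (i,j)"
  if ij: "i < n" "j < n" for i j
 proof -
  have t: "transpose_mat A $$ (i,j) = A $$ (j,i)" "transpose_mat B $$ (i,j) = B $$ (j,i)"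
   "(- A) $$ (i,j) = - A $$ (i,j)" "(- B) $$ (i,j) = - B $$ (i,j)"
   using A B ij by auto
  show "A $$ (j,i) = eps \<sigma> * A $$ (i,j)" "B $$ (j,i) = - eps \<sigma> * B $$ (i,j)"
   using sym t by (cases \<sigma>; simp)+
 qed
 have fl: "flip (L $$ (j,i)) = [:eps \<sigma>:] * L $$ (i,j)" if ij: "i < n" "j < n" for i j
  unfolding Li[OF ij] Li[OF ij(2,1)] flip_lin tr[OF ij] by simp
 show ?thesis unfolding alt_pencil_def is_pencil_def alternating_def
  using Lc Li fl by simp
qed

lemma alternating_det_flip:
 assumes "alternating \<epsilon> n L"
 shows "flip (det L) = [:\<epsilon> ^ n:] * det L"
proof -
 have L: "L \<in> Mat n" using assms unfolding alternating_def by simp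
 have "map_mat flip L = transpose_mat ([:\<epsilon>:] \<cdot>\<^sub>m L)"
  using assms L unfolding alternating_def by (intro eq_matI) auto
 hence "flip (det L) = det ([:\<epsilon>:] \<cdot>\<^sub>m L)"
  unfolding flip_det using L by (simp add: det_transpose[of _ n])
 thus ?thesis using L by (simp add: poly_const_pow)
qed

text \<open>Compare the lowest coefficients of \<open>p(-\<lambda>) = c p(\<lambda>)\<close>.\<close>

lemma order_parity:
 assumes p: "flip p = [:c:] * p" and nz: "p ~= 0"
 shows "c = (-1) ^ order 0 p"
proof -
 obtain d where d: "p = [:-0,1:] ^ order 0 p * d" "\<not> [:-0,1:] dvd d"
  using order_decomp[OF nz, of 0] by blast
 let ?a = "order 0 p" and ?s = "[:0,1:] :: complex poly"
 have pd: "p = ?s ^ ?a * d" using d(1) by simp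
 have d0: "poly d 0 ~= 0" using d(2) lin_dvd_iff[of 0 d] by simp
 have "(- ?s) ^ ?a * flip d = [:c:] * (?s ^ ?a * d)"
  using p by (subst (asm) (1 2) pd) simp
 hence "?s ^ ?a * ((- 1) ^ ?a * flip d) = ?s ^ ?a * ([:c:] * d)"
  by (simp only: power_minus[of ?s] mult_ac)
 hence "(- 1) ^ ?a * flip d = [:c:] * d" by (simp only: mult_cancel_left power_eq_0_iff) auto
 hence "poly ((- 1) ^ ?a * flip d) 0 = poly ([:c:] * d) 0" by simp
 hence "(- 1) ^ ?a * poly d 0 = c * poly d 0" by (simp add: poly_flip poly_power)
 thus ?thesis using d0 by simp
qed

lemma alternating_order:
 assumes "alternating \<epsilon> n L" "det L ~= 0"
 shows "\<epsilon> ^ n = (-1) ^ order 0 (det L)"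
 by (rule order_parity[OF alternating_det_flip[OF assms(1)] assms(2)])

lemma order_det_le:
 assumes "is_pencil n L" "det L ~= 0"
 shows "order \<mu> (det L) <= n"
proof -
 have "degree (det L) <= 1 * n"
  by (rule degree_det_le) (use assms in \<open>auto simp: is_pencil_def\<close>)
 thus ?thesis using order_degree[OF assms(2), of \<mu>] by simp
qed

lemma sum_list_exponents:
 assumes "\<forall>m \<in> set ns. m <= K"
 shows "(\<Sum>k = 1..K. exponents_ge ns k) = sum_list ns"
 using assms
proof (induction ns)
 case (Cons m ns)
 have "(\<Sum>k = 1..K. exponents_ge (m # ns) k) = (\<Sum>k = 1..K. (if k <= m then 1 else 0) + exponents_ge ns k)"
  by (intro sum.cong) (auto simp: exponents_ge_def)
 also have "\<dots> = card {k \<in> {1..K}. k <= m} + sum_list ns"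
  using Cons by (simp add: sum.distrib sum.If_cases Int_def)
 also have "{k \<in> {1..K}. k <= m} = {1..m}" using Cons.prems by auto
 finally show ?case by simp
qed (simp add: exponents_ge_def)

lemma partial_mult_le:
 assumes "is_pencil n L" "det L ~= 0" "m \<in> set (finite_partial_mults L \<mu>)"
 shows "m <= n"
 using member_le_sum_list[OF assms(3)] finite_partial_mults_props(3)[OF assms(1,2), of \<mu>]
  order_det_le[OF assms(1,2), of \<mu>] by simp

lemma blocks_ge_sum:
 assumes "is_pencil n L" "det L ~= 0" "n <= K"
 shows "(\<Sum>k = 1..K. blocks_ge L \<mu> k) = order \<mu> (det L)"
 using sum_list_exponents[of "finite_partial_mults L \<mu>" K] partial_mult_le[OF assms(1,2)]
  finite_partial_mults_props(3)[OF assms(1,2)] assms(3) le_trans by metis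

lemma blocks_ge_eq_0:
 assumes "is_pencil n L" "det L ~= 0" "n < k"
 shows "blocks_ge L \<mu> k = 0"
proof -
 have "\<not> k <= m" if "m \<in> set (finite_partial_mults L \<mu>)" for m
  using partial_mult_le[OF assms(1,2) that] assms(3) by simp
 thus ?thesis unfolding exponents_ge_def by (simp add: filter_empty_conv)
qed

text \<open>The number of multiplicities equal to \<open>k\<close> is \<open>\<nu> k - \<nu> (k + 1)\<close>. For the first entry of the \<open>\<top>\<close>-odd case,
 \<open>n\<close> has the parity of the order of the determinant, and that order is the sum of the \<open>\<nu> k\<close>, which cancel
 modulo 2 in pairs except for \<open>\<nu> 1\<close>.\<close>

theorem admissible_blocks:
 assumes L: "alt_pencil \<sigma> n L" and reg: "det L ~= 0"
 shows "admissible \<sigma> n (blocks_ge L 0)"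
proof -
 note A = alt_pencilD[OF L]
 obtain U V ms where ls: "local_smith n 0 L U V ms"
  by (rule finite_partial_mults_local_smith[OF A(1) reg])
 have len: "length ms = n" using ls unfolding local_smith_def by simp
 have par: "even (blocks_ge L 0 k) = even (blocks_ge L 0 (Suc k))"
  if k: "1 <= k" "(\<sigma> = T_even) = odd k" for k
 proof -
  have "eps \<sigma> * (-1) ^ k = -1" using k by (cases \<sigma>) auto
  moreover have "{i. i < n \<and> k = ms ! i} = {i. i < n \<and> ms ! i = k}" by auto
  ultimately have "even (count_list ms k)"
   using alternating_parity[OF ls A(3), of k]
   unfolding count_list_eq_length_filter length_filter_conv_card len by simp
  thus ?thesis
   using exponents_ge_Suc[of ms k] blocks_ge_local_smith[OF A(1) ls] k by simp
 qed
 have mono: "blocks_ge L 0 (Suc k) <= blocks_ge L 0 k" for k by (rule exponents_ge_antimono) simp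
 show ?thesis
 proof (cases \<sigma>)
  case T_even
  have "odd k ==> 1 <= k" for k :: nat by presburger
  thus ?thesis using par mono unfolding T_even by auto
 next
  case T_odd
  have "(-1 :: complex) ^ n = (-1) ^ order 0 (det L)"
   using alternating_order[OF A(3) reg] unfolding T_odd by simp
  hence "even n = even (order 0 (det L))" by (metis neg_one_even_power neg_one_odd_power one_neq_neg_one)
  moreover have "even (\<Sum>k = 1..2 * m + 1. blocks_ge L 0 k) = even (blocks_ge L 0 1)" for m
  proof (induction m)
   case (Suc m)
   have e: "{1..2 * Suc m + 1} = insert (Suc (2 * m + 2)) (insert (2 * m + 2) {1..2 * m + 1})" by auto
   have "(\<Sum>k = 1..2 * Suc m + 1. blocks_ge L 0 k) = (\<Sum>k = 1..2 * m + 1. blocks_ge L 0 k) +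
     (blocks_ge L 0 (2 * m + 2) + blocks_ge L 0 (Suc (2 * m + 2)))"
    unfolding e by (simp del: sum.cl_ivl_Suc)
   moreover have "even (blocks_ge L 0 (2 * m + 2) + blocks_ge L 0 (Suc (2 * m + 2)))"
    using par[of "2 * m + 2"] unfolding T_odd even_add by simp
   ultimately show ?case using Suc by (metis even_add)
  qed simp
  moreover have "(\<Sum>k = 1..2 * n + 1. blocks_ge L 0 k) = order 0 (det L)"
   by (rule blocks_ge_sum[OF A(1) reg]) simp
  ultimately have "even n = even (blocks_ge L 0 1)" by metis
  thus ?thesis using par mono unfolding T_odd by auto
 qed
qed

lemma target_eq_0:
 assumes L: "alt_pencil \<sigma> n L" "det L ~= 0" and k: "n + 1 < k"
 shows "target \<sigma> n r (blocks_ge L 0) k = 0"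
proof -
 have "blocks_ge L 0 k = 0" "blocks_ge L 0 (k - 1) = 0"
  using blocks_ge_eq_0[OF alt_pencilD(1)[OF L(1)] L(2)] k by auto
 thus ?thesis using target_eq_repaired[OF admissible_blocks[OF L], of k r] k by auto
qed

text \<open>What a perturbation of rank at most \<open>r\<close> does not change: \<open>b 0, \<dots>, b (r - 1)\<close> annihilate
 the vectors on which the two pencils agree.\<close>

definition rank_perturbed :: "nat => nat => complex poly mat => complex poly mat => bool" where
 "rank_perturbed n r L L' \<longleftrightarrow> (\<exists>b. (\<forall>l<r. b l \<in> Vec n) \<and>
   (\<forall>x \<in> Vec n. (\<forall>l<r. b l \<bullet> x = 0) \<longrightarrow> L' *\<^sub>v x = L *\<^sub>v x))"

lemma rank_perturbed_blocks:
 assumes "is_pencil n L" "det L ~= 0" "is_pencil n L'" "det L' ~= 0" "rank_perturbed n r L L'" "1 <= k"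
 shows "blocks_ge L \<mu> k <= blocks_ge L' \<mu> k + r"
proof -
 obtain b where "!!l. l < r ==> b l \<in> Vec n"
  "!!x. x \<in> Vec n ==> (!!l. l < r ==> b l \<bullet> x = 0) ==> L' *\<^sub>v x = L *\<^sub>v x"
  using assms(5) unfolding rank_perturbed_def by blast
 note b = this
 show ?thesis by (rule blocks_ge_perturbed[OF assms(1-4), of r b]) (use b assms(6) in auto)
qed

lemma pair_bound_ge: "n + 1 <= pair_bound \<sigma> n" "n <= pair_bound \<sigma> n"
 by (cases \<sigma>; simp)+

definition target_order :: "alternation => nat => nat => (nat => nat) => nat" where
 "target_order \<sigma> n r \<nu> = (\<Sum>k = 1..pair_bound \<sigma> n. target \<sigma> n r \<nu> k)"

lemma order_ge_target:
 assumes L: "alt_pencil \<sigma> n L" "det L ~= 0" and L': "alt_pencil \<sigma> n L'" "det L' ~= 0"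
  and rk: "rank_perturbed n r L L'"
 shows "target_order \<sigma> n r (blocks_ge L 0) <= order 0 (det L')"
 unfolding target_order_def
  blocks_ge_sum[OF alt_pencilD(1)[OF L'(1)] L'(2) pair_bound_ge(2)[of n \<sigma>], of 0, symmetric]
 by (rule target_sum_le[OF admissible_blocks[OF L] admissible_blocks[OF L']
    rank_perturbed_blocks[OF alt_pencilD(1)[OF L(1)] L(2) alt_pencilD(1)[OF L'(1)] L'(2) rk]])

text \<open>It suffices to bound the order of the determinant from above and to exhibit the repaired entry.\<close>

lemma blocks_eq_target:
 assumes L: "alt_pencil \<sigma> n L" "det L ~= 0" and L': "alt_pencil \<sigma> n L'" "det L' ~= 0"
  and rk: "rank_perturbed n r L L'"
  and ord: "order 0 (det L') <= target_order \<sigma> n r (blocks_ge L 0)"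
  and rep: "!!k. repaired \<sigma> r (blocks_ge L 0) k ==> 0 < blocks_ge L' 0 k" and k: "1 <= k"
 shows "blocks_ge L' 0 k = target \<sigma> n r (blocks_ge L 0) k"
proof (cases "k <= pair_bound \<sigma> n")
 case True
 show ?thesis
  by (rule target_unique[OF admissible_blocks[OF L] admissible_blocks[OF L']
    rank_perturbed_blocks[OF alt_pencilD(1)[OF L(1)] L(2) alt_pencilD(1)[OF L'(1)] L'(2) rk] rep _ k True])
   (use ord blocks_ge_sum[OF alt_pencilD(1)[OF L'(1)] L'(2) pair_bound_ge(2)[of n \<sigma>], of 0]
    in \<open>auto simp: target_order_def simp del: repaired.simps target.simps\<close>)
next
 case False
 hence "n + 1 < k" using pair_bound_ge(1)[of n \<sigma>] by simp
 thus ?thesis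
  using target_eq_0[OF L] blocks_ge_eq_0[OF alt_pencilD(1)[OF L'(1)] L'(2)] by simp
qed

lemma plain_blocks_eq:
 assumes L: "is_pencil n L" "det L ~= 0" and L': "is_pencil n L'" "det L' ~= 0"
  and rk: "rank_perturbed n r L L'"
  and ord: "order \<mu> (det L') <= (\<Sum>k = 1..n. blocks_ge L \<mu> k - r)" and k: "1 <= k"
 shows "blocks_ge L' \<mu> k = blocks_ge L \<mu> k - r"
proof (cases "k <= n")
 case True
 have le: "blocks_ge L \<mu> k - r <= blocks_ge L' \<mu> k" if "1 <= k" for k
  using rank_perturbed_blocks[OF L L' rk that, of \<mu>] by simp
 have "(\<Sum>k = 1..n. blocks_ge L \<mu> k - r) = (\<Sum>k = 1..n. blocks_ge L' \<mu> k)"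
 proof (rule antisym)
  show "(\<Sum>k = 1..n. blocks_ge L \<mu> k - r) <= (\<Sum>k = 1..n. blocks_ge L' \<mu> k)"
   using le by (intro sum_mono) auto
 qed (use ord blocks_ge_sum[OF L' order.refl, of \<mu>] in simp)
 thus ?thesis
  using sum_mono_inv[of "\<lambda>k. blocks_ge L \<mu> k - r" "{1..n}" "\<lambda>k. blocks_ge L' \<mu> k" k] le k True by auto
next
 case False
 thus ?thesis using blocks_ge_eq_0[OF L] blocks_ge_eq_0[OF L'] by simp
qed

lemma order_ge_plain:
 assumes L: "is_pencil n L" "det L ~= 0" and L': "is_pencil n L'" "det L' ~= 0"
  and rk: "rank_perturbed n r L L'"
 shows "(\<Sum>k = 1..n. blocks_ge L \<mu> k - r) <= order \<mu> (det L')"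
proof -
 have le: "blocks_ge L \<mu> k - r <= blocks_ge L' \<mu> k" if "1 <= k" for k
  using rank_perturbed_blocks[OF L L' rk that, of \<mu>] by simp
 show ?thesis unfolding blocks_ge_sum[OF L' order.refl, of \<mu>, symmetric]
  using le by (intro sum_mono) auto
qed

text \<open>An entry of the adjugate of small order bounds the largest partial multiplicity from below.\<close>

lemma blocks_ge_pos_of_adj:
 assumes L: "is_pencil n L" "det L ~= 0" and ij: "i < n" "j < n" and nz: "adj_mat L $$ (i,j) ~= 0"
  and le: "order \<mu> (adj_mat L $$ (i,j)) + k <= order \<mu> (det L)" and k: "1 <= k"
 shows "0 < blocks_ge L \<mu> k"
proof -
 have n: "0 < n" using ij by simp
 obtain C e where C: "C \<in> Mat n" "adj_mat L = [:-\<mu>,1:] ^ e \<cdot>\<^sub>m C"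
  "\<exists>i<n. \<exists>j<n. poly (C $$ (i,j)) \<mu> ~= 0"
  and e: "!!i j. i < n ==> j < n ==> adj_mat L $$ (i,j) ~= 0 ==> e <= order \<mu> (adj_mat L $$ (i,j))"
  by (rule adj_factorization[OF is_pencil_carrier[OF L(1)] L(2) n, where \<mu> = \<mu>]) blast
 show ?thesis unfolding blocks_ge_adj[OF L C k] using e[OF ij nz] le by simp
qed

text \<open>Polarization: a quadratic form that vanishes identically belongs to a skew-symmetric matrix.\<close>

lemma quadratic_form_nonzero:
 fixes X :: "complex mat"
 assumes X: "X \<in> Mat n" and ij: "i < n" "j < n" "X $$ (j,i) ~= - X $$ (i,j)"
 obtains u where "u \<in> Vec n" "u \<bullet> (X *\<^sub>v u) ~= 0"
proof (rule ccontr)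
 note obtained = that
 assume "\<not> thesis"
 hence z: "u \<bullet> (X *\<^sub>v u) = 0" if "u \<in> Vec n" for u using obtained that by blast
 have q: "unit_vec n k \<bullet> (X *\<^sub>v unit_vec n l) = X $$ (k,l)" if "k < n" "l < n" for k l
  using X that by simp
 let ?u = "unit_vec n i" and ?v = "unit_vec n j"
 have "(?u + ?v) \<bullet> (X *\<^sub>v (?u + ?v)) = ?u \<bullet> (X *\<^sub>v ?u) + ?u \<bullet> (X *\<^sub>v ?v) + (?v \<bullet> (X *\<^sub>v ?u) + ?v \<bullet> (X *\<^sub>v ?v))"
 proof -
  have c: "X *\<^sub>v ?u \<in> Vec n" "X *\<^sub>v ?v \<in> Vec n" using X by auto
  show ?thesis
   unfolding mult_add_distrib_mat_vec[OF X unit_vec_carrier unit_vec_carrier]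
    add_scalar_prod_distrib[OF unit_vec_carrier unit_vec_carrier add_carrier_vec[OF c]]
    scalar_prod_add_distrib[OF unit_vec_carrier c] ..
 qed
 hence "X $$ (i,i) + X $$ (i,j) + (X $$ (j,i) + X $$ (j,j)) = 0"
  using z[of "?u + ?v"] q ij by (simp del: scalar_prod_left_unit scalar_prod_right_unit)
 moreover have "X $$ (i,i) = 0" "X $$ (j,j) = 0" using z[of ?u] z[of ?v] q ij by auto
 ultimately show False using ij(3) by (simp add: add_eq_0_iff2)
qed

text \<open>The columns would be annihilated at every point at which the pencil is invertible.\<close>

lemma pencil_kills_only_zero:
 fixes X :: "complex mat"
 assumes L: "L \<in> Mat n" "det L ~= 0" and X: "X \<in> Mat n"
  and z: "L * const_mat X = 0\<^sub>m n n"
 shows "X = 0\<^sub>m n n"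
proof -
 have "const_mat X = 0\<^sub>m n n"
  by (rule mat_mult_cancel_left[OF L]) (use X z L in auto)
 hence "const_mat X $$ (i,j) = 0" if "i < n" "j < n" for i j using that by simp
 thus ?thesis using X by (intro eq_matI) auto
qed

section \<open>Polynomial functions and generic sets\<close>

definition monom_eval :: "nat => (nat \<Rightarrow>\<^sub>0 nat) => complex vec => complex" where
 "monom_eval m e x = (\<Prod>i<m. (x $ i) ^ Poly_Mapping.lookup e i)"

lemma cmpoly_eval_superset:
 assumes "cmpoly_in_vars m p" "finite K" "Poly_Mapping.keys p \<subseteq> K"
 shows "cmpoly_eval p x = (\<Sum>e\<in>K. Poly_Mapping.lookup p e * monom_eval m e x)"
proof -
 have "cmpoly_eval p x = (\<Sum>e \<in> Poly_Mapping.keys p. Poly_Mapping.lookup p e * monom_eval m e x)"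
  unfolding cmpoly_eval_def monom_eval_def
 proof (intro sum.cong refl arg_cong2[where f = "(*)"])
  fix e assume "e \<in> Poly_Mapping.keys p"
  hence "Poly_Mapping.keys e \<subseteq> {..<m}" using assms(1) unfolding cmpoly_in_vars_def by blast
  thus "(\<Prod>i \<in> Poly_Mapping.keys e. (x $ i) ^ Poly_Mapping.lookup e i) = (\<Prod>i<m. (x $ i) ^ Poly_Mapping.lookup e i)"
   by (intro prod.mono_neutral_left) (auto simp: in_keys_iff)
 qed
 also have "\<dots> = (\<Sum>e\<in>K. Poly_Mapping.lookup p e * monom_eval m e x)"
  using assms(2,3) by (intro sum.mono_neutral_left) (auto simp: in_keys_iff)
 finally show ?thesis .
qed

text \<open>A function of the parameters that is given by a polynomial. Its closure properties replace explicit
 manipulations of multivariate polynomials.\<close>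

definition polyfun :: "nat => (complex vec => complex) => bool" where
 "polyfun m f \<longleftrightarrow> (\<exists>p. cmpoly_in_vars m p \<and> (\<forall>x \<in> carrier_vec m. f x = cmpoly_eval p x))"

lemma polyfun_cong: "polyfun m f ==> (!!x. x \<in> carrier_vec m ==> g x = f x) ==> polyfun m g"
 unfolding polyfun_def by metis

lemma polyfun_if:
 "(b ==> polyfun m f) ==> (\<not> b ==> polyfun m g) ==> polyfun m (\<lambda>x. if b then f x else g x)"
 by (cases b) simp_all

lemma cmpoly_in_vars_add:
 assumes "cmpoly_in_vars m p" "cmpoly_in_vars m q"
 shows "cmpoly_in_vars m (p + q)"
 using assms Poly_Mapping.keys_add[of p q] unfolding cmpoly_in_vars_def by blast

lemma polyfun_add:
 assumes "polyfun m f" "polyfun m g"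
 shows "polyfun m (\<lambda>x. f x + g x)"
proof -
 obtain p q where p: "cmpoly_in_vars m p" "!!x. x \<in> carrier_vec m ==> f x = cmpoly_eval p x"
  and q: "cmpoly_in_vars m q" "!!x. x \<in> carrier_vec m ==> g x = cmpoly_eval q x"
  using assms unfolding polyfun_def by blast
 let ?K = "Poly_Mapping.keys p \<union> Poly_Mapping.keys q"
 have "cmpoly_eval p x + cmpoly_eval q x = cmpoly_eval (p + q) x" for x
  using cmpoly_eval_superset[OF p(1), of ?K x] cmpoly_eval_superset[OF q(1), of ?K x]
   cmpoly_eval_superset[OF cmpoly_in_vars_add[OF p(1) q(1)], of ?K x] Poly_Mapping.keys_add[of p q]
  by (simp add: lookup_add distrib_right sum.distrib)
 thus ?thesis unfolding polyfun_def using p q cmpoly_in_vars_add[OF p(1) q(1)] by metis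
qed

lemma polyfun_monom:
 assumes "Poly_Mapping.keys e \<subseteq> {..<m}"
 shows "polyfun m (\<lambda>x. c * monom_eval m e x)"
proof -
 let ?p = "Poly_Mapping.single e c"
 have v: "cmpoly_in_vars m ?p" unfolding cmpoly_in_vars_def using assms by simp
 have "c * monom_eval m e x = cmpoly_eval ?p x" for x
  by (subst cmpoly_eval_superset[OF v, of "{e}"]) auto
 thus ?thesis unfolding polyfun_def using v by blast
qed

lemma polyfun_const [simp]: "polyfun m (\<lambda>x. c)"
 using polyfun_monom[of 0 m c] by (simp add: monom_eval_def)

lemma polyfun_sum: "(!!i. i \<in> I ==> polyfun m (f i)) ==> polyfun m (\<lambda>x. \<Sum>i\<in>I. f i x)"
 by (induction I rule: infinite_finite_induct) (auto intro: polyfun_add)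

lemma polyfun_coord: "i < m ==> polyfun m (\<lambda>x. x $ i)"
proof -
 assume i: "i < m"
 have "monom_eval m (Poly_Mapping.single i 1) x = x $ i" for x
 proof -
  have "monom_eval m (Poly_Mapping.single i 1) x = (\<Prod>j<m. if j = i then x $ i else 1)"
   unfolding monom_eval_def by (intro prod.cong) (auto simp: lookup_single)
  thus ?thesis using i by simp
 qed
 thus ?thesis using polyfun_monom[of "Poly_Mapping.single i 1" m 1] i by simp
qed

lemma polyfun_mult:
 assumes "polyfun m f" "polyfun m g"
 shows "polyfun m (\<lambda>x. f x * g x)"
proof -
 obtain p q where p: "cmpoly_in_vars m p" "!!x. x \<in> carrier_vec m ==> f x = cmpoly_eval p x"
  and q: "cmpoly_in_vars m q" "!!x. x \<in> carrier_vec m ==> g x = cmpoly_eval q x"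
  using assms unfolding polyfun_def by blast
 have me: "monom_eval m e x * monom_eval m e' x = monom_eval m (e + e') x" for e e' x
  unfolding monom_eval_def by (simp add: lookup_add power_add prod.distrib)
 have "polyfun m (\<lambda>x. \<Sum>e\<in>Poly_Mapping.keys p. \<Sum>e'\<in>Poly_Mapping.keys q.
   (Poly_Mapping.lookup p e * Poly_Mapping.lookup q e') * monom_eval m (e + e') x)"
 proof (intro polyfun_sum polyfun_monom)
  fix e e' assume "e \<in> Poly_Mapping.keys p" "e' \<in> Poly_Mapping.keys q"
  thus "Poly_Mapping.keys (e + e') \<subseteq> {..<m}"
   using p(1) q(1) Poly_Mapping.keys_add[of e e'] unfolding cmpoly_in_vars_def by blast
 qed
 thus ?thesis
 proof (rule polyfun_cong)
  fix x :: "complex vec" assume x: "x \<in> carrier_vec m"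
  show "f x * g x = (\<Sum>e\<in>Poly_Mapping.keys p. \<Sum>e'\<in>Poly_Mapping.keys q.
   (Poly_Mapping.lookup p e * Poly_Mapping.lookup q e') * monom_eval m (e + e') x)"
   unfolding p(2)[OF x] q(2)[OF x] cmpoly_eval_superset[OF p(1) finite_keys order.refl]
    cmpoly_eval_superset[OF q(1) finite_keys order.refl] sum_product
   by (intro sum.cong refl) (simp add: me[symmetric] mult_ac)
 qed
qed

lemma polyfun_prod: "(!!i. i \<in> I ==> polyfun m (f i)) ==> polyfun m (\<lambda>x. \<Prod>i\<in>I. f i x)"
 by (induction I rule: infinite_finite_induct) (auto intro: polyfun_mult)

lemma polyfun_uminus: "polyfun m f ==> polyfun m (\<lambda>x. - f x)"
 using polyfun_mult[OF polyfun_const[of m "-1"], of f] by simp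

lemma polyfun_det:
 assumes "!!i j. i < k ==> j < k ==> polyfun m (\<lambda>x. A x $$ (i,j))" "!!x. x \<in> carrier_vec m ==> A x \<in> carrier_mat k k"
 shows "polyfun m (\<lambda>x. det (A x))"
proof -
 have "polyfun m (\<lambda>x. \<Sum>p \<in> {p. p permutes {0..<k}}. signof p * (\<Prod>i = 0..<k. A x $$ (i, p i)))"
 proof (intro polyfun_sum polyfun_mult polyfun_const polyfun_prod)
  fix p i assume "p \<in> {p. p permutes {0..<k}}" "i \<in> {0..<k}"
  thus "polyfun m (\<lambda>x. A x $$ (i, p i))" using assms(1)[of i "p i"] permutes_in_image[of p "{0..<k}" i] by auto
 qed
 thus ?thesis by (rule polyfun_cong) (simp add: det_def'[OF assms(2)])
qed

text \<open>On a line, a polynomial function is a univariate polynomial, which vanishes at finitely many points only.\<close>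

lemma polyfun_line:
 assumes f: "polyfun m f" and x: "x \<in> carrier_vec m" and y: "y \<in> carrier_vec m"
 obtains P where "!!t. f (x + t \<cdot>\<^sub>v y) = poly P t"
proof -
 obtain p where p: "cmpoly_in_vars m p" "!!x. x \<in> carrier_vec m ==> f x = cmpoly_eval p x"
  using f unfolding polyfun_def by blast
 \<comment> \<open>The coordinates of \<open>x + t y\<close> are the linear polynomials \<open>x $ i + t (y $ i)\<close>.\<close>
 define P where "P = (\<Sum>e\<in>Poly_Mapping.keys p. [:Poly_Mapping.lookup p e:] *
   (\<Prod>i<m. [:x $ i, y $ i:] ^ Poly_Mapping.lookup e i))"
 have "f (x + t \<cdot>\<^sub>v y) = poly P t" for t
 proof -
  have "f (x + t \<cdot>\<^sub>v y) = (\<Sum>e\<in>Poly_Mapping.keys p. Poly_Mapping.lookup p e * monom_eval m e (x + t \<cdot>\<^sub>v y))"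
   using p(2)[of "x + t \<cdot>\<^sub>v y"] x y cmpoly_eval_superset[OF p(1) finite_keys order.refl] by simp
  also have "\<dots> = poly P t"
   unfolding P_def monom_eval_def using x y by (simp add: poly_sum poly_prod poly_power)
  finally show ?thesis .
 qed
 thus ?thesis using that by blast
qed

text \<open>A product of polynomial functions that do not vanish identically does not vanish identically:
 restrict to the line through two points at which the factors do not vanish.\<close>

lemma polyfun_common_nonzero:
 assumes f: "polyfun m f" "x \<in> carrier_vec m" "f x ~= 0" and g: "polyfun m g" "y \<in> carrier_vec m" "g y ~= 0"
 obtains z where "z \<in> carrier_vec m" "f z ~= 0" "g z ~= 0"
proof -
 have d: "y - x \<in> carrier_vec m" using f g by auto
 obtain P where P: "!!t. f (x + t \<cdot>\<^sub>v (y - x)) = poly P t" by (rule polyfun_line[OF f(1,2) d]) blast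
 obtain Q where Q: "!!t. g (x + t \<cdot>\<^sub>v (y - x)) = poly Q t" by (rule polyfun_line[OF g(1) f(2) d]) blast
 have "x + 0 \<cdot>\<^sub>v (y - x) = x" "x + 1 \<cdot>\<^sub>v (y - x) = y" using f(2) g(2) by auto
 hence "P ~= 0" "Q ~= 0" using P[of 0] Q[of 1] f(3) g(3) by auto
 hence "P * Q ~= 0" by simp
 then obtain t where "poly (P * Q) t ~= 0" using poly_all_0_iff_0 by blast
 thus ?thesis using that[of "x + t \<cdot>\<^sub>v (y - x)"] P Q f(2) d by auto
qed

lemma polyfun_finite_common_nonzero:
 assumes "finite I" "!!i. i \<in> I ==> polyfun m (f i)" "!!i. i \<in> I ==> \<exists>x \<in> carrier_vec m. f i x ~= 0"
 shows "\<exists>z \<in> carrier_vec m. \<forall>i \<in> I. f i z ~= 0"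
proof -
 have "\<exists>z \<in> carrier_vec m. (\<Prod>i\<in>I. f i z) ~= 0"
  using assms
 proof (induction I)
  case empty
  show ?case by (intro bexI[of _ "0\<^sub>v m"]) auto
 next
  case (insert i I)
  then obtain x where x: "x \<in> carrier_vec m" "(\<Prod>i\<in>I. f i x) ~= 0" by auto
  obtain y where y: "y \<in> carrier_vec m" "f i y ~= 0" using insert.prems(2)[of i] by blast
  have pf: "polyfun m (\<lambda>x. \<Prod>i\<in>I. f i x)" by (rule polyfun_prod) (use insert.prems in auto)
  have pfi: "polyfun m (f i)" using insert.prems by auto
  obtain z where "z \<in> carrier_vec m" "(\<Prod>i\<in>I. f i z) ~= 0" "f i z ~= 0"
   by (rule polyfun_common_nonzero[where f = "\<lambda>x. \<Prod>i\<in>I. f i x", OF pf x pfi y]) blast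
  thus ?case using insert(1,2) by (intro bexI[of _ z]) auto
 qed
 then obtain z where z: "z \<in> carrier_vec m" "(\<Prod>i\<in>I. f i z) ~= 0" by blast
 show ?thesis using z assms(1) by (intro bexI[of _ z]) (auto simp: prod_zero_iff)
qed

lemma generic_nonzero_set:
 assumes "polyfun m f" "x \<in> carrier_vec m" "f x ~= 0"
 shows "generic m {x \<in> carrier_vec m. f x ~= 0}"
proof -
 obtain p where p: "cmpoly_in_vars m p" "!!x. x \<in> carrier_vec m ==> f x = cmpoly_eval p x"
  using assms(1) unfolding polyfun_def by blast
 let ?Z = "{x \<in> carrier_vec m. \<forall>p \<in> {p}. cmpoly_eval p x = 0}"
 have "algebraic_set m ?Z" unfolding algebraic_set_def using p(1) by (intro exI[of _ "{p}"]) auto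
 moreover have "?Z ~= carrier_vec m" using assms p by auto
 moreover have "carrier_vec m - {x \<in> carrier_vec m. f x ~= 0} \<subseteq> ?Z" using p by auto
 ultimately show ?thesis unfolding generic_def by blast
qed

text \<open>Families of univariate polynomials with polynomial coefficients.\<close>

definition polyfun_poly :: "nat => (complex vec => complex poly) => bool" where
 "polyfun_poly m F \<longleftrightarrow> (\<exists>N c. (\<forall>i\<le>N. polyfun m (c i)) \<and>
   (\<forall>x \<in> carrier_vec m. F x = (\<Sum>i\<le>N. monom (c i x) i)))"

lemma polyfun_poly_cong: "polyfun_poly m F ==> (!!x. x \<in> carrier_vec m ==> G x = F x) ==> polyfun_poly m G"
 unfolding polyfun_poly_def by metis

lemma polyfun_poly_coeff:
 assumes "polyfun_poly m F"
 shows "polyfun m (\<lambda>x. coeff (F x) k)"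
proof -
 obtain N c where c: "!!i. i <= N ==> polyfun m (c i)"
  "!!x. x \<in> carrier_vec m ==> F x = (\<Sum>i\<le>N. monom (c i x) i)"
  using assms unfolding polyfun_poly_def by blast
 have "polyfun m (\<lambda>x. \<Sum>i\<le>N. if i = k then c i x else 0)"
  by (intro polyfun_sum polyfun_if polyfun_const) (use c in auto)
 thus ?thesis by (rule polyfun_cong) (simp add: c(2) coeff_sum)
qed

lemma polyfun_poly_monom: "polyfun m c ==> polyfun_poly m (\<lambda>x. monom (c x) k)"
 unfolding polyfun_poly_def
 by (intro exI[of _ k] exI[of _ "\<lambda>i x. if i = k then c x else 0"]) (auto simp: if_distrib[of "\<lambda>a. monom a _"] intro!: polyfun_if cong: if_cong)

lemma polyfun_poly_add:
 assumes "polyfun_poly m F" "polyfun_poly m G"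
 shows "polyfun_poly m (\<lambda>x. F x + G x)"
proof -
 obtain N c where c: "!!i. i <= N ==> polyfun m (c i)"
  "!!x. x \<in> carrier_vec m ==> F x = (\<Sum>i\<le>N. monom (c i x) i)"
  using assms unfolding polyfun_poly_def by blast
 obtain M d where d: "!!i. i <= M ==> polyfun m (d i)"
  "!!x. x \<in> carrier_vec m ==> G x = (\<Sum>i\<le>M. monom (d i x) i)"
  using assms unfolding polyfun_poly_def by blast
 have ext: "(\<Sum>i\<le>N. monom (c i x) i) = (\<Sum>i\<le>N + M. monom (if i <= N then c i x else 0) i)"
  for N M x and c :: "nat => complex vec => complex"
  by (rule sum.mono_neutral_cong_left) auto
 show ?thesis unfolding polyfun_poly_def
 proof (intro exI[of _ "N + M"] exI[of _ "\<lambda>i x. (if i <= N then c i x else 0) + (if i <= M then d i x else 0)"] conjI allI impI ballI)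
  fix i assume "i <= N + M"
  show "polyfun m (\<lambda>x. (if i <= N then c i x else 0) + (if i <= M then d i x else 0))"
   by (intro polyfun_add polyfun_if polyfun_const c d)
 next
  fix x :: "complex vec" assume x: "x \<in> carrier_vec m"
  show "F x + G x = (\<Sum>i\<le>N + M. monom ((if i <= N then c i x else 0) + (if i <= M then d i x else 0)) i)"
   unfolding c(2)[OF x] d(2)[OF x] ext[where N = N and M = M] ext[where N = M and M = N] add.commute[of M N]
   by (simp add: add_monom[symmetric] sum.distrib)
 qed
qed

lemma polyfun_poly_0: "polyfun_poly m (\<lambda>x. 0)"
 using polyfun_poly_monom[OF polyfun_const[of m 0], of 0] by simp

lemma polyfun_poly_sum: "(!!i. i \<in> I ==> polyfun_poly m (f i)) ==> polyfun_poly m (\<lambda>x. \<Sum>i\<in>I. f i x)"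
 by (induction I rule: infinite_finite_induct) (auto intro: polyfun_poly_add polyfun_poly_0)

lemma polyfun_poly_const: "polyfun_poly m (\<lambda>x. p)"
proof -
 have "polyfun_poly m (\<lambda>x. \<Sum>i\<le>degree p. monom (coeff p i) i)"
  by (intro polyfun_poly_sum polyfun_poly_monom) simp
 thus ?thesis by (simp add: poly_as_sum_of_monoms)
qed

text \<open>A linear operation on polynomials acts on coefficients by a fixed matrix. This covers quotient and
 remainder by a fixed polynomial, and the derivative.\<close>

lemma polyfun_poly_linear:
 assumes F: "polyfun_poly m F"
  and T: "!!p q. T (p + q) = T p + T q" "!!c p. T (Polynomial.smult c p) = Polynomial.smult c (T p)" "T 0 = (0 :: complex poly)"
 shows "polyfun_poly m (\<lambda>x. T (F x))"
proof -
 obtain N c where c: "!!i. i <= N ==> polyfun m (c i)"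
  "!!x. x \<in> carrier_vec m ==> F x = (\<Sum>i\<le>N. monom (c i x) i)"
  using assms unfolding polyfun_poly_def by blast
 have Tsum: "T (\<Sum>i\<in>I. f i) = (\<Sum>i\<in>I. T (f i))" if "finite I" for f and I :: "nat set"
  using that by (induction I) (auto simp: T)
 have Tm: "T (monom a i) = (\<Sum>j\<le>degree (T (monom 1 i)). monom (a * coeff (T (monom 1 i)) j) j)" for a i
 proof -
  have "T (monom a i) = Polynomial.smult a (T (monom 1 i))" using T(2)[of a "monom 1 i"] by (simp add: smult_monom)
  also have "\<dots> = Polynomial.smult a (\<Sum>j\<le>degree (T (monom 1 i)). monom (coeff (T (monom 1 i)) j) j)"
   by (simp add: poly_as_sum_of_monoms)
  finally show ?thesis by (simp add: smult_sum2 smult_monom)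
 qed
 have "polyfun_poly m (\<lambda>x. \<Sum>i\<le>N. \<Sum>j\<le>degree (T (monom 1 i)). monom (c i x * coeff (T (monom 1 i)) j) j)"
  by (intro polyfun_poly_sum polyfun_poly_monom polyfun_mult polyfun_const c) auto
 thus ?thesis
 proof (rule polyfun_poly_cong)
  fix x :: "complex vec" assume x: "x \<in> carrier_vec m"
  show "T (F x) = (\<Sum>i\<le>N. \<Sum>j\<le>degree (T (monom 1 i)). monom (c i x * coeff (T (monom 1 i)) j) j)"
   unfolding c(2)[OF x] Tsum[OF finite_atMost] by (intro sum.cong refl Tm)
 qed
qed

lemma polyfun_poly_div: "polyfun_poly m F ==> polyfun_poly m (\<lambda>x. F x div g)"
 by (rule polyfun_poly_linear) (auto simp: poly_div_add_left div_smult_left)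

lemma polyfun_poly_mod: "polyfun_poly m F ==> polyfun_poly m (\<lambda>x. F x mod g)"
 by (rule polyfun_poly_linear) (auto simp: poly_mod_add_left mod_smult_left)

lemma polyfun_poly_pderiv: "polyfun_poly m F ==> polyfun_poly m (\<lambda>x. pderiv (F x))"
 by (rule polyfun_poly_linear) (auto simp: pderiv_add pderiv_smult)

lemma polyfun_poly_mult:
 assumes "polyfun_poly m F" "polyfun_poly m G"
 shows "polyfun_poly m (\<lambda>x. F x * G x)"
proof -
 obtain N c where c: "!!i. i <= N ==> polyfun m (c i)"
  "!!x. x \<in> carrier_vec m ==> F x = (\<Sum>i\<le>N. monom (c i x) i)"
  using assms unfolding polyfun_poly_def by blast
 obtain M d where d: "!!i. i <= M ==> polyfun m (d i)"
  "!!x. x \<in> carrier_vec m ==> G x = (\<Sum>i\<le>M. monom (d i x) i)"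
  using assms unfolding polyfun_poly_def by blast
 have "polyfun_poly m (\<lambda>x. \<Sum>i\<le>N. \<Sum>j\<le>M. monom (c i x * d j x) (i + j))"
  by (intro polyfun_poly_sum polyfun_poly_monom polyfun_mult) (use c d in auto)
 thus ?thesis by (rule polyfun_poly_cong) (simp add: c(2) d(2) sum_product mult_monom)
qed

lemma polyfun_poly_prod: "(!!i. i \<in> I ==> polyfun_poly m (f i)) ==> polyfun_poly m (\<lambda>x. \<Prod>i\<in>I. f i x)"
 by (induction I rule: infinite_finite_induct) (auto intro: polyfun_poly_mult polyfun_poly_const)

lemma polyfun_poly_det:
 assumes "!!i j. i < k ==> j < k ==> polyfun_poly m (\<lambda>x. A x $$ (i,j))" "!!x. x \<in> carrier_vec m ==> A x \<in> carrier_mat k k"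
 shows "polyfun_poly m (\<lambda>x. det (A x))"
proof -
 have "polyfun_poly m (\<lambda>x. \<Sum>p \<in> {p. p permutes {0..<k}}. signof p * (\<Prod>i = 0..<k. A x $$ (i, p i)))"
 proof (intro polyfun_poly_sum polyfun_poly_mult polyfun_poly_const polyfun_poly_prod)
  fix p i assume "p \<in> {p. p permutes {0..<k}}" "i \<in> {0..<k}"
  thus "polyfun_poly m (\<lambda>x. A x $$ (i, p i))" using assms(1)[of i "p i"] permutes_in_image[of p "{0..<k}" i] by auto
 qed
 thus ?thesis by (rule polyfun_poly_cong) (simp add: det_def'[OF assms(2)])
qed

lemma polyfun_poly_adj:
 assumes A: "!!i j. i < k ==> j < k ==> polyfun_poly m (\<lambda>x. A x $$ (i,j))" "!!x. x \<in> carrier_vec m ==> A x \<in> carrier_mat k k"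
  and ij: "i < k" "j < k"
 shows "polyfun_poly m (\<lambda>x. adj_mat (A x) $$ (i,j))"
proof -
 have "polyfun_poly m (\<lambda>x. (-1) ^ (j + i) * det (mat_delete (A x) j i))"
 proof (intro polyfun_poly_mult polyfun_poly_const polyfun_poly_det[of "k - 1"])
  fix i' j' assume ij': "i' < k - 1" "j' < k - 1"
  let ?i = "if i' < j then i' else Suc i'" and ?j = "if j' < i then j' else Suc j'"
  have "polyfun_poly m (\<lambda>x. A x $$ (?i, ?j))" by (rule A(1)) (use ij' in auto)
  thus "polyfun_poly m (\<lambda>x. mat_delete (A x) j i $$ (i', j'))"
   by (rule polyfun_poly_cong) (use ij' A(2) in \<open>auto simp: mat_delete_def dest!: A(2)\<close>)
 qed (rule mat_delete_carrier[OF A(2)])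
 thus ?thesis by (rule polyfun_poly_cong) (use ij A(2) in \<open>auto simp: adj_mat_def cofactor_def dest!: A(2)\<close>)
qed

text \<open>Not to be divisible is an open condition: some coefficient of the remainder does not vanish.\<close>

lemma polyfun_poly_not_dvd:
 assumes F: "polyfun_poly m F" and x0: "\<not> g dvd F x0"
 obtains f where "polyfun m f" "f x0 ~= 0" "!!x. f x ~= 0 ==> \<not> g dvd F x"
proof -
 have "F x0 mod g ~= 0" using x0 by (simp add: dvd_eq_mod_eq_0)
 then obtain k where k: "coeff (F x0 mod g) k ~= 0" by (auto simp: poly_eq_iff)
 show ?thesis
  by (rule that[OF polyfun_poly_coeff[OF polyfun_poly_mod[OF F, of g], of k] k]) (auto simp: dvd_eq_mod_eq_0)
qed

section \<open>Single perturbation steps at a point\<close>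

abbreviation cvec :: "complex vec => complex poly vec" where
 "cvec \<equiv> map_vec (\<lambda>a. [:a:])"

abbreviation ev_mat :: "complex => complex poly mat => complex mat" where
 "ev_mat \<mu> \<equiv> map_mat (\<lambda>p. poly p \<mu>)"

abbreviation coeff_mat :: "nat => complex poly mat => complex mat" where
 "coeff_mat k \<equiv> map_mat (\<lambda>p. coeff p k)"

lemma nonzero_entry:
 assumes "X \<in> carrier_mat n m" "X ~= 0\<^sub>m n m"
 shows "\<exists>i<n. \<exists>j<m. X $$ (i,j) ~= 0"
 using assms by (metis carrier_matD eq_matI index_zero_mat)

lemma cvec_form:
 assumes "C \<in> Mat n" "u \<in> Vec n" "v \<in> Vec n"
 shows "cvec v \<bullet> (C *\<^sub>v cvec u) = (\<Sum>i<n. \<Sum>j<n. [:v $ i * u $ j:] * C $$ (i,j))"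
 using assms
 by (auto simp: scalar_prod_def atLeast0LessThan sum_distrib_left smult_sum2 mult_ac intro!: sum.cong)

lemma form_sum:
 assumes "X \<in> Mat n" "u \<in> Vec n" "v \<in> Vec n"
 shows "v \<bullet> (X *\<^sub>v u) = (\<Sum>i<n. \<Sum>j<n. v $ i * u $ j * (X :: complex mat) $$ (i,j))"
 using assms by (auto simp: scalar_prod_def atLeast0LessThan sum_distrib_left mult_ac intro!: sum.cong)

lemma poly_cvec_form:
 assumes "C \<in> Mat n" "u \<in> Vec n" "v \<in> Vec n"
 shows "poly (cvec v \<bullet> (C *\<^sub>v cvec u)) \<mu> = v \<bullet> (ev_mat \<mu> C *\<^sub>v u)"
 unfolding cvec_form[OF assms] form_sum[OF map_carrier_mat[THEN iffD2, OF assms(1)] assms(2,3)]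
 using assms by (auto simp: poly_sum intro!: sum.cong)

lemma coeff_cvec_form:
 assumes "C \<in> Mat n" "u \<in> Vec n" "v \<in> Vec n"
 shows "coeff (cvec v \<bullet> (C *\<^sub>v cvec u)) k = v \<bullet> (coeff_mat k C *\<^sub>v u)"
 unfolding cvec_form[OF assms] form_sum[OF map_carrier_mat[THEN iffD2, OF assms(1)] assms(2,3)]
 using assms by (auto simp: coeff_sum intro!: sum.cong)

lemma poly_cvec_mult:
 assumes "C \<in> Mat n" "u \<in> Vec n" "i < n"
 shows "poly ((C *\<^sub>v cvec u) $ i) \<mu> = (ev_mat \<mu> C *\<^sub>v u) $ i"
 using assms by (auto simp: scalar_prod_def poly_sum mult_ac intro!: sum.cong)

fun weight :: "alternation => nat" where
 "weight T_even = 0"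
| "weight T_odd = 1"

text \<open>The structured perturbations of rank one, \<open>uu\<^sup>T\<close> and \<open>\<lambda>uu\<^sup>T\<close>.\<close>

definition rank_one_pert :: "alternation => complex vec => complex poly mat" where
 "rank_one_pert \<sigma> u = outer ([:0,1:] ^ weight \<sigma> \<cdot>\<^sub>v cvec u) (cvec u)"

lemma flip_weight: "flip ([:0,1:] ^ weight \<sigma>) = [:eps \<sigma>:] * [:0,1:] ^ weight \<sigma>"
 by (cases \<sigma>) (simp_all add: flip_lin one_pCons)

lemma rank_one_pert_index:
 "u \<in> Vec n ==> i < n ==> j < n ==> rank_one_pert \<sigma> u $$ (i,j) = [:0,1:] ^ weight \<sigma> * [:u $ i * u $ j:]"
 unfolding rank_one_pert_def by (cases \<sigma>) auto

lemma rank_one_pert_carrier [simp]: "u \<in> Vec n ==> rank_one_pert \<sigma> u \<in> Mat n"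
 unfolding rank_one_pert_def by (rule outer_carrier) auto

lemma alt_pencil_add:
 assumes "alt_pencil \<sigma> n L" "alt_pencil \<sigma> n E"
 shows "alt_pencil \<sigma> n (L + E)"
 using alt_pencilD(2,4,5)[OF assms(1)] alt_pencilD(2,4,5)[OF assms(2)]
 unfolding alt_pencil_def is_pencil_def alternating_def
 by (auto intro: degree_add_le simp: algebra_simps smult_add_right)

lemma alt_rank_one_pert: "u \<in> Vec n ==> alt_pencil \<sigma> n (rank_one_pert \<sigma> u)"
 unfolding alt_pencil_def is_pencil_def alternating_def
 by (cases \<sigma>) (auto simp: rank_one_pert_index flip_lin mult.commute)

lemma rank_perturbed_outer:
 assumes L: "L \<in> Mat n" and a: "a \<in> Vec n" and b: "b \<in> Vec n"
 shows "rank_perturbed n 1 L (L + outer a b)"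
 unfolding rank_perturbed_def
proof (intro exI[of _ "\<lambda>_. b"] conjI ballI allI impI)
 fix x :: "complex poly vec" assume x: "x \<in> Vec n" and "\<forall>l<(1::nat). b \<bullet> x = 0"
 hence z: "outer a b *\<^sub>v x = 0\<^sub>v n" using a outer_mult_vec[OF a b x] by auto
 have "L *\<^sub>v x \<in> Vec n" using L x by simp
 thus "(L + outer a b) *\<^sub>v x = L *\<^sub>v x"
  unfolding add_mult_distrib_mat_vec[OF L outer_carrier[OF a b] x] z by simp
qed (rule b)

lemma rank_perturbed_rank_one_pert:
 assumes "L \<in> Mat n" "u \<in> Vec n"
 shows "rank_perturbed n 1 L (L + rank_one_pert \<sigma> u)"
 unfolding rank_one_pert_def using assms by (intro rank_perturbed_outer) auto

lemma det_rank_one_pert: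
 assumes L: "L \<in> Mat n" "det L ~= 0" and u: "u \<in> Vec n"
 shows "det (L + rank_one_pert \<sigma> u) = det L + [:0,1:] ^ weight \<sigma> * (cvec u \<bullet> (adj_mat L *\<^sub>v cvec u))"
proof -
 have c: "cvec u \<in> Vec n" "[:0,1:] ^ weight \<sigma> \<cdot>\<^sub>v cvec u \<in> Vec n" using u by auto
 show ?thesis
  unfolding rank_one_pert_def det_rank_one_update[OF L c(2,1)] mult_mat_smult_vec[OF adj_carrier[OF L(1)] c(1)]
  using c(1) L(1) by simp
qed

lemma smult_mat_form:
 assumes "C \<in> Mat n" "v \<in> Vec n" "w \<in> Vec n"
 shows "v \<bullet> ((c \<cdot>\<^sub>m C) *\<^sub>v w) = c * (v \<bullet> (C *\<^sub>v (w :: complex poly vec)))"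
proof -
 have "(c \<cdot>\<^sub>m C) *\<^sub>v w = c \<cdot>\<^sub>v (C *\<^sub>v w)"
  using assms by (intro eq_vecI) (auto simp: scalar_prod_def sum_distrib_left mult_ac intro!: sum.cong)
 thus ?thesis using assms by simp
qed

lemma coeff_flip: "coeff (flip p) k = (-1) ^ k * coeff p k"
 unfolding flip_def by (rule coeff_pcompose_linear)

text \<open>The adjugate inherits the symmetry of the pencil, with a sign that is determined by the order of the
 determinant at zero.\<close>

lemma adj_flip:
 assumes L: "alternating \<epsilon> n L" and reg: "det L ~= 0" and e1: "\<epsilon> * \<epsilon> = 1" and ij: "i < n" "j < n"
 shows "flip (adj_mat L $$ (j,i)) = [:\<epsilon> * (-1) ^ order 0 (det L):] * adj_mat L $$ (i,j)"
proof -
 let ?J = "adj_mat L" and ?D = "det L"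
 have Lc: "L \<in> Mat n" using L unfolding alternating_def by simp
 note J = adj_carrier[OF Lc]
 define Jf where "Jf = transpose_mat (map_mat flip ?J)"
 have Jf: "Jf \<in> Mat n" unfolding Jf_def using J by auto
 have Lf: "transpose_mat (map_mat flip L) = [:\<epsilon>:] \<cdot>\<^sub>m L"
  using L Lc unfolding alternating_def by (intro eq_matI) auto
 have fc: "map_mat flip L \<in> Mat n" "map_mat flip ?J \<in> Mat n" using Lc J by auto
 have "map_mat flip L * map_mat flip ?J = map_mat flip (?D \<cdot>\<^sub>m 1\<^sub>m n)"
  unfolding flip_mat_mult[OF Lc J, symmetric] adj_mat(2)[OF Lc] ..
 also have "\<dots> = flip ?D \<cdot>\<^sub>m 1\<^sub>m n" by (intro eq_matI) auto
 finally have "transpose_mat (map_mat flip L * map_mat flip ?J) = transpose_mat (flip ?D \<cdot>\<^sub>m 1\<^sub>m n)"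
  by (rule arg_cong)
 moreover have "transpose_mat (flip ?D \<cdot>\<^sub>m 1\<^sub>m n) = flip ?D \<cdot>\<^sub>m 1\<^sub>m n" by (intro eq_matI) auto
 ultimately have "transpose_mat (map_mat flip L * map_mat flip ?J) = flip ?D \<cdot>\<^sub>m 1\<^sub>m n" by simp
 hence 1: "Jf * ([:\<epsilon>:] \<cdot>\<^sub>m L) = flip ?D \<cdot>\<^sub>m 1\<^sub>m n"
  unfolding transpose_mult[OF fc] Lf Jf_def[symmetric] .
 have "(Jf * ([:\<epsilon>:] \<cdot>\<^sub>m L)) * ?J = Jf * ([:\<epsilon>:] \<cdot>\<^sub>m (L * ?J))"
  using Jf Lc J by (simp add: assoc_mult_mat[of _ n n _ n _ n] mult_smult_assoc_mat[of _ n n _ n])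
 also have "\<dots> = ([:\<epsilon>:] * ?D) \<cdot>\<^sub>m Jf"
  unfolding adj_mat(2)[OF Lc] using Jf
  by (simp add: mult_smult_distrib[of _ n n _ n]) (intro eq_matI, auto)
 finally have 2: "([:\<epsilon>:] * ?D) \<cdot>\<^sub>m Jf = flip ?D \<cdot>\<^sub>m ?J"
  unfolding 1 mult_smult_assoc_mat[OF one_carrier_mat J] left_mult_one_mat[OF J] ..
 have "([:\<epsilon>:] * ?D) * Jf $$ (i,j) = flip ?D * ?J $$ (i,j)"
  using arg_cong[OF 2, of "\<lambda>M. M $$ (i,j)"] Jf Lc ij by simp
 hence "?D * ([:\<epsilon>:] * flip (?J $$ (j,i))) = ?D * ([:\<epsilon> ^ n:] * ?J $$ (i,j))"
  unfolding alternating_det_flip[OF L] using ij Lc by (simp add: Jf_def mult_ac)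
 hence "[:\<epsilon>:] * flip (?J $$ (j,i)) = [:\<epsilon> ^ n:] * ?J $$ (i,j)" using reg by (metis mult_cancel_left)
 hence "[:\<epsilon>:] * ([:\<epsilon>:] * flip (?J $$ (j,i))) = [:\<epsilon>:] * ([:\<epsilon> ^ n:] * ?J $$ (i,j))" by simp
 thus ?thesis unfolding alternating_order[OF L reg] using e1 by (simp add: mult.assoc[symmetric] mult.commute)
qed

lemma reduced_adj_flip:
 assumes L: "alternating \<epsilon> n L" and reg: "det L ~= 0" and e1: "\<epsilon> * \<epsilon> = 1"
  and C: "C \<in> Mat n" and adj: "adj_mat L = [:0,1:] ^ e \<cdot>\<^sub>m C" and e: "e <= order 0 (det L)"
  and ij: "i < n" "j < n"
 shows "flip (C $$ (j,i)) = [:\<epsilon> * (-1) ^ (order 0 (det L) - e):] * C $$ (i,j)"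
proof -
 let ?s = "[:0,1:] :: complex poly" and ?a = "order 0 (det L)"
 have J: "adj_mat L $$ (k,l) = ?s ^ e * C $$ (k,l)" if "k < n" "l < n" for k l
  unfolding adj using that C by (simp del: power.simps)
 have "(- ?s) ^ e * flip (C $$ (j,i)) = [:\<epsilon> * (-1) ^ ?a:] * (?s ^ e * C $$ (i,j))"
  using adj_flip[OF L reg e1 ij] unfolding J[OF ij] J[OF ij(2,1)] by simp
 hence "?s ^ e * ((- 1) ^ e * flip (C $$ (j,i))) = ?s ^ e * ([:\<epsilon> * (-1) ^ ?a:] * C $$ (i,j))"
  by (simp only: power_minus[of ?s] mult_ac)
 hence "(- 1) ^ e * flip (C $$ (j,i)) = [:\<epsilon> * (-1) ^ ?a:] * C $$ (i,j)"
  by (simp only: mult_cancel_left power_eq_0_iff) auto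
 hence "(- 1) ^ e * ((- 1) ^ e * flip (C $$ (j,i))) = (- 1) ^ e * ([:\<epsilon> * (-1) ^ ?a:] * C $$ (i,j))" by simp
 moreover have "(- 1) ^ e * ((- 1) ^ e * p) = p" for p :: "complex poly"
  by (metis left_minus_one_mult_self)
 moreover have "(- 1) ^ e * ([:\<epsilon> * (-1) ^ ?a:] * p) = [:\<epsilon> * (-1) ^ (?a - e):] * p" for p :: "complex poly"
 proof -
  have "(- 1 :: complex) ^ e * (-1) ^ ?a = (-1) ^ (?a - e)"
   using e by (metis le_add_diff_inverse left_minus_one_mult_self power_add)
  moreover have "(- 1 :: complex poly) ^ e = [:(- 1) ^ e:]"
  proof -
   have "(- 1 :: complex poly) = [:- 1:]" by (simp add: one_pCons)
   thus ?thesis by (simp only: poly_const_pow)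
  qed
  ultimately show ?thesis by (simp add: mult_ac)
 qed
 ultimately show ?thesis by simp
qed

text \<open>At \<open>\<mu> \<noteq> 0\<close> the leading coefficient \<open>X\<close> of the adjugate is not skew-symmetric. Otherwise its columns
 would be annihilated by the pencil both at \<open>\<mu>\<close> and at \<open>-\<mu>\<close>, hence everywhere.\<close>

lemma leading_coeff_not_skew:
 assumes L: "alt_pencil \<sigma> n L" "det L ~= 0" and mu: "\<mu> ~= 0" and X: "X \<in> Mat n"
  and LX: "ev_mat \<mu> L * X = 0\<^sub>m n n" and XL: "X * ev_mat \<mu> L = 0\<^sub>m n n"
  and skew: "!!i j. i < n ==> j < n ==> X $$ (j,i) = - X $$ (i,j)"
 shows "X = 0\<^sub>m n n"
proof (rule pencil_kills_only_zero[OF alt_pencilD(2)[OF L(1)] L(2) X])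
 note Lc = alt_pencilD(2)[OF L(1)]
 have em: "ev_mat \<mu> L \<in> Mat n" using Lc by auto
 have cX: "const_mat X \<in> Mat n" using X by auto
 show "L * const_mat X = 0\<^sub>m n n"
 proof (rule eq_matI)
  fix i j assume "i < dim_row (0\<^sub>m n n :: complex poly mat)" "j < dim_col (0\<^sub>m n n :: complex poly mat)"
  hence ij: "i < n" "j < n" by auto
  define p where "p = (\<Sum>l<n. L $$ (i,l) * [:X $$ (l,j):])"
  have p: "(L * const_mat X) $$ (i,j) = p"
   unfolding p_def mult_mat_sum[OF Lc cX ij] using X ij by (intro sum.cong) auto
  have "poly p \<mu> = (ev_mat \<mu> L * X) $$ (i,j)"
   unfolding mult_mat_sum[OF em X ij] p_def poly_sum using Lc ij by (intro sum.cong) auto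
  hence 1: "poly p \<mu> = 0" unfolding LX using ij by simp
  have fl: "poly (L $$ (i,l)) (-\<mu>) = eps \<sigma> * poly (L $$ (l,i)) \<mu>" if "l < n" for l
   using arg_cong[OF alt_pencilD(4)[OF L(1) that ij(1)], of "\<lambda>p. poly p \<mu>"] by (simp add: poly_flip)
  have "poly p (-\<mu>) = (\<Sum>l<n. eps \<sigma> * poly (L $$ (l,i)) \<mu> * X $$ (l,j))"
   unfolding p_def poly_sum using fl by (intro sum.cong) auto
  also have "\<dots> = - eps \<sigma> * (\<Sum>l<n. X $$ (j,l) * poly (L $$ (l,i)) \<mu>)"
   unfolding sum_distrib_left
  proof (intro sum.cong refl)
   fix l assume "l \<in> {..<n}"
   hence "X $$ (l,j) = - X $$ (j,l)" using skew[of j l] ij by simp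
   thus "eps \<sigma> * poly (L $$ (l,i)) \<mu> * X $$ (l,j) = - eps \<sigma> * (X $$ (j,l) * poly (L $$ (l,i)) \<mu>)"
    by simp
  qed
  also have "(\<Sum>l<n. X $$ (j,l) * poly (L $$ (l,i)) \<mu>) = (X * ev_mat \<mu> L) $$ (j,i)"
   unfolding mult_mat_sum[OF X em ij(2,1)] using Lc ij by (intro sum.cong) auto
  finally have 2: "poly p (-\<mu>) = 0" unfolding XL using ij by simp
  have "degree p <= 1" unfolding p_def
  proof (rule degree_sum_le)
   fix l assume "l \<in> {..<n}"
   hence "degree (L $$ (i,l)) <= 1" using alt_pencilD(5)[OF L(1) ij(1)] by simp
   thus "degree (L $$ (i,l) * [:X $$ (l,j):]) <= 1" by (simp add: degree_smult_le order_trans)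
  qed simp
  from poly_deg1[OF this] obtain a b where pab: "p = [:a, b:]" by metis
  have "a + \<mu> * b = 0" "a - \<mu> * b = 0" using 1 2 unfolding pab by auto
  hence "a = 0" "\<mu> * b = 0" by (auto simp: add_eq_0_iff2)
  hence "p = 0" unfolding pab using mu by simp
  thus "(L * const_mat X) $$ (i,j) = 0\<^sub>m n n $$ (i,j)" using p ij by simp
 qed (use Lc X in auto)
qed

text \<open>If \<open>L C\<close> vanishes to order two at zero, then \<open>L\<close> annihilates the constant coefficient of \<open>C\<close> as soon as
 the linear coefficient vanishes.\<close>

lemma second_coeff_nonzero:
 assumes L: "is_pencil n L" "det L ~= 0" and C: "C \<in> Mat n"
  and LC: "!!i j. i < n ==> j < n ==> [:0,1:] ^ 2 dvd (L * C) $$ (i,j)"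
  and C1: "!!i j. i < n ==> j < n ==> coeff (C $$ (i,j)) 1 = 0"
 shows "coeff_mat 0 C = 0\<^sub>m n n"
proof (rule pencil_kills_only_zero[OF is_pencil_carrier[OF L(1)] L(2)])
 note Lc = is_pencil_carrier[OF L(1)]
 show X: "coeff_mat 0 C \<in> Mat n" using C by auto
 show "L * const_mat (coeff_mat 0 C) = 0\<^sub>m n n"
 proof (rule eq_matI)
  fix i j assume "i < dim_row (0\<^sub>m n n :: complex poly mat)" "j < dim_col (0\<^sub>m n n :: complex poly mat)"
  hence ij: "i < n" "j < n" by auto
  define p where "p = (\<Sum>l<n. L $$ (i,l) * [:coeff (C $$ (l,j)) 0:])"
  have p: "(L * const_mat (coeff_mat 0 C)) $$ (i,j) = p"
   unfolding p_def using C ij mult_mat_sum[OF Lc, of "const_mat (coeff_mat 0 C)" n i j]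
   by (auto intro!: sum.cong)
  obtain q where q: "(L * C) $$ (i,j) = [:0,1:] ^ 2 * q" using LC[OF ij] by (auto elim: dvdE)
  have q01: "coeff ([:0,1:] ^ 2 * q) 0 = 0" "coeff ([:0,1:] ^ 2 * q) (Suc 0) = 0"
   by (simp_all add: power2_eq_square)
  have c0: "coeff (a * b) 0 = coeff a 0 * coeff b 0" for a b :: "complex poly" by (simp add: coeff_mult)
  have c1: "coeff (a * b) (Suc 0) = coeff a 0 * coeff b 1 + coeff a 1 * coeff b 0" for a b :: "complex poly"
   by (simp add: coeff_mult)
  have "coeff p 0 = coeff ((L * C) $$ (i,j)) 0"
   unfolding p_def mult_mat_sum[OF Lc C ij] coeff_sum c0 by (intro sum.cong) auto
  moreover have "coeff p 1 = coeff ((L * C) $$ (i,j)) 1"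
   unfolding p_def mult_mat_sum[OF Lc C ij] coeff_sum One_nat_def c1
   using C1[unfolded One_nat_def] ij by (intro sum.cong) auto
  moreover have "degree p <= 1" unfolding p_def
  proof (rule degree_sum_le)
   fix l assume "l \<in> {..<n}"
   hence "degree (L $$ (i,l)) <= 1" using L(1) ij unfolding is_pencil_def by simp
   thus "degree (L $$ (i,l) * [:coeff (C $$ (l,j)) 0:]) <= 1" by (simp add: degree_smult_le order_trans)
  qed simp
  ultimately have "p = 0" using poly_deg1[of p] q q01 by simp
  thus "(L * const_mat (coeff_mat 0 C)) $$ (i,j) = 0\<^sub>m n n $$ (i,j)" using p ij by simp
 qed (use Lc C in auto)
qed

lemma order_lin_power_mult:
 assumes "p = [:-\<mu>,1:] ^ k * q" "poly q \<mu> ~= 0"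
 shows "p ~= 0" "order \<mu> p = k"
proof -
 have q: "q ~= 0" using assms(2) by auto
 thus p: "p ~= 0" unfolding assms(1) by simp
 show "order \<mu> p = k"
  using p unfolding assms(1) by (simp add: order_mult order_lin_power order_0I[OF assms(2)] del: power.simps)
qed

lemma truncated_sum:
 fixes \<nu> :: "nat => nat"
 assumes "!!k. 1 <= k ==> 0 < \<nu> k \<longleftrightarrow> k <= m" "m <= K"
 shows "(\<Sum>k = 1..K. \<nu> k) = (\<Sum>k = 1..K. \<nu> k - 1) + m"
proof -
 have "(\<Sum>k = 1..K. \<nu> k) = (\<Sum>k = 1..K. (\<nu> k - 1) + (if k <= m then 1 else 0))"
 proof (intro sum.cong refl)
  fix k assume "k \<in> {1..K}"
  thus "\<nu> k = (\<nu> k - 1) + (if k <= m then 1 else 0)" using assms(1)[of k] by (cases "k <= m") auto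
 qed
 also have "\<dots> = (\<Sum>k = 1..K. \<nu> k - 1) + card {k \<in> {1..K}. k <= m}"
  by (simp add: sum.distrib sum.If_cases Int_def)
 also have "{k \<in> {1..K}. k <= m} = {1..m}" using assms(2) by auto
 finally show ?thesis by simp
qed

text \<open>Everything a perturbation step uses about a point that is an eigenvalue.\<close>

lemma eigenvalue_data:
 assumes L: "is_pencil n L" "det L ~= 0" and ne: "0 < blocks_ge L \<mu> 1"
 obtains C e d where "0 < n" "C \<in> Mat n" "adj_mat L = [:-\<mu>,1:] ^ e \<cdot>\<^sub>m C"
  "ev_mat \<mu> C ~= 0\<^sub>m n n" "poly d \<mu> ~= 0" "det L = [:-\<mu>,1:] ^ order \<mu> (det L) * d"
  "e < order \<mu> (det L)" "order \<mu> (det L) - e <= n"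
  "L * C = ([:-\<mu>,1:] ^ (order \<mu> (det L) - e) * d) \<cdot>\<^sub>m 1\<^sub>m n"
  "C * L = ([:-\<mu>,1:] ^ (order \<mu> (det L) - e) * d) \<cdot>\<^sub>m 1\<^sub>m n"
  "!!k. 1 <= k ==> 0 < blocks_ge L \<mu> k \<longleftrightarrow> k <= order \<mu> (det L) - e"
proof -
 note Lc = is_pencil_carrier[OF L(1)]
 have "blocks_ge L \<mu> 1 = 0" if "n = 0" using blocks_ge_eq_0[OF L, of 1] that by simp
 hence n: "0 < n" using ne by (cases n) auto
 obtain C e where C: "C \<in> Mat n" "adj_mat L = [:-\<mu>,1:] ^ e \<cdot>\<^sub>m C"
  and nz: "\<exists>i<n. \<exists>j<n. poly (C $$ (i,j)) \<mu> ~= 0"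
  by (rule adj_factorization[OF Lc L(2) n, where \<mu> = \<mu>]) blast
 obtain d where d: "poly d \<mu> ~= 0" "det L = [:-\<mu>,1:] ^ order \<mu> (det L) * d"
  "L * C = ([:-\<mu>,1:] ^ (order \<mu> (det L) - e) * d) \<cdot>\<^sub>m 1\<^sub>m n"
  "C * L = ([:-\<mu>,1:] ^ (order \<mu> (det L) - e) * d) \<cdot>\<^sub>m 1\<^sub>m n"
  by (rule adj_mult_reduced[OF Lc L(2) C nz])
 have bg: "0 < blocks_ge L \<mu> k \<longleftrightarrow> k <= order \<mu> (det L) - e" if "1 <= k" for k
  by (rule blocks_ge_adj[OF L C nz that])
 have lt: "e < order \<mu> (det L)" using bg[of 1] ne by simp
 have "order \<mu> (det L) - e <= n"
  using bg[of "order \<mu> (det L) - e"] lt blocks_ge_eq_0[OF L, of "order \<mu> (det L) - e" \<mu>]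
  by (metis Suc_leI diff_is_0_eq less_irrefl linorder_not_less nat_le_linear not_less_eq_eq One_nat_def order.refl zero_less_diff)
 moreover have "ev_mat \<mu> C ~= 0\<^sub>m n n"
 proof
  assume a: "ev_mat \<mu> C = 0\<^sub>m n n"
  obtain i j where ij: "i < n" "j < n" "poly (C $$ (i,j)) \<mu> ~= 0" using nz by blast
  have "ev_mat \<mu> C $$ (i,j) = poly (C $$ (i,j)) \<mu>" using ij C by simp
  thus False using a ij by simp
 qed
 ultimately show ?thesis using that[OF n C _ d(1,2) lt _ d(3,4) bg] by blast
qed

text \<open>The determinant of \<open>L + f uu\<^sup>T\<close> is \<open>det L + f u\<^sup>T (adj L) u\<close>. As the leading coefficient of the
 adjugate is not skew-symmetric, some \<open>u\<close> gives the determinant the order of the adjugate, which removes the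
 largest multiplicity.\<close>

theorem plain_step:
 assumes L: "alt_pencil \<sigma> n L" "det L ~= 0" and mu: "\<mu> ~= 0"
 shows "\<exists>u \<in> Vec n. det (L + rank_one_pert \<sigma> u) ~= 0 \<and>
  (\<forall>k\<ge>1. blocks_ge (L + rank_one_pert \<sigma> u) \<mu> k = blocks_ge L \<mu> k - 1)"
proof (cases "0 < blocks_ge L \<mu> 1")
 case False
 note Lp = alt_pencilD(1)[OF L(1)] and Lc = alt_pencilD(2)[OF L(1)]
 have "rank_one_pert \<sigma> (0\<^sub>v n) = 0\<^sub>m n n" by (intro eq_matI) (auto simp: rank_one_pert_def)
 hence eq: "L + rank_one_pert \<sigma> (0\<^sub>v n) = L" using Lc by simp
 have "blocks_ge L \<mu> k = blocks_ge L \<mu> k - 1" if "1 <= k" for k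
  using exponents_ge_antimono[OF that, of "finite_partial_mults L \<mu>"] False by simp
 thus ?thesis using L(2) by (intro bexI[of _ "0\<^sub>v n"]) (auto simp: eq)
next
 case True
 note Lp = alt_pencilD(1)[OF L(1)] and Lc = alt_pencilD(2)[OF L(1)]
 let ?s = "[:-\<mu>,1:]" and ?a = "order \<mu> (det L)" and ?f = "[:0,1:] ^ weight \<sigma> :: complex poly"
 obtain C e d where C: "C \<in> Mat n" "adj_mat L = ?s ^ e \<cdot>\<^sub>m C" "ev_mat \<mu> C ~= 0\<^sub>m n n"
  and d: "poly d \<mu> ~= 0" "det L = ?s ^ ?a * d" and lt: "e < ?a" and n1: "?a - e <= n"
  and LC: "L * C = (?s ^ (?a - e) * d) \<cdot>\<^sub>m 1\<^sub>m n" and CL: "C * L = (?s ^ (?a - e) * d) \<cdot>\<^sub>m 1\<^sub>m n"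
  and bg: "!!k. 1 <= k ==> 0 < blocks_ge L \<mu> k \<longleftrightarrow> k <= ?a - e"
  by (rule eigenvalue_data[OF Lp L(2) True]) blast
 have z: "ev_mat \<mu> ((?s ^ (?a - e) * d) \<cdot>\<^sub>m 1\<^sub>m n) = 0\<^sub>m n n"
  using lt by (intro eq_matI) (auto simp: poly_power simp del: power.simps)
 have X: "ev_mat \<mu> C \<in> Mat n" using C(1) by auto
 have LX: "ev_mat \<mu> L * ev_mat \<mu> C = 0\<^sub>m n n"
  unfolding map_poly_mat_mult[OF Lc C(1), symmetric] LC z ..
 have XL: "ev_mat \<mu> C * ev_mat \<mu> L = 0\<^sub>m n n"
  unfolding map_poly_mat_mult[OF C(1) Lc, symmetric] CL z ..
 obtain i j where ij: "i < n" "j < n" "ev_mat \<mu> C $$ (j,i) ~= - ev_mat \<mu> C $$ (i,j)"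
  using leading_coeff_not_skew[OF L mu X LX XL] C(3) by blast
 obtain u where u: "u \<in> Vec n" "u \<bullet> (ev_mat \<mu> C *\<^sub>v u) ~= 0"
  by (rule quadratic_form_nonzero[OF X ij])
 define q where "q = cvec u \<bullet> (C *\<^sub>v cvec u)"
 have q: "poly q \<mu> ~= 0" unfolding q_def poly_cvec_form[OF C(1) u(1) u(1)] using u(2) .
 have cu: "cvec u \<in> Vec n" using u by auto
 let ?L' = "L + rank_one_pert \<sigma> u"
 have "det ?L' = ?s ^ ?a * d + ?f * (?s ^ e * q)"
  unfolding det_rank_one_pert[OF Lc L(2) u(1)] C(2) smult_mat_form[OF C(1) cu cu] q_def
  using d(2) by simp
 also have "\<dots> = ?s ^ e * (?s ^ (?a - e) * d + ?f * q)"
  using lt power_add[of ?s e "?a - e"] by (simp add: algebra_simps del: power.simps)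
 finally have det': "det ?L' = ?s ^ e * (?s ^ (?a - e) * d + ?f * q)" .
 have "poly (?s ^ (?a - e) * d + ?f * q) \<mu> ~= 0"
 proof -
  have "poly (?s ^ (?a - e)) \<mu> = 0" using lt by (simp add: poly_power power_0_left)
  hence "poly (?s ^ (?a - e) * d + ?f * q) \<mu> = poly ?f \<mu> * poly q \<mu>"
   by (simp only: poly_add poly_mult mult_zero_left add_0_left)
  moreover have "poly ?f \<mu> ~= 0" using mu by (cases \<sigma>) auto
  ultimately show ?thesis using q by (metis mult_eq_0_iff)
 qed
 note ord = order_lin_power_mult[OF det' this]
 have L': "alt_pencil \<sigma> n ?L'" by (rule alt_pencil_add[OF L(1) alt_rank_one_pert[OF u(1)]])
 have "?a = (\<Sum>k = 1..n. blocks_ge L \<mu> k - 1) + (?a - e)"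
  using truncated_sum[of "blocks_ge L \<mu>" "?a - e" n] bg n1 blocks_ge_sum[OF Lp L(2) order.refl, of \<mu>] by simp
 hence "order \<mu> (det ?L') <= (\<Sum>k = 1..n. blocks_ge L \<mu> k - 1)" unfolding ord(2) using lt by simp
 from plain_blocks_eq[OF Lp L(2) alt_pencilD(1)[OF L'] ord(1) rank_perturbed_rank_one_pert[OF Lc u(1)] this]
 show ?thesis using u(1) ord(1) by blast
qed

lemma polyfun_form:
 assumes "X \<in> Mat n"
 shows "polyfun n (\<lambda>u. u \<bullet> (X *\<^sub>v u))"
proof -
 have "polyfun n (\<lambda>u. \<Sum>i<n. \<Sum>j<n. u $ i * u $ j * X $$ (i,j))"
  by (intro polyfun_sum polyfun_mult polyfun_coord polyfun_const) auto
 thus ?thesis by (rule polyfun_cong) (rule form_sum[OF assms])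
qed

lemma polyfun_mult_vec:
 assumes "X \<in> Mat n" "i < n"
 shows "polyfun n (\<lambda>u. (X *\<^sub>v u) $ i)"
proof -
 have "polyfun n (\<lambda>u. \<Sum>j<n. X $$ (i,j) * u $ j)"
  by (intro polyfun_sum polyfun_mult polyfun_coord polyfun_const) auto
 thus ?thesis by (rule polyfun_cong) (rule mult_mat_vec_sum[OF assms(1) _ assms(2)])
qed

text \<open>The sum of the target multiplicities after a step of rank one: the largest multiplicity is lost,
 up to a simple one in the \<open>\<top>\<close>-odd case and up to the repair of the parity.\<close>

lemma target_order_one:
 assumes adm: "admissible \<sigma> n \<nu>" and m: "1 <= m" "m <= n"
  and bg: "!!k. 1 <= k ==> 0 < \<nu> k \<longleftrightarrow> k <= m" and sum: "(\<Sum>k = 1..pair_bound \<sigma> n. \<nu> k) = a"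
 shows "a - m + weight \<sigma> + (if odd (m + weight \<sigma>) then 1 else 0) <= target_order \<sigma> n 1 \<nu>"
proof -
 let ?K = "pair_bound \<sigma> n"
 let ?c = "\<lambda>k. (if k = 1 then weight \<sigma> else 0) + (if k = m + 1 \<and> odd (m + weight \<sigma>) then 1 else 0)"
 have K: "m + 1 <= ?K" using m pair_bound_ge(1)[of n \<sigma>] by simp
 have a: "a = (\<Sum>k = 1..?K. \<nu> k - 1) + m"
  unfolding sum[symmetric] by (rule truncated_sum[OF bg]) (use K in auto)
 have le: "(\<nu> k - 1) + ?c k <= target \<sigma> n 1 \<nu> k" if k: "1 <= k" for k
 proof (cases "k = 1")
  case True
  have "0 < \<nu> 1" using bg[of 1] m by simp
  show ?thesis
  proof (cases \<sigma>)
   case T_even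
   thus ?thesis using True m by simp
  next
   case T_odd
   have "even (\<nu> 1) = even n" using admissible_first adm unfolding T_odd by blast
   thus ?thesis using True m \<open>0 < \<nu> 1\<close> unfolding T_odd by (simp add: repair_def)
  qed
 next
  case False
  hence k2: "2 <= k" using k by simp
  show ?thesis
  proof (cases "k = m + 1 \<and> odd (m + weight \<sigma>)")
   case True
   have z: "\<nu> (Suc m) = 0" using bg[of "Suc m"] by simp
   have cls: "(\<sigma> = T_even) = odd m" using True by (cases \<sigma>) auto
   have "even (\<nu> m)" using admissible_pair[OF adm m(1) cls] z by simp
   moreover have "0 < \<nu> m" using bg[of m] m by simp
   ultimately have "1 < \<nu> m" "odd (\<nu> m - 1)" by (auto simp: even_diff_nat)
   hence "repaired \<sigma> 1 \<nu> k" using True z cls m by simp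
   thus ?thesis using target_eq_repaired[OF adm k2, of 1] False True z by (simp del: repaired.simps)
  next
   case nr: False
   thus ?thesis using target_eq_repaired[OF adm k2, of 1] False by (auto simp: )
  qed
 qed
 have "(\<Sum>k = 1..?K. ?c k) = weight \<sigma> + (if odd (m + weight \<sigma>) then 1 else 0)"
  using K by (simp add: sum.distrib)
 hence "a - m + weight \<sigma> + (if odd (m + weight \<sigma>) then 1 else 0) = (\<Sum>k = 1..?K. (\<nu> k - 1) + ?c k)"
  unfolding sum.distrib[of "\<lambda>k. \<nu> k - 1"] a by simp
 also have "\<dots> <= target_order \<sigma> n 1 \<nu>" unfolding target_order_def using le by (intro sum_mono) auto
 finally show ?thesis .
qed

lemma rank_perturbed_refl: "rank_perturbed n r L L"
 unfolding rank_perturbed_def by (intro exI[of _ "\<lambda>_. 0\<^sub>v n"]) auto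

text \<open>If zero is not an eigenvalue, nothing has to be done: the target is zero, also in its first entry,
 since \<open>n\<close> is then even in the \<open>\<top>\<close>-odd case.\<close>

lemma non_eigenvalue_target:
 assumes L: "alt_pencil \<sigma> n L" "det L ~= 0" and z: "blocks_ge L 0 1 = 0" and k: "1 <= k"
 shows "blocks_ge L 0 k = target \<sigma> n r (blocks_ge L 0) k"
proof (rule blocks_eq_target[OF L L rank_perturbed_refl _ _ k])
 have zk: "blocks_ge L 0 k = 0" if "1 <= k" for k
  using exponents_ge_antimono[OF that, of "finite_partial_mults L 0"] z by simp
 have "order 0 (det L) = 0"
  using blocks_ge_sum[OF alt_pencilD(1)[OF L(1)] L(2) order.refl, of 0] zk by simp
 thus "order 0 (det L) <= target_order \<sigma> n r (blocks_ge L 0)" by simp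
 fix k assume "repaired \<sigma> r (blocks_ge L 0) k"
 hence "1 <= k - 1" "r < blocks_ge L 0 (k - 1)" by auto
 thus "0 < blocks_ge L 0 k" using zk[of "k - 1"] by linarith
qed

text \<open>Let \<open>m\<close> be the largest multiplicity and \<open>C\<close> the reduced adjugate, with \<open>C(-\<lambda>)\<^sup>T = \<plusminus> C(\<lambda>)\<close>. If the sign
 is \<open>+\<close>, then \<open>C(0)\<close> is symmetric and \<open>u\<^sup>T C u\<close> can be made nonzero at 0. If it is \<open>-\<close>, then \<open>C(0)\<close> is
 skew-symmetric and \<open>u\<^sup>T C u\<close> vanishes at 0, but the next coefficient of \<open>C\<close> is symmetric. The determinant then has
 one order more, and the repaired entry \<open>m + 1\<close> is found in the adjugate, where \<open>C(0) u \<noteq> 0\<close> survives.\<close>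

theorem zero_step:
 assumes L: "alt_pencil \<sigma> n L" "det L ~= 0"
 shows "\<exists>u \<in> Vec n. det (L + rank_one_pert \<sigma> u) ~= 0 \<and>
  (\<forall>k\<ge>1. blocks_ge (L + rank_one_pert \<sigma> u) 0 k = target \<sigma> n 1 (blocks_ge L 0) k)"
proof (cases "0 < blocks_ge L 0 1")
 case False
 have "rank_one_pert \<sigma> (0\<^sub>v n) = 0\<^sub>m n n" by (intro eq_matI) (auto simp: rank_one_pert_def)
 hence eq: "L + rank_one_pert \<sigma> (0\<^sub>v n) = L" using alt_pencilD(2)[OF L(1)] by simp
 have "\<forall>k\<ge>1. blocks_ge L 0 k = target \<sigma> n 1 (blocks_ge L 0) k"
  using non_eigenvalue_target[OF L, of _ 1] False by blast
 hence "det (L + rank_one_pert \<sigma> (0\<^sub>v n)) ~= 0 \<and>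
  (\<forall>k\<ge>1. blocks_ge (L + rank_one_pert \<sigma> (0\<^sub>v n)) 0 k = target \<sigma> n 1 (blocks_ge L 0) k)"
  unfolding eq using L(2) by blast
 thus ?thesis using zero_carrier_vec by blast
next
 case True
 note Lp = alt_pencilD(1)[OF L(1)] and Lc = alt_pencilD(2)[OF L(1)]
 let ?s = "[:0,1:] :: complex poly" and ?a = "order 0 (det L)" and ?w = "weight \<sigma>" and ?\<nu> = "blocks_ge L 0"
 obtain C e d where n: "0 < n" and C: "C \<in> Mat n" "adj_mat L = ?s ^ e \<cdot>\<^sub>m C" "ev_mat 0 C ~= 0\<^sub>m n n"
  and d: "poly d 0 ~= 0" "det L = ?s ^ ?a * d" and lt: "e < ?a" and m: "?a - e <= n"
  and LC: "L * C = (?s ^ (?a - e) * d) \<cdot>\<^sub>m 1\<^sub>m n"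
  and bg: "!!k. 1 <= k ==> 0 < ?\<nu> k \<longleftrightarrow> k <= ?a - e"
  by (rule eigenvalue_data[OF Lp L(2) True, unfolded minus_zero]) blast
 define m where "m = ?a - e"
 have m1: "1 <= m" "m <= n" "e = ?a - m" "m <= ?a" using lt m unfolding m_def by auto
 note adm = admissible_blocks[OF L]
 have tord: "?a - m + ?w + (if odd (m + ?w) then 1 else 0) <= target_order \<sigma> n 1 ?\<nu>"
  by (rule target_order_one[OF adm m1(1,2) bg[folded m_def]])
   (use blocks_ge_sum[OF Lp L(2) pair_bound_ge(2)] in auto)
 have flC: "flip (C $$ (j,i)) = [:(-1) ^ (m + ?w):] * C $$ (i,j)" if "i < n" "j < n" for i j
 proof -
  have "eps \<sigma> * (-1) ^ m = (-1) ^ (m + ?w)" by (cases \<sigma>) auto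
  thus ?thesis using reduced_adj_flip[OF alt_pencilD(3)[OF L(1)] L(2) eps_square C(1,2) _ that] lt
   unfolding m_def[symmetric] by simp
 qed
 define C0 where "C0 = coeff_mat 0 C"
 define C1 where "C1 = coeff_mat 1 C"
 have Cc: "C0 \<in> Mat n" "C1 \<in> Mat n" unfolding C0_def C1_def using C(1) by auto
 have C0e: "C0 = ev_mat 0 C" unfolding C0_def by (simp add: poly_0_coeff_0)
 have C0s: "C0 $$ (j,i) = (-1) ^ (m + ?w) * C0 $$ (i,j)"
  and C1s: "- C1 $$ (j,i) = (-1) ^ (m + ?w) * C1 $$ (i,j)" if "i < n" "j < n" for i j
  using arg_cong[OF flC[OF that], of "\<lambda>p. coeff p 0"] arg_cong[OF flC[OF that], of "\<lambda>p. coeff p 1"] that C(1)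
  unfolding C0_def C1_def by (auto simp: coeff_flip)
 have "C0 ~= 0\<^sub>m n n" using C(3) C0e by simp
 then obtain i0 j0 where ij0: "i0 < n" "j0 < n" "C0 $$ (i0,j0) ~= 0"
  using nonzero_entry[OF Cc(1)] by blast
 define q where "q = (\<lambda>u. cvec u \<bullet> (C *\<^sub>v cvec u))"
 have det': "det (L + rank_one_pert \<sigma> u) = ?s ^ ?a * d + ?s ^ ?w * (?s ^ e * q u)" if u: "u \<in> Vec n" for u
 proof -
  have cu: "cvec u \<in> Vec n" using u by auto
  show ?thesis
   unfolding det_rank_one_pert[OF Lc L(2) u] C(2) smult_mat_form[OF C(1) cu cu] q_def
   using d(2) by simp
 qed
 have L': "alt_pencil \<sigma> n (L + rank_one_pert \<sigma> u)" if u: "u \<in> Vec n" for u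
  by (rule alt_pencil_add[OF L(1) alt_rank_one_pert[OF u]])
 have rep: "k = m + 1" if "repaired \<sigma> 1 ?\<nu> k" for k
 proof -
  have "2 <= k" "\<not> 0 < ?\<nu> k" "0 < ?\<nu> (k - 1)" using that by auto
  moreover have "1 <= k" "1 <= k - 1" using \<open>2 <= k\<close> by auto
  ultimately have "\<not> k <= m" "k - 1 <= m" using bg[of k] bg[of "k - 1"] unfolding m_def by auto
  thus ?thesis by simp
 qed
 show ?thesis
 proof (cases "even (m + ?w)")
  case True
  have "\<exists>u \<in> Vec n. poly (?s ^ (m - ?w) * d + q u) 0 ~= 0"
  proof (cases "m = ?w")
   case True
   have "q (0\<^sub>v n) = 0" unfolding q_def using cvec_form[OF C(1), of "0\<^sub>v n" "0\<^sub>v n"] by simp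
   thus ?thesis using d(1) True by (intro bexI[of _ "0\<^sub>v n"]) auto
  next
   case False
   hence lw: "?w < m" using m1 by (cases \<sigma>) auto
   have "C0 $$ (j0,i0) = C0 $$ (i0,j0)" using C0s[OF ij0(1,2)] True by simp
   hence "C0 $$ (j0,i0) ~= - C0 $$ (i0,j0)" using ij0(3) by simp
   then obtain u where u: "u \<in> Vec n" "u \<bullet> (C0 *\<^sub>v u) ~= 0"
    using quadratic_form_nonzero[OF Cc(1) ij0(1,2)] by metis
   have "poly (q u) 0 ~= 0" unfolding q_def poly_cvec_form[OF C(1) u(1) u(1)] using u(2) C0e by simp
   moreover have "poly (?s ^ (m - ?w)) 0 = 0" using lw by (simp add: poly_power power_0_left)
   ultimately show ?thesis using u(1) by (intro bexI[of _ u]) (simp_all only: poly_add poly_mult mult_zero_left add_0_left not_False_eq_True)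
  qed
  then obtain u where u: "u \<in> Vec n" and g: "poly (?s ^ (m - ?w) * d + q u) 0 ~= 0" by blast
  let ?L' = "L + rank_one_pert \<sigma> u"
  have "?w <= m" using m1 by (cases \<sigma>) auto
  hence "?a = (e + ?w) + (m - ?w)" using m1 by simp
  hence "?s ^ ?a = ?s ^ (e + ?w) * ?s ^ (m - ?w)" by (metis power_add)
  hence "det ?L' = [:-0,1:] ^ (e + ?w) * (?s ^ (m - ?w) * d + q u)"
   unfolding det'[OF u] by (simp add: algebra_simps power_add del: power.simps)
  note ord = order_lin_power_mult[OF this g]
  have "blocks_ge ?L' 0 k = target \<sigma> n 1 ?\<nu> k" if "1 <= k" for k
  proof (rule blocks_eq_target[OF L L'[OF u] ord(1) rank_perturbed_rank_one_pert[OF Lc u] _ _ that])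
   show "order 0 (det ?L') <= target_order \<sigma> n 1 ?\<nu>" unfolding ord(2) using tord m1 True by simp
   fix k assume r: "repaired \<sigma> 1 ?\<nu> k"
   have "odd (m + ?w)" using r rep[OF r] by (cases \<sigma>) auto
   thus "0 < blocks_ge ?L' 0 k" using True by simp
  qed
  thus ?thesis using u ord(1) by blast
 next
  case False
  hence odd: "odd (m + ?w)" .
  have wm: "Suc ?w <= m" using odd m1 by (cases \<sigma>) (auto elim: evenE intro: Suc_leI)
  define q1 where "q1 = (\<lambda>u. q u div ?s)"
  have q1: "q u = ?s * q1 u" "poly (q1 u) 0 = u \<bullet> (C1 *\<^sub>v u)" if u: "u \<in> Vec n" for u
  proof -
   have "flip (q u) = - q u"
   proof -
    have fs: "flip (Polynomial.smult c p) = Polynomial.smult c (flip p)" for c p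
     unfolding flip_def by (rule pcompose_smult)
    have "flip (q u) = (\<Sum>i<n. \<Sum>j<n. [:u $ i * u $ j:] * flip (C $$ (i,j)))"
     unfolding q_def cvec_form[OF C(1) u u] by (simp add: fs)
    also have "\<dots> = (\<Sum>i<n. \<Sum>j<n. - ([:u $ j * u $ i:] * C $$ (j,i)))"
     using flC odd by (intro sum.cong) (auto simp: mult.commute)
    also have "\<dots> = - q u" unfolding q_def cvec_form[OF C(1) u u] sum_negf
     by (subst sum.swap) simp
    finally show ?thesis .
   qed
   hence "coeff (flip (q u)) 0 = coeff (- q u) 0" by simp
   hence c0: "coeff (q u) 0 = 0" by (simp add: coeff_flip)
   hence "[:-0,1:] dvd q u" unfolding lin_dvd_iff by (simp add: poly_0_coeff_0)
   hence "?s dvd q u" by simp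
   thus e1: "q u = ?s * q1 u" unfolding q1_def by (metis dvd_mult_div_cancel)
   have "coeff (q u) 1 = coeff (q1 u) 0" by (subst e1) simp
   thus "poly (q1 u) 0 = u \<bullet> (C1 *\<^sub>v u)"
    unfolding q_def coeff_cvec_form[OF C(1) u u] C1_def[symmetric] by (simp add: poly_0_coeff_0)
  qed
  define h where "h = (\<lambda>u. (if m = Suc ?w then poly d 0 else 0) + u \<bullet> (C1 *\<^sub>v u))"
  have ph: "polyfun n h" unfolding h_def by (intro polyfun_add polyfun_const polyfun_form Cc)
  have "\<exists>u \<in> Vec n. h u ~= 0"
  proof (cases "m = Suc ?w")
   case True
   have "h (0\<^sub>v n) = poly d 0" unfolding h_def using True Cc by simp
   thus ?thesis using d(1) by (intro bexI[of _ "0\<^sub>v n"]) auto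
  next
   case False
   hence m2: "2 <= m" using wm by simp
   have "\<exists>i<n. \<exists>j<n. C1 $$ (i,j) ~= 0"
   proof (rule ccontr)
    assume a: "\<not> ?thesis"
    have "coeff_mat 0 C = 0\<^sub>m n n"
    proof (rule second_coeff_nonzero[OF Lp L(2) C(1)])
     fix i j assume ij: "i < n" "j < n"
     show "coeff (C $$ (i,j)) 1 = 0" using a ij C(1) unfolding C1_def by auto
     have "(L * C) $$ (i,j) = ?s ^ m * (d * (if i = j then 1 else 0))"
      unfolding LC m_def[symmetric] using ij by (simp del: power.simps)
     thus "?s ^ 2 dvd (L * C) $$ (i,j)" using le_imp_power_dvd[OF m2, of ?s] by (metis dvd_mult2)
    qed
    thus False using C(3) C0e C0_def by simp
   qed
   then obtain i j where ij: "i < n" "j < n" "C1 $$ (i,j) ~= 0" by blast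
   have "- C1 $$ (j,i) = - C1 $$ (i,j)" using C1s[OF ij(1,2)] odd by simp
   hence "C1 $$ (j,i) ~= - C1 $$ (i,j)" using ij(3) by simp
   then obtain u where u: "u \<in> Vec n" "u \<bullet> (C1 *\<^sub>v u) ~= 0"
    using quadratic_form_nonzero[OF Cc(2) ij(1,2)] by metis
   thus ?thesis unfolding h_def using False by auto
  qed
  then obtain y where y: "y \<in> Vec n" "h y ~= 0" by blast
  have "(C0 *\<^sub>v unit_vec n j0) $ i0 ~= 0" using ij0 Cc by simp
  from polyfun_common_nonzero[OF polyfun_mult_vec[OF Cc(1) ij0(1)] unit_vec_carrier this ph y]
  obtain u where u: "u \<in> Vec n" "(C0 *\<^sub>v u) $ i0 ~= 0" "h u ~= 0" by blast
  let ?L' = "L + rank_one_pert \<sigma> u"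
  define g where "g = ?s ^ (m - Suc ?w) * d + q1 u"
  have "?a = (e + Suc ?w) + (m - Suc ?w)" using m1 wm by simp
  hence "?s ^ ?a = ?s ^ (e + Suc ?w) * ?s ^ (m - Suc ?w)" by (metis power_add)
  hence "?s ^ ?a * d + ?s ^ ?w * (?s ^ e * (?s * q1 u)) = ?s ^ (e + Suc ?w) * g"
   unfolding g_def by (simp only: power_add power_Suc algebra_simps)
  hence d'g: "det ?L' = [:-0,1:] ^ (e + Suc ?w) * g"
   unfolding det'[OF u(1)] q1(1)[OF u(1)] by (simp only: minus_zero)
  have "poly (?s ^ (m - Suc ?w)) 0 = (if m = Suc ?w then 1 else 0)"
   using wm by (simp add: poly_power power_0_left)
  hence "poly g 0 = h u" unfolding g_def h_def q1(2)[OF u(1), symmetric] by (simp only: poly_add poly_mult) simp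
  hence g0: "poly g 0 ~= 0" using u(3) by simp
  note ord = order_lin_power_mult[OF d'g g0]
  \<comment> \<open>The diagonal entry \<open>i0\<close> of the adjugate has order \<open>2 e + w - a\<close>, where \<open>a\<close> is the order of \<open>det L\<close>.\<close>
  have "0 < blocks_ge ?L' 0 (m + 1)"
  proof -
   define x where "x = (C *\<^sub>v cvec u) $ i0"
   define z where "z = (C\<^sup>T *\<^sub>v cvec u) $ i0"
   have Ct: "C\<^sup>T \<in> Mat n" using C(1) by simp
   have cu: "cvec u \<in> Vec n" using u by auto
   have x0: "poly x 0 ~= 0" unfolding x_def poly_cvec_mult[OF C(1) u(1) ij0(1)] using u(2) C0e by simp
   have "poly z 0 = (\<Sum>l<n. C0 $$ (l,i0) * u $ l)"
    unfolding z_def poly_cvec_mult[OF Ct u(1) ij0(1)]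
    using mult_mat_vec_sum[of "ev_mat 0 (C\<^sup>T)" n n u i0] C(1) u(1) ij0(1) unfolding C0e by simp
   also have "\<dots> = (\<Sum>l<n. - (C0 $$ (i0,l) * u $ l))"
   proof (intro sum.cong refl)
    fix l assume "l \<in> {..<n}"
    hence "C0 $$ (l,i0) = - C0 $$ (i0,l)" using C0s[of i0 l] ij0 odd by simp
    thus "C0 $$ (l,i0) * u $ l = - (C0 $$ (i0,l) * u $ l)" by simp
   qed
   also have "\<dots> = - (C0 *\<^sub>v u) $ i0" unfolding mult_mat_vec_sum[OF Cc(1) u(1) ij0(1)] sum_negf ..
   finally have z0: "poly z 0 ~= 0" using u(2) by simp
   let ?J = "adj_mat L" and ?J' = "adj_mat ?L'"
   have Jx: "(?J *\<^sub>v (?s ^ ?w \<cdot>\<^sub>v cvec u)) $ i0 = ?s ^ ?w * (?s ^ e * x)"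
   proof -
    have "?J *\<^sub>v (?s ^ ?w \<cdot>\<^sub>v cvec u) = ?s ^ ?w \<cdot>\<^sub>v (?J *\<^sub>v cvec u)"
     by (rule mult_mat_smult_vec[OF adj_carrier[OF Lc] cu])
    moreover have "(?J *\<^sub>v cvec u) $ i0 = ?s ^ e * x"
     unfolding mult_mat_vec_sum[OF adj_carrier[OF Lc] cu ij0(1)] x_def mult_mat_vec_sum[OF C(1) cu ij0(1)] sum_distrib_left
     unfolding C(2) using C(1) ij0 by (intro sum.cong) (auto simp: mult.assoc simp del: power.simps)
    ultimately show ?thesis using Lc cu ij0 by (simp del: power.simps index_mult_mat_vec)
   qed
   have Jz: "(?J\<^sup>T *\<^sub>v cvec u) $ i0 = ?s ^ e * z"
    unfolding mult_mat_vec_sum[OF transpose_carrier_mat[THEN iffD2, OF adj_carrier[OF Lc]] cu ij0(1)] z_def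
     mult_mat_vec_sum[OF Ct cu ij0(1)] sum_distrib_left
    unfolding C(2) using C(1) ij0 by (intro sum.cong) (auto simp: mult.assoc simp del: power.simps)
   have wc: "?s ^ ?w \<cdot>\<^sub>v cvec u \<in> Vec n" using cu by simp
   have "det L \<cdot>\<^sub>m ?J' = det ?L' \<cdot>\<^sub>m ?J - outer (?J *\<^sub>v (?s ^ ?w \<cdot>\<^sub>v cvec u)) (?J\<^sup>T *\<^sub>v cvec u)"
    using adj_rank_one_update[OF Lc L(2) wc cu] ord(1) unfolding rank_one_pert_def by simp
   from arg_cong[OF this, of "\<lambda>M. M $$ (i0,i0)"]
   have "det L * ?J' $$ (i0,i0) = det ?L' * ?J $$ (i0,i0) - (?J *\<^sub>v (?s ^ ?w \<cdot>\<^sub>v cvec u)) $ i0 * (?J\<^sup>T *\<^sub>v cvec u) $ i0"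
    using Lc u(1) ij0(1) carrier_matD[OF adj_carrier[OF alt_pencilD(2)[OF L'[OF u(1)]]]]
    by (simp del: index_mult_mat_vec)
   also have "\<dots> = ?s ^ (e + Suc ?w) * g * (?s ^ e * C $$ (i0,i0)) - ?s ^ ?w * (?s ^ e * x) * (?s ^ e * z)"
    unfolding Jx Jz unfolding d'g C(2) using C(1) ij0 by (simp del: power.simps)
   also have "\<dots> = ?s ^ (e + e + ?w) * (?s * g * C $$ (i0,i0) - x * z)"
    by (simp only: power_add power_Suc algebra_simps)
   finally have key: "?s ^ ?a * (d * ?J' $$ (i0,i0)) = ?s ^ (e + e + ?w) * (?s * g * C $$ (i0,i0) - x * z)"
    using d(2) by (metis mult.assoc)
   have nz: "poly (?s * g * C $$ (i0,i0) - x * z) 0 ~= 0" using x0 z0 by simp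
   have o1: "order 0 (?s ^ (e + e + ?w) * (?s * g * C $$ (i0,i0) - x * z)) = e + e + ?w"
    "?s ^ (e + e + ?w) * (?s * g * C $$ (i0,i0) - x * z) ~= 0"
    using order_lin_power_mult[of _ 0, OF refl nz, of "e + e + ?w", unfolded minus_zero] by blast+
   have J'0: "?J' $$ (i0,i0) ~= 0" using o1(2) unfolding key[symmetric] by auto
   have "order 0 (?s ^ ?a * (d * ?J' $$ (i0,i0))) = ?a + order 0 (?J' $$ (i0,i0))"
   proof -
    have "d ~= 0" using d(1) by auto
    hence "d * ?J' $$ (i0,i0) ~= 0" "?s ^ ?a * (d * ?J' $$ (i0,i0)) ~= 0" using J'0 by auto
    thus ?thesis using order_lin_power[of 0 ?a] order_0I[OF d(1)]
     by (simp add: order_mult del: power.simps)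
   qed
   hence "?a + order 0 (?J' $$ (i0,i0)) = e + e + ?w" using o1(1) key by simp
   hence "order 0 (?J' $$ (i0,i0)) + (m + 1) <= order 0 (det ?L')" unfolding ord(2) using m1 by simp
   from blocks_ge_pos_of_adj[OF alt_pencilD(1)[OF L'[OF u(1)]] ord(1) ij0(1) ij0(1) J'0 this]
   show ?thesis by simp
  qed
  hence "blocks_ge ?L' 0 k = target \<sigma> n 1 ?\<nu> k" if "1 <= k" for k
   using tord m1 odd rep
   by (intro blocks_eq_target[OF L L'[OF u(1)] ord(1) rank_perturbed_rank_one_pert[OF Lc u(1)] _ _ that])
    (auto simp: ord(2) simp del: repaired.simps)
  thus ?thesis using u(1) ord(1) by blast
 qed
qed

section \<open>The structured perturbations\<close>

text \<open>The perturbation with the parameters \<open>v\<^sub>j\<close>, \<open>\<gamma>\<^sub>j\<close>, \<open>\<delta>\<^sub>j\<close>, \<open>u\<close> given as families. In this form the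
 reversal of the pencil just exchanges \<open>\<gamma>\<close> and \<open>\<delta>\<close>, and two more ranks are gained by one more index.\<close>

definition pert_pair :: "alternation => complex vec => complex vec => complex vec => nat => nat => complex poly" where
 "pert_pair \<sigma> v \<gamma> \<delta> a b = [:v $ a:] * [:\<gamma> $ b, \<delta> $ b:] + [:eps \<sigma>:] * ([:\<gamma> $ a, - (\<delta> $ a):] * [:v $ b:])"

text \<open>The perturbation with its parameters given as families. In this form the reversal of the pencil just
 exchanges \<open>\<gamma>\<close> and \<open>\<delta>\<close>, and two more ranks are gained by one more index.\<close>

definition struct_pert :: "alternation => nat => nat => (nat => complex vec) => (nat => complex vec) =>
  (nat => complex vec) => complex vec => complex poly mat" where
 "struct_pert \<sigma> n r v \<gamma> \<delta> u = mat n n (\<lambda>(a, b).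
   (if odd r then [:0,1:] ^ weight \<sigma> * [:u $ a * u $ b:] else 0) +
   (\<Sum>j<r div 2. pert_pair \<sigma> (v j) (\<gamma> j) (\<delta> j) a b))"

definition pair_pert :: "alternation => nat => complex vec => complex vec => complex vec => complex poly mat" where
 "pair_pert \<sigma> n v \<gamma> \<delta> = mat n n (\<lambda>(a, b). pert_pair \<sigma> v \<gamma> \<delta> a b)"

lemma struct_pert_dims [simp]:
 "struct_pert \<sigma> n r v \<gamma> \<delta> u \<in> Mat n" "pair_pert \<sigma> n x y z \<in> Mat n"
 "dim_row (struct_pert \<sigma> n r v \<gamma> \<delta> u) = n" "dim_col (struct_pert \<sigma> n r v \<gamma> \<delta> u) = n"
 unfolding struct_pert_def pair_pert_def by auto

lemma Phi_eq_struct_pert: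
 "Phi \<sigma> n r x = struct_pert \<sigma> n r (\<lambda>j. block n j x) (\<lambda>j. block n (r div 2 + j) x)
   (\<lambda>j. block n (2 * (r div 2) + j) x) (block n (3 * (r div 2)) x)"
 unfolding Phi_def struct_pert_def pert_pair_def Let_def
 by (cases \<sigma>) (auto intro!: cong_mat sum.cong)

lemma param_count: "(3 * r) div 2 = 3 * (r div 2) + (if odd r then 1 else 0)" for r :: nat
 by (cases "even r") (auto elim!: evenE oddE)

lemma Phi_surj:
 obtains x where "x \<in> carrier_vec ((3 * r div 2) * n)" "Phi \<sigma> n r x = struct_pert \<sigma> n r v \<gamma> \<delta> u"
proof -
 obtain s where s: "r div 2 = s" by blast
 have cnt: "3 * r div 2 = 3 * s + (if odd r then 1 else 0)" using param_count[of r] s by simp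
 define w where "w = (\<lambda>k. if k < s then v k else if k < 2 * s then \<gamma> (k - s)
  else if k < 3 * s then \<delta> (k - 2 * s) else u)"
 define x where "x = vec ((3 * r div 2) * n) (\<lambda>i. w (i div n) $ (i mod n))"
 have b: "block n k x $ a = w k $ a" if "k < 3 * r div 2" "a < n" for k a
 proof -
  have "k * n + a < (k + 1) * n" using that(2) by simp
  also have "\<dots> <= (3 * r div 2) * n" using that(1) by (intro mult_le_mono1) simp
  finally show ?thesis using that(2) unfolding block_def x_def by (simp add: div_mult_self3)
 qed
 have "Phi \<sigma> n r x = struct_pert \<sigma> n r v \<gamma> \<delta> u"
  unfolding Phi_eq_struct_pert struct_pert_def pert_pair_def s
 proof (intro cong_mat refl, unfold split, intro arg_cong2[of _ _ _ _ "(+)"] sum.cong refl)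
  fix i j assume ij: "i < n" "j < n"
  have "block n (3 * s) x $ a = u $ a" if "odd r" "a < n" for a
   using b[of "3 * s" a] that unfolding cnt w_def by simp
  thus "(if odd r then [:0,1:] ^ weight \<sigma> * [:block n (3 * s) x $ i * block n (3 * s) x $ j:] else 0) =
   (if odd r then [:0,1:] ^ weight \<sigma> * [:u $ i * u $ j:] else 0)" using ij by auto
  fix k assume "k \<in> {..<s}"
  hence k: "k < s" by simp
  have "block n k x $ a = v k $ a" "block n (s + k) x $ a = \<gamma> k $ a" "block n (2 * s + k) x $ a = \<delta> k $ a"
   if "a < n" for a
   using b[of k a] b[of "s + k" a] b[of "2 * s + k" a] that k unfolding cnt w_def by auto
  thus "[:block n k x $ i:] * [:block n (s + k) x $ j, block n (2 * s + k) x $ j:] =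
    [:v k $ i:] * [:\<gamma> k $ j, \<delta> k $ j:]"
   "[:eps \<sigma>:] * ([:block n (s + k) x $ i, - (block n (2 * s + k) x $ i):] * [:block n k x $ j:]) =
    [:eps \<sigma>:] * ([:\<gamma> k $ i, - (\<delta> k $ i):] * [:v k $ j:])" using ij by auto
 qed
 thus ?thesis using that[of x] unfolding x_def by simp
qed

lemma struct_pert_0: "struct_pert \<sigma> n 0 v \<gamma> \<delta> u = 0\<^sub>m n n"
 unfolding struct_pert_def by (intro eq_matI) auto

lemma struct_pert_1: "u \<in> Vec n ==> struct_pert \<sigma> n 1 v \<gamma> \<delta> u = rank_one_pert \<sigma> u"
 using carrier_matD[OF rank_one_pert_carrier[of u n \<sigma>]] unfolding struct_pert_def
 by (intro eq_matI) (simp_all add: rank_one_pert_index del: power.simps mult_pCons_right)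

lemma struct_pert_2: "struct_pert \<sigma> n 2 v \<gamma> \<delta> u = pair_pert \<sigma> n (v 0) (\<gamma> 0) (\<delta> 0)"
 unfolding struct_pert_def pair_pert_def by (intro cong_mat) (auto simp: )

lemma struct_pert_add:
 fixes r :: nat
 defines "s \<equiv> r div 2"
 shows "struct_pert \<sigma> n r v \<gamma> \<delta> u + pair_pert \<sigma> n x y z = struct_pert \<sigma> n (r + 2) (v(s := x)) (\<gamma>(s := y)) (\<delta>(s := z)) u"
proof -
 have "(\<Sum>j<s. pert_pair \<sigma> ((v(s := x)) j) ((\<gamma>(s := y)) j) ((\<delta>(s := z)) j) a b) =
   (\<Sum>j<s. pert_pair \<sigma> (v j) (\<gamma> j) (\<delta> j) a b)" for a b
  by (intro sum.cong) auto
 thus ?thesis unfolding struct_pert_def pair_pert_def s_def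
  by (intro eq_matI) (auto simp: add.assoc)
qed

lemma flip_pert_pair: "flip (pert_pair \<sigma> v \<gamma> \<delta> b a) = [:eps \<sigma>:] * pert_pair \<sigma> v \<gamma> \<delta> a b"
 unfolding pert_pair_def by (cases \<sigma>) (auto simp: flip_lin mult_ac)

lemma alt_struct_pert: "alt_pencil \<sigma> n (struct_pert \<sigma> n r v \<gamma> \<delta> u)"
proof -
 have d: "degree (pert_pair \<sigma> v \<gamma> \<delta> a b) <= 1" for v \<gamma> \<delta> a b
  unfolding pert_pair_def by (intro degree_add_le) (auto simp: degree_pCons_eq_if)
 have "degree ([:0,1:] ^ weight \<sigma> * [:c:]) <= 1" for c by (cases \<sigma>) auto
 hence "degree (struct_pert \<sigma> n r v \<gamma> \<delta> u $$ (i,j)) <= 1" if "i < n" "j < n" for i j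
  unfolding struct_pert_def using that d by (auto intro!: degree_add_le degree_sum_le simp del: power.simps)
 moreover have "flip (struct_pert \<sigma> n r v \<gamma> \<delta> u $$ (j,i)) = [:eps \<sigma>:] * struct_pert \<sigma> n r v \<gamma> \<delta> u $$ (i,j)"
  if "i < n" "j < n" for i j
 proof -
  have "flip ([:0,1:] ^ weight \<sigma> * [:u $ j * u $ i:]) = [:eps \<sigma>:] * ([:0,1:] ^ weight \<sigma> * [:u $ i * u $ j:])"
   unfolding flip_simps flip_weight by (simp add: mult.commute)
  moreover have "flip (\<Sum>k<r div 2. pert_pair \<sigma> (v k) (\<gamma> k) (\<delta> k) j i) =
    [:eps \<sigma>:] * (\<Sum>k<r div 2. pert_pair \<sigma> (v k) (\<gamma> k) (\<delta> k) i j)"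
   unfolding flip_simps flip_pert_pair sum_distrib_left ..
  ultimately show ?thesis unfolding struct_pert_def using that
   by (cases "odd r") (simp_all only: index_mat split flip_simps(1) distrib_left if_True if_False not_not
     add_0_left simp_thms)
 qed
 ultimately show ?thesis unfolding alt_pencil_def is_pencil_def alternating_def by simp
qed

lemma alt_pair_pert: "alt_pencil \<sigma> n (pair_pert \<sigma> n v \<gamma> \<delta>)"
 using alt_struct_pert[of \<sigma> n 2 "\<lambda>_. v" "\<lambda>_. \<gamma>" "\<lambda>_. \<delta>"] unfolding struct_pert_2 .

text \<open>The perturbation annihilates every vector that is orthogonal to all \<open>w\<^sub>j\<close>, all \<open>v\<^sub>j\<close> and \<open>u\<close>.\<close>

lemma rank_perturbed_struct_pert:
 assumes L: "L \<in> Mat n"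
 shows "rank_perturbed n r L (L + struct_pert \<sigma> n r v \<gamma> \<delta> u)"
proof -
 let ?s = "r div 2" and ?E = "struct_pert \<sigma> n r v \<gamma> \<delta> u"
 define b where "b = (\<lambda>l. if l < ?s then vec n (\<lambda>i. [:\<gamma> l $ i, \<delta> l $ i:])
  else if l < 2 * ?s then vec n (\<lambda>i. [:v (l - ?s) $ i:]) else vec n (\<lambda>i. [:u $ i:]))"
 have bc: "b l \<in> Vec n" for l unfolding b_def by auto
 have "?E *\<^sub>v x = 0\<^sub>v n" if x: "x \<in> Vec n" and z: "!!l. l < r ==> b l \<bullet> x = 0" for x
 proof (intro eq_vecI)
  fix i assume "i < dim_vec (0\<^sub>v n :: complex poly vec)"
  hence i: "i < n" by simp
  have zv: "(\<Sum>k<n. [:v j $ k:] * x $ k) = 0" and zw: "(\<Sum>k<n. [:\<gamma> j $ k, \<delta> j $ k:] * x $ k) = 0" if "j < ?s" for j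
   using z[of j] z[of "?s + j"] that x unfolding b_def by (auto simp: scalar_prod_def atLeast0LessThan)
  have zu: "(\<Sum>k<n. [:u $ k:] * x $ k) = 0" if "odd r"
   using z[of "2 * ?s"] that x unfolding b_def by (auto simp: scalar_prod_def atLeast0LessThan elim!: oddE)
  have "(?E *\<^sub>v x) $ i = (\<Sum>k<n. ?E $$ (i,k) * x $ k)" by (rule mult_mat_vec_sum[OF _ x i]) simp
  also have "\<dots> = (if odd r then \<Sum>k<n. [:0,1:] ^ weight \<sigma> * [:u $ i * u $ k:] * x $ k else 0) +
    (\<Sum>j<?s. \<Sum>k<n. pert_pair \<sigma> (v j) (\<gamma> j) (\<delta> j) i k * x $ k)"
   unfolding struct_pert_def using i
   by (subst sum.swap) (auto simp: distrib_right sum.distrib sum_distrib_right simp del: power.simps)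
  also have "(\<Sum>k<n. [:0,1:] ^ weight \<sigma> * [:u $ i * u $ k:] * x $ k) =
    [:0,1:] ^ weight \<sigma> * [:u $ i:] * (\<Sum>k<n. [:u $ k:] * x $ k)"
   unfolding sum_distrib_left by (intro sum.cong) (auto simp: mult_ac simp del: power.simps)
  also have "(\<Sum>j<?s. \<Sum>k<n. pert_pair \<sigma> (v j) (\<gamma> j) (\<delta> j) i k * x $ k) = (\<Sum>j<?s. 0)"
  proof (intro sum.cong refl)
   fix j assume "j \<in> {..<?s}"
   hence j: "j < ?s" by simp
   have "(\<Sum>k<n. pert_pair \<sigma> (v j) (\<gamma> j) (\<delta> j) i k * x $ k) = [:v j $ i:] * (\<Sum>k<n. [:\<gamma> j $ k, \<delta> j $ k:] * x $ k) +
     [:eps \<sigma>:] * [:\<gamma> j $ i, - (\<delta> j $ i):] * (\<Sum>k<n. [:v j $ k:] * x $ k)"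
    unfolding pert_pair_def distrib_right sum.distrib sum_distrib_left by (simp only: mult.assoc)
   thus "(\<Sum>k<n. pert_pair \<sigma> (v j) (\<gamma> j) (\<delta> j) i k * x $ k) = 0" unfolding zv[OF j] zw[OF j] by simp
  qed
  finally show "(?E *\<^sub>v x) $ i = 0\<^sub>v n $ i" using zu i by (simp del: index_mult_mat_vec power.simps split: if_splits)
 qed simp
 hence "(L + ?E) *\<^sub>v x = L *\<^sub>v x" if "x \<in> Vec n" "\<forall>l<r. b l \<bullet> x = 0" for x
  using that L by (subst add_mult_distrib_mat_vec[of _ n n]) auto
 thus ?thesis unfolding rank_perturbed_def using bc by blast
qed

lemma rank_perturbed_pair_pert: "L \<in> Mat n ==> rank_perturbed n 2 L (L + pair_pert \<sigma> n v \<gamma> \<delta>)"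
 using rank_perturbed_struct_pert[of L n 2 \<sigma> "\<lambda>_. v" "\<lambda>_. \<gamma>" "\<lambda>_. \<delta>"] unfolding struct_pert_2 .

section \<open>Reversal\<close>

fun dual :: "alternation => alternation" where
 "dual T_even = T_odd"
| "dual T_odd = T_even"

lemma rev_pencil_carrier [simp]: "L \<in> Mat n ==> rev_pencil L \<in> Mat n"
 unfolding rev_pencil_def by simp

lemma rev_pencil_index: "L \<in> Mat n ==> i < n ==> j < n ==>
  rev_pencil L $$ (i,j) = [:coeff (L $$ (i,j)) 1, coeff (L $$ (i,j)) 0:]"
 unfolding rev_pencil_def by simp

lemma rev_pencil_add: "L \<in> Mat n ==> E \<in> Mat n ==> rev_pencil (L + E) = rev_pencil L + rev_pencil E"
 unfolding rev_pencil_def by (intro eq_matI) auto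

lemma rev_struct_pert: "rev_pencil (struct_pert \<sigma> n r v \<gamma> \<delta> u) = struct_pert (dual \<sigma>) n r v \<delta> \<gamma> u"
proof (intro eq_matI)
 fix i j assume "i < dim_row (struct_pert (dual \<sigma>) n r v \<delta> \<gamma> u)" "j < dim_col (struct_pert (dual \<sigma>) n r v \<delta> \<gamma> u)"
 hence ij: "i < n" "j < n" unfolding struct_pert_def by auto
 define R :: "complex poly => complex poly" where "R = (\<lambda>p. [:coeff p 1, coeff p 0:])"
 have Rs: "R (p + q) = R p + R q" "R 0 = 0" "R (sum f A) = (\<Sum>x\<in>A. R (f x))" for p q and f :: "nat => complex poly" and A
 proof -
  show a: "R (p + q) = R p + R q" for p q unfolding R_def by simp
  show "R 0 = 0" unfolding R_def by simp
  thus "R (sum f A) = (\<Sum>x\<in>A. R (f x))" for f :: "nat => complex poly" and A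
   by (induction A rule: infinite_finite_induct) (auto simp: a)
 qed
 have 1: "R (pert_pair \<sigma> a b c i j) = pert_pair (dual \<sigma>) a c b i j" for a b c
  unfolding R_def pert_pair_def by (cases \<sigma>) auto
 have 2: "R ([:0,1:] ^ weight \<sigma> * [:a:]) = [:0,1:] ^ weight (dual \<sigma>) * [:a:]" for a
  unfolding R_def by (cases \<sigma>) auto
 have "rev_pencil (struct_pert \<sigma> n r v \<gamma> \<delta> u) $$ (i,j) = R (struct_pert \<sigma> n r v \<gamma> \<delta> u $$ (i,j))"
  unfolding R_def by (rule rev_pencil_index[OF _ ij]) simp
 also have "\<dots> = struct_pert (dual \<sigma>) n r v \<delta> \<gamma> u $$ (i,j)"
  unfolding struct_pert_def using ij by (simp add: Rs 1 2 del: power.simps mult_pCons_right)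
 finally show "rev_pencil (struct_pert \<sigma> n r v \<gamma> \<delta> u) $$ (i,j) = struct_pert (dual \<sigma>) n r v \<delta> \<gamma> u $$ (i,j)" .
qed (auto simp: rev_pencil_def struct_pert_def)

lemma rev_pair_pert: "rev_pencil (pair_pert \<sigma> n v \<gamma> \<delta>) = pair_pert (dual \<sigma>) n v \<delta> \<gamma>"
 using rev_struct_pert[of \<sigma> n 2 "\<lambda>_. v" "\<lambda>_. \<gamma>" "\<lambda>_. \<delta>"] unfolding struct_pert_2 .

lemma rev_rank_one_pert: "u \<in> Vec n ==> rev_pencil (rank_one_pert \<sigma> u) = rank_one_pert (dual \<sigma>) u"
 using rev_struct_pert[of \<sigma> n 1 v \<gamma> \<delta> u for v \<gamma> \<delta>] struct_pert_1 by metis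

lemma alt_rev_pencil:
 assumes L: "alt_pencil \<sigma> n L"
 shows "alt_pencil (dual \<sigma>) n (rev_pencil L)"
proof -
 note Lc = alt_pencilD(2)[OF L]
 have "flip (rev_pencil L $$ (j,i)) = [:eps (dual \<sigma>):] * rev_pencil L $$ (i,j)" if ij: "i < n" "j < n" for i j
 proof -
  have "coeff (flip (L $$ (j,i))) k = coeff ([:eps \<sigma>:] * L $$ (i,j)) k" for k
   using alt_pencilD(4)[OF L ij] by simp
  hence "(-1) ^ k * coeff (L $$ (j,i)) k = eps \<sigma> * coeff (L $$ (i,j)) k" for k
   by (simp add: coeff_flip)
  from this[of 0] this[of 1] show ?thesis
   unfolding rev_pencil_index[OF Lc ij] rev_pencil_index[OF Lc ij(2,1)] 
   by (cases \<sigma>) (auto simp: flip_lin eq_commute[of "- coeff p (Suc 0)" for p] neg_eq_iff_add_eq_0 add_eq_0_iff)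
 qed
 moreover have "degree (rev_pencil L $$ (i,j)) <= 1" if ij: "i < n" "j < n" for i j
  unfolding rev_pencil_index[OF Lc ij] by (simp add: degree_pCons_eq_if)
 ultimately show ?thesis using Lc unfolding alt_pencil_def is_pencil_def alternating_def by simp
qed

text \<open>As \<open>rev L (t) = t L(1/t)\<close>. Hence the coefficients of the determinant, up to degree \<open>n\<close>, are reversed,
 and the multiplicity of \<open>\<infinity>\<close> is the defect of the degree.\<close>

lemma poly_det_rev:
 assumes L: "is_pencil n L" and t: "t ~= 0"
 shows "poly (det (rev_pencil L)) t = t ^ n * poly (det L) (1 / t)"
proof -
 note Lc = is_pencil_carrier[OF L]
 have "ev_mat t (rev_pencil L) = t \<cdot>\<^sub>m ev_mat (1/t) L"
 proof (intro eq_matI)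
  fix i j assume "i < dim_row (t \<cdot>\<^sub>m ev_mat (1/t) L)" "j < dim_col (t \<cdot>\<^sub>m ev_mat (1/t) L)"
  hence ij: "i < n" "j < n" using Lc by auto
  have p: "L $$ (i,j) = [:coeff (L $$ (i,j)) 0, coeff (L $$ (i,j)) 1:]" using L ij poly_deg1 unfolding is_pencil_def by blast
  have "poly (L $$ (i,j)) (1/t) = coeff (L $$ (i,j)) 0 + (1/t) * coeff (L $$ (i,j)) 1" by (subst p) simp
  hence "t * poly (L $$ (i,j)) (1/t) = t * coeff (L $$ (i,j)) 0 + coeff (L $$ (i,j)) 1"
   using t by (simp add: field_simps)
  thus "ev_mat t (rev_pencil L) $$ (i,j) = (t \<cdot>\<^sub>m ev_mat (1/t) L) $$ (i,j)"
   using ij Lc carrier_matD[OF rev_pencil_carrier[OF Lc]] by (simp add: rev_pencil_index[OF Lc ij])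
 qed (use Lc in \<open>auto simp: rev_pencil_def\<close>)
 thus ?thesis using Lc t by (simp add: poly_det det_smult)
qed

lemma det_rev_reflect:
 assumes L: "is_pencil n L"
 shows "det (rev_pencil L) = monom 1 (n - degree (det L)) * reflect_poly (det L)"
proof -
 have dn: "degree (det L) <= n" 
  using degree_det_le[of n L 1] L unfolding is_pencil_def by auto
 have "poly (det (rev_pencil L)) t = poly (monom 1 (n - degree (det L)) * reflect_poly (det L)) t" if "t ~= 0" for t
  using poly_det_rev[OF L that] that dn
  by (simp add: poly_monom poly_reflect_poly_nz field_simps flip: power_add)
 hence "UNIV - {0} \<subseteq> {t. poly (det (rev_pencil L) - monom 1 (n - degree (det L)) * reflect_poly (det L)) t = 0}" by auto
 moreover have "infinite (UNIV - {0 :: complex})" by (simp add: infinite_UNIV_char_0)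
 ultimately have "infinite {t. poly (det (rev_pencil L) - monom 1 (n - degree (det L)) * reflect_poly (det L)) t = 0}"
  by (rule infinite_super)
 thus ?thesis using poly_roots_finite eq_iff_diff_eq_0 by metis
qed

lemma det_rev_eq_0_iff:
 assumes L: "is_pencil n L"
 shows "det (rev_pencil L) = 0 \<longleftrightarrow> det L = 0"
 unfolding det_rev_reflect[OF L] by (simp add: monom_eq_0_iff)

lemma order_det_rev:
 assumes L: "is_pencil n L" "det L ~= 0"
 shows "order 0 (det (rev_pencil L)) = n - degree (det L)" "degree (det L) <= n"
proof -
 have "coeff (reflect_poly (det L)) 0 ~= 0" using L(2) by (simp add: coeff_reflect_poly)
 hence "poly (reflect_poly (det L)) 0 ~= 0" by (simp add: poly_0_coeff_0)
 hence "order 0 (reflect_poly (det L)) = 0" "reflect_poly (det L) ~= 0" by (auto intro: order_0I)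
 moreover have "order 0 (monom (1::complex) k) = k" for k
  using order_lin_power[of "0::complex" k] by (simp add: monom_altdef)
 ultimately show "order 0 (det (rev_pencil L)) = n - degree (det L)"
  unfolding det_rev_reflect[OF L(1)] by (subst order_mult) (auto simp: monom_eq_0_iff)
 show "degree (det L) <= n" using degree_det_le[of n L 1] L unfolding is_pencil_def by auto
qed

section \<open>Perturbation steps of rank two\<close>

lemma smult_mat_mult_vec:
 fixes A :: "'a :: comm_ring_1 mat"
 assumes "A \<in> carrier_mat n m" "x \<in> carrier_vec m"
 shows "(c \<cdot>\<^sub>m A) *\<^sub>v x = c \<cdot>\<^sub>v (A *\<^sub>v x)"
 using assms by (intro eq_vecI) (auto simp: scalar_prod_def sum_distrib_left mult_ac intro!: sum.cong)

text \<open>Two rank-one updates in a row. The result is symmetric in the two updates, and multiplication by \<open>det L\<close>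
 makes it polynomial in the entries of the adjugate of \<open>L\<close>.\<close>

lemma skew_pair_det:
 fixes L :: "complex poly mat"
 assumes L: "L \<in> Mat n" and D: "det L ~= 0"
  and c: "u \<in> Vec n" "v \<in> Vec n" "x \<in> Vec n" "y \<in> Vec n"
  and A: "det L + v \<bullet> (adj_mat L *\<^sub>v u) ~= 0"
 shows "det L * det (L + outer u v + outer x y) =
  (det L + v \<bullet> (adj_mat L *\<^sub>v u)) * (det L + y \<bullet> (adj_mat L *\<^sub>v x)) -
  (y \<bullet> (adj_mat L *\<^sub>v u)) * (v \<bullet> (adj_mat L *\<^sub>v x))"
proof -
 let ?J = "adj_mat L" and ?A = "L + outer u v"
 have Jc: "?J \<in> Mat n" "?J\<^sup>T \<in> Mat n" using L by auto
 have oc: "outer u v \<in> Mat n" using c by simp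
 have Ac: "?A \<in> Mat n" "adj_mat ?A \<in> Mat n" using L oc by auto
 have dA: "det ?A = det L + v \<bullet> (?J *\<^sub>v u)" by (rule det_rank_one_update[OF L D c(1,2)])
 hence A': "det ?A ~= 0" using A by simp
 have dL2: "det (?A + outer x y) = det ?A + y \<bullet> (adj_mat ?A *\<^sub>v x)" by (rule det_rank_one_update[OF Ac(1) A' c(3,4)])
 note adj = adj_rank_one_update[OF L D c(1,2) A']
 have Ju: "?J *\<^sub>v u \<in> Vec n" "?J *\<^sub>v x \<in> Vec n" "?J\<^sup>T *\<^sub>v v \<in> Vec n"
  using Jc c by auto
 have o2: "outer (?J *\<^sub>v u) (?J\<^sup>T *\<^sub>v v) \<in> Mat n" using Ju by simp
 have JT: "(?J\<^sup>T *\<^sub>v v) \<bullet> x = v \<bullet> (?J *\<^sub>v x)" using scalar_prod_mult_mat_vec[OF Jc(1) c(3,2)] by simp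
 have "(det L \<cdot>\<^sub>m adj_mat ?A) *\<^sub>v x = (det ?A \<cdot>\<^sub>m ?J) *\<^sub>v x - outer (?J *\<^sub>v u) (?J\<^sup>T *\<^sub>v v) *\<^sub>v x"
  unfolding adj by (rule minus_mult_distrib_mat_vec[OF _ o2 c(3)]) (use Jc in simp)
 also have "\<dots> = det ?A \<cdot>\<^sub>v (?J *\<^sub>v x) - (v \<bullet> (?J *\<^sub>v x)) \<cdot>\<^sub>v (?J *\<^sub>v u)"
  unfolding outer_mult_vec[OF Ju(1,3) c(3)] JT smult_mat_mult_vec[OF Jc(1) c(3)] ..
 finally have e: "det L \<cdot>\<^sub>v (adj_mat ?A *\<^sub>v x) = \<dots>"
  unfolding smult_mat_mult_vec[OF Ac(2) c(3)] .
 have "det L * (y \<bullet> (adj_mat ?A *\<^sub>v x)) = y \<bullet> (det L \<cdot>\<^sub>v (adj_mat ?A *\<^sub>v x))"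
  using Ac c by simp
 also have "\<dots> = det ?A * (y \<bullet> (?J *\<^sub>v x)) - (v \<bullet> (?J *\<^sub>v x)) * (y \<bullet> (?J *\<^sub>v u))"
  unfolding e using Ju c by (subst scalar_prod_minus_distrib[of _ n]) auto
 finally show ?thesis unfolding dL2 unfolding dA by (simp add: algebra_simps)
qed

text \<open>The adjugate of \<open>L + VW\<^sup>T - WV\<^sup>T\<close>, up to the scalar \<open>c\<close>. The matrix \<open>H\<close> is the increment of the adjugate
 when \<open>VV\<^sup>T\<close> is added to \<open>L\<close>. The formula is verified by multiplication with the perturbed pencil, using
 \<open>V\<^sup>T H = 0\<close> and \<open>L H = c - V (V\<^sup>T adj L)\<close>.\<close>

lemma skew_pair_adj:
 fixes L :: "complex poly mat"
 assumes L: "L \<in> Mat n" and D: "det L ~= 0"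
  and V: "V \<in> Vec n" and W: "W \<in> Vec n" and H: "H \<in> Mat n"
  and DH: "det L \<cdot>\<^sub>m H = c \<cdot>\<^sub>m adj_mat L - outer (adj_mat L *\<^sub>v V) ((adj_mat L)\<^sup>T *\<^sub>v V)"
  and c: "c = V \<bullet> (adj_mat L *\<^sub>v V)"
 defines "\<Delta> \<equiv> det L + W \<bullet> (adj_mat L *\<^sub>v V) - V \<bullet> (adj_mat L *\<^sub>v W) + W \<bullet> (H *\<^sub>v W)"
  and "g \<equiv> adj_mat L *\<^sub>v V + H *\<^sub>v W" and "g' \<equiv> (adj_mat L)\<^sup>T *\<^sub>v V - H\<^sup>T *\<^sub>v W"
  and "L2 \<equiv> L + (outer V W + outer (- W) V)"
 assumes d2: "det L2 = \<Delta>" "\<Delta> ~= 0"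
 shows "c \<cdot>\<^sub>m adj_mat L2 = \<Delta> \<cdot>\<^sub>m H + outer g g'"
  "L * H = c \<cdot>\<^sub>m 1\<^sub>m n - outer V ((adj_mat L)\<^sup>T *\<^sub>v V)"
proof -
 let ?J = "adj_mat L" and ?D = "det L"
 define p where "p = ?J\<^sup>T *\<^sub>v V"
 define x where "x = ?J *\<^sub>v V"
 have Jc: "?J \<in> Mat n" "?J\<^sup>T \<in> Mat n" "H\<^sup>T \<in> Mat n" using L H by auto
 have xp: "x \<in> Vec n" "p \<in> Vec n" unfolding x_def p_def using Jc V by auto
 have LJ: "L * ?J = ?D \<cdot>\<^sub>m 1\<^sub>m n" by (rule adj_mat(2)[OF L])
 have Lx: "L *\<^sub>v x = ?D \<cdot>\<^sub>v V"
  unfolding x_def assoc_mult_mat_vec[OF L Jc(1) V, symmetric] LJ by (rule smult_one_mult_mat_vec[OF V])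
 have ox: "outer x p \<in> Mat n" "outer V p \<in> Mat n" using xp V by auto
 have "?D \<cdot>\<^sub>m (L * H) = L * (?D \<cdot>\<^sub>m H)" using L H by (simp add: mult_smult_distrib)
 also have "\<dots> = L * (c \<cdot>\<^sub>m ?J) - L * outer x p"
  unfolding DH x_def[symmetric] p_def[symmetric] by (rule mult_minus_distrib_mat[OF L _ ox(1)]) (use Jc in simp)
 also have "L * (c \<cdot>\<^sub>m ?J) = (c * ?D) \<cdot>\<^sub>m 1\<^sub>m n"
  unfolding mult_smult_distrib[OF L Jc(1)] LJ by (intro eq_matI) auto
 also have "L * outer x p = outer (?D \<cdot>\<^sub>v V) p" unfolding mult_outer[OF L xp] Lx ..
 also have "(c * ?D) \<cdot>\<^sub>m 1\<^sub>m n - outer (?D \<cdot>\<^sub>v V) p = ?D \<cdot>\<^sub>m (c \<cdot>\<^sub>m 1\<^sub>m n - outer V p)"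
  using V xp by (intro eq_matI) (auto simp: algebra_simps)
 finally have LH: "L * H = c \<cdot>\<^sub>m 1\<^sub>m n - outer V p"
  using smult_mat_cancel[of "L * H" n n "c \<cdot>\<^sub>m 1\<^sub>m n - outer V p" "det L"] D L H minus_carrier_mat[OF ox(2), of "c \<cdot>\<^sub>m 1\<^sub>m n"] by auto
 thus "L * H = c \<cdot>\<^sub>m 1\<^sub>m n - outer V (?J\<^sup>T *\<^sub>v V)" unfolding p_def .
 have HV0: "(H\<^sup>T *\<^sub>v V) $ j = 0" if j: "j < n" for j
 proof -
  have "?D * (H\<^sup>T *\<^sub>v V) $ j = (\<Sum>i<n. (?D \<cdot>\<^sub>m H) $$ (i,j) * V $ i)"
   unfolding mult_mat_vec_sum[OF Jc(3) V j] sum_distrib_left using H j by (intro sum.cong) (auto simp: mult.assoc)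
  also have "\<dots> = (\<Sum>i<n. c * (?J\<^sup>T $$ (j,i) * V $ i) - (V $ i * x $ i) * p $ j)"
   unfolding DH using L Jc V xp j
   by (intro sum.cong) (auto simp: x_def[symmetric] p_def[symmetric] algebra_simps simp del: index_mult_mat_vec)
  also have "\<dots> = c * p $ j - (V \<bullet> x) * p $ j"
   unfolding sum_subtractf sum_distrib_left[symmetric] sum_distrib_right[symmetric] p_def mult_mat_vec_sum[OF Jc(2) V j]
   using xp by (simp add: scalar_prod_def atLeast0LessThan)
  finally show ?thesis using D unfolding c x_def by simp
 qed
 hence HV: "H\<^sup>T *\<^sub>v V = 0\<^sub>v n" using Jc V by (intro eq_vecI) (auto simp del: index_mult_mat_vec)
 define h where "h = H *\<^sub>v W"
 define h' where "h' = H\<^sup>T *\<^sub>v W"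
 have hc: "h \<in> Vec n" "h' \<in> Vec n" unfolding h_def h'_def using H Jc W by auto
 have g: "g = x + h" "g' = p - h'" unfolding g_def g'_def x_def h_def p_def h'_def by auto
 have gc: "g \<in> Vec n" "g' \<in> Vec n" unfolding g using xp hc by auto
 have nW: "- W \<in> Vec n" using W by simp
 have oc: "outer V W \<in> Mat n" "outer (- W) V \<in> Mat n"
  "outer V W + outer (- W) V \<in> Mat n" "outer g g' \<in> Mat n" "outer V g' \<in> Mat n"
  using V W nW gc by auto
 have L2c: "L2 \<in> Mat n" "adj_mat L2 \<in> Mat n" unfolding L2_def using L oc by auto
 have L2H: "L2 * H = c \<cdot>\<^sub>m 1\<^sub>m n - outer V g'"
 proof -
  have "L2 * H = L * H + (outer V W * H + outer (- W) V * H)"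
   unfolding L2_def add_mult_distrib_mat[OF L oc(3) H] add_mult_distrib_mat[OF oc(1,2) H] ..
  also have "outer V W * H = outer V h'" unfolding h'_def by (rule outer_mult[OF H V W])
  also have "outer (- W) V * H = outer (- W) (0\<^sub>v n)" unfolding outer_mult[OF H nW V] HV ..
  finally show ?thesis unfolding LH g using V W hc xp
   by (intro eq_matI) (auto simp: algebra_simps)
 qed
 have L2g: "L2 *\<^sub>v g = \<Delta> \<cdot>\<^sub>v V"
 proof -
  have Lh: "L *\<^sub>v h = c \<cdot>\<^sub>v W - (p \<bullet> W) \<cdot>\<^sub>v V"
  proof -
   have "L *\<^sub>v h = (L * H) *\<^sub>v W" unfolding h_def by (rule assoc_mult_mat_vec[OF L H W, symmetric])
   also have "\<dots> = (c \<cdot>\<^sub>m 1\<^sub>m n) *\<^sub>v W - outer V p *\<^sub>v W"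
    unfolding LH by (rule minus_mult_distrib_mat_vec[OF _ ox(2) W]) simp
   finally show ?thesis unfolding smult_one_mult_mat_vec[OF W] outer_mult_vec[OF V xp(2) W] .
  qed
  have pW: "p \<bullet> W = V \<bullet> (?J *\<^sub>v W)" unfolding p_def by (rule scalar_prod_mult_mat_vec[OF Jc(1) W V, symmetric])
  have Vg: "V \<bullet> g = c"
  proof -
   have "V \<bullet> h = (H\<^sup>T *\<^sub>v V) \<bullet> W" unfolding h_def by (rule scalar_prod_mult_mat_vec[OF H W V])
   thus ?thesis unfolding g using HV W V xp hc by (simp add: scalar_prod_add_distrib[of _ n] c x_def)
  qed
  have Wg: "W \<bullet> g = W \<bullet> (?J *\<^sub>v V) + W \<bullet> (H *\<^sub>v W)"
   unfolding g using W xp hc by (simp add: scalar_prod_add_distrib[of _ n] x_def h_def)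
  have "L2 *\<^sub>v g = L *\<^sub>v g + (outer V W *\<^sub>v g + outer (- W) V *\<^sub>v g)"
   unfolding L2_def add_mult_distrib_mat_vec[OF L oc(3) gc(1)] add_mult_distrib_mat_vec[OF oc(1,2) gc(1)] ..
  also have "L *\<^sub>v g = ?D \<cdot>\<^sub>v V + (c \<cdot>\<^sub>v W - (p \<bullet> W) \<cdot>\<^sub>v V)"
   unfolding g mult_add_distrib_mat_vec[OF L xp(1) hc(1)] Lx Lh ..
  also have "outer V W *\<^sub>v g = (W \<bullet> g) \<cdot>\<^sub>v V" by (rule outer_mult_vec[OF V W gc(1)])
  also have "outer (- W) V *\<^sub>v g = (V \<bullet> g) \<cdot>\<^sub>v (- W)" by (rule outer_mult_vec[OF nW V gc(1)])
  finally show ?thesis unfolding Vg Wg pW \<Delta>_def using V W by (intro eq_vecI) (auto simp: algebra_simps)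
 qed
 have "L2 * (\<Delta> \<cdot>\<^sub>m H + outer g g') = \<Delta> \<cdot>\<^sub>m (L2 * H) + L2 * outer g g'"
  using L2c H oc by (subst mult_add_distrib_mat[of _ n n _ n]) (auto simp: mult_smult_distrib)
 also have "\<dots> = \<Delta> \<cdot>\<^sub>m (c \<cdot>\<^sub>m 1\<^sub>m n - outer V g') + outer (\<Delta> \<cdot>\<^sub>v V) g'"
  unfolding L2H mult_outer[OF L2c(1) gc] L2g ..
 also have "\<dots> = c \<cdot>\<^sub>m (\<Delta> \<cdot>\<^sub>m 1\<^sub>m n)" using V gc by (intro eq_matI) (auto simp: algebra_simps)
 also have "\<dots> = c \<cdot>\<^sub>m (L2 * adj_mat L2)" unfolding adj_mat(2)[OF L2c(1)] d2(1) ..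
 also have "\<dots> = L2 * (c \<cdot>\<^sub>m adj_mat L2)" by (rule mult_smult_distrib[OF L2c, symmetric])
 finally have eq: "L2 * (c \<cdot>\<^sub>m adj_mat L2) = L2 * (\<Delta> \<cdot>\<^sub>m H + outer g g')" by (rule sym)
 have "det L2 ~= 0" unfolding d2(1) by (rule d2(2))
 thus "c \<cdot>\<^sub>m adj_mat L2 = \<Delta> \<cdot>\<^sub>m H + outer g g'"
  by (rule mat_mult_cancel_left[OF L2c(1) _ smult_carrier_mat[OF L2c(2)] add_carrier_mat[OF oc(4)] eq])
qed

text \<open>A sum of two squares is the product of \<open>u + \<i> u'\<close> and \<open>u - \<i> u'\<close>, symmetrized.\<close>

lemma pair_pert_rank_one_sum:
 assumes u: "u \<in> Vec n" "u' \<in> Vec n"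
 shows "\<exists>v \<in> Vec n. \<exists>\<gamma> \<in> Vec n. \<exists>\<delta> \<in> Vec n.
  pair_pert \<sigma> n v \<gamma> \<delta> = rank_one_pert \<sigma> u + rank_one_pert \<sigma> u'"
proof -
 let ?v = "u + \<i> \<cdot>\<^sub>v u'" and ?w = "(1/2) \<cdot>\<^sub>v (u - \<i> \<cdot>\<^sub>v u')"
 have i: "(a + \<i> * b) * ((c - \<i> * d) / 2) + (a - \<i> * b) / 2 * (c + \<i> * d) = a * c + b * d" for a b c d :: complex
  by (simp add: field_simps)
 have "pair_pert \<sigma> n ?v (if \<sigma> = T_even then ?w else 0\<^sub>v n) (if \<sigma> = T_even then 0\<^sub>v n else ?w) =
   rank_one_pert \<sigma> u + rank_one_pert \<sigma> u'"
 proof (rule eq_matI)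
  fix a b assume "a < dim_row (rank_one_pert \<sigma> u + rank_one_pert \<sigma> u')" "b < dim_col (rank_one_pert \<sigma> u + rank_one_pert \<sigma> u')"
  hence ab: "a < n" "b < n" using carrier_matD[OF rank_one_pert_carrier[OF u(2), of \<sigma>]] by auto
  have "pert_pair \<sigma> ?v (if \<sigma> = T_even then ?w else 0\<^sub>v n) (if \<sigma> = T_even then 0\<^sub>v n else ?w) a b =
    [:0,1:] ^ weight \<sigma> * [:u $ a * u $ b + u' $ a * u' $ b:]"
   using i[of "u $ a" "u' $ a" "u $ b" "u' $ b"] ab u unfolding pert_pair_def by (cases \<sigma>) (simp_all add: mult.commute)
  thus "pair_pert \<sigma> n ?v (if \<sigma> = T_even then ?w else 0\<^sub>v n) (if \<sigma> = T_even then 0\<^sub>v n else ?w) $$ (a,b) =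
   (rank_one_pert \<sigma> u + rank_one_pert \<sigma> u') $$ (a,b)"
   using ab u carrier_matD[OF rank_one_pert_carrier[OF u(2), of \<sigma>]] unfolding pair_pert_def
   by (simp add: rank_one_pert_index smult_add_left del: power.simps)
 qed (use u carrier_matD[OF rank_one_pert_carrier[OF u(2), of \<sigma>]] in \<open>auto simp: pair_pert_def\<close>)
 thus ?thesis using u by (intro bexI[of _ ?v] bexI[of _ "if \<sigma> = T_even then ?w else 0\<^sub>v n"]
    bexI[of _ "if \<sigma> = T_even then 0\<^sub>v n else ?w"]) auto
qed

lemma pair_pert_skew:
 assumes "v \<in> Vec n" "w \<in> Vec n"
 shows "pair_pert T_odd n v w (0\<^sub>v n) = outer (cvec v) (cvec w) + outer (- cvec w) (cvec v)"
 using assms unfolding pair_pert_def pert_pair_def by (intro eq_matI) auto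

lemma rank_one_pert_0: "rank_one_pert \<sigma> (0\<^sub>v n) = 0\<^sub>m n n"
 by (intro eq_matI) (auto simp: rank_one_pert_def)

lemma pair_plain_step:
 assumes L: "alt_pencil \<sigma> n L" "det L ~= 0" and mu: "\<mu> ~= 0"
 shows "\<exists>v \<in> Vec n. \<exists>\<gamma> \<in> Vec n. \<exists>\<delta> \<in> Vec n. det (L + pair_pert \<sigma> n v \<gamma> \<delta>) ~= 0 \<and>
  (\<forall>k\<ge>1. blocks_ge (L + pair_pert \<sigma> n v \<gamma> \<delta>) \<mu> k = blocks_ge L \<mu> k - 2)"
proof -
 obtain u where u: "u \<in> Vec n" "det (L + rank_one_pert \<sigma> u) ~= 0"
  "!!k. 1 <= k ==> blocks_ge (L + rank_one_pert \<sigma> u) \<mu> k = blocks_ge L \<mu> k - 1"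
  using plain_step[OF L mu] by blast
 obtain u' where u': "u' \<in> Vec n" "det (L + rank_one_pert \<sigma> u + rank_one_pert \<sigma> u') ~= 0"
  "!!k. 1 <= k ==> blocks_ge (L + rank_one_pert \<sigma> u + rank_one_pert \<sigma> u') \<mu> k = blocks_ge (L + rank_one_pert \<sigma> u) \<mu> k - 1"
  using plain_step[OF alt_pencil_add[OF L(1) alt_rank_one_pert[OF u(1)]] u(2) mu] by blast
 obtain v \<gamma> \<delta> where p: "v \<in> Vec n" "\<gamma> \<in> Vec n" "\<delta> \<in> Vec n"
  "pair_pert \<sigma> n v \<gamma> \<delta> = rank_one_pert \<sigma> u + rank_one_pert \<sigma> u'"
  using pair_pert_rank_one_sum[OF u(1) u'(1)] by blast
 have "L + pair_pert \<sigma> n v \<gamma> \<delta> = L + rank_one_pert \<sigma> u + rank_one_pert \<sigma> u'"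
  unfolding p(4) using assoc_add_mat[OF alt_pencilD(2)[OF L(1)] rank_one_pert_carrier rank_one_pert_carrier] u u' by metis
 thus ?thesis using p(1-3) u(3) u'(2,3) by (metis diff_diff_left nat_1_add_1)
qed

lemma order_zero_mult: "p = [:0,1:] ^ k * q ==> poly q 0 ~= 0 ==> p ~= 0 \<and> order 0 (p :: complex poly) = k"
 using order_lin_power_mult[of p 0 k q] by simp

lemma poly_lin_power_0: "1 <= k ==> poly ([:0,1:] ^ k * p) (0 :: complex) = 0"
 by (simp add: poly_power power_0_left)

lemma target_order_ge:
 assumes adm: "admissible \<sigma> n \<nu>"
 shows "(\<Sum>k = 1..pair_bound \<sigma> n. \<nu> k - r) + (if repaired \<sigma> r \<nu> l \<and> l <= pair_bound \<sigma> n then 1 else 0) <= target_order \<sigma> n r \<nu>"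
proof -
 let ?K = "pair_bound \<sigma> n"
 let ?c = "\<lambda>k. if k = l \<and> repaired \<sigma> r \<nu> l then 1 else 0 :: nat"
 have le: "(\<nu> k - r) + ?c k <= target \<sigma> n r \<nu> k" if k: "1 <= k" for k
 proof (cases "k = 1")
  case True
  thus ?thesis by (cases \<sigma>) (auto simp: repair_def)
 next
  case False
  thus ?thesis using k target_eq_repaired[OF adm, of k r] by (auto split: if_splits)
 qed
 have "(\<Sum>k = 1..?K. ?c k) = (if repaired \<sigma> r \<nu> l \<and> l <= ?K then 1 else 0)"
  by (cases "repaired \<sigma> r \<nu> l") (auto simp: )
 hence "(\<Sum>k = 1..?K. \<nu> k - r) + (if repaired \<sigma> r \<nu> l \<and> l <= ?K then 1 else 0) = (\<Sum>k = 1..?K. (\<nu> k - r) + ?c k)"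
  by (simp add: sum.distrib del: repaired.simps)
 also have "\<dots> <= target_order \<sigma> n r \<nu>" unfolding target_order_def using le by (intro sum_mono) auto
 finally show ?thesis .
qed

text \<open>For a pair, the target order exceeds the sum of the \<open>\<nu> k - 2\<close> by at least one if an entry has to be repaired.\<close>

lemma pair_step_by_order:
 assumes L: "alt_pencil \<sigma> n L" "det L ~= 0" and d: "det (L + pair_pert \<sigma> n v \<gamma> \<delta>) ~= 0"
  and ord: "order 0 (det (L + pair_pert \<sigma> n v \<gamma> \<delta>)) \<le>
   (\<Sum>k = 1..pair_bound \<sigma> n. blocks_ge L 0 k - 2) + (if repaired \<sigma> 2 (blocks_ge L 0) l \<and> l <= pair_bound \<sigma> n then 1 else 0)"
  and rep: "!!k. repaired \<sigma> 2 (blocks_ge L 0) k ==> 0 < blocks_ge (L + pair_pert \<sigma> n v \<gamma> \<delta>) 0 k" and k: "1 <= k"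
 shows "blocks_ge (L + pair_pert \<sigma> n v \<gamma> \<delta>) 0 k = target \<sigma> n 2 (blocks_ge L 0) k"
 by (rule blocks_eq_target[OF L alt_pencil_add[OF L(1) alt_pair_pert] d
    rank_perturbed_pair_pert[OF alt_pencilD(2)[OF L(1)]] _ rep k])
  (rule le_trans[OF ord target_order_ge[OF admissible_blocks[OF L]]])

lemma skew_form_0:
 assumes X: "X \<in> Mat n" and w: "w \<in> Vec n"
  and skew: "!!i j. i < n ==> j < n ==> X $$ (j,i) = - X $$ (i,j)"
 shows "w \<bullet> (X *\<^sub>v w) = (0 :: complex)"
proof -
 have "w \<bullet> (X *\<^sub>v w) = (\<Sum>i<n. \<Sum>j<n. w $ j * w $ i * X $$ (j,i))"
  unfolding form_sum[OF X w w] by (rule sum.swap)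
 also have "\<dots> = (\<Sum>i<n. \<Sum>j<n. - (w $ i * w $ j * X $$ (i,j)))"
 proof (intro sum.cong refl)
  fix i j assume "i \<in> {..<n}" "j \<in> {..<n}"
  hence "X $$ (j,i) = - X $$ (i,j)" using skew[of i j] by simp
  thus "w $ j * w $ i * X $$ (j,i) = - (w $ i * w $ j * X $$ (i,j))" by simp
 qed
 also have "\<dots> = - (w \<bullet> (X *\<^sub>v w))" unfolding form_sum[OF X w w] sum_negf ..
 finally show ?thesis by simp
qed

text \<open>In the \<open>\<top>\<close>-odd case with an even largest multiplicity \<open>m\<close>, two multiplicities equal \<open>m\<close>. The constant
 coefficient of the reduced adjugate is skew-symmetric. For two unit vectors at a nonzero entry of it, the
 determinant loses twice \<open>m\<close>, so both are removed.\<close>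

lemma skew_step_even:
 assumes L: "alt_pencil T_odd n L" "det L ~= 0" and ne: "0 < blocks_ge L 0 1"
  and C: "C \<in> Mat n" "adj_mat L = [:0,1:] ^ e \<cdot>\<^sub>m C" and ij0: "i0 < n" "j0 < n" "coeff_mat 0 C $$ (i0,j0) ~= 0"
  and d: "poly d 0 ~= 0" "det L = [:0,1:] ^ (e + m) * d" and m: "1 <= m" "even m" "m <= n"
  and bg: "!!k. 1 <= k ==> 0 < blocks_ge L 0 k \<longleftrightarrow> k <= m"
  and skew: "!!i j. i < n ==> j < n ==> coeff_mat 0 C $$ (j,i) = - coeff_mat 0 C $$ (i,j)"
 shows "\<exists>v \<in> Vec n. \<exists>\<gamma> \<in> Vec n. \<exists>\<delta> \<in> Vec n. det (L + pair_pert T_odd n v \<gamma> \<delta>) ~= 0 \<and>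
  (\<forall>k\<ge>1. blocks_ge (L + pair_pert T_odd n v \<gamma> \<delta>) 0 k = target T_odd n 2 (blocks_ge L 0) k)"
proof -
 note Lp = alt_pencilD(1)[OF L(1)] and Lc = alt_pencilD(2)[OF L(1)]
 let ?s = "[:0,1:] :: complex poly" and ?\<nu> = "blocks_ge L 0" and ?J = "adj_mat L" and ?C0 = "coeff_mat 0 C"
 note adm = admissible_blocks[OF L]
 \<comment> \<open>These two unit vectors pick the nonzero entry of the skew-symmetric constant coefficient.\<close>
 define V where "V = cvec (unit_vec n j0)"
 define W where "W = cvec (unit_vec n i0)"
 have VW: "V \<in> Vec n" "W \<in> Vec n" "- W \<in> Vec n" unfolding V_def W_def by auto
 have unit: "unit_vec n i \<bullet> (?C0 *\<^sub>v unit_vec n j) = ?C0 $$ (i,j)" if "i < n" "j < n" for i j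
  using that C(1) by simp
 have f: "poly (cvec (unit_vec n i) \<bullet> (C *\<^sub>v cvec (unit_vec n j))) 0 = ?C0 $$ (i,j)" if "i < n" "j < n" for i j
  unfolding poly_0_coeff_0 coeff_cvec_form[OF C(1) unit_vec_carrier unit_vec_carrier] by (rule unit[OF that])
 have Jf: "x \<bullet> (?J *\<^sub>v y) = ?s ^ e * (x \<bullet> (C *\<^sub>v y))" if "x \<in> Vec n" "y \<in> Vec n" for x y
  unfolding C(2) by (rule smult_mat_form[OF C(1) that])
 define A where "A = W \<bullet> (C *\<^sub>v V)"
 define B where "B = V \<bullet> (C *\<^sub>v W)"
 define P where "P = V \<bullet> (C *\<^sub>v V)"
 define Q where "Q = W \<bullet> (C *\<^sub>v W)"
 have diag: "?C0 $$ (i,i) = 0" if "i < n" for i using skew[OF that that] by simp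
 have "poly A 0 = ?C0 $$ (i0,j0)" "poly B 0 = ?C0 $$ (j0,i0)" "poly P 0 = 0" "poly Q 0 = 0"
  unfolding A_def B_def P_def Q_def V_def W_def using f ij0 diag by auto
 hence ev: "poly A 0 ~= 0" "poly B 0 = - poly A 0" "poly P 0 = 0" "poly Q 0 = 0"
  using ij0 skew[OF ij0(1,2)] by auto
 let ?E = "pair_pert T_odd n (unit_vec n j0) (unit_vec n i0) (0\<^sub>v n)"
 have E: "?E = outer V W + outer (- W) V" unfolding V_def W_def by (rule pair_pert_skew) auto
 have DA: "det L + W \<bullet> (?J *\<^sub>v V) = ?s ^ e * (?s ^ m * d + A)"
  unfolding Jf[OF VW(2,1)] d(2) A_def by (simp add: power_add algebra_simps del: power.simps)
 have Am: "poly (?s ^ m * d + A) 0 ~= 0" unfolding poly_add poly_lin_power_0[OF m(1)] using ev by simp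
 have DA0: "det L + W \<bullet> (?J *\<^sub>v V) ~= 0" using order_zero_mult[OF DA Am] by simp
 have neg: "x \<bullet> (?J *\<^sub>v (- W)) = - (x \<bullet> (?J *\<^sub>v W))" if "x \<in> Vec n" for x
 proof -
  have "?J *\<^sub>v (- W) = - (?J *\<^sub>v W)" using VW(2) Lc
   by (intro eq_vecI) (auto simp: scalar_prod_def sum_negf)
  thus ?thesis using that Lc VW(2) by (simp add: scalar_prod_uminus_right)
 qed
 have oc: "outer V W \<in> Mat n" "outer (- W) V \<in> Mat n" using VW by auto
 have "det L * det (L + ?E) = (det L + W \<bullet> (?J *\<^sub>v V)) * (det L - V \<bullet> (?J *\<^sub>v W)) + (V \<bullet> (?J *\<^sub>v V)) * (W \<bullet> (?J *\<^sub>v W))"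
  unfolding E assoc_add_mat[OF Lc oc, symmetric] skew_pair_det[OF Lc L(2) VW(1,2,3,1) DA0] neg[OF VW(1)] neg[OF VW(2)]
  by simp
 also have "\<dots> = ?s ^ (e + e) * ((?s ^ m * d + A) * (?s ^ m * d - B) + P * Q)"
  unfolding DA unfolding Jf[OF VW(1,2)] Jf[OF VW(1,1)] Jf[OF VW(2,2)] d(2) B_def[symmetric] P_def[symmetric] Q_def[symmetric]
  by (simp add: power_add algebra_simps del: power.simps)
 finally have det2: "det L * det (L + ?E) = ?s ^ (e + e) * ((?s ^ m * d + A) * (?s ^ m * d - B) + P * Q)" .
 have "poly ((?s ^ m * d + A) * (?s ^ m * d - B) + P * Q) 0 ~= 0"
  unfolding poly_add poly_diff poly_mult[of _ Q] poly_mult[of "_ + _"] poly_add poly_diff poly_lin_power_0[OF m(1)] using ev by simp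
 note o2 = order_zero_mult[OF det2 this]
 have d2: "det (L + ?E) ~= 0" using o2 by auto
 have oL: "order 0 (det L) = e + m" using order_zero_mult[OF d(2,1)] by simp
 have ord: "e + m + order 0 (det (L + ?E)) = e + e" using order_mult[of "det L" "det (L + ?E)" 0] o2 oL by simp
 have two: "0 < ?\<nu> k - 1 \<longleftrightarrow> k <= m" if k: "1 <= k" for k
 proof
  assume "0 < ?\<nu> k - 1"
  thus "k <= m" using bg[OF k] by simp
 next
  assume km: "k <= m"
  have "even (?\<nu> m) = even (?\<nu> (Suc m))" using admissible_pair[OF adm m(1)] m(2) by simp
  moreover have "?\<nu> (Suc m) = 0" using bg[of "Suc m"] by simp
  ultimately have "even (?\<nu> m)" by simp
  moreover have "0 < ?\<nu> m" using bg[OF m(1)] by simp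
  ultimately have "2 <= ?\<nu> m" by presburger
  moreover have "?\<nu> m <= ?\<nu> k" by (rule exponents_ge_antimono[OF km])
  ultimately show "0 < ?\<nu> k - 1" by simp
 qed
 let ?K = "pair_bound T_odd n"
 have K: "n <= ?K" "m <= ?K" using m(3) by auto
 have e2: "(\<Sum>k = 1..?K. ?\<nu> k - 1 - 1) = (\<Sum>k = 1..?K. ?\<nu> k - 2)"
  by (simp add: numeral_2_eq_2 del: pair_bound.simps)
 have "e + m = (\<Sum>k = 1..?K. ?\<nu> k - 2) + m + m"
  using truncated_sum[OF bg K(2)] truncated_sum[OF two K(2)] blocks_ge_sum[OF Lp L(2) K(1), of 0] oL
  unfolding e2 by linarith
 hence "order 0 (det (L + ?E)) <= (\<Sum>k = 1..?K. ?\<nu> k - 2) + (if repaired T_odd 2 ?\<nu> 0 \<and> 0 <= ?K then 1 else 0)"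
  using ord by simp
 moreover have "0 < blocks_ge (L + ?E) 0 k" if r: "repaired T_odd 2 ?\<nu> k" for k
 proof -
  have "2 <= k" "odd k" "?\<nu> k < 2" "2 < ?\<nu> (k - 1)" using r by auto
  hence "\<not> k <= m" "k - 1 <= m" using two[of k] two[of "k - 1"] by auto
  hence "k = m + 1" by simp
  hence "2 < ?\<nu> m" "odd (?\<nu> m - 2)" using r by auto
  moreover have "even (?\<nu> m) = even (?\<nu> (Suc m))" using admissible_pair[OF adm m(1)] m(2) by simp
  moreover have "?\<nu> (Suc m) = 0" using bg[of "Suc m"] by simp
  ultimately show ?thesis by simp
 qed
 ultimately have "\<forall>k\<ge>1. blocks_ge (L + ?E) 0 k = target T_odd n 2 ?\<nu> k"
  using pair_step_by_order[OF L d2, where l = 0] by blast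
 thus ?thesis using d2 unit_vec_carrier zero_carrier_vec by blast
qed

text \<open>The rank-one perturbation \<open>vv\<^sup>T\<close>, which is not \<open>\<top>\<close>-odd, removes the largest multiplicity \<open>m\<close>. The adjugate of
 \<open>L + vv\<^sup>T\<close>, and with it the increment \<open>H\<close>, has an order governed by the second largest multiplicity \<open>m2\<close>.
 The increment inherits a symmetry from the adjugate.\<close>

lemma adjugate_increment:
 assumes L: "alt_pencil T_odd n L" "det L ~= 0" and ne: "2 <= blocks_ge L 0 1"
  and C: "C \<in> Mat n" "adj_mat L = [:0,1:] ^ e \<cdot>\<^sub>m C"
  and d: "poly d 0 ~= 0" "det L = [:0,1:] ^ (e + m) * d" and m: "1 <= m" "odd m" "m <= n"
  and bg: "!!k. 1 <= k ==> 0 < blocks_ge L 0 k \<longleftrightarrow> k <= m"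
  and v: "v \<in> Vec n" "v \<bullet> (coeff_mat 0 C *\<^sub>v v) ~= 0"
 obtains H C2 h m2 where "H \<in> Mat n" "C2 \<in> Mat n" "H = [:0,1:] ^ h \<cdot>\<^sub>m C2"
  "det L \<cdot>\<^sub>m H = (cvec v \<bullet> (adj_mat L *\<^sub>v cvec v)) \<cdot>\<^sub>m adj_mat L -
   outer (adj_mat L *\<^sub>v cvec v) ((adj_mat L)\<^sup>T *\<^sub>v cvec v)"
  "1 <= m2" "m2 <= n" "e = h + m2" "coeff_mat 0 C2 ~= 0\<^sub>m n n"
  "\<forall>i<n. \<forall>j<n. flip (C2 $$ (j,i)) = [:(-1) ^ (m2 + 1):] * C2 $$ (i,j)"
  "\<forall>k\<ge>1. 2 <= blocks_ge L 0 k \<longleftrightarrow> k <= m2"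
proof -
 note Lp = alt_pencilD(1)[OF L(1)] and Lc = alt_pencilD(2)[OF L(1)]
 let ?s = "[:0,1:] :: complex poly" and ?\<nu> = "blocks_ge L 0" and ?J = "adj_mat L" and ?V = "cvec v"
 have V: "?V \<in> Vec n" using v by auto
 have Jc: "?J \<in> Mat n" "?J\<^sup>T \<in> Mat n" using Lc by auto
 define cc where "cc = ?V \<bullet> (C *\<^sub>v ?V)"
 have c: "?V \<bullet> (?J *\<^sub>v ?V) = ?s ^ e * cc" unfolding C(2) cc_def by (rule smult_mat_form[OF C(1) V V])
 have cc0: "poly cc 0 ~= 0" unfolding cc_def poly_0_coeff_0 coeff_cvec_form[OF C(1) v(1) v(1)] using v(2) .
 let ?M = "L + outer ?V ?V"
 have oV: "outer ?V ?V \<in> Mat n" using V by simp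
 have Mc: "?M \<in> Mat n" "adj_mat ?M \<in> Mat n" using Lc oV by auto
 have dM: "det ?M = det L + ?V \<bullet> (?J *\<^sub>v ?V)" by (rule det_rank_one_update[OF Lc L(2) V V])
 hence "det ?M = ?s ^ e * (?s ^ m * d + cc)"
  unfolding c d(2) by (simp add: power_add algebra_simps del: power.simps)
 moreover have "poly (?s ^ m * d + cc) 0 ~= 0" unfolding poly_add poly_lin_power_0[OF m(1)] using cc0 by simp
 ultimately have oM: "det ?M ~= 0" "order 0 (det ?M) = e" using order_zero_mult by blast+
 have oL: "order 0 (det L) = e + m" using order_zero_mult[OF d(2,1)] by simp
 have Mp: "is_pencil n ?M"
  using Mc(1) Lp V unfolding is_pencil_def by (auto intro!: degree_add_le)
 have bM: "blocks_ge ?M 0 k = ?\<nu> k - 1" if "1 <= k" for k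
 proof (rule plain_blocks_eq[OF Lp L(2) Mp oM(1) rank_perturbed_outer[OF Lc V V] _ that])
  show "order 0 (det ?M) <= (\<Sum>k = 1..n. ?\<nu> k - 1)"
   using truncated_sum[OF bg m(3)] blocks_ge_sum[OF Lp L(2) order.refl, of 0] unfolding oM(2) oL by simp
 qed
 have neM: "0 < blocks_ge ?M 0 1" using bM[of 1] ne by simp
 obtain C' h where C': "C' \<in> Mat n" "adj_mat ?M = ?s ^ h \<cdot>\<^sub>m C'" "ev_mat 0 C' ~= 0\<^sub>m n n"
  and lt: "h < order 0 (det ?M)" "order 0 (det ?M) - h <= n"
  and bg': "!!k. 1 <= k ==> 0 < blocks_ge ?M 0 k \<longleftrightarrow> k <= order 0 (det ?M) - h"
  by (rule eigenvalue_data[OF Mp oM(1) neM, unfolded minus_zero]) blast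
 define m2 where "m2 = e - h"
 have m2: "1 <= m2" "m2 <= n" "e = h + m2" using lt unfolding oM m2_def by auto
 have bg2: "2 <= ?\<nu> k \<longleftrightarrow> k <= m2" if "1 <= k" for k
  using bg'[OF that] bM[OF that] unfolding oM m2_def by auto
 define H where "H = adj_mat ?M - ?J"
 define C2 where "C2 = C' - ?s ^ m2 \<cdot>\<^sub>m C"
 have HC: "H \<in> Mat n" "C2 \<in> Mat n" unfolding H_def C2_def using Jc C C' by auto
 have H: "H = ?s ^ h \<cdot>\<^sub>m C2"
  unfolding H_def C2_def C'(2) C(2) m2(3) using C C'(1)
  by (intro eq_matI) (simp_all add: power_add algebra_simps del: power.simps)
 have DH: "det L \<cdot>\<^sub>m H = (?V \<bullet> (?J *\<^sub>v ?V)) \<cdot>\<^sub>m ?J - outer (?J *\<^sub>v ?V) (?J\<^sup>T *\<^sub>v ?V)"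
 proof -
  have xp: "?J *\<^sub>v ?V \<in> Vec n" "?J\<^sup>T *\<^sub>v ?V \<in> Vec n" using Jc V by auto
  have "det L \<cdot>\<^sub>m H = det L \<cdot>\<^sub>m adj_mat ?M - det L \<cdot>\<^sub>m ?J"
   unfolding H_def using carrier_matD[OF Mc(2)] carrier_matD[OF Jc(1)]
   by (intro eq_matI) (simp_all add: algebra_simps)
  also have "\<dots> = (?V \<bullet> (?J *\<^sub>v ?V)) \<cdot>\<^sub>m ?J - outer (?J *\<^sub>v ?V) (?J\<^sup>T *\<^sub>v ?V)"
   unfolding adj_rank_one_update[OF Lc L(2) V V oM(1)] dM using Jc Lc xp V
   by (intro eq_matI) (simp_all add: algebra_simps del: index_mult_mat_vec)
  finally show ?thesis .
 qed
 have "ev_mat 0 C2 = ev_mat 0 C'"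
  unfolding C2_def using C C'(1) m2(1)
  by (intro eq_matI) (simp_all add: poly_lin_power_0 del: power.simps)
 moreover have "coeff_mat 0 C2 = ev_mat 0 C2" by (simp add: poly_0_coeff_0)
 ultimately have C20: "coeff_mat 0 C2 ~= 0\<^sub>m n n" using C'(3) by simp
 have fl: "flip (C2 $$ (j,i)) = [:(-1) ^ (m2 + 1):] * C2 $$ (i,j)" if ij: "i < n" "j < n" for i j
 proof -
  let ?a = "e + m"
  define \<eta> :: complex where "\<eta> = eps T_odd * (-1) ^ ?a"
  have \<eta>: "\<eta> * \<eta> = 1" unfolding \<eta>_def by (simp add: power_mult_distrib[symmetric] mult.commute)
  define x where "x = ?J *\<^sub>v ?V"
  define p where "p = ?J\<^sup>T *\<^sub>v ?V"
  have fJ: "flip (?J $$ (j,i)) = [:\<eta>:] * ?J $$ (i,j)" if "i < n" "j < n" for i j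
   using adj_flip[OF alt_pencilD(3)[OF L(1)] L(2) eps_square that] unfolding oL \<eta>_def .
  have x: "x $ i = (\<Sum>j<n. ?J $$ (i,j) * ?V $ j)" and p: "p $ i = (\<Sum>j<n. ?J $$ (j,i) * ?V $ j)" if "i < n" for i
   unfolding x_def p_def mult_mat_vec_sum[OF Jc(1) V that] mult_mat_vec_sum[OF Jc(2) V that]
   using that Lc by (auto intro!: sum.cong)
  have fV: "flip (?V $ i) = ?V $ i" if "i < n" for i using that v(1) by simp
  have fp: "flip (p $ i) = [:\<eta>:] * x $ i" if "i < n" for i
   unfolding x[OF that] p[OF that] flip_simps sum_distrib_left
   using fJ that fV by (intro sum.cong) (auto simp: mult.assoc)
  have \<eta>': "[:\<eta>:] * ([:\<eta>:] * q) = q" for q using \<eta> by simp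
  have fx: "flip (x $ i) = [:\<eta>:] * p $ i" if "i < n" for i
  proof -
   have "x $ i = [:\<eta>:] * flip (p $ i)" unfolding fp[OF that] \<eta>' ..
   thus ?thesis by (metis flip_flip flip_simps(4,7))
  qed
  have c1: "?V \<bullet> x = (\<Sum>i<n. ?V $ i * x $ i)" using Lc by (simp add: scalar_prod_def atLeast0LessThan x_def)
  have c2: "?V \<bullet> x = (\<Sum>i<n. ?V $ i * p $ i)"
  proof -
   have "?V \<bullet> x = p \<bullet> ?V" unfolding x_def p_def by (rule scalar_prod_mult_mat_vec[OF Jc(1) V V])
   also have "\<dots> = (\<Sum>i<n. ?V $ i * p $ i)" using v(1) by (simp add: scalar_prod_def atLeast0LessThan mult.commute)
   finally show ?thesis .
  qed
  have fc: "flip (?V \<bullet> x) = [:\<eta>:] * (?V \<bullet> x)"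
  proof -
   have "flip (?V \<bullet> x) = (\<Sum>i<n. ?V $ i * flip (x $ i))"
    unfolding c1 flip_simps using fV by (intro sum.cong) auto
   also have "\<dots> = [:\<eta>:] * (?V \<bullet> x)" unfolding c2 sum_distrib_left
    using fx by (intro sum.cong) (auto simp: mult_ac)
   finally show ?thesis .
  qed
  have DHij: "det L * H $$ (i,j) = (?V \<bullet> x) * ?J $$ (i,j) - x $ i * p $ j" if "i < n" "j < n" for i j
  proof -
   have "det L * H $$ (i,j) = (det L \<cdot>\<^sub>m H) $$ (i,j)" using that HC by simp
   also have "\<dots> = (?V \<bullet> x) * ?J $$ (i,j) - x $ i * p $ j"
    unfolding DH x_def[symmetric] p_def[symmetric] using that Lc by (simp add: x_def p_def)
   finally show ?thesis .
  qed
  have "flip (det L) * flip (H $$ (j,i)) = [:\<eta>:] * ([:\<eta>:] * ((?V \<bullet> x) * ?J $$ (i,j) - x $ i * p $ j))"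
   unfolding flip_simps(4)[symmetric] DHij[OF ij(2,1)]
   unfolding flip_simps(2,4) fc fJ[OF ij] fx[OF ij(2)] fp[OF ij(1)] by (simp only: algebra_simps)
  also have "\<dots> = det L * H $$ (i,j)" unfolding \<eta>' DHij[OF ij] ..
  finally have e1: "flip (det L) * flip (H $$ (j,i)) = det L * H $$ (i,j)" .
  have sg: "[:(-1) ^ k:] * ([:(-1) ^ k:] * q) = q" for k and q :: "complex poly"
   by (simp add: power_mult_distrib[symmetric])
  have "flip (det L) = [:(-1) ^ ?a:] * det L"
   unfolding alternating_det_flip[OF alt_pencilD(3)[OF L(1)]] alternating_order[OF alt_pencilD(3)[OF L(1)] L(2)] oL ..
  hence "det L * ([:(-1) ^ ?a:] * flip (H $$ (j,i))) = det L * H $$ (i,j)" using e1 by (simp only: mult_ac)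
  hence e2: "[:(-1) ^ ?a:] * flip (H $$ (j,i)) = H $$ (i,j)" using L(2) by (metis mult_left_cancel)
  have Hij: "H $$ (i,j) = ?s ^ h * C2 $$ (i,j)" if "i < n" "j < n" for i j unfolding H using that HC by (simp del: power.simps)
  have fs: "flip (?s ^ h) = [:(-1) ^ h:] * ?s ^ h"
  proof -
   have "flip (?s ^ h) = (- ?s) ^ h" by simp
   also have "\<dots> = (-1) ^ h * ?s ^ h" by (rule power_minus)
   also have "(-1 :: complex poly) ^ h = [:(-1) ^ h:]" by (metis minus_pCons minus_zero one_pCons poly_const_pow)
   finally show ?thesis .
  qed
  have "?s ^ h * ([:(-1) ^ ?a:] * ([:(-1) ^ h:] * flip (C2 $$ (j,i)))) = ?s ^ h * C2 $$ (i,j)"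
   using e2 unfolding Hij[OF ij] Hij[OF ij(2,1)] flip_simps(4) fs by (simp only: mult_ac)
  moreover have "?s ^ h ~= 0" by simp
  ultimately have e3: "[:(-1) ^ ?a:] * ([:(-1) ^ h:] * flip (C2 $$ (j,i))) = C2 $$ (i,j)" by (metis mult_left_cancel)
  have "(-1 :: complex) ^ ?a * (-1) ^ h = (-1) ^ (m2 + 1)"
  proof -
   have "even (?a + h) = even (m2 + 1)" using m2(3) m(2) by presburger
   thus ?thesis unfolding power_add[symmetric] by (simp only: minus_one_power_iff)
  qed
  hence "[:(-1) ^ (m2 + 1):] * flip (C2 $$ (j,i)) = C2 $$ (i,j)" using e3 by (simp add: mult.commute)
  thus ?thesis using sg[of "m2 + 1" "flip (C2 $$ (j,i))"] by simp
 qed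
 show ?thesis using that[OF HC H DH m2 C20] fl bg2 by blast
qed

text \<open>In the \<open>\<top>\<close>-odd case with an odd largest multiplicity, take \<open>E = vw\<^sup>T - wv\<^sup>T\<close>. To lowest order, the determinant
 is \<open>w\<^sup>T H w\<close>. If \<open>m2\<close> is odd, the leading coefficient of \<open>H\<close> is symmetric and this has the least
 conceivable order. If \<open>m2\<close> is even, it is skew-symmetric, one order is lost, and the repaired entry
 \<open>m2 + 1\<close> is found in the adjugate, as in the step of rank one.\<close>

lemma skew_step_odd:
 assumes L: "alt_pencil T_odd n L" "det L ~= 0" and ne: "2 <= blocks_ge L 0 1"
  and C: "C \<in> Mat n" "adj_mat L = [:0,1:] ^ e \<cdot>\<^sub>m C"
  and d: "poly d 0 ~= 0" "det L = [:0,1:] ^ (e + m) * d" and m: "1 <= m" "odd m" "m <= n"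
  and bg: "!!k. 1 <= k ==> 0 < blocks_ge L 0 k \<longleftrightarrow> k <= m"
  and v: "v \<in> Vec n" "v \<bullet> (coeff_mat 0 C *\<^sub>v v) ~= 0"
 shows "\<exists>v \<in> Vec n. \<exists>\<gamma> \<in> Vec n. \<exists>\<delta> \<in> Vec n. det (L + pair_pert T_odd n v \<gamma> \<delta>) ~= 0 \<and>
  (\<forall>k\<ge>1. blocks_ge (L + pair_pert T_odd n v \<gamma> \<delta>) 0 k = target T_odd n 2 (blocks_ge L 0) k)"
proof -
 note Lp = alt_pencilD(1)[OF L(1)] and Lc = alt_pencilD(2)[OF L(1)]
 let ?s = "[:0,1:] :: complex poly" and ?\<nu> = "blocks_ge L 0" and ?J = "adj_mat L" and ?V = "cvec v" and ?K = "pair_bound T_odd n"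
 note adm = admissible_blocks[OF L]
 obtain H C2 h m2 where H: "H \<in> Mat n" "C2 \<in> Mat n" "H = ?s ^ h \<cdot>\<^sub>m C2"
  and DH: "det L \<cdot>\<^sub>m H = (?V \<bullet> (?J *\<^sub>v ?V)) \<cdot>\<^sub>m ?J - outer (?J *\<^sub>v ?V) (?J\<^sup>T *\<^sub>v ?V)"
  and m2: "1 <= m2" "m2 <= n" "e = h + m2" and nz: "coeff_mat 0 C2 ~= 0\<^sub>m n n"
  and fl': "\<forall>i<n. \<forall>j<n. flip (C2 $$ (j,i)) = [:(-1) ^ (m2 + 1):] * C2 $$ (i,j)"
  and bg2': "\<forall>k\<ge>1. 2 <= ?\<nu> k \<longleftrightarrow> k <= m2"
  by (rule adjugate_increment[OF L ne C d m bg v])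
 have fl: "flip (C2 $$ (j,i)) = [:(-1) ^ (m2 + 1):] * C2 $$ (i,j)" if "i < n" "j < n" for i j using fl' that by blast
 have bg2: "2 <= ?\<nu> k \<longleftrightarrow> k <= m2" if "1 <= k" for k using bg2' that by blast
 have V: "?V \<in> Vec n" using v by auto
 have Jc: "?J \<in> Mat n" "?J\<^sup>T \<in> Mat n" using Lc by auto
 define cc where "cc = ?V \<bullet> (C *\<^sub>v ?V)"
 have c: "?V \<bullet> (?J *\<^sub>v ?V) = ?s ^ e * cc" unfolding C(2) cc_def by (rule smult_mat_form[OF C(1) V V])
 have cc0: "poly cc 0 ~= 0" unfolding cc_def poly_0_coeff_0 coeff_cvec_form[OF C(1) v(1) v(1)] using v(2) .
 have oL: "order 0 (det L) = e + m" using order_zero_mult[OF d(2,1)] by simp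
 define S where "S = (\<Sum>k = 1..?K. ?\<nu> k - 2)"
 have S: "S = h"
 proof -
  have K: "n <= ?K" "m <= ?K" "m2 <= ?K" using m(3) m2(2) by auto
  have two: "0 < ?\<nu> k - 1 \<longleftrightarrow> k <= m2" if "1 <= k" for k using bg2[OF that] by auto
  have e2: "(\<Sum>k = 1..?K. ?\<nu> k - 1 - 1) = (\<Sum>k = 1..?K. ?\<nu> k - 2)"
   by (simp add: numeral_2_eq_2 del: pair_bound.simps)
  show ?thesis
   using truncated_sum[OF bg K(2)] truncated_sum[OF two K(3)] blocks_ge_sum[OF Lp L(2) K(1), of 0] oL m2(3)
   unfolding e2 S_def by linarith
 qed
 have rep_index: "k = m2 + 1 \<and> odd k" if "repaired T_odd 2 ?\<nu> k" for k
 proof -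
  have k: "2 <= k" "odd k" "?\<nu> k < 2" "2 < ?\<nu> (k - 1)" using that by auto
  hence "1 <= k" "1 <= k - 1" "\<not> 2 <= ?\<nu> k" "2 <= ?\<nu> (k - 1)" by auto
  hence "\<not> k <= m2" "k - 1 <= m2" using bg2[of k] bg2[of "k - 1"] by blast+
  thus ?thesis using k(2) by auto
 qed
 define C20 where "C20 = coeff_mat 0 C2"
 define C21 where "C21 = coeff_mat 1 C2"
 have CC: "C20 \<in> Mat n" "C21 \<in> Mat n" unfolding C20_def C21_def using H by auto
 have C20s: "C20 $$ (j,i) = (-1) ^ (m2 + 1) * C20 $$ (i,j)" and C21s: "- C21 $$ (j,i) = (-1) ^ (m2 + 1) * C21 $$ (i,j)"
  if "i < n" "j < n" for i j
  using arg_cong[OF fl[OF that], of "\<lambda>p. coeff p 0"] arg_cong[OF fl[OF that], of "\<lambda>p. coeff p 1"] that H(2)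
  unfolding C20_def C21_def by (auto simp: coeff_flip)
 have "C20 ~= 0\<^sub>m n n" using nz C20_def by simp
 then obtain i0 j0 where ij0: "i0 < n" "j0 < n" "C20 $$ (i0,j0) ~= 0"
  using nonzero_entry[OF CC(1)] by blast
 \<comment> \<open>Replacing \<open>w\<close> by \<open>-w\<close> makes the intermediate determinant nonzero.\<close>
 define A where "A = (\<lambda>w. cvec w \<bullet> (C *\<^sub>v ?V))"
 define B where "B = (\<lambda>w. ?V \<bullet> (C *\<^sub>v cvec w))"
 define Q where "Q = (\<lambda>w. cvec w \<bullet> (C2 *\<^sub>v cvec w))"
 have sign: "\<exists>w. (w = w0 \<or> w = - w0) \<and> det L + cvec w \<bullet> (?J *\<^sub>v ?V) ~= 0" if "w0 \<in> Vec n" for w0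
 proof (rule ccontr)
  assume a: "\<not> ?thesis"
  have "cvec (- w0) = - cvec w0" using that by (intro eq_vecI) auto
  hence "cvec (- w0) \<bullet> (?J *\<^sub>v ?V) = - (cvec w0 \<bullet> (?J *\<^sub>v ?V))"
   using that Lc V by simp
  moreover have "det L + cvec w0 \<bullet> (?J *\<^sub>v ?V) = 0" "det L + cvec (- w0) \<bullet> (?J *\<^sub>v ?V) = 0" using a by blast+
  ultimately have "det L + det L = 0" by (metis add.right_inverse add_0_right add_eq_0_iff minus_minus)
  thus False using L(2) by simp
 qed
 have main: "det (L + pair_pert T_odd n v w (0\<^sub>v n)) = ?s ^ h * (?s ^ m2 * (?s ^ m * d + A w - B w) + Q w)"
  if w: "w \<in> Vec n" and nz: "det L + cvec w \<bullet> (?J *\<^sub>v ?V) ~= 0" for w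
 proof -
  let ?W = "cvec w"
  have W: "?W \<in> Vec n" "- ?W \<in> Vec n" using w by auto
  have oc: "outer ?V ?W \<in> Mat n" "outer (- ?W) ?V \<in> Mat n" using W V by auto
  have neg: "x \<bullet> (?J *\<^sub>v (- ?W)) = - (x \<bullet> (?J *\<^sub>v ?W))" if "x \<in> Vec n" for x
  proof -
   have "?J *\<^sub>v (- ?W) = - (?J *\<^sub>v ?W)" using W Lc
    by (intro eq_vecI) (auto simp: scalar_prod_def sum_negf)
   thus ?thesis using that Lc W by (simp add: scalar_prod_uminus_right)
  qed
  have q: "?W \<bullet> (H *\<^sub>v ?W) = ?s ^ h * Q w" unfolding H(3) Q_def by (rule smult_mat_form[OF H(2) W(1) W(1)])
  have xp: "?J *\<^sub>v ?V \<in> Vec n" "?J\<^sup>T *\<^sub>v ?V \<in> Vec n" using Jc V by auto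
  have Dq: "det L * (?W \<bullet> (H *\<^sub>v ?W)) = (?V \<bullet> (?J *\<^sub>v ?V)) * (?W \<bullet> (?J *\<^sub>v ?W)) - (?W \<bullet> (?J *\<^sub>v ?V)) * (?V \<bullet> (?J *\<^sub>v ?W))"
  proof -
   have "det L * (?W \<bullet> (H *\<^sub>v ?W)) = ?W \<bullet> ((det L \<cdot>\<^sub>m H) *\<^sub>v ?W)" by (rule smult_mat_form[OF H(1) W(1) W(1), symmetric])
   also have "(det L \<cdot>\<^sub>m H) *\<^sub>v ?W = ((?V \<bullet> (?J *\<^sub>v ?V)) \<cdot>\<^sub>m ?J) *\<^sub>v ?W - outer (?J *\<^sub>v ?V) (?J\<^sup>T *\<^sub>v ?V) *\<^sub>v ?W"
    unfolding DH by (rule minus_mult_distrib_mat_vec[OF _ outer_carrier[OF xp] W(1)]) (use Jc in simp)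
   also have "\<dots> = (?V \<bullet> (?J *\<^sub>v ?V)) \<cdot>\<^sub>v (?J *\<^sub>v ?W) - (?V \<bullet> (?J *\<^sub>v ?W)) \<cdot>\<^sub>v (?J *\<^sub>v ?V)"
    unfolding outer_mult_vec[OF xp W(1)] smult_mat_mult_vec[OF Jc(1) W(1)]
     scalar_prod_mult_mat_vec[OF Jc(1) W(1) V, symmetric] ..
   finally show ?thesis using W xp Jc by (subst (asm) scalar_prod_minus_distrib[of _ n]) (auto simp: mult.commute)
  qed
  have "det L * det (L + pair_pert T_odd n v w (0\<^sub>v n)) =
    (det L + ?W \<bullet> (?J *\<^sub>v ?V)) * (det L - ?V \<bullet> (?J *\<^sub>v ?W)) + (?V \<bullet> (?J *\<^sub>v ?V)) * (?W \<bullet> (?J *\<^sub>v ?W))"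
   unfolding pair_pert_skew[OF v(1) w] assoc_add_mat[OF Lc oc, symmetric] skew_pair_det[OF Lc L(2) V W V nz] neg[OF V] neg[OF W(1)]
   by simp
  also have "\<dots> = det L * (det L + ?W \<bullet> (?J *\<^sub>v ?V) - ?V \<bullet> (?J *\<^sub>v ?W)) + det L * (?W \<bullet> (H *\<^sub>v ?W))"
   unfolding Dq by (simp add: algebra_simps)
  also have "\<dots> = det L * (det L + ?W \<bullet> (?J *\<^sub>v ?V) - ?V \<bullet> (?J *\<^sub>v ?W) + ?W \<bullet> (H *\<^sub>v ?W))"
   by (simp only: distrib_left)
  finally have "det (L + pair_pert T_odd n v w (0\<^sub>v n)) = det L + ?W \<bullet> (?J *\<^sub>v ?V) - ?V \<bullet> (?J *\<^sub>v ?W) + ?W \<bullet> (H *\<^sub>v ?W)"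
   using L(2) by (metis mult_left_cancel)
  also have "\<dots> = ?s ^ h * (?s ^ m2 * (?s ^ m * d + A w - B w) + Q w)"
  proof -
   have Jw: "?W \<bullet> (?J *\<^sub>v ?V) = ?s ^ e * A w" "?V \<bullet> (?J *\<^sub>v ?W) = ?s ^ e * B w"
    unfolding C(2) A_def B_def by (rule smult_mat_form[OF C(1) W(1) V], rule smult_mat_form[OF C(1) V W(1)])
   show ?thesis unfolding q Jw d(2) m2(3) by (simp add: power_add algebra_simps del: power.simps)
  qed
  finally show ?thesis .
 qed
 have coeffQ: "coeff (Q w) k = w \<bullet> (coeff_mat k C2 *\<^sub>v w)" if "w \<in> Vec n" for w k
  unfolding Q_def by (rule coeff_cvec_form[OF H(2) that that])
 have negform: "(- w) \<bullet> (X *\<^sub>v (- w)) = w \<bullet> (X *\<^sub>v w)" if "w \<in> Vec n" "X \<in> Mat n" for w and X :: "complex mat"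
  unfolding form_sum[OF that(2) uminus_carrier_vec[THEN iffD2, OF that(1)] uminus_carrier_vec[THEN iffD2, OF that(1)]] form_sum[OF that(2,1,1)]
  using that by (intro sum.cong) auto
 show ?thesis
 proof (cases "odd m2")
  case True
  have "C20 $$ (j0,i0) = C20 $$ (i0,j0)" using C20s[OF ij0(1,2)] True by simp
  hence "C20 $$ (j0,i0) ~= - C20 $$ (i0,j0)" using ij0(3) by simp
  then obtain w0 where w0: "w0 \<in> Vec n" "w0 \<bullet> (C20 *\<^sub>v w0) ~= 0"
   using quadratic_form_nonzero[OF CC(1) ij0(1,2)] by metis
  obtain w where w: "w = w0 \<or> w = - w0" and nzw: "det L + cvec w \<bullet> (?J *\<^sub>v ?V) ~= 0" using sign[OF w0(1)] by blast
  have wc: "w \<in> Vec n" using w w0(1) by auto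
  have "w \<bullet> (C20 *\<^sub>v w) ~= 0" using w w0(2) negform[OF w0(1) CC(1)] by auto
  hence "poly (?s ^ m2 * (?s ^ m * d + A w - B w) + Q w) 0 ~= 0"
   unfolding poly_add poly_lin_power_0[OF m2(1)] using coeffQ[OF wc, of 0] by (simp add: poly_0_coeff_0 C20_def)
  note o = order_zero_mult[OF main[OF wc nzw] this]
  let ?E = "pair_pert T_odd n v w (0\<^sub>v n)"
  have "\<not> repaired T_odd 2 ?\<nu> k" for k
  proof
   assume "repaired T_odd 2 ?\<nu> k"
   from rep_index[OF this] True show False by (metis Suc_eq_plus1 even_Suc)
  qed
  hence "\<forall>k\<ge>1. blocks_ge (L + ?E) 0 k = target T_odd n 2 ?\<nu> k"
   using pair_step_by_order[OF L, of v w "0\<^sub>v n" 0] o S unfolding S_def by (simp del: repaired.simps)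
  thus ?thesis using o v(1) wc zero_carrier_vec by blast
 next
  case False
  hence ev: "even m2" "2 <= m2" using m2(1) by presburger+
  have skew0: "C20 $$ (j,i) = - C20 $$ (i,j)" and sym1: "C21 $$ (j,i) = C21 $$ (i,j)" if "i < n" "j < n" for i j
   using C20s[OF that] C21s[OF that] ev(1) by auto
  define x' where "x' = C *\<^sub>v ?V"
  define p' where "p' = C\<^sup>T *\<^sub>v ?V"
  have Ct: "C\<^sup>T \<in> Mat n" "C2\<^sup>T \<in> Mat n" using C H by auto
  have x'p': "x' \<in> Vec n" "p' \<in> Vec n" unfolding x'_def p'_def using C Ct V by auto
  have Jx: "?J *\<^sub>v ?V = ?s ^ e \<cdot>\<^sub>v x'" unfolding C(2) x'_def by (rule smult_mat_mult_vec[OF C(1) V])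
  have Jt: "?J\<^sup>T = ?s ^ e \<cdot>\<^sub>m C\<^sup>T" unfolding C(2) using C(1) by (intro eq_matI) (auto simp del: power.simps)
  have Jp: "?J\<^sup>T *\<^sub>v ?V = ?s ^ e \<cdot>\<^sub>v p'" unfolding Jt p'_def by (rule smult_mat_mult_vec[OF Ct(1) V])
  have "\<exists>i<n. \<exists>j<n. C21 $$ (i,j) ~= 0"
  proof (rule ccontr)
   assume a: "\<not> ?thesis"
   have "coeff_mat 0 C2 = 0\<^sub>m n n"
   proof (rule second_coeff_nonzero[OF Lp L(2) H(2)])
    fix i j assume ij: "i < n" "j < n"
    show "coeff (C2 $$ (i,j)) 1 = 0" using a ij H(2) unfolding C21_def by auto
    have "det L * (L * H) $$ (i,j) = (L * (det L \<cdot>\<^sub>m H)) $$ (i,j)"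
     unfolding mult_smult_distrib[OF Lc H(1)] using ij Lc H by simp
    also have "L * (det L \<cdot>\<^sub>m H) = L * ((?s ^ e * cc) \<cdot>\<^sub>m ?J) - L * outer (?s ^ e \<cdot>\<^sub>v x') (?s ^ e \<cdot>\<^sub>v p')"
     unfolding DH unfolding c unfolding Jx Jp by (rule mult_minus_distrib_mat[OF Lc]) (use Jc x'p' in auto)
    also have "L * ((?s ^ e * cc) \<cdot>\<^sub>m ?J) = (?s ^ e * cc) \<cdot>\<^sub>m (det L \<cdot>\<^sub>m 1\<^sub>m n)"
     unfolding mult_smult_distrib[OF Lc Jc(1)] adj_mat(2)[OF Lc] ..
    also have "L * outer (?s ^ e \<cdot>\<^sub>v x') (?s ^ e \<cdot>\<^sub>v p') = outer (det L \<cdot>\<^sub>v ?V) (?s ^ e \<cdot>\<^sub>v p')"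
    proof -
     have "L *\<^sub>v (?s ^ e \<cdot>\<^sub>v x') = det L \<cdot>\<^sub>v ?V"
      unfolding Jx[symmetric] assoc_mult_mat_vec[OF Lc Jc(1) V, symmetric] adj_mat(2)[OF Lc]
      by (rule smult_one_mult_mat_vec[OF V])
     thus ?thesis using mult_outer[OF Lc, of "?s ^ e \<cdot>\<^sub>v x'" "?s ^ e \<cdot>\<^sub>v p'"] x'p' by simp
    qed
    finally have "det L * (L * H) $$ (i,j) = det L * (?s ^ e * (cc * (if i = j then 1 else 0) - ?V $ i * p' $ j))"
     using ij V x'p' v(1) by (simp add: algebra_simps del: power.simps)
    hence e1: "(L * H) $$ (i,j) = ?s ^ e * (cc * (if i = j then 1 else 0) - ?V $ i * p' $ j)"
     using L(2) by (metis mult_left_cancel)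
    have "(L * H) $$ (i,j) = ?s ^ h * (L * C2) $$ (i,j)"
     unfolding H(3) mult_smult_distrib[OF Lc H(2)] using ij Lc H by (simp del: power.simps)
    hence "?s ^ h * (L * C2) $$ (i,j) = ?s ^ h * (?s ^ m2 * (cc * (if i = j then 1 else 0) - ?V $ i * p' $ j))"
     unfolding e1 m2(3) by (simp only: power_add mult.assoc)
    moreover have "?s ^ h ~= 0" by simp
    ultimately have "(L * C2) $$ (i,j) = ?s ^ m2 * (cc * (if i = j then 1 else 0) - ?V $ i * p' $ j)"
     by (metis mult_left_cancel)
    thus "?s ^ 2 dvd (L * C2) $$ (i,j)" using le_imp_power_dvd[OF ev(2), of ?s] by (metis dvd_mult2)
   qed
   thus False using nz by simp
  qed
  then obtain i j where ij: "i < n" "j < n" "C21 $$ (i,j) ~= 0" by blast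
  have "C21 $$ (j,i) ~= - C21 $$ (i,j)" unfolding sym1[OF ij(1,2)] using ij(3) by simp
  then obtain y where y: "y \<in> Vec n" "y \<bullet> (C21 *\<^sub>v y) ~= 0"
   using quadratic_form_nonzero[OF CC(2) ij(1,2)] by metis
  have "(C20 *\<^sub>v unit_vec n j0) $ i0 ~= 0" using ij0 CC by simp
  from polyfun_common_nonzero[OF polyfun_mult_vec[OF CC(1) ij0(1)] unit_vec_carrier this polyfun_form[OF CC(2)] y]
  obtain w0 where w0: "w0 \<in> Vec n" "(C20 *\<^sub>v w0) $ i0 ~= 0" "w0 \<bullet> (C21 *\<^sub>v w0) ~= 0" by blast
  obtain w where w: "w = w0 \<or> w = - w0" and nzw: "det L + cvec w \<bullet> (?J *\<^sub>v ?V) ~= 0" using sign[OF w0(1)] by blast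
  have wc: "w \<in> Vec n" using w w0(1) by auto
  have "(C20 *\<^sub>v (- w0)) $ i0 = - (C20 *\<^sub>v w0) $ i0" using CC ij0 w0(1) by (simp add: scalar_prod_uminus_right)
  hence y0: "(C20 *\<^sub>v w) $ i0 ~= 0" using w w0(2) by auto
  have q1nz: "w \<bullet> (C21 *\<^sub>v w) ~= 0" using w w0(3) negform[OF w0(1) CC(2)] by auto
  have "coeff (Q w) 0 = 0" using coeffQ[OF wc, of 0] skew_form_0[OF CC(1) wc skew0] unfolding C20_def by simp
  then obtain Q1 where Q1: "Q w = ?s * Q1" by (cases "Q w") auto
  have "poly Q1 0 = coeff (Q w) 1" unfolding Q1 poly_0_coeff_0 by simp
  hence Q10: "poly Q1 0 ~= 0" using coeffQ[OF wc, of 1] q1nz unfolding C21_def by simp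
  define G where "G = ?s ^ (m2 - 1) * (?s ^ m * d + A w - B w) + Q1"
  have "m2 = Suc (m2 - 1)" using m2(1) by simp
  hence sm2: "?s ^ m2 = ?s * ?s ^ (m2 - 1)" by (metis power_Suc)
  let ?E = "pair_pert T_odd n v w (0\<^sub>v n)"
  have d2: "det (L + ?E) = ?s ^ (h + 1) * G"
   unfolding main[OF wc nzw] Q1 G_def sm2 by (simp add: power_add algebra_simps del: power.simps)
  have "1 <= m2 - 1" using ev(2) by simp
  hence G0: "poly G 0 ~= 0" unfolding G_def poly_add using Q10 poly_lin_power_0 by (metis add_0)
  note o = order_zero_mult[OF d2 G0]
  have rep: "repaired T_odd 2 ?\<nu> (m2 + 1) \<and> m2 + 1 <= ?K"
  proof -
   have "2 <= ?\<nu> m2" using bg2[OF m2(1)] by simp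
   moreover have "?\<nu> (m2 + 1) < 2" using bg2[of "m2 + 1"] by simp
   moreover have "0 < ?\<nu> (m2 + 1)"
   proof -
    have "m2 <= m" using bg[OF m2(1)] calculation(1) by simp
    hence "m2 + 1 <= m" using m(2) ev(1) by (cases "m2 = m") auto
    thus ?thesis using bg[of "m2 + 1"] by simp
   qed
   moreover have "even (?\<nu> m2) = even (?\<nu> (Suc m2))" using admissible_pair[OF adm m2(1)] ev(1) by simp
   ultimately have "?\<nu> (m2 + 1) = 1" "odd (?\<nu> m2)" "2 < ?\<nu> m2" by (simp_all, presburger+)
   thus ?thesis using ev m2(2) by simp
  qed
  \<comment> \<open>The diagonal entry \<open>i0\<close> of the adjugate has order \<open>h - m2\<close>.\<close>
  have "0 < blocks_ge (L + ?E) 0 (m2 + 1)"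
  proof -
   let ?W = "cvec w" and ?L2 = "L + ?E"
   have W: "?W \<in> Vec n" using wc by auto
   note L2 = alt_pencil_add[OF L(1) alt_pair_pert[of T_odd n v w "0\<^sub>v n"]]
   define \<Delta> where "\<Delta> = det L + ?W \<bullet> (?J *\<^sub>v ?V) - ?V \<bullet> (?J *\<^sub>v ?W) + ?W \<bullet> (H *\<^sub>v ?W)"
   have "\<Delta> = ?s ^ h * (?s ^ m2 * (?s ^ m * d + A w - B w) + Q w)"
   proof -
    have Jw: "?W \<bullet> (?J *\<^sub>v ?V) = ?s ^ e * A w" "?V \<bullet> (?J *\<^sub>v ?W) = ?s ^ e * B w"
     unfolding C(2) A_def B_def by (rule smult_mat_form[OF C(1) W V], rule smult_mat_form[OF C(1) V W])
    have q: "?W \<bullet> (H *\<^sub>v ?W) = ?s ^ h * Q w" unfolding H(3) Q_def by (rule smult_mat_form[OF H(2) W W])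
    show ?thesis unfolding \<Delta>_def q Jw d(2) m2(3) by (simp add: power_add algebra_simps del: power.simps)
   qed
   hence D2: "det (L + (outer ?V ?W + outer (- ?W) ?V)) = \<Delta>" "\<Delta> ~= 0"
    using main[OF wc nzw] o unfolding pair_pert_skew[OF v(1) wc] by auto
   have \<Delta>: "\<Delta> = ?s ^ (h + 1) * G" using D2(1) d2 unfolding pair_pert_skew[OF v(1) wc] by simp
   define z where "z = C2 *\<^sub>v ?W"
   define z' where "z' = C2\<^sup>T *\<^sub>v ?W"
   have zz: "z \<in> Vec n" "z' \<in> Vec n" unfolding z_def z'_def using H Ct W by auto
   have Hz: "H *\<^sub>v ?W = ?s ^ h \<cdot>\<^sub>v z" unfolding H(3) z_def by (rule smult_mat_mult_vec[OF H(2) W])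
   have Ht: "H\<^sup>T = ?s ^ h \<cdot>\<^sub>m C2\<^sup>T" unfolding H(3) using H(2) by (intro eq_matI) (auto simp del: power.simps)
   have Hz': "H\<^sup>T *\<^sub>v ?W = ?s ^ h \<cdot>\<^sub>v z'" unfolding Ht z'_def by (rule smult_mat_mult_vec[OF Ct(2) W])
   have C20e: "C20 = ev_mat 0 C2" unfolding C20_def by (simp add: poly_0_coeff_0)
   have z0: "poly (z $ i0) 0 = (C20 *\<^sub>v w) $ i0" unfolding z_def poly_cvec_mult[OF H(2) wc ij0(1)] C20e ..
   have z0': "poly (z' $ i0) 0 = - (C20 *\<^sub>v w) $ i0"
   proof -
    have "poly (z' $ i0) 0 = (\<Sum>l<n. C20 $$ (l,i0) * w $ l)"
     unfolding z'_def poly_cvec_mult[OF Ct(2) wc ij0(1)]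
     using mult_mat_vec_sum[of "ev_mat 0 (C2\<^sup>T)" n n w i0] H(2) wc ij0 unfolding C20e by simp
    also have "\<dots> = (\<Sum>l<n. - (C20 $$ (i0,l) * w $ l))"
    proof (intro sum.cong refl)
     fix l assume "l \<in> {..<n}"
     hence "C20 $$ (l,i0) = - C20 $$ (i0,l)" using skew0[of i0 l] ij0 by simp
     thus "C20 $$ (l,i0) * w $ l = - (C20 $$ (i0,l) * w $ l)" by simp
    qed
    also have "\<dots> = - (C20 *\<^sub>v w) $ i0" unfolding mult_mat_vec_sum[OF CC(1) wc ij0(1)] sum_negf ..
    finally show ?thesis .
   qed
   let ?a = "adj_mat ?L2 $$ (i0,i0)"
   have "(?s ^ e * cc) \<cdot>\<^sub>m adj_mat ?L2 = \<Delta> \<cdot>\<^sub>m H + outer (?s ^ e \<cdot>\<^sub>v x' + ?s ^ h \<cdot>\<^sub>v z) (?s ^ e \<cdot>\<^sub>v p' - ?s ^ h \<cdot>\<^sub>v z')"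
    using skew_pair_adj(1)[OF Lc L(2) V W H(1) DH refl, folded \<Delta>_def, OF D2]
    unfolding c unfolding Jx Jp Hz Hz' pair_pert_skew[OF v(1) wc] .
   from arg_cong[OF this, of "\<lambda>M. M $$ (i0,i0)"]
   have "(?s ^ e * cc) * ?a = \<Delta> * H $$ (i0,i0) + (?s ^ e * x' $ i0 + ?s ^ h * z $ i0) * (?s ^ e * p' $ i0 - ?s ^ h * z' $ i0)"
    using ij0(1) carrier_matD[OF adj_carrier[OF alt_pencilD(2)[OF L2]]] carrier_matD[OF H(1)]
     carrier_vecD[OF x'p'(1)] carrier_vecD[OF x'p'(2)] carrier_vecD[OF zz(1)] carrier_vecD[OF zz(2)]
    by (simp del: power.simps)
   also have "\<dots> = ?s ^ (h + h) * (?s * G * C2 $$ (i0,i0) + (?s ^ m2 * x' $ i0 + z $ i0) * (?s ^ m2 * p' $ i0 - z' $ i0))"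
   proof -
    have "H $$ (i0,i0) = ?s ^ h * C2 $$ (i0,i0)" unfolding H(3) using H(2) ij0 by (simp del: power.simps)
    thus ?thesis unfolding \<Delta> m2(3) by (simp add: power_add algebra_simps del: power.simps) (simp add: algebra_simps)?
   qed
   finally have key: "?s ^ e * (cc * ?a) =
    ?s ^ (h + h) * (?s * G * C2 $$ (i0,i0) + (?s ^ m2 * x' $ i0 + z $ i0) * (?s ^ m2 * p' $ i0 - z' $ i0))"
    by (simp only: mult.assoc)
   have "poly (?s * G * C2 $$ (i0,i0) + (?s ^ m2 * x' $ i0 + z $ i0) * (?s ^ m2 * p' $ i0 - z' $ i0)) 0 =
     (C20 *\<^sub>v w) $ i0 * (C20 *\<^sub>v w) $ i0"
    unfolding poly_add poly_mult[of "_ + _"] poly_diff poly_add poly_lin_power_0[OF m2(1)] z0 z0' by simp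
   hence nzk: "poly (?s * G * C2 $$ (i0,i0) + (?s ^ m2 * x' $ i0 + z $ i0) * (?s ^ m2 * p' $ i0 - z' $ i0)) 0 ~= 0"
    using y0 by simp
   note ok = order_zero_mult[OF key nzk]
   have anz: "?a ~= 0" and ccnz: "cc ~= 0" using ok by auto
   have "order 0 (?s ^ e * (cc * ?a)) = e + order 0 ?a"
    using ok order_mult[of "?s ^ e" "cc * ?a" 0] order_mult[of cc ?a 0] anz ccnz order_0I[OF cc0] order_lin_power[of 0 e]
    by (simp del: power.simps)
   hence "order 0 ?a + (m2 + 1) <= order 0 (det ?L2)" using ok o m2(3) by simp
   from blocks_ge_pos_of_adj[OF alt_pencilD(1)[OF L2] _ ij0(1) ij0(1) anz this] show ?thesis using o by simp
  qed
  hence rp: "0 < blocks_ge (L + ?E) 0 k" if "repaired T_odd 2 ?\<nu> k" for k using rep_index[OF that] by simp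
  have "order 0 (det (L + ?E)) <= S + (if repaired T_odd 2 ?\<nu> (m2 + 1) \<and> m2 + 1 <= ?K then 1 else 0)"
   using rep o S by (simp del: repaired.simps pair_bound.simps)
  hence "\<forall>k\<ge>1. blocks_ge (L + ?E) 0 k = target T_odd n 2 ?\<nu> k"
   using pair_step_by_order[OF L _ _ rp, of "m2 + 1"] o unfolding S_def by blast
  thus ?thesis using o v(1) wc zero_carrier_vec by blast
 qed
qed

text \<open>In the \<open>\<top>\<close>-even case two steps of rank one do. In the \<open>\<top>\<close>-odd case they would not, because a step of odd
 rank creates a multiplicity 1.\<close>

theorem pair_zero_step:
 assumes L: "alt_pencil \<sigma> n L" "det L ~= 0"
 shows "\<exists>v \<in> Vec n. \<exists>\<gamma> \<in> Vec n. \<exists>\<delta> \<in> Vec n. det (L + pair_pert \<sigma> n v \<gamma> \<delta>) ~= 0 \<and>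
  (\<forall>k\<ge>1. blocks_ge (L + pair_pert \<sigma> n v \<gamma> \<delta>) 0 k = target \<sigma> n 2 (blocks_ge L 0) k)"
proof -
 note Lc = alt_pencilD(2)[OF L(1)]
 have via_sum: ?thesis if u: "u \<in> Vec n" "u' \<in> Vec n" "det (L + rank_one_pert \<sigma> u + rank_one_pert \<sigma> u') ~= 0"
  "!!k. 1 <= k ==> blocks_ge (L + rank_one_pert \<sigma> u + rank_one_pert \<sigma> u') 0 k = target \<sigma> n 2 (blocks_ge L 0) k" for u u'
 proof -
  obtain v \<gamma> \<delta> where p: "v \<in> Vec n" "\<gamma> \<in> Vec n" "\<delta> \<in> Vec n"
   "pair_pert \<sigma> n v \<gamma> \<delta> = rank_one_pert \<sigma> u + rank_one_pert \<sigma> u'"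
   using pair_pert_rank_one_sum[OF u(1,2)] by blast
  have "L + pair_pert \<sigma> n v \<gamma> \<delta> = L + rank_one_pert \<sigma> u + rank_one_pert \<sigma> u'"
   unfolding p(4) using assoc_add_mat[OF Lc rank_one_pert_carrier rank_one_pert_carrier] u by metis
  thus ?thesis using p(1-3) u(3,4) by metis
 qed
 have zero: "L + rank_one_pert \<sigma> u + rank_one_pert \<sigma> (0\<^sub>v n) = L + rank_one_pert \<sigma> u" if "u \<in> Vec n" for u
  unfolding rank_one_pert_0 using Lc rank_one_pert_carrier[OF that, of \<sigma>] by simp
 show ?thesis
 proof (cases \<sigma>)
  case T_even
  obtain u where u: "u \<in> Vec n" "det (L + rank_one_pert \<sigma> u) ~= 0"
   "!!k. 1 <= k ==> blocks_ge (L + rank_one_pert \<sigma> u) 0 k = target \<sigma> n 1 (blocks_ge L 0) k"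
   using zero_step[OF L] by blast
  obtain u' where u': "u' \<in> Vec n" "det (L + rank_one_pert \<sigma> u + rank_one_pert \<sigma> u') ~= 0"
   "!!k. 1 <= k ==> blocks_ge (L + rank_one_pert \<sigma> u + rank_one_pert \<sigma> u') 0 k = target \<sigma> n 1 (blocks_ge (L + rank_one_pert \<sigma> u) 0) k"
   using zero_step[OF alt_pencil_add[OF L(1) alt_rank_one_pert[OF u(1)]] u(2)] by blast
  have "target \<sigma> n 1 (blocks_ge (L + rank_one_pert \<sigma> u) 0) k = target \<sigma> n 2 (blocks_ge L 0) k" if k: "1 <= k" for k
  proof -
   have "target \<sigma> n 1 (blocks_ge (L + rank_one_pert \<sigma> u) 0) k = target \<sigma> n 1 (target \<sigma> n 1 (blocks_ge L 0)) k"
    using u(3) by (rule target_cong) (use k in auto)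
   also have "\<dots> = target \<sigma> n (1 + 1) (blocks_ge L 0) k"
    using target_compose[OF admissible_blocks[OF L] k, of 1 1] T_even by blast
   finally show ?thesis unfolding one_add_one .
  qed
  thus ?thesis using via_sum[OF u(1) u'(1,2)] u'(3) by metis
 next
  case T_odd
  consider "blocks_ge L 0 1 = 0" | "blocks_ge L 0 1 = 1" | "2 <= blocks_ge L 0 1" by linarith
  thus ?thesis
  proof cases
   case 1
   have "L + rank_one_pert \<sigma> (0\<^sub>v n) + rank_one_pert \<sigma> (0\<^sub>v n) = L" unfolding rank_one_pert_0 using Lc by simp
   thus ?thesis using via_sum[of "0\<^sub>v n" "0\<^sub>v n"] non_eigenvalue_target[OF L 1] L(2) by (metis zero_carrier_vec)
  next
   case 2
   obtain u where u: "u \<in> Vec n" "det (L + rank_one_pert \<sigma> u) ~= 0"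
    "!!k. 1 <= k ==> blocks_ge (L + rank_one_pert \<sigma> u) 0 k = target \<sigma> n 1 (blocks_ge L 0) k"
    using zero_step[OF L] by blast
   have "target \<sigma> n 1 (blocks_ge L 0) k = target \<sigma> n 2 (blocks_ge L 0) k" if k: "1 <= k" for k
   proof -
    have le: "blocks_ge L 0 j <= 1" if "1 <= j" for j using exponents_ge_antimono[OF that, of "finite_partial_mults L 0"] 2 by simp
    have "k = 1 \<or> 1 <= k - 1" using k by auto
    thus ?thesis using le[of k] le[of "k - 1"] k unfolding T_odd by auto
   qed
   thus ?thesis using via_sum[OF u(1) zero_carrier_vec] u(2,3) unfolding zero[OF u(1)] by metis
  next
   case 3
   note Lo = L[unfolded T_odd]
   have ne: "0 < blocks_ge L 0 1" using 3 by simp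
   let ?s = "[:0,1:] :: complex poly" and ?a = "order 0 (det L)"
   obtain C e d where n: "0 < n" and C: "C \<in> Mat n" "adj_mat L = ?s ^ e \<cdot>\<^sub>m C" "ev_mat 0 C ~= 0\<^sub>m n n"
    and d: "poly d 0 ~= 0" "det L = ?s ^ ?a * d" and lt: "e < ?a" and m: "?a - e <= n"
    and bg: "!!k. 1 <= k ==> 0 < blocks_ge L 0 k \<longleftrightarrow> k <= ?a - e"
    by (rule eigenvalue_data[OF alt_pencilD(1)[OF L(1)] L(2) ne, unfolded minus_zero]) blast
   define m' where "m' = ?a - e"
   have m': "1 <= m'" "m' <= n" "?a = e + m'" using lt m unfolding m'_def by auto
   have d': "det L = ?s ^ (e + m') * d" using d(2) unfolding m'(3) .
   define C0 where "C0 = coeff_mat 0 C"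
   have C0c: "C0 \<in> Mat n" unfolding C0_def using C by auto
   have C0e: "C0 = ev_mat 0 C" unfolding C0_def by (simp add: poly_0_coeff_0)
   have sy: "C0 $$ (j,i) = - ((-1) ^ m') * C0 $$ (i,j)" if "i < n" "j < n" for i j
   proof -
    have "flip (C $$ (j,i)) = [:eps T_odd * (-1) ^ m':] * C $$ (i,j)"
     using reduced_adj_flip[OF alt_pencilD(3)[OF Lo(1)] L(2) eps_square C(1,2) _ that] lt unfolding m'_def by simp
    from arg_cong[OF this, of "\<lambda>p. coeff p 0"] show ?thesis using that C(1) unfolding C0_def by (simp add: coeff_flip)
   qed
   have "C0 ~= 0\<^sub>m n n" using C(3) C0e by simp
   then obtain i0 j0 where ij0: "i0 < n" "j0 < n" "C0 $$ (i0,j0) ~= 0"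
    using nonzero_entry[OF C0c] by blast
   show ?thesis
   proof (cases "even m'")
    case True
    have sk: "C0 $$ (j,i) = - C0 $$ (i,j)" if "i < n" "j < n" for i j using sy[OF that] True by simp
    show ?thesis unfolding T_odd
     by (rule skew_step_even[OF Lo ne C(1,2) ij0[unfolded C0_def] d(1) d' m'(1) True m'(2) bg[folded m'_def] sk[unfolded C0_def]])
   next
    case False
    have "C0 $$ (j0,i0) = C0 $$ (i0,j0)" using sy[OF ij0(1,2)] False by simp
    hence "C0 $$ (j0,i0) ~= - C0 $$ (i0,j0)" using ij0(3) by simp
    then obtain v where v: "v \<in> Vec n" "v \<bullet> (C0 *\<^sub>v v) ~= 0"
     using quadratic_form_nonzero[OF C0c ij0(1,2)] by metis
    show ?thesis unfolding T_odd
     by (rule skew_step_odd[OF Lo 3 C(1,2) d(1) d' m'(1) False m'(2) bg[folded m'_def] v[unfolded C0_def]])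
   qed
  qed
 qed
qed

section \<open>The perturbed multiplicities are an open condition\<close>

lemma polyfun_poly_pCons:
 assumes "polyfun m p" "polyfun m q"
 shows "polyfun_poly m (\<lambda>x. [:p x, q x:])"
proof -
 have "polyfun_poly m (\<lambda>x. monom (p x) 0 + monom (q x) 1)" by (intro polyfun_poly_add polyfun_poly_monom assms)
 thus ?thesis by (rule polyfun_poly_cong) (simp add: monom_0 monom_Suc)
qed

lemma polyfun_poly_pCons0: "polyfun m p ==> polyfun_poly m (\<lambda>x. [:p x:])"
 using polyfun_poly_pCons[of m p "\<lambda>_. 0"] by (simp)

lemma polyfun_block:
 assumes "k < K" "a < n"
 shows "polyfun (K * n) (\<lambda>x. block n k x $ a)"
proof -
 have "k * n + a < (k + 1) * n" using assms(2) by simp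
 also have "\<dots> <= K * n" using assms(1) by (intro mult_le_mono1) simp
 finally show ?thesis using polyfun_coord[of "k * n + a" "K * n"] assms(2) unfolding block_def by simp
qed

lemma polyfun_Phi:
 assumes "i < n" "j < n"
 shows "polyfun_poly ((3 * r div 2) * n) (\<lambda>x. Phi \<sigma> n r x $$ (i,j))"
proof -
 obtain s where s: "r div 2 = s" by blast
 have cnt: "3 * r div 2 = 3 * s + (if odd r then 1 else 0)" using param_count[of r] s by simp
 have b: "polyfun ((3 * r div 2) * n) (\<lambda>x. block n k x $ a)" if "k < 3 * s + (if odd r then 1 else 0)" "a < n" for k a
  unfolding cnt by (rule polyfun_block[OF that])
 have u: "polyfun_poly ((3 * r div 2) * n) (\<lambda>x. if odd r then [:0,1:] ^ weight \<sigma> * [:block n (3 * s) x $ i * block n (3 * s) x $ j:] else 0)"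
 proof (cases "odd r")
  case True
  have "polyfun_poly ((3 * r div 2) * n) (\<lambda>x. [:0,1:] ^ weight \<sigma> * [:block n (3 * s) x $ i * block n (3 * s) x $ j:])"
   by (intro polyfun_poly_mult polyfun_poly_const polyfun_poly_pCons0 polyfun_mult b) (use True assms in auto)
  thus ?thesis using True by simp
 qed (simp add: polyfun_poly_0)
 have p: "polyfun_poly ((3 * r div 2) * n)
   (\<lambda>x. \<Sum>k<s. pert_pair \<sigma> (block n k x) (block n (s + k) x) (block n (2 * s + k) x) i j)"
  unfolding pert_pair_def
  by (intro polyfun_poly_sum polyfun_poly_add polyfun_poly_mult polyfun_poly_const polyfun_poly_pCons0
    polyfun_poly_pCons polyfun_uminus b) (use assms in auto)
 show ?thesis
  unfolding Phi_eq_struct_pert struct_pert_def using polyfun_poly_add[OF u p] assms unfolding s by simp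
qed

lemma Phi_dims [simp]: "Phi \<sigma> n r x \<in> Mat n"
 unfolding Phi_eq_struct_pert by simp

lemma alt_Phi: "alt_pencil \<sigma> n (Phi \<sigma> n r x)"
 unfolding Phi_eq_struct_pert by (rule alt_struct_pert)

text \<open>The order of the determinant is upper semicontinuous, and its least value forces the multiplicities.\<close>

lemma plain_open:
 assumes L: "is_pencil n L" "det L ~= 0"
  and F: "!!x. x \<in> carrier_vec m ==> is_pencil n (F x)" "!!x. x \<in> carrier_vec m ==> rank_perturbed n r L (F x)"
   "!!i j. i < n ==> j < n ==> polyfun_poly m (\<lambda>x. F x $$ (i,j))"
  and x0: "x0 \<in> carrier_vec m" "det (F x0) ~= 0" "!!k. 1 <= k ==> blocks_ge (F x0) \<mu> k = blocks_ge L \<mu> k - r"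
 obtains f where "polyfun m f" "f x0 ~= 0" "!!x. x \<in> carrier_vec m ==> f x ~= 0 ==>
  det (F x) ~= 0 \<and> (\<forall>k\<ge>1. blocks_ge (F x) \<mu> k = blocks_ge L \<mu> k - r)"
proof -
 define t where "t = (\<Sum>k = 1..n. blocks_ge L \<mu> k - r)"
 have "t = order \<mu> (det (F x0))"
  unfolding t_def blocks_ge_sum[OF F(1)[OF x0(1)] x0(2) order.refl, symmetric] using x0(3) by (intro sum.cong) auto
 hence nd: "\<not> [:-\<mu>,1:] ^ Suc t dvd det (F x0)" using order_2[OF x0(2)] by simp
 have pd: "polyfun_poly m (\<lambda>x. det (F x))"
  by (rule polyfun_poly_det[OF F(3)]) (auto intro: is_pencil_carrier F(1))
 obtain f where f: "polyfun m f" "f x0 ~= 0" "!!x. f x ~= 0 ==> \<not> [:-\<mu>,1:] ^ Suc t dvd det (F x)"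
  by (rule polyfun_poly_not_dvd[OF pd nd]) blast
 show ?thesis
 proof (rule that[OF f(1,2)])
  fix x assume x: "x \<in> carrier_vec m" "f x ~= 0"
  have d: "det (F x) ~= 0" using f(3)[OF x(2)] by auto
  have "order \<mu> (det (F x)) <= t" using f(3)[OF x(2)] order_divides[of \<mu> "Suc t" "det (F x)"] d by auto
  thus "det (F x) ~= 0 \<and> (\<forall>k\<ge>1. blocks_ge (F x) \<mu> k = blocks_ge L \<mu> k - r)"
   using plain_blocks_eq[OF L F(1)[OF x(1)] d F(2)[OF x(1)]] d unfolding t_def by blast
 qed
qed

lemma repaired_unique:
 assumes "repaired \<sigma> r (blocks_ge L 0) k" "repaired \<sigma> r (blocks_ge L 0) k'"
 shows "k = k'"
proof -
 have F: False if a: "k < k'" and r: "repaired \<sigma> r (blocks_ge L 0) k" "repaired \<sigma> r (blocks_ge L 0) k'" for k k'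
 proof -
  have "k <= k' - 1" using a by simp
  from exponents_ge_antimono[OF this, of "finite_partial_mults L 0"] r show False by simp
 qed
 show ?thesis using F[of k k'] F[of k' k] assms by (metis linorder_neqE_nat)
qed

text \<open>At zero the order of the determinant is not enough. The repaired entry is kept by an entry of the
 adjugate whose order stays small.\<close>

lemma target_open:
 assumes L: "alt_pencil \<sigma> n L" "det L ~= 0"
  and F: "!!x. x \<in> carrier_vec m ==> alt_pencil \<sigma> n (F x)" "!!x. x \<in> carrier_vec m ==> rank_perturbed n r L (F x)"
   "!!i j. i < n ==> j < n ==> polyfun_poly m (\<lambda>x. F x $$ (i,j))"
  and x0: "x0 \<in> carrier_vec m" "det (F x0) ~= 0" "!!k. 1 <= k ==> blocks_ge (F x0) 0 k = target \<sigma> n r (blocks_ge L 0) k"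
 obtains f where "polyfun m f" "f x0 ~= 0" "!!x. x \<in> carrier_vec m ==> f x ~= 0 ==>
  det (F x) ~= 0 \<and> (\<forall>k\<ge>1. blocks_ge (F x) 0 k = target \<sigma> n r (blocks_ge L 0) k)"
proof -
 let ?\<nu> = "blocks_ge L 0"
 define t where "t = target_order \<sigma> n r ?\<nu>"
 have t0: "t = order 0 (det (F x0))"
  unfolding t_def target_order_def
   blocks_ge_sum[OF alt_pencilD(1)[OF F(1)[OF x0(1)]] x0(2) pair_bound_ge(2)[of n \<sigma>], symmetric]
  using x0(3) by (intro sum.cong) auto
 hence nd: "\<not> [:-0,1:] ^ Suc t dvd det (F x0)" using order_2[OF x0(2)] by metis
 have pd: "polyfun_poly m (\<lambda>x. det (F x))"
  by (rule polyfun_poly_det[OF F(3)]) (auto intro: alt_pencilD(2) F(1))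
 obtain f where f: "polyfun m f" "f x0 ~= 0" "!!x. f x ~= 0 ==> \<not> [:-0,1:] ^ Suc t dvd det (F x)"
  by (rule polyfun_poly_not_dvd[OF pd nd]) blast
 have ft: "det (F x) ~= 0" "order 0 (det (F x)) = t" if x: "x \<in> carrier_vec m" "f x ~= 0" for x
 proof -
  show d: "det (F x) ~= 0" using f(3)[OF x(2)] by auto
  have "order 0 (det (F x)) <= t" using f(3)[OF x(2)] order_divides[of 0 "Suc t" "det (F x)"] d by auto
  moreover have "t <= order 0 (det (F x))" unfolding t_def by (rule order_ge_target[OF L F(1)[OF x(1)] d F(2)[OF x(1)]])
  ultimately show "order 0 (det (F x)) = t" by simp
 qed
 have "\<exists>f1. polyfun m f1 \<and> f1 x0 ~= 0 \<and> (\<forall>x\<in>carrier_vec m. f x ~= 0 \<longrightarrow> f1 x ~= 0 \<longrightarrow>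
   (\<forall>k. repaired \<sigma> r ?\<nu> k \<longrightarrow> 0 < blocks_ge (F x) 0 k))"
 proof (cases "\<exists>k. repaired \<sigma> r ?\<nu> k")
  case False
  thus ?thesis by (intro exI[of _ "\<lambda>_. 1"]) (simp del: repaired.simps)
 next
  case True
  then obtain k where k: "repaired \<sigma> r ?\<nu> k" by blast
  have k2: "2 <= k" using k by simp
  have "blocks_ge (F x0) 0 k = 1" using x0(3)[of k] target_eq_repaired[OF admissible_blocks[OF L] k2, of r] k k2 by simp
  hence pos: "0 < blocks_ge (F x0) 0 k" by simp
  note Fx0 = F(1)[OF x0(1)]
  have n: "0 < n"
  proof (rule ccontr)
   assume "\<not> 0 < n"
   thus False using blocks_ge_eq_0[OF alt_pencilD(1)[OF Fx0] x0(2), of k] k2 pos by simp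
  qed
  obtain e C where C: "C \<in> Mat n" "adj_mat (F x0) = [:-0,1:] ^ e \<cdot>\<^sub>m C" "\<exists>i<n. \<exists>j<n. poly (C $$ (i,j)) 0 ~= 0"
   by (rule adj_factorization[OF alt_pencilD(2)[OF Fx0] x0(2) n, where \<mu> = 0]) blast
  have ke: "k <= t - e" using blocks_ge_adj[OF alt_pencilD(1)[OF Fx0] x0(2) C, of k] pos k2 t0 by simp
  obtain i j where ij: "i < n" "j < n" "poly (C $$ (i,j)) 0 ~= 0" using C(3) by blast
  have "adj_mat (F x0) $$ (i,j) = [:0,1:] ^ e * C $$ (i,j)" unfolding C(2) using ij C(1) by (simp del: power.simps)
  note oe = order_zero_mult[OF this ij(3)]
  have nd1: "\<not> [:-0,1:] ^ Suc (t - k) dvd adj_mat (F x0) $$ (i,j)"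
   using order_divides[of 0 "Suc (t - k)" "adj_mat (F x0) $$ (i,j)"] oe ke k2 by auto
  have pa: "polyfun_poly m (\<lambda>x. adj_mat (F x) $$ (i,j))"
   by (rule polyfun_poly_adj[OF F(3) _ ij(1,2)]) (auto intro: alt_pencilD(2) F(1))
  obtain f1 where f1: "polyfun m f1" "f1 x0 ~= 0" "!!x. f1 x ~= 0 ==> \<not> [:-0,1:] ^ Suc (t - k) dvd adj_mat (F x) $$ (i,j)"
   by (rule polyfun_poly_not_dvd[OF pa nd1]) blast
  have "0 < blocks_ge (F x) 0 k'" if x: "x \<in> carrier_vec m" "f x ~= 0" "f1 x ~= 0" and k': "repaired \<sigma> r ?\<nu> k'" for x k'
  proof -
   have eq: "k' = k" by (rule repaired_unique[OF k' k])
   have anz: "adj_mat (F x) $$ (i,j) ~= 0" using f1(3)[OF x(3)] by auto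
   have "order 0 (adj_mat (F x) $$ (i,j)) <= t - k"
    using order_divides[of 0 "Suc (t - k)" "adj_mat (F x) $$ (i,j)"] f1(3)[OF x(3)] anz by auto
   hence "order 0 (adj_mat (F x) $$ (i,j)) + k <= order 0 (det (F x))" using ft(2)[OF x(1,2)] ke k2 by simp
   thus ?thesis unfolding eq
    using blocks_ge_pos_of_adj[OF alt_pencilD(1)[OF F(1)[OF x(1)]] ft(1)[OF x(1,2)] ij(1,2) anz] k2 by simp
  qed
  thus ?thesis using f1(1,2) by blast
 qed
 then obtain f1 where f1: "polyfun m f1" "f1 x0 ~= 0"
  "!!x k. x \<in> carrier_vec m ==> f x ~= 0 ==> f1 x ~= 0 ==> repaired \<sigma> r ?\<nu> k ==> 0 < blocks_ge (F x) 0 k" by blast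
 show ?thesis
 proof (rule that[OF polyfun_mult[OF f(1) f1(1)]])
  show "f x0 * f1 x0 ~= 0" using f(2) f1(2) by simp
  fix x assume x: "x \<in> carrier_vec m" and "f x * f1 x ~= 0"
  hence nz: "f x ~= 0" "f1 x ~= 0" by auto
  have "blocks_ge (F x) 0 k = target \<sigma> n r ?\<nu> k" if "1 <= k" for k
   by (rule blocks_eq_target[OF L F(1)[OF x] ft(1)[OF x nz(1)] F(2)[OF x] _ f1(3)[OF x nz] that])
    (simp add: ft(2)[OF x nz(1)] t_def)
  thus "det (F x) ~= 0 \<and> (\<forall>k\<ge>1. blocks_ge (F x) 0 k = target \<sigma> n r ?\<nu> k)" using ft(1)[OF x nz(1)] by blast
 qed
qed

text \<open>The claim about the point \<open>z\<close>, in terms of the numbers \<open>\<nu> k\<close>.\<close>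

fun meets :: "alternation => nat => nat => complex poly mat => complex poly mat => eigval => bool" where
 "meets \<sigma> n r L L' (Fin \<mu>) \<longleftrightarrow> (\<forall>k\<ge>1. blocks_ge L' \<mu> k =
   (if \<mu> = 0 then target \<sigma> n r (blocks_ge L 0) k else blocks_ge L \<mu> k - r))"
| "meets \<sigma> n r L L' Infty \<longleftrightarrow> (\<forall>k\<ge>1. blocks_ge (rev_pencil L') 0 k = target (dual \<sigma>) n r (blocks_ge (rev_pencil L) 0) k)"

lemma meets_open:
 assumes L: "alt_pencil \<sigma> n L" "det L ~= 0"
  and x0: "x0 \<in> carrier_vec ((3 * r div 2) * n)" "det (L + Phi \<sigma> n r x0) ~= 0" "meets \<sigma> n r L (L + Phi \<sigma> n r x0) z"
 obtains f where "polyfun ((3 * r div 2) * n) f" "f x0 ~= 0" "!!x. x \<in> carrier_vec ((3 * r div 2) * n) ==> f x ~= 0 ==>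
  det (L + Phi \<sigma> n r x) ~= 0 \<and> meets \<sigma> n r L (L + Phi \<sigma> n r x) z"
proof -
 note Lp = alt_pencilD(1)[OF L(1)] and Lc = alt_pencilD(2)[OF L(1)]
 let ?m = "(3 * r div 2) * n" and ?F = "\<lambda>x. L + Phi \<sigma> n r x"
 have F: "alt_pencil \<sigma> n (?F x)" "rank_perturbed n r L (?F x)" for x
  using alt_pencil_add[OF L(1) alt_Phi] rank_perturbed_struct_pert[OF Lc] unfolding Phi_eq_struct_pert by auto
 have pF: "polyfun_poly ?m (\<lambda>x. ?F x $$ (i,j))" if ij: "i < n" "j < n" for i j
 proof -
  have "polyfun_poly ?m (\<lambda>x. L $$ (i,j) + Phi \<sigma> n r x $$ (i,j))" by (intro polyfun_poly_add polyfun_poly_const polyfun_Phi ij)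
  thus ?thesis using ij carrier_matD[OF Phi_dims[of \<sigma> n r]] by simp
 qed
 show ?thesis
 proof (cases z)
  case (Fin \<mu>)
  show ?thesis
  proof (cases "\<mu> = 0")
   case True
   have x3: "blocks_ge (?F x0) 0 k = target \<sigma> n r (blocks_ge L 0) k" if "1 <= k" for k
    using x0(3) that unfolding Fin True meets.simps by presburger
   obtain f where f: "polyfun ?m f" "f x0 ~= 0" "!!x. x \<in> carrier_vec ?m ==> f x ~= 0 ==>
     det (?F x) ~= 0 \<and> (\<forall>k\<ge>1. blocks_ge (?F x) 0 k = target \<sigma> n r (blocks_ge L 0) k)"
    by (rule target_open[OF L F pF x0(1,2) x3]) blast+
   show ?thesis by (rule that[OF f(1,2)]) (use f(3) in \<open>simp add: Fin True del: target.simps\<close>)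
  next
   case False
   have x3: "blocks_ge (?F x0) \<mu> k = blocks_ge L \<mu> k - r" if "1 <= k" for k
    using x0(3) that False unfolding Fin meets.simps by presburger
   obtain f where f: "polyfun ?m f" "f x0 ~= 0" "!!x. x \<in> carrier_vec ?m ==> f x ~= 0 ==>
     det (?F x) ~= 0 \<and> (\<forall>k\<ge>1. blocks_ge (?F x) \<mu> k = blocks_ge L \<mu> k - r)"
    by (rule plain_open[OF Lp L(2) alt_pencilD(1)[OF F(1)] F(2) pF x0(1,2) x3]) blast+
   show ?thesis by (rule that[OF f(1,2)]) (use f(3) False in \<open>simp add: Fin\<close>)
  qed
 next
  case Infty
  let ?R = "\<lambda>x. rev_pencil (?F x)"
  have R: "?R x = rev_pencil L + struct_pert (dual \<sigma>) n r (\<lambda>j. block n j x) (\<lambda>j. block n (2 * (r div 2) + j) x)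
   (\<lambda>j. block n (r div 2 + j) x) (block n (3 * (r div 2)) x)" for x
   unfolding rev_pencil_add[OF Lc Phi_dims] unfolding Phi_eq_struct_pert rev_struct_pert ..
  have RF: "alt_pencil (dual \<sigma>) n (?R x)" "rank_perturbed n r (rev_pencil L) (?R x)" for x
   using alt_rev_pencil[OF F(1)] apply blast
   unfolding R by (rule rank_perturbed_struct_pert[OF rev_pencil_carrier[OF Lc]])
  have pR: "polyfun_poly ?m (\<lambda>x. ?R x $$ (i,j))" if ij: "i < n" "j < n" for i j
   unfolding rev_pencil_index[OF alt_pencilD(2)[OF F(1)] ij]
   by (intro polyfun_poly_pCons polyfun_poly_coeff pF ij)
  have dR: "det (?R x) ~= 0 \<longleftrightarrow> det (?F x) ~= 0" for x using det_rev_eq_0_iff[OF alt_pencilD(1)[OF F(1)]] by simp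
  have rL: "alt_pencil (dual \<sigma>) n (rev_pencil L)" "det (rev_pencil L) ~= 0"
   using alt_rev_pencil[OF L(1)] det_rev_eq_0_iff[OF Lp] L(2) by auto
  have x3: "blocks_ge (?R x0) 0 k = target (dual \<sigma>) n r (blocks_ge (rev_pencil L) 0) k" if "1 <= k" for k
   using x0(3) that unfolding Infty meets.simps by presburger
  obtain f where f: "polyfun ?m f" "f x0 ~= 0" "!!x. x \<in> carrier_vec ?m ==> f x ~= 0 ==>
    det (?R x) ~= 0 \<and> (\<forall>k\<ge>1. blocks_ge (?R x) 0 k = target (dual \<sigma>) n r (blocks_ge (rev_pencil L) 0) k)"
   by (rule target_open[OF rL RF pR x0(1) dR[THEN iffD2, OF x0(2)] x3]) blast+
  show ?thesis by (rule that[OF f(1,2)]) (use f(3) dR in \<open>simp add: Infty del: target.simps\<close>)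
 qed
qed

lemma meets_generic:
 assumes L: "alt_pencil \<sigma> n L" "det L ~= 0" and Z: "finite Z" "Z ~= {}"
  and w: "!!z. z \<in> Z ==> \<exists>x \<in> carrier_vec ((3 * r div 2) * n). det (L + Phi \<sigma> n r x) ~= 0 \<and> meets \<sigma> n r L (L + Phi \<sigma> n r x) z"
 obtains f x0 where "polyfun ((3 * r div 2) * n) f" "x0 \<in> carrier_vec ((3 * r div 2) * n)" "f x0 ~= 0"
  "\<forall>x \<in> carrier_vec ((3 * r div 2) * n). f x ~= 0 \<longrightarrow>
   det (L + Phi \<sigma> n r x) ~= 0 \<and> (\<forall>z\<in>Z. meets \<sigma> n r L (L + Phi \<sigma> n r x) z)"
proof -
 let ?m = "(3 * r div 2) * n"
 have "\<forall>z\<in>Z. \<exists>f. polyfun ?m f \<and> (\<exists>x\<in>carrier_vec ?m. f x ~= 0) \<and> (\<forall>x\<in>carrier_vec ?m. f x ~= 0 \<longrightarrow>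
   det (L + Phi \<sigma> n r x) ~= 0 \<and> meets \<sigma> n r L (L + Phi \<sigma> n r x) z)"
 proof
  fix z assume "z \<in> Z"
  then obtain x where x: "x \<in> carrier_vec ?m" "det (L + Phi \<sigma> n r x) ~= 0" "meets \<sigma> n r L (L + Phi \<sigma> n r x) z" using w by blast
  obtain f where "polyfun ?m f" "f x ~= 0" "!!x. x \<in> carrier_vec ?m ==> f x ~= 0 ==>
    det (L + Phi \<sigma> n r x) ~= 0 \<and> meets \<sigma> n r L (L + Phi \<sigma> n r x) z"
   by (rule meets_open[OF L x]) blast
  thus "\<exists>f. polyfun ?m f \<and> (\<exists>x\<in>carrier_vec ?m. f x ~= 0) \<and> (\<forall>x\<in>carrier_vec ?m. f x ~= 0 \<longrightarrow>
   det (L + Phi \<sigma> n r x) ~= 0 \<and> meets \<sigma> n r L (L + Phi \<sigma> n r x) z)" using x(1) by blast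
 qed
 then obtain f where f: "!!z. z \<in> Z ==> polyfun ?m (f z) \<and> (\<exists>x\<in>carrier_vec ?m. f z x ~= 0) \<and> (\<forall>x\<in>carrier_vec ?m. f z x ~= 0 \<longrightarrow>
   det (L + Phi \<sigma> n r x) ~= 0 \<and> meets \<sigma> n r L (L + Phi \<sigma> n r x) z)" by metis
 have "\<exists>x\<in>carrier_vec ?m. \<forall>z\<in>Z. f z x ~= 0" by (rule polyfun_finite_common_nonzero[OF Z(1)]) (use f in auto)
 then obtain x0 where x0: "x0 \<in> carrier_vec ?m" "!!z. z \<in> Z ==> f z x0 ~= 0" by blast
 show ?thesis
 proof (rule that[of "\<lambda>x. \<Prod>z\<in>Z. f z x" x0])
  show "polyfun ?m (\<lambda>x. \<Prod>z\<in>Z. f z x)" using f by (intro polyfun_prod) auto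
  show "(\<Prod>z\<in>Z. f z x0) ~= 0" using x0(2) Z(1) by (simp add: prod_zero_iff)
  show "\<forall>x\<in>carrier_vec ?m. (\<Prod>z\<in>Z. f z x) ~= 0 \<longrightarrow>
   det (L + Phi \<sigma> n r x) ~= 0 \<and> (\<forall>z\<in>Z. meets \<sigma> n r L (L + Phi \<sigma> n r x) z)"
   using f Z by (auto simp: prod_zero_iff)
 qed (rule x0(1))
qed

text \<open>For ranks one and two, every single point can be given its multiplicities.\<close>

lemma Phi_pair_pert: "\<exists>x \<in> carrier_vec ((3 * 2 div 2) * n). Phi \<sigma> n 2 x = pair_pert \<sigma> n v \<gamma> \<delta>"
proof -
 obtain x where "x \<in> carrier_vec ((3 * 2 div 2) * n)" "Phi \<sigma> n 2 x = struct_pert \<sigma> n 2 (\<lambda>_. v) (\<lambda>_. \<gamma>) (\<lambda>_. \<delta>) v"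
  by (rule Phi_surj)
 thus ?thesis unfolding struct_pert_2 by blast
qed

lemma Phi_rank_one_pert: 
 assumes "u \<in> Vec n"
 shows "\<exists>x \<in> carrier_vec ((3 * 1 div 2) * n). Phi \<sigma> n 1 x = rank_one_pert \<sigma> u"
proof -
 obtain x where "x \<in> carrier_vec ((3 * 1 div 2) * n)" "Phi \<sigma> n 1 x = struct_pert \<sigma> n 1 (\<lambda>_. u) (\<lambda>_. u) (\<lambda>_. u) u"
  by (rule Phi_surj)
 thus ?thesis unfolding struct_pert_1[OF assms] by blast
qed

lemma meets_witness:
 assumes L: "alt_pencil \<sigma> n L" "det L ~= 0" and q: "q = 1 \<or> q = 2"
 shows "\<exists>x \<in> carrier_vec ((3 * q div 2) * n). det (L + Phi \<sigma> n q x) ~= 0 \<and> meets \<sigma> n q L (L + Phi \<sigma> n q x) z"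
proof -
 note Lp = alt_pencilD(1)[OF L(1)] and Lc = alt_pencilD(2)[OF L(1)]
 have rL: "alt_pencil (dual \<sigma>) n (rev_pencil L)" "det (rev_pencil L) ~= 0"
  using alt_rev_pencil[OF L(1)] det_rev_eq_0_iff[OF Lp] L(2) by auto
 have rev: "rev_pencil (L + E) = rev_pencil L + rev_pencil E" "det (rev_pencil L + rev_pencil E) ~= 0 \<longleftrightarrow> det (L + E) ~= 0"
  if "alt_pencil \<sigma> n E" for E
  using rev_pencil_add[OF Lc alt_pencilD(2)[OF that]] det_rev_eq_0_iff[OF alt_pencilD(1)[OF alt_pencil_add[OF L(1) that]]] by auto
 have "\<exists>E. (\<exists>x \<in> carrier_vec ((3 * q div 2) * n). Phi \<sigma> n q x = E) \<and> det (L + E) ~= 0 \<and> meets \<sigma> n q L (L + E) z"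
 proof (cases z)
  case (Fin \<mu>)
  show ?thesis
  proof (cases "q = 1")
   case True
   have "\<exists>u \<in> Vec n. det (L + rank_one_pert \<sigma> u) ~= 0 \<and> meets \<sigma> n 1 L (L + rank_one_pert \<sigma> u) z"
   proof (cases "\<mu> = 0")
    case True
    thus ?thesis using zero_step[OF L] unfolding Fin meets.simps if_P[OF True] by blast
   next
    case False
    thus ?thesis using plain_step[OF L False] unfolding Fin meets.simps if_not_P[OF False] by blast
   qed
   thus ?thesis using Phi_rank_one_pert unfolding True by metis
  next
   case False
   hence q2: "q = 2" using q by simp
   have "\<exists>v \<gamma> \<delta>. det (L + pair_pert \<sigma> n v \<gamma> \<delta>) ~= 0 \<and> meets \<sigma> n 2 L (L + pair_pert \<sigma> n v \<gamma> \<delta>) z"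
   proof (cases "\<mu> = 0")
    case True
    thus ?thesis using pair_zero_step[OF L] unfolding Fin meets.simps if_P[OF True] by blast
   next
    case False
    thus ?thesis using pair_plain_step[OF L False] unfolding Fin meets.simps if_not_P[OF False] by blast
   qed
   thus ?thesis using Phi_pair_pert unfolding q2 by metis
  qed
 next
  case Infty
  show ?thesis
  proof (cases "q = 1")
   case True
   obtain u where u: "u \<in> Vec n" "det (rev_pencil L + rank_one_pert (dual \<sigma>) u) ~= 0"
    "\<forall>k\<ge>1. blocks_ge (rev_pencil L + rank_one_pert (dual \<sigma>) u) 0 k = target (dual \<sigma>) n 1 (blocks_ge (rev_pencil L) 0) k"
    using zero_step[OF rL] by blast
   have "det (L + rank_one_pert \<sigma> u) ~= 0 \<and> meets \<sigma> n 1 L (L + rank_one_pert \<sigma> u) z"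
    using u(2,3) rev[OF alt_rank_one_pert[OF u(1)]] unfolding rev_rank_one_pert[OF u(1)] Infty meets.simps by simp
   thus ?thesis using Phi_rank_one_pert[OF u(1)] unfolding True by metis
  next
   case False
   hence q2: "q = 2" using q by simp
   obtain v \<gamma> \<delta> where u: "det (rev_pencil L + pair_pert (dual \<sigma>) n v \<gamma> \<delta>) ~= 0"
    "\<forall>k\<ge>1. blocks_ge (rev_pencil L + pair_pert (dual \<sigma>) n v \<gamma> \<delta>) 0 k = target (dual \<sigma>) n 2 (blocks_ge (rev_pencil L) 0) k"
    using pair_zero_step[OF rL] by blast
   have "det (L + pair_pert \<sigma> n v \<delta> \<gamma>) ~= 0 \<and> meets \<sigma> n 2 L (L + pair_pert \<sigma> n v \<delta> \<gamma>) z"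
    using u rev[OF alt_pair_pert] unfolding rev_pair_pert Infty meets.simps by simp
   thus ?thesis using Phi_pair_pert unfolding q2 by metis
  qed
 qed
 thus ?thesis by blast
qed

text \<open>The second perturbation only has to know the multiplicities after the first, as the target is
 transitive.\<close>

lemma meets_compose:
 assumes L: "alt_pencil \<sigma> n L" "det L ~= 0" and m1: "meets \<sigma> n r L L1 z" and m2: "meets \<sigma> n 2 L1 L2 z"
 shows "meets \<sigma> n (r + 2) L L2 z"
proof -
 have t: "target \<sigma>' n 2 \<nu>' k = target \<sigma>' n (r + 2) \<nu> k" if "admissible \<sigma>' n \<nu>" "!!k. 1 <= k ==> \<nu>' k = target \<sigma>' n r \<nu> k" "1 <= k"
  for \<sigma>' \<nu> \<nu>' and k :: nat
 proof -
  have "target \<sigma>' n 2 \<nu>' k = target \<sigma>' n 2 (target \<sigma>' n r \<nu>) k" by (rule target_cong[OF that(2,3)])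
  also have "\<dots> = target \<sigma>' n (r + 2) \<nu> k" by (rule target_compose[OF that(1,3)]) simp
  finally show ?thesis .
 qed
 have rL: "alt_pencil (dual \<sigma>) n (rev_pencil L)" "det (rev_pencil L) ~= 0"
  using alt_rev_pencil[OF L(1)] det_rev_eq_0_iff[OF alt_pencilD(1)[OF L(1)]] L(2) by auto
 show ?thesis
 proof (cases z)
  case (Fin \<mu>)
  show ?thesis
  proof (cases "\<mu> = 0")
   case True
   show ?thesis using m1 m2 t[OF admissible_blocks[OF L]] unfolding Fin True meets.simps if_True by metis
  next
   case False
   show ?thesis using m1 m2 False unfolding Fin by simp
  qed
 next
  case Infty
  show ?thesis using m1 m2 t[OF admissible_blocks[OF rL]] unfolding Infty meets.simps by metis
 qed
qed

section \<open>Simplicity of the new eigenvalues\<close>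

lemma double_root:
 assumes "2 <= order \<mu> p"
 shows "poly p \<mu> = 0" "poly (pderiv p) \<mu> = (0 :: complex)"
proof -
 have "[:-\<mu>,1:] ^ 2 dvd p" using assms by (meson dvd_trans le_imp_power_dvd order_1)
 then obtain r where r: "p = [:-\<mu>,1:] ^ 2 * r" by (elim dvdE)
 show "poly p \<mu> = 0" unfolding r by simp
 show "poly (pderiv p) \<mu> = 0" unfolding r power2_eq_square mult.assoc pderiv_mult[of "[:-\<mu>,1:]"] poly_add poly_mult by simp
qed

text \<open>In a linear family of polynomials, a root that is not a base point can be multiple for only finitely
 many members: it is a root of the Wronskian, and it determines the member.\<close>

lemma multiple_roots_in_family:
 fixes q0 q1 :: "complex poly"
 assumes q1: "q1 ~= 0" and base: "!!z. z \<notin> S ==> poly q1 z = 0 ==> poly q0 z ~= 0" and S: "finite S"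
 shows "finite {t. \<exists>z. z \<notin> S \<and> 2 <= order z (q0 + Polynomial.smult t q1)}"
proof -
 let ?W = "q0 * pderiv q1 - pderiv q0 * q1"
 let ?T = "{t. \<exists>z. z \<notin> S \<and> 2 <= order z (q0 + Polynomial.smult t q1)}"
 have key: "poly ?W z = 0 \<and> poly q1 z ~= 0 \<and> t = - poly q0 z / poly q1 z"
  if "z \<notin> S" "2 <= order z (q0 + Polynomial.smult t q1)" for z t
 proof -
  have 1: "poly q0 z = - t * poly q1 z" "poly (pderiv q0) z = - t * poly (pderiv q1) z"
   using double_root[OF that(2)] by (simp_all add: pderiv_add pderiv_smult eq_neg_iff_add_eq_0)
  hence "poly q1 z ~= 0" using base[OF that(1)] by auto
  thus ?thesis using 1 by simp
 qed
 show ?thesis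
 proof (cases "?W = 0")
  case False
  have "?T \<subseteq> (\<lambda>z. - poly q0 z / poly q1 z) ` {z. poly ?W z = 0}" using key by blast
  thus ?thesis using poly_roots_finite[OF False] by (meson finite_imageI finite_subset)
 next
  case True
  have "finite (S \<union> {z. poly q1 z = 0})" using S poly_roots_finite[OF q1] by blast
  then obtain y where "y \<notin> S \<union> {z. poly q1 z = 0}" using ex_new_if_finite[OF infinite_UNIV_char_0] by blast
  hence y: "y \<notin> S" "poly q1 y ~= 0" by auto
  define c where "c = poly q0 y / poly q1 y"
  define p where "p = q0 - Polynomial.smult c q1"
  have py: "poly p y = 0" unfolding p_def c_def using y by simp
  have W: "p * pderiv q1 = pderiv p * q1"
   using True unfolding p_def by (simp add: pderiv_diff pderiv_smult algebra_simps)
  have "p = 0"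
  proof (rule ccontr)
   assume p: "p ~= 0"
   have o: "order y p ~= 0" using p py by (simp add: order_root)
   have dp: "pderiv p ~= 0"
   proof
    assume "pderiv p = 0"
    then obtain a where "p = [:a:]" using pderiv_iszero by blast
    thus False using py p by simp
   qed
   have "pderiv q1 ~= 0" using W dp q1 by auto
   hence "order y p + order y (pderiv q1) = order y (pderiv p) + order y q1"
    using W p dp q1 order_mult[of p "pderiv q1" y] order_mult[of "pderiv p" q1 y] by simp
   moreover have "order y q1 = 0" using y(2) by (rule order_0I)
   moreover have "order y p = Suc (order y (pderiv p))" by (rule order_pderiv[OF p py])
   ultimately show False by simp
  qed
  hence q0: "q0 = Polynomial.smult c q1" unfolding p_def by simp
  have "?T \<subseteq> {- c}"
  proof
   fix t assume "t \<in> ?T"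
   then obtain z where z: "z \<notin> S" "2 <= order z (q0 + Polynomial.smult t q1)" by blast
   thus "t \<in> {- c}" using key[OF z] unfolding q0 by simp
  qed
  thus ?thesis using finite_subset by blast
 qed
qed

text \<open>After the power of \<open>\<lambda>\<close> is split off, the polynomial is \<open>a + b \<lambda>\<^sup>2\<close> with \<open>a \<noteq> 0\<close>.\<close>

lemma even_quadratic_simple:
 assumes fl: "flip q = [:c:] * q" and q: "q ~= 0" and deg: "degree q <= order 0 q + 2" and mu: "\<mu> ~= 0"
 shows "order \<mu> q <= 1"
proof (rule ccontr)
 assume "\<not> ?thesis"
 hence two: "2 <= order \<mu> q" by simp
 let ?s = "[:0,1:] :: complex poly"
 obtain p where p: "q = [:-0,1:] ^ order 0 q * p" "\<not> [:-0,1:] dvd p" using order_decomp[OF q, of 0] by blast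
 define j where "j = order 0 q"
 have qp: "q = ?s ^ j * p" using p(1) unfolding j_def by simp
 have p0: "poly p 0 ~= 0" using p(2) unfolding dvd_iff_poly_eq_0 by simp
 hence pnz: "p ~= 0" by auto
 have sj: "?s ^ j ~= 0" by simp
 have "degree q = j + degree p" unfolding qp using pnz by (subst degree_mult_eq) (simp_all add: degree_linear_power[of 0, simplified])
 hence dp: "degree p <= 2" using deg unfolding j_def by simp
 have "(- ?s) ^ j * flip p = [:c:] * (?s ^ j * p)" using fl unfolding qp by simp
 hence "?s ^ j * ((-1) ^ j * flip p) = ?s ^ j * ([:c:] * p)" by (simp only: power_minus[of ?s] mult_ac)
 hence e: "(-1) ^ j * flip p = [:c:] * p" using sj by (metis mult_left_cancel)
 have m1: "(-1 :: complex poly) ^ j = [:(-1) ^ j:]" by (metis minus_pCons minus_zero one_pCons poly_const_pow)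
 have cf: "(-1) ^ j * ((-1) ^ k * coeff p k) = c * coeff p k" for k
  using arg_cong[OF e, of "\<lambda>p. coeff p k"] unfolding m1 by (simp add: coeff_flip)
 have c: "c = (-1) ^ j" using cf[of 0] p0 by (simp add: poly_0_coeff_0)
 have "coeff p 1 = 0" using cf[of 1] unfolding c by simp
 moreover have "coeff p 0 ~= 0" using p0 by (simp add: poly_0_coeff_0)
 moreover have pe: "p = [:coeff p 0, coeff p 1, coeff p 2:]"
  using dp by (intro poly_eqI) (auto simp: coeff_pCons numeral_2_eq_2 coeff_eq_0 split: nat.splits)
 ultimately obtain a b where ab: "p = [:a, 0, b:]" "a ~= 0" by metis
 have op: "2 <= order \<mu> p"
 proof -
  have "order \<mu> (?s ^ j) = 0" using mu by (intro order_0I) (simp add: poly_power)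
  thus ?thesis using two order_mult[of "?s ^ j" p \<mu>] q unfolding qp by simp
 qed
 show False using double_root[OF op] mu ab(2) unfolding ab(1) by (auto simp: pderiv_pCons)
qed

text \<open>If \<open>v\<^sup>T (adj L) v\<close> vanishes for all \<open>v\<close>, then the adjugate is skew-symmetric, hence so is \<open>L\<close>. Together with the
 alternating structure, \<open>L\<close> is a constant matrix or \<open>\<lambda>\<close> times a constant matrix.\<close>

lemma isotropic_pencil:
 assumes L: "alt_pencil \<sigma> n L" "det L ~= 0"
  and iso: "!!v. v \<in> Vec n ==> cvec v \<bullet> (adj_mat L *\<^sub>v cvec v) = 0"
 shows "i < n ==> j < n ==> L $$ (j,i) = - L $$ (i,j)"
proof -
 note Lc = alt_pencilD(2)[OF L(1)]
 let ?J = "adj_mat L"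
 have Jc: "?J \<in> Mat n" and Lt: "L\<^sup>T \<in> Mat n" using Lc by auto
 have sk: "?J $$ (j,i) = - ?J $$ (i,j)" if ij: "i < n" "j < n" for i j
 proof (rule poly_eqI)
  fix k
  have ck: "coeff_mat k ?J \<in> Mat n" using Jc by simp
  have z: "v \<bullet> (coeff_mat k ?J *\<^sub>v v) = 0" if "v \<in> Vec n" for v
   unfolding coeff_cvec_form[OF Jc that that, symmetric] iso[OF that] by simp
  have "coeff_mat k ?J $$ (j,i) = - coeff_mat k ?J $$ (i,j)"
  proof (rule ccontr)
   assume "\<not> ?thesis"
   then obtain u where "u \<in> Vec n" "u \<bullet> (coeff_mat k ?J *\<^sub>v u) ~= 0" using quadratic_form_nonzero[OF ck ij] by blast
   thus False using z by blast
  qed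
  thus "coeff (?J $$ (j,i)) k = coeff (- ?J $$ (i,j)) k" using ij Lc by simp
 qed
 have Jt: "?J\<^sup>T = (-1) \<cdot>\<^sub>m ?J"
 proof (rule eq_matI)
  fix i j assume "i < dim_row ((-1) \<cdot>\<^sub>m ?J)" "j < dim_col ((-1) \<cdot>\<^sub>m ?J)"
  hence ij: "i < n" "j < n" using Lc by auto
  show "?J\<^sup>T $$ (i,j) = ((-1) \<cdot>\<^sub>m ?J) $$ (i,j)" using ij Lc sk[OF ij] by simp
 qed (use Lc in auto)
 have "(L * ?J)\<^sup>T = ?J\<^sup>T * L\<^sup>T" by (rule transpose_mult[OF Lc Jc])
 hence "(det L \<cdot>\<^sub>m 1\<^sub>m n)\<^sup>T = (-1) \<cdot>\<^sub>m (?J * L\<^sup>T)" unfolding adj_mat(2)[OF Lc] Jt using Jc Lc by (simp add: mult_smult_assoc_mat[of _ n n _ n])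
 moreover have "(det L \<cdot>\<^sub>m 1\<^sub>m n)\<^sup>T = det L \<cdot>\<^sub>m 1\<^sub>m n" by (intro eq_matI) auto
 ultimately have "L * (det L \<cdot>\<^sub>m 1\<^sub>m n) = L * ((-1) \<cdot>\<^sub>m (?J * L\<^sup>T))" by simp
 also have "\<dots> = (-1) \<cdot>\<^sub>m ((L * ?J) * L\<^sup>T)"
  unfolding mult_smult_distrib[OF Lc mult_square_carrier[OF Jc Lt]] assoc_mult_mat[OF Lc Jc Lt] ..
 also have "\<dots> = (-1) \<cdot>\<^sub>m (det L \<cdot>\<^sub>m L\<^sup>T)" unfolding adj_mat(2)[OF Lc] using Lc by (simp add: mult_smult_assoc_mat[of _ n n _ n])
 finally have e: "L * (det L \<cdot>\<^sub>m 1\<^sub>m n) = (-1) \<cdot>\<^sub>m (det L \<cdot>\<^sub>m L\<^sup>T)" .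
 have "L * (det L \<cdot>\<^sub>m 1\<^sub>m n) = det L \<cdot>\<^sub>m L" using Lc by (simp add: mult_smult_distrib[of _ n n _ n])
 with e have e': "det L \<cdot>\<^sub>m L = (-1) \<cdot>\<^sub>m (det L \<cdot>\<^sub>m L\<^sup>T)" by simp
 assume ij: "i < n" "j < n"
 have "det L * L $$ (i,j) = det L * (- L $$ (j,i))"
  using arg_cong[OF e', of "\<lambda>M. M $$ (i,j)"] ij Lc by simp
 hence "L $$ (i,j) = - L $$ (j,i)" using L(2) by (metis mult_left_cancel)
 thus "L $$ (j,i) = - L $$ (i,j)" by simp
qed

text \<open>For \<open>L = \<lambda>B\<close> with \<open>B\<close> invertible there are \<open>n\<close> multiplicities 1 at zero, and rank two spoils at most two of
 them.\<close>

lemma homogeneous_order: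
 assumes L: "is_pencil n L" "det L ~= 0" and h: "!!i j. i < n ==> j < n ==> coeff (L $$ (i,j)) 0 = 0"
  and L2: "is_pencil n L2" "det L2 ~= 0" and rk: "rank_perturbed n 2 L L2"
 shows "n <= order 0 (det L2) + 2"
proof (cases "n = 0")
 case False
 note Lc = is_pencil_carrier[OF L(1)]
 let ?s = "[:0,1:] :: complex poly"
 define B where "B = coeff_mat 1 L"
 have Bc: "B \<in> Mat n" unfolding B_def using Lc by simp
 have Lij: "L $$ (i,j) = ?s * [:B $$ (i,j):]" if ij: "i < n" "j < n" for i j
 proof -
  have "L $$ (i,j) = [:coeff (L $$ (i,j)) 0, coeff (L $$ (i,j)) 1:]" using L(1) ij poly_deg1 unfolding is_pencil_def by blast
  thus ?thesis using h[OF ij] ij Lc unfolding B_def by simp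
 qed
 have "L = ?s \<cdot>\<^sub>m const_mat B" using Lc Bc Lij by (intro eq_matI) auto
 hence dL: "det L = ?s ^ n * det (const_mat B)" using Bc by (simp add: det_smult del: power.simps)
 have "?s ^ n dvd det L" unfolding dL by simp
 hence "[:-0,1:] ^ n dvd det L" by simp
 hence "n <= order 0 (det L)" using order_divides[of 0 n "det L"] L(2) by auto
 hence on: "order 0 (det L) = n" using order_det_le[OF L, of 0] by simp
 have "0 < blocks_ge L 0 1"
 proof (rule ccontr)
  assume "\<not> ?thesis"
  hence "blocks_ge L 0 k = 0" if "1 <= k" for k using exponents_ge_antimono[OF that, of "finite_partial_mults L 0"] by simp
  hence "order 0 (det L) = 0" using blocks_ge_sum[OF L order.refl, of 0] by simp
  thus False using on False by simp
 qed
 note ne = this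
 obtain C e d where C: "C \<in> Mat n" "ev_mat 0 C ~= 0\<^sub>m n n" and lt: "e < order 0 (det L)"
  and LC: "L * C = (?s ^ (order 0 (det L) - e) * d) \<cdot>\<^sub>m 1\<^sub>m n"
  and bg: "!!k. 1 <= k ==> 0 < blocks_ge L 0 k \<longleftrightarrow> k <= order 0 (det L) - e"
  by (rule eigenvalue_data[OF L ne, unfolded minus_zero]) blast
 define m where "m = order 0 (det L) - e"
 have "m = 1"
 proof (rule ccontr)
  assume "m ~= 1"
  hence m2: "2 <= m" using lt unfolding m_def by simp
  have "coeff_mat 0 C = 0\<^sub>m n n"
  proof (rule pencil_kills_only_zero[OF Lc L(2)])
   show "coeff_mat 0 C \<in> Mat n" using C by simp
   show "L * const_mat (coeff_mat 0 C) = 0\<^sub>m n n"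
   proof (rule eq_matI)
    fix i j assume "i < dim_row (0\<^sub>m n n :: complex poly mat)" "j < dim_col (0\<^sub>m n n :: complex poly mat)"
    hence ij: "i < n" "j < n" by auto
    have "(L * C) $$ (i,j) = ?s ^ m * (d * (if i = j then 1 else 0))" unfolding LC m_def[symmetric] using ij by (simp del: power.simps)
    hence "?s ^ 2 dvd (L * C) $$ (i,j)" using le_imp_power_dvd[OF m2, of ?s] by (metis dvd_mult2)
    then obtain r where r: "(L * C) $$ (i,j) = ?s ^ 2 * r" by (elim dvdE)
    have "coeff ((L * C) $$ (i,j)) 1 = 0" unfolding r by (simp add: power2_eq_square)
    moreover have "coeff ((L * C) $$ (i,j)) 1 = (\<Sum>l<n. B $$ (i,l) * coeff (C $$ (l,j)) 0)"
     unfolding mult_mat_sum[OF Lc C(1) ij] coeff_sum using ij by (intro sum.cong) (simp_all add: Lij)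
    ultimately have z: "(\<Sum>l<n. B $$ (i,l) * coeff (C $$ (l,j)) 0) = 0" by simp
    have "(L * const_mat (coeff_mat 0 C)) $$ (i,j) = (\<Sum>l<n. ?s * [:B $$ (i,l) * coeff (C $$ (l,j)) 0:])"
     using mult_mat_sum[OF Lc, of "const_mat (coeff_mat 0 C)" n i j] C ij by (simp add: Lij mult.commute)
    also have "\<dots> = ?s * [:\<Sum>l<n. B $$ (i,l) * coeff (C $$ (l,j)) 0:]"
    proof -
     have "(\<Sum>l<n. [:f l:]) = [:\<Sum>l<n. f l:]" for f :: "nat => complex" by (induction n) auto
     thus ?thesis unfolding sum_distrib_left[symmetric] by simp
    qed
    finally show "(L * const_mat (coeff_mat 0 C)) $$ (i,j) = 0\<^sub>m n n $$ (i,j)" unfolding z using ij by simp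
   qed (use Lc C in auto)
  qed
  thus False using C(2) by (simp add: poly_0_coeff_0)
 qed
 hence zk: "blocks_ge L 0 k = 0" if "2 <= k" for k using bg[of k] that unfolding m_def by simp
 have "order 0 (det L) = blocks_ge L 0 1 + (\<Sum>k = 2..n. blocks_ge L 0 k)"
  unfolding blocks_ge_sum[OF L order.refl, of 0, symmetric] using False by (subst sum.atLeast_Suc_atMost) (auto simp: numeral_2_eq_2)
 hence b1: "blocks_ge L 0 1 = n" using zk on by simp
 have "blocks_ge L 0 1 - 2 <= (\<Sum>k = 1..n. blocks_ge L 0 k - 2)"
  using member_le_sum[of 1 "{1..n}" "\<lambda>k. blocks_ge L 0 k - 2"] False by simp
 thus ?thesis using order_ge_plain[OF L L2 rk, of 0] unfolding b1 by simp
qed simp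

text \<open>In the exceptional case the determinant after the perturbation is \<open>\<lambda>\<^sup>j (a + b \<lambda>\<^sup>2)\<close>. If \<open>L\<close> is constant,
 its reversal is \<open>\<lambda>\<close> times a constant matrix, and the degree is at most two.\<close>

lemma isotropic_step:
 assumes L: "alt_pencil \<sigma> n L" "det L ~= 0"
  and iso: "!!v. v \<in> Vec n ==> cvec v \<bullet> (adj_mat L *\<^sub>v cvec v) = 0"
  and E: "det (L + pair_pert \<sigma> n v \<gamma> \<delta>) ~= 0" and mu: "\<mu> ~= 0"
 shows "order \<mu> (det (L + pair_pert \<sigma> n v \<gamma> \<delta>)) <= 1"
proof -
 let ?L2 = "L + pair_pert \<sigma> n v \<gamma> \<delta>"
 note Lp = alt_pencilD(1)[OF L(1)] and Lc = alt_pencilD(2)[OF L(1)]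
 have L2: "alt_pencil \<sigma> n ?L2" by (rule alt_pencil_add[OF L(1) alt_pair_pert])
 have sk: "L $$ (j,i) = - L $$ (i,j)" if "i < n" "j < n" for i j by (rule isotropic_pencil[OF L iso that])
 have fl: "flip (L $$ (i,j)) = [:- eps \<sigma>:] * L $$ (i,j)" if "i < n" "j < n" for i j
  using alt_pencilD(4)[OF L(1) that(2,1)] sk[OF that] by simp
 have cf: "(-1) ^ k * coeff (L $$ (i,j)) k = - eps \<sigma> * coeff (L $$ (i,j)) k" if "i < n" "j < n" for i j k
  using arg_cong[OF fl[OF that], of "\<lambda>p. coeff p k"] by (simp add: coeff_flip)
 have deg: "degree (det ?L2) <= order 0 (det ?L2) + 2"
 proof (cases \<sigma>)
  case T_even
  have "coeff (L $$ (i,j)) 0 = 0" if "i < n" "j < n" for i j using cf[OF that, of 0] T_even by simp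
  hence "n <= order 0 (det ?L2) + 2"
   using homogeneous_order[OF Lp L(2) _ alt_pencilD(1)[OF L2] E rank_perturbed_pair_pert[OF Lc]] by blast
  thus ?thesis using order_det_rev(2)[OF alt_pencilD(1)[OF L2] E] by simp
 next
  case T_odd
  have c1: "coeff (L $$ (i,j)) 1 = 0" if "i < n" "j < n" for i j using cf[OF that, of 1] T_odd by simp
  have rL: "is_pencil n (rev_pencil L)" "det (rev_pencil L) ~= 0"
   using alt_pencilD(1)[OF alt_rev_pencil[OF L(1)]] det_rev_eq_0_iff[OF Lp] L(2) by auto
  have rE: "rev_pencil ?L2 = rev_pencil L + pair_pert (dual \<sigma>) n v \<delta> \<gamma>"
   unfolding rev_pair_pert[symmetric] by (rule rev_pencil_add[OF Lc]) simp
  have "n <= order 0 (det (rev_pencil ?L2)) + 2"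
  proof (rule homogeneous_order[OF rL])
   show "coeff (rev_pencil L $$ (i,j)) 0 = 0" if "i < n" "j < n" for i j
    unfolding rev_pencil_index[OF Lc that] using c1[OF that] by simp
   show "is_pencil n (rev_pencil ?L2)" by (rule alt_pencilD(1)[OF alt_rev_pencil[OF L2]])
   show "det (rev_pencil ?L2) ~= 0" using det_rev_eq_0_iff[OF alt_pencilD(1)[OF L2]] E by simp
   show "rank_perturbed n 2 (rev_pencil L) (rev_pencil ?L2)" unfolding rE
    by (rule rank_perturbed_pair_pert[OF rev_pencil_carrier[OF Lc]])
  qed
  thus ?thesis using order_det_rev[OF alt_pencilD(1)[OF L2] E] by simp
 qed
 show ?thesis by (rule even_quadratic_simple[OF alternating_det_flip[OF alt_pencilD(3)[OF L2]] E deg mu])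
qed

text \<open>All that has to be shown about the perturbed pencil \<open>L'\<close>, where \<open>S\<close> contains the nonzero finite
 eigenvalues of \<open>L\<close>. Further points in \<open>S\<close> are points at which \<open>L'\<close> must not acquire an eigenvalue.\<close>

definition good :: "alternation => nat => nat => complex set => complex poly mat => complex poly mat => bool" where
 "good \<sigma> n r S L L' \<longleftrightarrow> det L' ~= 0 \<and> (\<forall>z \<in> Fin ` S \<union> {Fin 0, Infty}. meets \<sigma> n r L L' z) \<and>
   (\<forall>\<mu>. \<mu> ~= 0 \<longrightarrow> \<mu> \<notin> S \<longrightarrow> order \<mu> (det L') <= 1)"

lemma block_carrier [simp]: "block n k x \<in> Vec n"
 unfolding block_def by simp

lemma block_line:
 assumes "x \<in> carrier_vec (K * n)" "y \<in> carrier_vec (K * n)" "k < K"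
 shows "block n k (x + t \<cdot>\<^sub>v y) = block n k x + t \<cdot>\<^sub>v block n k y"
proof (rule eq_vecI)
 fix a assume "a < dim_vec (block n k x + t \<cdot>\<^sub>v block n k y)"
 hence a: "a < n" by (simp add: block_def)
 have "k * n + a < (k + 1) * n" using a by simp
 also have "\<dots> <= K * n" using assms(3) by (intro mult_le_mono1) simp
 finally show "block n k (x + t \<cdot>\<^sub>v y) $ a = (block n k x + t \<cdot>\<^sub>v block n k y) $ a"
  using assms a unfolding block_def by simp
qed (simp add: block_def)

lemma Phi_1: "Phi \<sigma> n 1 x = rank_one_pert \<sigma> (block n 0 x)"
 unfolding Phi_eq_struct_pert using struct_pert_1[OF block_carrier] by simp

lemma Phi_2: "Phi \<sigma> n 2 x = pair_pert \<sigma> n (block n 0 x) (block n 1 x) (block n 2 x)"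
 unfolding Phi_eq_struct_pert struct_pert_2 by simp

lemma cvec_form_scale:
 assumes "C \<in> Mat n" "u \<in> Vec n"
 shows "cvec (c \<cdot>\<^sub>v u) \<bullet> (C *\<^sub>v cvec (c \<cdot>\<^sub>v u)) = Polynomial.smult (c * c) (cvec u \<bullet> (C *\<^sub>v cvec u))"
 using assms unfolding cvec_form[OF assms(1) smult_carrier_vec[THEN iffD2, OF assms(2)] smult_carrier_vec[THEN iffD2, OF assms(2)]]
  cvec_form[OF assms(1,2,2)] smult_sum2
 by (intro sum.cong) (auto simp: mult_ac)

lemma order_outside_roots: "poly p \<mu> ~= 0 ==> order \<mu> p <= 1"
 by (simp add: order_0I)

text \<open>Scaling \<open>u\<close> by \<open>t\<close> moves the determinant along the line from \<open>det L\<close> in the direction of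
 \<open>f u\<^sup>T (adj L) u\<close>, at parameter \<open>t\<^sup>2\<close>. The roots of \<open>det L\<close> belong to \<open>S\<close> or are zero, so there are no
 base points elsewhere.\<close>

lemma good_rank_one:
 assumes L: "alt_pencil \<sigma> n L" "det L ~= 0" and S: "finite S" "!!\<mu>. poly (det L) \<mu> = 0 ==> \<mu> \<in> S \<union> {0}"
 shows "\<exists>x \<in> carrier_vec ((3 * 1 div 2) * n). good \<sigma> n 1 S L (L + Phi \<sigma> n 1 x)"
proof -
 note Lc = alt_pencilD(2)[OF L(1)]
 let ?m = "(3 * 1 div 2) * n" and ?Z = "Fin ` S \<union> {Fin 0, Infty}" and ?s = "[:0,1:] :: complex poly"
 have Z: "finite ?Z" "?Z ~= {}" using S(1) by auto
 obtain f x0 where f: "polyfun ?m f" and x0: "x0 \<in> carrier_vec ?m" "f x0 ~= 0" and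
  ok: "\<forall>x \<in> carrier_vec ?m. f x ~= 0 \<longrightarrow> det (L + Phi \<sigma> n 1 x) ~= 0 \<and> (\<forall>z\<in>?Z. meets \<sigma> n 1 L (L + Phi \<sigma> n 1 x) z)"
  by (rule meets_generic[OF L Z meets_witness[OF L, of 1]]) auto
 have x0c: "x0 \<in> carrier_vec (1 * n)" "0\<^sub>v n \<in> carrier_vec (1 * n)" using x0(1) by auto
 obtain P where P: "!!t. f (0\<^sub>v n + t \<cdot>\<^sub>v x0) = poly P t"
  by (rule polyfun_line[OF f, of "0\<^sub>v n" x0]) (use x0(1) in auto)
 define u where "u = block n 0 x0"
 have u: "u \<in> Vec n" unfolding u_def by simp
 define q1 where "q1 = ?s ^ weight \<sigma> * (cvec u \<bullet> (adj_mat L *\<^sub>v cvec u))"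
 have det: "det (L + Phi \<sigma> n 1 (0\<^sub>v n + t \<cdot>\<^sub>v x0)) = det L + Polynomial.smult (t * t) q1" for t
 proof -
  have "block n 0 (0\<^sub>v n + t \<cdot>\<^sub>v x0) = t \<cdot>\<^sub>v u"
   unfolding u_def block_line[OF x0c(2,1), of 0, simplified] by (intro eq_vecI) (auto simp: block_def)
  thus ?thesis unfolding Phi_1 det_rank_one_pert[OF Lc L(2) block_carrier] q1_def
   using cvec_form_scale[OF adj_carrier[OF Lc] u, of t] by simp
 qed
 have "f x0 = poly P 1" using P[of 1] x0c by simp
 hence P0: "P ~= 0" using x0(2) by auto
 have "\<exists>t. poly P t ~= 0 \<and> (\<forall>\<mu>. \<mu> \<notin> S \<union> {0} \<longrightarrow> order \<mu> (det L + Polynomial.smult (t * t) q1) <= 1)"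
 proof (cases "q1 = 0")
  case True
  have "order \<mu> (det L) <= 1" if "\<mu> \<notin> S \<union> {0}" for \<mu> using S(2)[of \<mu>] that order_outside_roots by blast
  moreover have "poly P 1 ~= 0" using P[of 1] x0(2) x0c by simp
  ultimately show ?thesis unfolding True by auto
 next
  case False
  define T where "T = {t. \<exists>z. z \<notin> S \<union> {0} \<and> 2 <= order z (det L + Polynomial.smult t q1)}"
  have T: "finite T" unfolding T_def by (rule multiple_roots_in_family[OF False]) (use S in auto)
  have fin1: "finite (\<Union>t\<in>T. {c. poly [:- t, 0, 1:] c = 0})"
   using T by (intro finite_UN_I poly_roots_finite) auto
  have sub: "{c. c * c \<in> T} \<subseteq> (\<Union>t\<in>T. {c. poly [:- t, 0, 1:] c = 0})" by auto
  have fin: "finite ({c. c * c \<in> T} \<union> {c. poly P c = 0})" using finite_subset[OF sub fin1] poly_roots_finite[OF P0] by blast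
  obtain c where "c \<notin> {c. c * c \<in> T} \<union> {c. poly P c = 0}" using ex_new_if_finite[OF infinite_UNIV_char_0 fin] by blast
  hence c: "c * c \<notin> T" "poly P c ~= 0" by auto
  have "order \<mu> (det L + Polynomial.smult (c * c) q1) <= 1" if "\<mu> \<notin> S \<union> {0}" for \<mu>
   using c(1) that unfolding T_def by (metis (mono_tags, lifting) Suc_1 mem_Collect_eq not_less_eq_eq)
  thus ?thesis using c(2) by blast
 qed
 then obtain t where t: "poly P t ~= 0" "!!\<mu>. \<mu> \<notin> S \<union> {0} ==> order \<mu> (det L + Polynomial.smult (t * t) q1) <= 1" by blast
 let ?x = "0\<^sub>v n + t \<cdot>\<^sub>v x0"
 have x: "?x \<in> carrier_vec ?m" using x0(1) by auto
 have "f ?x ~= 0" unfolding P by (rule t(1))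
 hence "good \<sigma> n 1 S L (L + Phi \<sigma> n 1 ?x)" using ok x t(2) unfolding good_def det[of t, symmetric] by blast
 thus ?thesis using x by blast
qed

text \<open>Moving \<open>w\<close> in the direction of \<open>v\<close> adds a multiple of \<open>vv\<^sup>T\<close> and moves the determinant along a line
 whose direction \<open>v\<^sup>T adj L v\<close> depends on \<open>v\<close> alone.\<close>

lemma det_pair_pert_line:
 assumes L: "L \<in> Mat n" "det L ~= 0" and v: "v \<in> Vec n" "\<gamma> \<in> Vec n" "\<delta> \<in> Vec n"
  and nz: "det L + vec n (\<lambda>i. [:\<gamma> $ i, \<delta> $ i:]) \<bullet> (adj_mat L *\<^sub>v cvec v) ~= 0"
 shows "det (L + pair_pert \<sigma> n v (\<gamma> + t \<cdot>\<^sub>v (if \<sigma> = T_even then (1/2) \<cdot>\<^sub>v v else 0\<^sub>v n))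
   (\<delta> + t \<cdot>\<^sub>v (if \<sigma> = T_even then 0\<^sub>v n else (1/2) \<cdot>\<^sub>v v))) =
  det (L + pair_pert \<sigma> n v \<gamma> \<delta>) + Polynomial.smult t ([:0,1:] ^ weight \<sigma> * (cvec v \<bullet> (adj_mat L *\<^sub>v cvec v)))"
proof -
 let ?J = "adj_mat L"
 define V where "V = cvec v"
 define W where "W = vec n (\<lambda>i. [:\<gamma> $ i, \<delta> $ i:])"
 define X where "X = vec n (\<lambda>i. [:eps \<sigma>:] * [:\<gamma> $ i, - (\<delta> $ i):])"
 define c where "c = [:t:] * [:0,1:] ^ weight \<sigma>"
 have Vc: "V \<in> Vec n" "W \<in> Vec n" "X \<in> Vec n" "c \<cdot>\<^sub>v V \<in> Vec n" "X + c \<cdot>\<^sub>v V \<in> Vec n"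
  unfolding V_def W_def X_def using v by auto
 have Jc: "?J \<in> Mat n" using L by simp
 have oc: "outer V W \<in> Mat n" "outer X V \<in> Mat n" "outer (X + c \<cdot>\<^sub>v V) V \<in> Mat n" using Vc by auto
 have e1: "pair_pert \<sigma> n v \<gamma> \<delta> = outer V W + outer X V"
  unfolding V_def W_def X_def using v by (intro eq_matI) (auto simp: pair_pert_def pert_pair_def)
 have e2: "pair_pert \<sigma> n v (\<gamma> + t \<cdot>\<^sub>v (if \<sigma> = T_even then (1/2) \<cdot>\<^sub>v v else 0\<^sub>v n))
   (\<delta> + t \<cdot>\<^sub>v (if \<sigma> = T_even then 0\<^sub>v n else (1/2) \<cdot>\<^sub>v v)) = outer V W + outer (X + c \<cdot>\<^sub>v V) V"
  unfolding V_def W_def X_def c_def using v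
  by (intro eq_matI; cases \<sigma>) (auto simp: pair_pert_def pert_pair_def algebra_simps)
 have JX: "?J *\<^sub>v (X + c \<cdot>\<^sub>v V) = ?J *\<^sub>v X + c \<cdot>\<^sub>v (?J *\<^sub>v V)"
  unfolding mult_add_distrib_mat_vec[OF Jc Vc(3,4)] mult_mat_smult_vec[OF Jc Vc(1)] ..
 have JXc: "?J *\<^sub>v X \<in> Vec n" "?J *\<^sub>v V \<in> Vec n" using Jc Vc by auto
 have dot: "Y \<bullet> (?J *\<^sub>v (X + c \<cdot>\<^sub>v V)) = Y \<bullet> (?J *\<^sub>v X) + c * (Y \<bullet> (?J *\<^sub>v V))" if "Y \<in> Vec n" for Y
  unfolding JX using that JXc by (subst scalar_prod_add_distrib[of _ n]) auto
 have nz': "det L + W \<bullet> (?J *\<^sub>v V) ~= 0" using nz unfolding W_def V_def .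
 have "det L * det (L + (outer V W + outer (X + c \<cdot>\<^sub>v V) V)) =
   det L * (det (L + (outer V W + outer X V)) + c * (V \<bullet> (?J *\<^sub>v V)))"
  unfolding assoc_add_mat[OF L(1) oc(1,2), symmetric] assoc_add_mat[OF L(1) oc(1,3), symmetric] distrib_left[of "det L"]
   skew_pair_det[OF L Vc(1,2,3,1) nz'] skew_pair_det[OF L Vc(1,2,5,1) nz'] dot[OF Vc(1)] dot[OF Vc(2)]
  by (simp add: algebra_simps del: power.simps)
 hence "det (L + (outer V W + outer (X + c \<cdot>\<^sub>v V) V)) = det (L + (outer V W + outer X V)) + c * (V \<bullet> (?J *\<^sub>v V))"
  using L(2) by (metis mult_left_cancel)
 thus ?thesis unfolding e1 e2 c_def V_def by (simp add: mult.assoc del: power.simps)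
qed

definition embed :: "nat => complex vec => complex vec => complex vec => complex vec" where
 "embed n a b c = vec (3 * n) (\<lambda>i. if i < n then a $ i else if i < 2 * n then b $ (i - n) else c $ (i - 2 * n))"

lemma embed_carrier [simp]: "embed n a b c \<in> carrier_vec (3 * n)"
 unfolding embed_def by simp

lemma block_embed:
 assumes "a \<in> Vec n" "b \<in> Vec n" "c \<in> Vec n"
 shows "block n 0 (embed n a b c) = a" "block n 1 (embed n a b c) = b" "block n 2 (embed n a b c) = c"
 using assms unfolding block_def embed_def by (intro eq_vecI; simp)+

lemma embed_line:
 assumes "a \<in> Vec n" "b \<in> Vec n" "c \<in> Vec n" "a' \<in> Vec n" "b' \<in> Vec n" "c' \<in> Vec n"
 shows "embed n a b c + t \<cdot>\<^sub>v embed n a' b' c' = embed n (a + t \<cdot>\<^sub>v a') (b + t \<cdot>\<^sub>v b') (c + t \<cdot>\<^sub>v c')"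
 using assms unfolding embed_def by (intro eq_vecI) auto

lemma embed_blocks:
 assumes "x \<in> carrier_vec (3 * n)"
 shows "embed n (block n 0 x) (block n 1 x) (block n 2 x) = x"
 using assms unfolding embed_def block_def by (intro eq_vecI) auto

lemma polyfun_poly_eval:
 assumes "polyfun_poly m F"
 shows "polyfun m (\<lambda>x. poly (F x) a)"
proof -
 obtain N c where c: "!!i. i <= N ==> polyfun m (c i)"
  "!!x. x \<in> carrier_vec m ==> F x = (\<Sum>i\<le>N. monom (c i x) i)"
  using assms unfolding polyfun_poly_def by blast
 have "polyfun m (\<lambda>x. \<Sum>i\<le>N. c i x * a ^ i)" using c(1) by (intro polyfun_sum polyfun_mult polyfun_const) auto
 thus ?thesis by (rule polyfun_cong) (simp add: c(2) poly_sum poly_monom)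
qed

lemma polyfun_det_Phi:
 assumes "L \<in> Mat n"
 shows "polyfun_poly ((3 * r div 2) * n) (\<lambda>x. det (L + Phi \<sigma> n r x))"
proof (rule polyfun_poly_det[of n])
 fix i j assume ij: "i < n" "j < n"
 have "polyfun_poly ((3 * r div 2) * n) (\<lambda>x. L $$ (i,j) + Phi \<sigma> n r x $$ (i,j))"
  by (intro polyfun_poly_add polyfun_poly_const polyfun_Phi ij)
 thus "polyfun_poly ((3 * r div 2) * n) (\<lambda>x. (L + Phi \<sigma> n r x) $$ (i,j))"
  using ij carrier_matD[OF Phi_dims[of \<sigma> n r]] by simp
qed (use assms in simp)

lemma finite_smult_root: "(p :: complex poly) ~= 0 ==> finite {t. p + Polynomial.smult t q = 0}"
proof -
 assume p: "p ~= 0"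
 let ?k = "degree p"
 have "{t. p + Polynomial.smult t q = 0} \<subseteq> {t. poly [:coeff p ?k, coeff q ?k:] t = 0}"
 proof
  fix t assume "t \<in> {t. p + Polynomial.smult t q = 0}"
  hence "coeff (p + Polynomial.smult t q) ?k = 0" by simp
  thus "t \<in> {t. poly [:coeff p ?k, coeff q ?k:] t = 0}" by simp
 qed
 moreover have "finite {t. poly [:coeff p ?k, coeff q ?k:] t = 0}" using p by (intro poly_roots_finite) simp
 ultimately show ?thesis by (rule finite_subset)
qed

lemma pair_pert_0: "pair_pert \<sigma> n v (0\<^sub>v n) (0\<^sub>v n) = 0\<^sub>m n n"
 unfolding pair_pert_def pert_pair_def by (intro eq_matI) auto

text \<open>Choose generic parameters, shrink \<open>w\<close> so that the determinant does not vanish at the roots of the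
 direction \<open>v\<^sup>T (adj L) v\<close>, and then move \<open>w\<close> in the direction of \<open>v\<close>. If that direction vanishes for
 all \<open>v\<close>, the exceptional case applies and there is nothing to choose.\<close>

lemma good_pair:
 assumes L: "alt_pencil \<sigma> n L" "det L ~= 0" and S: "finite S" "!!\<mu>. poly (det L) \<mu> = 0 ==> \<mu> \<in> S \<union> {0}"
 shows "\<exists>v \<gamma> \<delta>. good \<sigma> n 2 S L (L + pair_pert \<sigma> n v \<gamma> \<delta>)"
proof -
 note Lc = alt_pencilD(2)[OF L(1)]
 let ?Z = "Fin ` S \<union> {Fin 0, Infty}" and ?s = "[:0,1:] :: complex poly" and ?J = "adj_mat L"
 have Z: "finite ?Z" "?Z ~= {}" using S(1) by auto
 have M: "(3 * 2 div 2) * n = 3 * n" by simp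
 obtain f x0 where f: "polyfun (3 * n) f" and x0: "x0 \<in> carrier_vec (3 * n)" "f x0 ~= 0" and
  ok: "\<forall>x \<in> carrier_vec (3 * n). f x ~= 0 \<longrightarrow> det (L + Phi \<sigma> n 2 x) ~= 0 \<and> (\<forall>z\<in>?Z. meets \<sigma> n 2 L (L + Phi \<sigma> n 2 x) z)"
  by (rule meets_generic[OF L Z meets_witness[OF L, of 2], unfolded M]) auto
 have Jc: "?J \<in> Mat n" using Lc by simp
 show ?thesis
 proof (cases "\<forall>v \<in> Vec n. cvec v \<bullet> (?J *\<^sub>v cvec v) = 0")
  case True
  have d: "det (L + pair_pert \<sigma> n (block n 0 x0) (block n 1 x0) (block n 2 x0)) ~= 0" using ok x0 unfolding Phi_2 by blast
  have "good \<sigma> n 2 S L (L + pair_pert \<sigma> n (block n 0 x0) (block n 1 x0) (block n 2 x0))"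
   using ok x0 isotropic_step[OF L _ d] True unfolding good_def Phi_2 by blast
  thus ?thesis by blast
 next
  case False
  then obtain v1 where v1: "v1 \<in> Vec n" "cvec v1 \<bullet> (?J *\<^sub>v cvec v1) ~= 0" by blast
  then obtain k where k: "coeff (cvec v1 \<bullet> (?J *\<^sub>v cvec v1)) k ~= 0" by (auto simp: poly_eq_iff)
  have Jk: "coeff_mat k ?J \<in> Mat n" using Jc by simp
  have "polyfun (3 * n) (\<lambda>x. \<Sum>i<n. \<Sum>j<n. block n 0 x $ i * block n 0 x $ j * coeff_mat k ?J $$ (i,j))"
   by (intro polyfun_sum polyfun_mult polyfun_const polyfun_block) auto
  hence ph: "polyfun (3 * n) (\<lambda>x. coeff (cvec (block n 0 x) \<bullet> (?J *\<^sub>v cvec (block n 0 x))) k)"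
   by (rule polyfun_cong) (simp only: coeff_cvec_form[OF Jc block_carrier block_carrier] form_sum[OF Jk block_carrier block_carrier])
  have "coeff (cvec (block n 0 (embed n v1 v1 v1)) \<bullet> (?J *\<^sub>v cvec (block n 0 (embed n v1 v1 v1)))) k ~= 0"
   using k unfolding block_embed(1)[OF v1(1) v1(1) v1(1)] .
  from polyfun_common_nonzero[OF f x0 ph embed_carrier this]
  obtain x1 where x1: "x1 \<in> carrier_vec (3 * n)" "f x1 ~= 0" "coeff (cvec (block n 0 x1) \<bullet> (?J *\<^sub>v cvec (block n 0 x1))) k ~= 0" by blast
  define v where "v = block n 0 x1"
  define \<gamma> where "\<gamma> = block n 1 x1"
  define \<delta> where "\<delta> = block n 2 x1"
  have vc: "v \<in> Vec n" "\<gamma> \<in> Vec n" "\<delta> \<in> Vec n" "0\<^sub>v n \<in> Vec n" unfolding v_def \<gamma>_def \<delta>_def by auto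
  define q1 where "q1 = ?s ^ weight \<sigma> * (cvec v \<bullet> (?J *\<^sub>v cvec v))"
  have q1: "q1 ~= 0" using x1(3) unfolding q1_def v_def by auto
  \<comment> \<open>The points that must not become base points of the line.\<close>
  define F where "F = {z. poly q1 z = 0} - (S \<union> {0})"
  have F: "finite F" unfolding F_def using poly_roots_finite[OF q1] by blast
  let ?A = "embed n v (0\<^sub>v n) (0\<^sub>v n)" and ?B = "embed n (0\<^sub>v n) \<gamma> \<delta>"
  have AB: "?A + \<tau> \<cdot>\<^sub>v ?B = embed n v (\<tau> \<cdot>\<^sub>v \<gamma>) (\<tau> \<cdot>\<^sub>v \<delta>)" for \<tau>
  proof -
   have "v + \<tau> \<cdot>\<^sub>v 0\<^sub>v n = v" "0\<^sub>v n + \<tau> \<cdot>\<^sub>v \<gamma> = \<tau> \<cdot>\<^sub>v \<gamma>" "0\<^sub>v n + \<tau> \<cdot>\<^sub>v \<delta> = \<tau> \<cdot>\<^sub>v \<delta>" using vc by auto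
   thus ?thesis unfolding embed_line[OF vc(1,4,4,4,2,3)] by simp
  qed
  have AB1: "?A + 1 \<cdot>\<^sub>v ?B = x1" unfolding AB using embed_blocks[OF x1(1)] unfolding v_def \<gamma>_def \<delta>_def by simp
  have PhiAB: "Phi \<sigma> n 2 (?A + \<tau> \<cdot>\<^sub>v ?B) = pair_pert \<sigma> n v (\<tau> \<cdot>\<^sub>v \<gamma>) (\<tau> \<cdot>\<^sub>v \<delta>)" for \<tau>
   unfolding AB Phi_2 using block_embed[of v n "\<tau> \<cdot>\<^sub>v \<gamma>" "\<tau> \<cdot>\<^sub>v \<delta>"] vc by simp
  \<comment> \<open>Shrinking \<open>w\<close> keeps the common roots of the two ends of the line away.\<close>
  obtain P where P: "!!t. f (?A + t \<cdot>\<^sub>v ?B) = poly P t" by (rule polyfun_line[OF f embed_carrier embed_carrier]) blast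
  have P0: "P ~= 0" using P[of 1] x1(2) unfolding AB1 by auto
  have pd: "polyfun (3 * n) (\<lambda>x. \<Prod>z\<in>F. poly (det (L + Phi \<sigma> n 2 x)) z)"
   using polyfun_poly_eval[OF polyfun_det_Phi[OF Lc, of 2 \<sigma>]] unfolding M by (intro polyfun_prod) auto
  obtain Q where Q: "!!t. (\<Prod>z\<in>F. poly (det (L + Phi \<sigma> n 2 (?A + t \<cdot>\<^sub>v ?B))) z) = poly Q t"
   by (rule polyfun_line[OF pd embed_carrier embed_carrier]) blast
  have "Phi \<sigma> n 2 (?A + 0 \<cdot>\<^sub>v ?B) = 0\<^sub>m n n"
  proof -
   have "(0 :: complex) \<cdot>\<^sub>v \<gamma> = 0\<^sub>v n" "(0 :: complex) \<cdot>\<^sub>v \<delta> = 0\<^sub>v n" using vc by auto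
   thus ?thesis unfolding PhiAB using pair_pert_0 by simp
  qed
  hence "poly Q 0 = (\<Prod>z\<in>F. poly (det L) z)" using Q[of 0] Lc by simp
  moreover have "(\<Prod>z\<in>F. poly (det L) z) ~= 0" using F S(2) by (auto simp: F_def prod_zero_iff)
  ultimately have Q0: "Q ~= 0" by auto
  define W where "W = (\<lambda>\<tau>. vec n (\<lambda>i. [:(\<tau> \<cdot>\<^sub>v \<gamma>) $ i, (\<tau> \<cdot>\<^sub>v \<delta>) $ i:]))"
  define g where "g = W 1 \<bullet> (?J *\<^sub>v cvec v)"
  have Wt: "W \<tau> \<bullet> (?J *\<^sub>v cvec v) = Polynomial.smult \<tau> g" for \<tau>
  proof -
   have "W \<tau> = [:\<tau>:] \<cdot>\<^sub>v W 1" unfolding W_def using vc by (intro eq_vecI) auto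
   moreover have "W 1 \<in> Vec n" unfolding W_def by simp
   ultimately show ?thesis unfolding g_def using Jc vc by simp
  qed
  have fin: "finite ({t. poly P t = 0} \<union> {t. poly Q t = 0} \<union> {t. det L + Polynomial.smult t g = 0})"
   using poly_roots_finite[OF P0] poly_roots_finite[OF Q0] finite_smult_root[OF L(2), of g] by blast
  obtain \<tau> where "\<tau> \<notin> {t. poly P t = 0} \<union> {t. poly Q t = 0} \<union> {t. det L + Polynomial.smult t g = 0}"
   using ex_new_if_finite[OF infinite_UNIV_char_0 fin] by blast
  hence \<tau>: "poly P \<tau> ~= 0" "poly Q \<tau> ~= 0" "det L + W \<tau> \<bullet> (?J *\<^sub>v cvec v) ~= 0" unfolding Wt by auto
  let ?D = "embed n (0\<^sub>v n) (if \<sigma> = T_even then (1/2) \<cdot>\<^sub>v v else 0\<^sub>v n) (if \<sigma> = T_even then 0\<^sub>v n else (1/2) \<cdot>\<^sub>v v)"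
  define X where "X = ?A + \<tau> \<cdot>\<^sub>v ?B"
  have Xc: "X \<in> carrier_vec (3 * n)" unfolding X_def by simp
  have \<tau>c: "\<tau> \<cdot>\<^sub>v \<gamma> \<in> Vec n" "\<tau> \<cdot>\<^sub>v \<delta> \<in> Vec n" using vc by auto
  have hc: "(if \<sigma> = T_even then (1/2) \<cdot>\<^sub>v v else 0\<^sub>v n) \<in> Vec n" "(if \<sigma> = T_even then 0\<^sub>v n else (1/2) \<cdot>\<^sub>v v) \<in> Vec n"
   using vc by auto
  define G where "G = (\<lambda>t. \<tau> \<cdot>\<^sub>v \<gamma> + t \<cdot>\<^sub>v (if \<sigma> = T_even then (1/2) \<cdot>\<^sub>v v else 0\<^sub>v n))"
  define H where "H = (\<lambda>t. \<tau> \<cdot>\<^sub>v \<delta> + t \<cdot>\<^sub>v (if \<sigma> = T_even then 0\<^sub>v n else (1/2) \<cdot>\<^sub>v v))"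
  have GHc: "G t \<in> Vec n" "H t \<in> Vec n" for t unfolding G_def H_def using \<tau>c hc by auto
  have PhiX: "Phi \<sigma> n 2 (X + t \<cdot>\<^sub>v ?D) = pair_pert \<sigma> n v (G t) (H t)" for t
  proof -
   have "X + t \<cdot>\<^sub>v ?D = embed n v (G t) (H t)"
   proof -
    have "v + t \<cdot>\<^sub>v 0\<^sub>v n = v" using vc by auto
    thus ?thesis unfolding X_def AB embed_line[OF vc(1) \<tau>c vc(4) hc] G_def H_def by simp
   qed
   thus ?thesis unfolding Phi_2 using block_embed[OF vc(1) GHc] by simp
  qed
  define q0 where "q0 = det (L + pair_pert \<sigma> n v (\<tau> \<cdot>\<^sub>v \<gamma>) (\<tau> \<cdot>\<^sub>v \<delta>))"
  have det: "det (L + Phi \<sigma> n 2 (X + t \<cdot>\<^sub>v ?D)) = q0 + Polynomial.smult t q1" for t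
   unfolding PhiX G_def H_def q0_def q1_def
   by (rule det_pair_pert_line[OF Lc L(2) vc(1) \<tau>c \<tau>(3)[unfolded W_def]])
  obtain R where R: "!!t. f (X + t \<cdot>\<^sub>v ?D) = poly R t" by (rule polyfun_line[OF f Xc embed_carrier]) blast
  have "X + 0 \<cdot>\<^sub>v ?D = X" using Xc by (intro eq_vecI) (auto simp: embed_def)
  hence R0: "R ~= 0" using R[of 0] P[of \<tau>] \<tau>(1) unfolding X_def by auto
  \<comment> \<open>The exceptional parameters, at which a multiple root appears.\<close>
  define T where "T = {t. \<exists>z. z \<notin> S \<union> {0} \<and> 2 <= order z (q0 + Polynomial.smult t q1)}"
  have T: "finite T" unfolding T_def
  proof (rule multiple_roots_in_family[OF q1])
   fix z assume z: "z \<notin> S \<union> {0}" "poly q1 z = 0"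
   hence zF: "z \<in> F" unfolding F_def by simp
   have "(\<Prod>z\<in>F. poly q0 z) ~= 0" using Q[of \<tau>] \<tau>(2) unfolding PhiAB q0_def by simp
   thus "poly q0 z ~= 0" using zF F by (auto simp: prod_zero_iff)
  qed (use S(1) in simp)
  have fin2: "finite (T \<union> {t. poly R t = 0})" using T poly_roots_finite[OF R0] by blast
  obtain t where "t \<notin> T \<union> {t. poly R t = 0}" using ex_new_if_finite[OF infinite_UNIV_char_0 fin2] by blast
  hence t: "t \<notin> T" "poly R t ~= 0" by auto
  have sim: "order \<mu> (det (L + pair_pert \<sigma> n v (G t) (H t))) <= 1" if "\<mu> ~= 0" "\<mu> \<notin> S" for \<mu>
  proof (rule ccontr)
   assume "\<not> ?thesis"
   hence "2 <= order \<mu> (q0 + Polynomial.smult t q1)" unfolding det[of t, symmetric] PhiX by simp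
   thus False using t(1) that unfolding T_def by blast
  qed
  have "X + t \<cdot>\<^sub>v ?D \<in> carrier_vec (3 * n)" "f (X + t \<cdot>\<^sub>v ?D) ~= 0" using Xc t(2) R[of t] by auto
  hence "good \<sigma> n 2 S L (L + pair_pert \<sigma> n v (G t) (H t))"
   using ok sim unfolding good_def PhiX[of t, symmetric] by blast
  thus ?thesis by blast
 qed
qed

text \<open>Induction in steps of two. The simple new eigenvalues of the first pencil have to disappear in the
 second step, so they are added to \<open>S\<close>: a perturbation of rank two removes them generically.\<close>

lemma good_exists:
 assumes L: "alt_pencil \<sigma> n L" "det L ~= 0" and S: "finite S" "!!\<mu>. poly (det L) \<mu> = 0 ==> \<mu> \<in> S \<union> {0}"
 shows "\<exists>x \<in> carrier_vec ((3 * r div 2) * n). good \<sigma> n r S L (L + Phi \<sigma> n r x)"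
proof (induction r rule: nat_less_induct)
 case (1 r)
 note Lc = alt_pencilD(2)[OF L(1)] and Lp = alt_pencilD(1)[OF L(1)]
 have rL: "alt_pencil (dual \<sigma>) n (rev_pencil L)" "det (rev_pencil L) ~= 0"
  using alt_rev_pencil[OF L(1)] det_rev_eq_0_iff[OF Lp] L(2) by auto
 consider "r = 0" | "r = 1" | r' where "r = r' + 2" by (metis One_nat_def Suc_1 add_2_eq_Suc' old.nat.exhaust)
 thus ?case
 proof cases
  case 1
  have "L + Phi \<sigma> n 0 (0\<^sub>v ((3 * 0 div 2) * n)) = L" unfolding Phi_eq_struct_pert struct_pert_0 using Lc by simp
  moreover have "good \<sigma> n 0 S L L"
  proof -
   have "meets \<sigma> n 0 L L z" for z
    using target_0[OF admissible_blocks[OF L]] target_0[OF admissible_blocks[OF rL]] by (cases z) (auto simp del: target.simps)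
   moreover have "order \<mu> (det L) <= 1" if "\<mu> ~= 0" "\<mu> \<notin> S" for \<mu> using S(2)[of \<mu>] that order_outside_roots by blast
   ultimately show ?thesis unfolding good_def using L(2) by blast
  qed
  ultimately show ?thesis unfolding 1 by (metis zero_carrier_vec)
 next
  case 2
  show ?thesis unfolding 2 by (rule good_rank_one[OF L S])
 next
  case 3
  hence "r' < r" by simp
  then obtain x where x: "good \<sigma> n r' S L (L + Phi \<sigma> n r' x)" using 1 by blast
  let ?L1 = "L + Phi \<sigma> n r' x"
  have L1: "alt_pencil \<sigma> n ?L1" "det ?L1 ~= 0" using alt_pencil_add[OF L(1) alt_Phi] x unfolding good_def by auto
  let ?S1 = "S \<union> {\<mu>. poly (det ?L1) \<mu> = 0}"
  have "finite ?S1" using S(1) poly_roots_finite[OF L1(2)] by blast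
  then obtain v \<gamma> \<delta> where y: "good \<sigma> n 2 ?S1 ?L1 (?L1 + pair_pert \<sigma> n v \<gamma> \<delta>)"
   using good_pair[OF L1, of ?S1] by blast
  let ?L2 = "?L1 + pair_pert \<sigma> n v \<gamma> \<delta>"
  have L2: "alt_pencil \<sigma> n ?L2" "det ?L2 ~= 0" using alt_pencil_add[OF L1(1) alt_pair_pert] y unfolding good_def by auto
  have "meets \<sigma> n r L ?L2 z" if "z \<in> Fin ` S \<union> {Fin 0, Infty}" for z
  proof -
   have "meets \<sigma> n r' L ?L1 z" "meets \<sigma> n 2 ?L1 ?L2 z" using x y that unfolding good_def by auto
   thus ?thesis unfolding 3 by (rule meets_compose[OF L])
  qed
  moreover have "order \<mu> (det ?L2) <= 1" if \<mu>: "\<mu> ~= 0" "\<mu> \<notin> S" for \<mu>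
  proof (cases "\<mu> \<in> ?S1")
   case False
   thus ?thesis using y \<mu> unfolding good_def by blast
  next
   case True
   have "order \<mu> (det ?L1) <= 1" using x \<mu> unfolding good_def by blast
   hence b1: "(\<Sum>k = 1..n. blocks_ge ?L1 \<mu> k) <= 1"
    using blocks_ge_sum[OF alt_pencilD(1)[OF L1(1)] L1(2) order.refl, of \<mu>] by simp
   have m: "meets \<sigma> n 2 ?L1 ?L2 (Fin \<mu>)" using y True unfolding good_def by blast
   have "blocks_ge ?L2 \<mu> k = 0" if "k \<in> {1..n}" for k
   proof -
    have "blocks_ge ?L1 \<mu> k <= (\<Sum>k = 1..n. blocks_ge ?L1 \<mu> k)" by (rule member_le_sum[OF that]) auto
    thus ?thesis using b1 m \<mu>(1) that by simp
   qed
   hence "(\<Sum>k = 1..n. blocks_ge ?L2 \<mu> k) = 0" by simp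
   thus ?thesis using blocks_ge_sum[OF alt_pencilD(1)[OF L2(1)] L2(2) order.refl, of \<mu>] by simp
  qed
  ultimately have g: "good \<sigma> n r S L ?L2" unfolding good_def using L2(2) by blast
  obtain v0 \<gamma>0 \<delta>0 u0 where e: "Phi \<sigma> n r' x = struct_pert \<sigma> n r' v0 \<gamma>0 \<delta>0 u0" using Phi_eq_struct_pert by blast
  obtain x' where x': "x' \<in> carrier_vec ((3 * r div 2) * n)" "Phi \<sigma> n r x' = struct_pert \<sigma> n (r' + 2) (v0(r' div 2 := v))
    (\<gamma>0(r' div 2 := \<gamma>)) (\<delta>0(r' div 2 := \<delta>)) u0"
   unfolding 3 by (rule Phi_surj)
  have "L + Phi \<sigma> n r x' = ?L2"
   unfolding x'(2) struct_pert_add[symmetric] e[symmetric]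
   by (rule assoc_add_mat[OF Lc, symmetric]) auto
  thus ?thesis using g x'(1) by metis
 qed
qed


section \<open>Simple roots are an open condition\<close>

text \<open>The rows of the Sylvester matrix of \<open>c\<close> and \<open>c'\<close> for the formal degrees \<open>D\<close> and \<open>D - 1\<close>: the coefficients of
 \<open>X\<^sup>i c\<close> and of \<open>X\<^sup>k c'\<close>. With a fixed formal degree the determinant is polynomial in the coefficients of \<open>c\<close>.\<close>

definition deriv_row :: "nat => complex poly => nat => complex poly" where
 "deriv_row D c i = (if i < D - 1 then monom 1 i * c else monom 1 (i - (D - 1)) * pderiv c)"

definition deriv_mat :: "nat => complex poly => complex mat" where
 "deriv_mat D c = mat (D - 1 + D) (D - 1 + D) (\<lambda>(i, j). coeff (deriv_row D c i) j)"

lemma degree_deriv_row: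
 assumes "degree c <= D" "i < D - 1 + D"
 shows "degree (deriv_row D c i) < D - 1 + D"
proof -
 have "degree (monom (1 :: complex) k * p) <= k + degree p" for k p
  using degree_mult_le[of "monom 1 k" p] degree_monom_le[of "1 :: complex" k] by linarith
 from this[of i c] this[of "i - (D - 1)" "pderiv c"] show ?thesis
  using assms degree_pderiv_le[of c] unfolding deriv_row_def by (cases "i < D - 1") auto
qed

text \<open>A common root \<open>\<mu>\<close> gives the kernel vector \<open>(1, \<mu>, \<mu>\<^sup>2, \<dots>)\<close>.\<close>

lemma deriv_mat_common_root:
 assumes deg: "degree c <= D" and D: "0 < D" and mu: "poly c \<mu> = 0" "poly (pderiv c) \<mu> = 0"
 shows "det (deriv_mat D c) = 0"
proof -
 let ?N = "D - 1 + D"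
 define y where "y = vec ?N (\<lambda>j. \<mu> ^ j)"
 have Mc: "deriv_mat D c \<in> carrier_mat ?N ?N" unfolding deriv_mat_def by simp
 have "(deriv_mat D c *\<^sub>v y) $ i = 0" if i: "i < ?N" for i
 proof -
  have "(deriv_mat D c *\<^sub>v y) $ i = (\<Sum>j<?N. coeff (deriv_row D c i) j * \<mu> ^ j)"
   using mult_mat_vec_sum[OF Mc _ i, of y] i unfolding deriv_mat_def y_def by simp
  also have "\<dots> = (\<Sum>j\<le>degree (deriv_row D c i). coeff (deriv_row D c i) j * \<mu> ^ j)"
   by (rule sum.mono_neutral_right) (use degree_deriv_row[OF deg i] in \<open>auto simp: coeff_eq_0\<close>)
  also have "\<dots> = poly (deriv_row D c i) \<mu>" unfolding poly_altdef ..
  also have "\<dots> = 0" using mu unfolding deriv_row_def by simp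
  finally show ?thesis .
 qed
 hence "deriv_mat D c *\<^sub>v y = 0\<^sub>v ?N" using Mc by (intro eq_vecI) (auto simp del: index_mult_mat_vec)
 moreover have "y ~= 0\<^sub>v ?N"
 proof
  assume "y = 0\<^sub>v ?N"
  hence "y $ 0 = 0\<^sub>v ?N $ 0" by simp
  thus False using D unfolding y_def by simp
 qed
 moreover have "y \<in> carrier_vec ?N" unfolding y_def by simp
 ultimately show ?thesis using det_0_iff_vec_prod_zero[OF Mc] by blast
qed

text \<open>A left kernel vector gives a relation \<open>U c + V c' = 0\<close> with \<open>V\<close> of degree less than \<open>D\<close>. But \<open>V\<close> vanishes at
 the \<open>D\<close> distinct roots of \<open>c\<close>.\<close>

lemma deriv_mat_coprime:
 assumes deg: "degree c = D" and c: "c ~= 0" and cop: "!!\<mu>. poly c \<mu> = 0 ==> poly (pderiv c) \<mu> ~= 0"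
 shows "det (deriv_mat D c) ~= 0"
proof
 let ?N = "D - 1 + D"
 have Mc: "deriv_mat D c \<in> carrier_mat ?N ?N" unfolding deriv_mat_def by simp
 assume "det (deriv_mat D c) = 0"
 hence "det ((deriv_mat D c)\<^sup>T) = 0" using det_transpose[OF Mc] by simp
 then obtain w where w: "w \<in> carrier_vec ?N" "w ~= 0\<^sub>v ?N" "(deriv_mat D c)\<^sup>T *\<^sub>v w = 0\<^sub>v ?N"
  using det_0_iff_vec_prod_zero[of "(deriv_mat D c)\<^sup>T" ?N] Mc by auto
 define U where "U = (\<Sum>i<D - 1. monom (w $ i) i)"
 define V where "V = (\<Sum>k<D. monom (w $ (D - 1 + k)) k)"
 have split: "(\<Sum>i<a + b. f i) = (\<Sum>i<a. f i) + (\<Sum>k<b. f (a + k))" for f :: "nat => complex poly" and a b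
  by (induction b) (auto simp: add.assoc)
 have "(\<Sum>i<?N. Polynomial.smult (w $ i) (deriv_row D c i)) = 0"
 proof (rule poly_eqI)
  fix j
  show "coeff (\<Sum>i<?N. Polynomial.smult (w $ i) (deriv_row D c i)) j = coeff 0 j"
  proof (cases "j < ?N")
   case True
   have Mt: "(deriv_mat D c)\<^sup>T \<in> carrier_mat ?N ?N" using Mc by simp
   have "((deriv_mat D c)\<^sup>T *\<^sub>v w) $ j = (\<Sum>i<?N. coeff (deriv_row D c i) j * w $ i)"
    unfolding mult_mat_vec_sum[OF Mt w(1) True] using True by (intro sum.cong) (auto simp: deriv_mat_def)
   thus ?thesis unfolding w(3) using True by (simp add: coeff_sum mult.commute)
  next
   case False
   have "coeff (deriv_row D c i) j = 0" if "i < ?N" for i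
   proof (rule coeff_eq_0)
    show "degree (deriv_row D c i) < j" using degree_deriv_row[OF _ that, of c] deg False by linarith
   qed
   thus ?thesis by (simp add: coeff_sum)
  qed
 qed
 moreover have "(\<Sum>i<D - 1. Polynomial.smult (w $ i) (deriv_row D c i)) = U * c"
  unfolding U_def sum_distrib_right deriv_row_def by (intro sum.cong) (auto simp: smult_monom simp flip: mult_smult_left)
 moreover have "(\<Sum>k<D. Polynomial.smult (w $ (D - 1 + k)) (deriv_row D c (D - 1 + k))) = V * pderiv c"
  unfolding V_def sum_distrib_right deriv_row_def by (intro sum.cong) (auto simp: smult_monom simp flip: mult_smult_left)
 ultimately have rel: "U * c + V * pderiv c = 0" using split by simp
 have cf: "coeff V k = (if k < D then w $ (D - 1 + k) else 0)" "coeff U k = (if k < D - 1 then w $ k else 0)" for k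
  unfolding U_def V_def by (simp_all add: coeff_sum if_distrib cong: if_cong)
 have V: "V = 0"
 proof (rule ccontr)
  assume V: "V ~= 0"
  have "{z. poly c z = 0} \<subseteq> {z. poly V z = 0}"
  proof
   fix z assume "z \<in> {z. poly c z = 0}"
   hence z: "poly c z = 0" by simp
   have "poly (U * c + V * pderiv c) z = 0" unfolding rel by simp
   thus "z \<in> {z. poly V z = 0}" using z cop[OF z] by simp
  qed
  hence "card {z. poly c z = 0} <= card {z. poly V z = 0}" by (rule card_mono[OF poly_roots_finite[OF V]])
  moreover have "card {z. poly c z = 0} = D"
  proof -
   have "rsquarefree c" unfolding rsquarefree_roots using cop by blast
   thus ?thesis using rsquarefree_card_degree[OF c] deg by simp
  qed
  ultimately have "D <= degree V" using card_poly_roots_bound[OF V] by linarith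
  hence "coeff V (degree V) = 0" using cf(1)[of "degree V"] by simp
  thus False using V by simp
 qed
 hence U: "U = 0" using rel c by simp
 have "w $ i = 0" if "i < ?N" for i
 proof (cases "i < D - 1")
  case True
  thus ?thesis using cf(2)[of i] U by simp
 next
  case False
  thus ?thesis using cf(1)[of "i - (D - 1)"] V that by (auto split: if_splits)
 qed
 hence "w = 0\<^sub>v ?N" using w(1) by (intro eq_vecI) auto
 thus False using w(2) by blast
qed

text \<open>For \<open>D = 0\<close> the determinant is 1, and the factor \<open>coeff c D\<close> excludes the zero polynomial.\<close>

lemma simple_roots_open:
 assumes c: "polyfun_poly m c" and x0: "c x0 ~= 0" "degree (c x0) = D" "!!\<mu>. poly (c x0) \<mu> = 0 ==> poly (pderiv (c x0)) \<mu> ~= 0"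
 obtains f where "polyfun m f" "f x0 ~= 0"
  "!!x \<mu>. f x ~= 0 ==> degree (c x) <= D ==> order \<mu> (c x) <= 1"
proof -
 have row: "polyfun_poly m (\<lambda>x. deriv_row D (c x) i)" for i
  unfolding deriv_row_def by (cases "i < D - 1") (auto intro!: polyfun_poly_mult polyfun_poly_const polyfun_poly_pderiv c)
 have pd: "polyfun m (\<lambda>x. det (deriv_mat D (c x)))"
 proof (rule polyfun_det)
  fix i j assume "i < D - 1 + D" "j < D - 1 + D"
  thus "polyfun m (\<lambda>x. deriv_mat D (c x) $$ (i,j))" unfolding deriv_mat_def using polyfun_poly_coeff[OF row] by simp
 qed (simp add: deriv_mat_def)
 show ?thesis
 proof (rule that[OF polyfun_mult[OF pd polyfun_poly_coeff[OF c, of D]]])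
  have "coeff (c x0) D ~= 0" using x0(1,2) by auto
  thus "det (deriv_mat D (c x0)) * coeff (c x0) D ~= 0" using deriv_mat_coprime[OF x0(2,1,3)] by simp
 next
  fix x \<mu> assume "det (deriv_mat D (c x)) * coeff (c x) D ~= 0" and deg: "degree (c x) <= D"
  hence nz: "det (deriv_mat D (c x)) ~= 0" "coeff (c x) D ~= 0" by auto
  show "order \<mu> (c x) <= 1"
  proof (rule ccontr)
   assume "\<not> ?thesis"
   hence two: "2 <= order \<mu> (c x)" by simp
   show False
   proof (cases "D = 0")
    case False
    thus ?thesis using deriv_mat_common_root[OF deg _ double_root[OF two]] nz by simp
   next
    case True
    have "order \<mu> (c x) <= degree (c x)" using nz(2) by (intro order_degree) auto
    thus ?thesis using two deg True by simp
   qed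
  qed
 qed
qed

lemma prod_order_dvd:
 fixes p :: "complex poly"
 assumes "finite A" "p ~= 0"
 shows "(\<Prod>\<mu>\<in>A. [:-\<mu>,1:] ^ order \<mu> p) dvd p"
 using assms(1)
proof induction
 case (insert a A)
 let ?G = "\<Prod>\<mu>\<in>A. [:-\<mu>,1:] ^ order \<mu> p"
 obtain r where r: "p = ?G * r" using insert.IH by (elim dvdE)
 have "poly ?G a ~= 0" using insert.hyps by (auto simp: poly_prod poly_power prod_zero_iff)
 hence "order a ?G = 0" by (rule order_0I)
 moreover have "order a p = order a ?G + order a r" using order_mult[of ?G r a] assms(2) r by metis
 ultimately have "order a p = order a r" by simp
 hence "[:-a,1:] ^ order a p dvd r" by (metis order_1)
 hence "?G * [:-a,1:] ^ order a p dvd ?G * r" by (rule mult_dvd_mono[OF dvd_refl])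
 hence "?G * [:-a,1:] ^ order a p dvd p" using r by metis
 thus ?case unfolding prod.insert[OF insert.hyps] by (subst mult.commute)
qed simp

lemma order_prod_lin:
 fixes \<mu> :: complex
 assumes "finite A" "\<mu> \<notin> A"
 shows "order \<mu> (\<Prod>a\<in>A. [:-a,1:] ^ k a) = 0"
proof (rule order_0I)
 show "poly (\<Prod>a\<in>A. [:-a,1:] ^ k a) \<mu> ~= 0" using assms by (auto simp: poly_prod poly_power prod_zero_iff)
qed

section \<open>The generic set\<close>

text \<open>On the set where all prescribed points behave as claimed, the orders of the determinant at these
 points and its degree are constant. So the cofactor \<open>c\<close> of the prescribed part \<open>g\<close> has constant degree, and
 simplicity of its roots is an open condition, which holds for one good perturbation.\<close>

theorem good_generic:
 assumes L: "alt_pencil \<sigma> n L" "det L ~= 0" and S: "finite S" "!!\<mu>. poly (det L) \<mu> = 0 ==> \<mu> \<in> S \<union> {0}"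
 obtains G where "generic ((3 * r div 2) * n) G" "\<forall>x\<in>G. good \<sigma> n r S L (L + Phi \<sigma> n r x)"
proof -
 note Lc = alt_pencilD(2)[OF L(1)]
 let ?m = "(3 * r div 2) * n" and ?Z = "Fin ` S \<union> {Fin 0, Infty}" and ?F = "\<lambda>x. L + Phi \<sigma> n r x" and ?S = "insert 0 S"
 have FA: "alt_pencil \<sigma> n (?F x)" for x by (rule alt_pencil_add[OF L(1) alt_Phi])
 have Z: "finite ?Z" "?Z ~= {}" using S(1) by auto
 obtain x1 where x1: "x1 \<in> carrier_vec ?m" and g1: "good \<sigma> n r S L (?F x1)" using good_exists[OF L S] by blast
 have wit: "\<exists>x \<in> carrier_vec ?m. det (?F x) ~= 0 \<and> meets \<sigma> n r L (?F x) z" if "z \<in> ?Z" for z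
  using x1 g1 that unfolding good_def by blast
 obtain f x0 where f: "polyfun ?m f" and x0: "x0 \<in> carrier_vec ?m" "f x0 ~= 0" and
  ok: "\<forall>x \<in> carrier_vec ?m. f x ~= 0 \<longrightarrow> det (?F x) ~= 0 \<and> (\<forall>z\<in>?Z. meets \<sigma> n r L (?F x) z)"
  by (rule meets_generic[OF L Z wit]) auto
 define p1 where "p1 = det (?F x1)"
 have p1: "p1 ~= 0" using g1 unfolding good_def p1_def by blast
 \<comment> \<open>The prescribed part of the determinant.\<close>
 define g where "g = (\<Prod>\<mu>\<in>?S. [:-\<mu>,1:] ^ order \<mu> p1)"
 have gnz: "g ~= 0" unfolding g_def using S(1) by (simp add: prod_zero_iff)
 have same_order: "order \<mu> (det (?F x)) = order \<mu> p1" if x: "det (?F x) ~= 0" "\<forall>z\<in>?Z. meets \<sigma> n r L (?F x) z" and \<mu>: "\<mu> \<in> ?S" for x \<mu>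
 proof -
  have m: "meets \<sigma> n r L (?F x) (Fin \<mu>)" "meets \<sigma> n r L (?F x1) (Fin \<mu>)" using x(2) g1 \<mu> unfolding good_def by auto
  have "(\<Sum>k = 1..n. blocks_ge (?F x) \<mu> k) = (\<Sum>k = 1..n. blocks_ge (?F x1) \<mu> k)"
   using m by (intro sum.cong) (auto simp del: target.simps)
  thus ?thesis using blocks_ge_sum[OF alt_pencilD(1)[OF FA] x(1) order.refl, of \<mu>]
    blocks_ge_sum[OF alt_pencilD(1)[OF FA] p1[unfolded p1_def] order.refl, of \<mu>] unfolding p1_def by simp
 qed
 have same_degree: "degree (det (?F x)) = degree p1" if x: "det (?F x) ~= 0" "\<forall>z\<in>?Z. meets \<sigma> n r L (?F x) z" for x
 proof -
  let ?R = "\<lambda>x. rev_pencil (?F x)"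
  have R: "is_pencil n (?R x)" for x by (rule alt_pencilD(1)[OF alt_rev_pencil[OF FA]])
  have Rd: "det (?R x) ~= 0" "det (?R x1) ~= 0" using det_rev_eq_0_iff[OF alt_pencilD(1)[OF FA]] x(1) p1 unfolding p1_def by auto
  have m: "meets \<sigma> n r L (?F x) Infty" "meets \<sigma> n r L (?F x1) Infty" using x(2) g1 unfolding good_def by auto
  have "(\<Sum>k = 1..n. blocks_ge (?R x) 0 k) = (\<Sum>k = 1..n. blocks_ge (?R x1) 0 k)"
   using m by (intro sum.cong) (auto simp del: target.simps)
  hence "order 0 (det (?R x)) = order 0 (det (?R x1))"
   using blocks_ge_sum[OF R Rd(1) order.refl, of 0] blocks_ge_sum[OF R Rd(2) order.refl, of 0] by simp
  thus ?thesis using order_det_rev[OF alt_pencilD(1)[OF FA] x(1)] order_det_rev[OF alt_pencilD(1)[OF FA] p1[unfolded p1_def]]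
   unfolding p1_def by linarith
 qed
 define c where "c = (\<lambda>x. det (?F x) div g)"
 have fac: "det (?F x) = g * c x \<and> c x ~= 0 \<and> degree (c x) = degree p1 - degree g \<and>
   (\<forall>\<mu>. order \<mu> (det (?F x)) = order \<mu> g + order \<mu> (c x))"
  if x: "det (?F x) ~= 0" "\<forall>z\<in>?Z. meets \<sigma> n r L (?F x) z" for x
 proof -
  have "g = (\<Prod>\<mu>\<in>?S. [:-\<mu>,1:] ^ order \<mu> (det (?F x)))" unfolding g_def using same_order[OF x] by (intro prod.cong) auto
  hence "g dvd det (?F x)" using prod_order_dvd[OF _ x(1), of ?S] S(1) by simp
  hence e: "det (?F x) = g * c x" unfolding c_def by simp
  hence nz: "c x ~= 0" "g * c x ~= 0" using x(1) by auto
  have "degree (c x) = degree p1 - degree g" using same_degree[OF x] degree_mult_eq[OF gnz nz(1)] unfolding e[symmetric] by simp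
  moreover have "order \<mu> (det (?F x)) = order \<mu> g + order \<mu> (c x)" for \<mu> unfolding e by (rule order_mult[OF nz(2)])
  ultimately show ?thesis using e nz(1) by blast
 qed
 have x1ok: "det (?F x1) ~= 0" "\<forall>z\<in>?Z. meets \<sigma> n r L (?F x1) z" using g1 unfolding good_def by auto
 have sq: "poly (pderiv (c x1)) \<mu> ~= 0" if root: "poly (c x1) \<mu> = 0" for \<mu>
 proof -
  note fx = fac[OF x1ok]
  have o: "order \<mu> (c x1) ~= 0" using fx root by (simp add: order_root)
  have "order \<mu> (c x1) <= 1"
  proof (cases "\<mu> \<in> ?S")
   case False
   thus ?thesis using g1 fx unfolding good_def by (metis add_leD2 insertCI)
  next
   case True
   have "g = [:-\<mu>,1:] ^ order \<mu> p1 * (\<Prod>a\<in>?S - {\<mu>}. [:-a,1:] ^ order a p1)"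
    unfolding g_def using True S(1) by (subst prod.remove[of _ \<mu>]) auto
   hence "order \<mu> g = order \<mu> p1 + 0"
    using order_mult[of "[:-\<mu>,1:] ^ order \<mu> p1" "\<Prod>a\<in>?S - {\<mu>}. [:-a,1:] ^ order a p1" \<mu>] gnz
     order_prod_lin[of "?S - {\<mu>}" \<mu>] S(1) order_lin_power by simp
   moreover have "order \<mu> (det (?F x1)) = order \<mu> g + order \<mu> (c x1)" using fx by blast
   ultimately show ?thesis unfolding p1_def by linarith
  qed
  hence "order \<mu> (c x1) = 1" using o by simp
  moreover have "order \<mu> (c x1) = Suc (order \<mu> (pderiv (c x1)))" using order_pderiv[OF _ root] fx by blast
  ultimately have o0: "order \<mu> (pderiv (c x1)) = 0" by simp
  have "pderiv (c x1) ~= 0"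
  proof
   assume "pderiv (c x1) = 0"
   then obtain a where "c x1 = [:a:]" using pderiv_iszero by blast
   thus False using root fx by simp
  qed
  thus ?thesis using o0 by (simp add: order_root)
 qed
 have pc: "polyfun_poly ?m c" unfolding c_def by (intro polyfun_poly_div polyfun_det_Phi Lc)
 obtain h where h: "polyfun ?m h" "h x1 ~= 0" "!!x \<mu>. h x ~= 0 ==> degree (c x) <= degree p1 - degree g ==> order \<mu> (c x) <= 1"
  by (rule simple_roots_open[OF pc, of x1 "degree p1 - degree g"]) (use fac[OF x1ok] sq in blast)+
 obtain y where y: "y \<in> carrier_vec ?m" "f y ~= 0" "h y ~= 0" by (rule polyfun_common_nonzero[OF f x0 h(1) x1 h(2)])
 show ?thesis
 proof (rule that)
  show "generic ?m {x \<in> carrier_vec ?m. f x * h x ~= 0}"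
   by (rule generic_nonzero_set[OF polyfun_mult[OF f h(1)] y(1)]) (use y in simp)
  show "\<forall>x \<in> {x \<in> carrier_vec ?m. f x * h x ~= 0}. good \<sigma> n r S L (?F x)"
  proof
  fix x assume "x \<in> {x \<in> carrier_vec ?m. f x * h x ~= 0}"
  hence x: "x \<in> carrier_vec ?m" "f x ~= 0" "h x ~= 0" by auto
  have okx: "det (?F x) ~= 0" "\<forall>z\<in>?Z. meets \<sigma> n r L (?F x) z" using ok x by auto
  have "order \<mu> (det (?F x)) <= 1" if "\<mu> ~= 0" "\<mu> \<notin> S" for \<mu>
  proof -
   have "order \<mu> g = 0" unfolding g_def by (rule order_prod_lin) (use S(1) that in auto)
   moreover have "order \<mu> (c x) <= 1" by (rule h(3)[OF x(3)]) (use fac[OF okx] in simp)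
   moreover have "order \<mu> (det (?F x)) = order \<mu> g + order \<mu> (c x)" using fac[OF okx] by blast
   ultimately show ?thesis by linarith
  qed
  thus "good \<sigma> n r S L (?F x)" using okx unfolding good_def by blast
  qed
 qed
qed

text \<open>The numbers \<open>\<nu> k\<close> are turned back into lists.\<close>

lemma partial_mults_at_zero:
 assumes M: "alt_pencil \<sigma> n M" "det M ~= 0" and M': "is_pencil n M'" "det M' ~= 0" and r: "1 <= r"
  and t: "!!k. 1 <= k ==> blocks_ge M' 0 k = target \<sigma> n r (blocks_ge M 0) k"
 shows "finite_partial_mults M' 0 = zero_mults \<sigma> n r (finite_partial_mults M 0)"
proof -
 note p = finite_partial_mults_props[OF alt_pencilD(1)[OF M(1)] M(2), of 0]
 note p' = finite_partial_mults_props[OF M', of 0]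
 note z = zero_mults_exponents[OF p(1,2) r admissible_blocks[OF M]]
 show ?thesis by (rule sorted_desc_unique[OF _ p'(2) z(3) p'(1) z(2)]) (simp only: t z(1))
qed

lemma partial_mults_away_from_zero:
 assumes M: "is_pencil n M" "det M ~= 0" and M': "is_pencil n M'" "det M' ~= 0"
  and t: "!!k. 1 <= k ==> blocks_ge M' \<mu> k = blocks_ge M \<mu> k - r"
 shows "finite_partial_mults M' \<mu> = drop r (finite_partial_mults M \<mu>)"
proof -
 note p = finite_partial_mults_props[OF M, of \<mu>]
 note p' = finite_partial_mults_props[OF M', of \<mu>]
 have "sorted (rev (drop r (finite_partial_mults M \<mu>)))" using p(1) by (simp add: rev_drop sorted_wrt_take)
 moreover have "\<forall>x \<in> set (drop r (finite_partial_mults M \<mu>)). 0 < x" using p(2) by (meson in_set_dropD)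
 ultimately show ?thesis
  by (intro sorted_desc_unique[OF _ p'(2) _ p'(1)]) (simp_all only: t exponents_ge_drop[OF p(1)])
qed

lemma blocks_ge_1: "is_pencil n M ==> det M ~= 0 ==> blocks_ge M \<mu> 1 = length (finite_partial_mults M \<mu>)"
proof -
 assume "is_pencil n M" "det M ~= 0"
 from finite_partial_mults_props(2)[OF this, of \<mu>]
 have "filter (\<lambda>m. 1 <= m) (finite_partial_mults M \<mu>) = finite_partial_mults M \<mu>" by (auto simp: filter_id_conv)
 thus ?thesis unfolding exponents_ge_def by simp
qed

lemma no_eigenvalue:
 assumes "is_pencil n M" "det M ~= 0" "blocks_ge M \<mu> 1 = 0"
 shows "poly (det M) \<mu> ~= 0"
proof -
 have "finite_partial_mults M \<mu> = []" using blocks_ge_1[OF assms(1,2), of \<mu>] assms(3) by simp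
 hence "order \<mu> (det M) = 0" using finite_partial_mults_props(3)[OF assms(1,2), of \<mu>] by simp
 thus ?thesis using assms(2) by (simp add: order_root)
qed

lemma no_partial_mults:
 assumes "is_pencil n M" "det M ~= 0" "poly (det M) \<mu> ~= 0"
 shows "finite_partial_mults M \<mu> = []"
proof -
 have "sum_list (finite_partial_mults M \<mu>) = 0"
  using finite_partial_mults_props(3)[OF assms(1,2), of \<mu>] order_0I[OF assms(3)] by simp
 thus ?thesis using finite_partial_mults_props(2)[OF assms(1,2), of \<mu>] by (cases "finite_partial_mults M \<mu>") auto
qed

lemma target_first_0: "\<nu> 1 <= r ==> (\<sigma> = T_odd ==> even n) ==> target \<sigma> n r \<nu> 1 = 0"
 by (cases \<sigma>) (auto simp: repair_def)

theorem theorem19: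
  fixes L :: "complex poly mat" and n r :: nat and \<sigma> :: alternation
  assumes "alternating_pencil \<sigma> n L"
    and "regular_pencil L"
    and "r > 0"
  shows "\<exists>G. generic ((3 * r div 2) * n) G \<and>
    (\<forall>E \<in> Phi \<sigma> n r ` G.
       regular_pencil (L + E) \<and>
       (\<forall>z. pencil_eigenvalue L z \<longrightarrow>
          partial_mults (L + E) z =
            (if z = skew_point \<sigma> \<and> length (partial_mults L z) < r \<and> even n \<noteq> even r
             then (if odd n then [1] else [])
             else perturbed_mults \<sigma> r z (partial_mults L z))) \<and>
       (\<forall>z. pencil_eigenvalue L z \<and> r \<ge> length (partial_mults L z) \<and>
            \<not> (z = skew_point \<sigma> \<and> odd n) \<longrightarrow>
          \<not> pencil_eigenvalue (L + E) z) \<and>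
       (\<forall>z. pencil_eigenvalue (L + E) z \<and> \<not> pencil_eigenvalue L z \<longrightarrow>
          simple_eigenvalue (L + E) z))"
proof -
 have L: "alt_pencil \<sigma> n L" "det L ~= 0"
  using alternating_pencil_imp_alt_pencil[OF assms(1)] assms(2) unfolding regular_pencil_def by auto
 note Lp = alt_pencilD(1)[OF L(1)] and Lc = alt_pencilD(2)[OF L(1)]
 have r: "1 <= r" using assms(3) by simp
 define S where "S = {\<mu>. poly (det L) \<mu> = 0} - {0}"
 have S: "finite S" "!!\<mu>. poly (det L) \<mu> = 0 ==> \<mu> \<in> S \<union> {0}"
  unfolding S_def using poly_roots_finite[OF L(2)] by auto
 have rL: "alt_pencil (dual \<sigma>) n (rev_pencil L)" "det (rev_pencil L) ~= 0"
  using alt_rev_pencil[OF L(1)] det_rev_eq_0_iff[OF Lp] L(2) by auto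
 obtain G where G: "generic ((3 * r div 2) * n) G" "\<forall>x\<in>G. good \<sigma> n r S L (L + Phi \<sigma> n r x)"
  by (rule good_generic[OF L S, where r = r])
 have main: "regular_pencil (L + E) \<and>
    (\<forall>z. pencil_eigenvalue L z \<longrightarrow>
     partial_mults (L + E) z =
      (if z = skew_point \<sigma> \<and> length (partial_mults L z) < r \<and> even n ~= even r
       then (if odd n then [1] else [])
       else perturbed_mults \<sigma> r z (partial_mults L z))) \<and>
    (\<forall>z. pencil_eigenvalue L z \<and> r \<ge> length (partial_mults L z) \<and>
      \<not> (z = skew_point \<sigma> \<and> odd n) \<longrightarrow>
     \<not> pencil_eigenvalue (L + E) z) \<and>
    (\<forall>z. pencil_eigenvalue (L + E) z \<and> \<not> pencil_eigenvalue L z \<longrightarrow>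
     simple_eigenvalue (L + E) z)" if "E \<in> Phi \<sigma> n r ` G" for E
 proof -
  obtain x where x: "x \<in> G" "E = Phi \<sigma> n r x" using \<open>E \<in> Phi \<sigma> n r ` G\<close> by blast
  let ?M = "L + E"
  have M: "alt_pencil \<sigma> n ?M" unfolding x(2) by (rule alt_pencil_add[OF L(1) alt_Phi])
  note Mp = alt_pencilD(1)[OF M]
  have g: "good \<sigma> n r S L ?M" unfolding x(2) using G(2) x(1) by blast
  have d: "det ?M ~= 0" using g unfolding good_def by blast
  have rM: "is_pencil n (rev_pencil ?M)" "det (rev_pencil ?M) ~= 0"
   using alt_pencilD(1)[OF alt_rev_pencil[OF M]] det_rev_eq_0_iff[OF Mp] d by auto
  have at0: "blocks_ge ?M 0 k = target \<sigma> n r (blocks_ge L 0) k" if "1 <= k" for k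
  proof -
   have "meets \<sigma> n r L ?M (Fin 0)" using g unfolding good_def by blast
   thus ?thesis using that unfolding meets.simps by presburger
  qed
  have atinf: "blocks_ge (rev_pencil ?M) 0 k = target (dual \<sigma>) n r (blocks_ge (rev_pencil L) 0) k" if "1 <= k" for k
  proof -
   have "meets \<sigma> n r L ?M Infty" using g unfolding good_def by blast
   thus ?thesis using that unfolding meets.simps by presburger
  qed
  have atmu: "blocks_ge ?M \<mu> k = blocks_ge L \<mu> k - r" if "poly (det L) \<mu> = 0" "\<mu> ~= 0" "1 <= k" for \<mu> k
  proof -
   have "meets \<sigma> n r L ?M (Fin \<mu>)" using g that unfolding good_def S_def by blast
   thus ?thesis using that unfolding meets.simps by presburger
  qed
  have c1: "partial_mults ?M z = (if z = skew_point \<sigma> \<and> length (partial_mults L z) < r \<and> even n ~= even r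
       then (if odd n then [1] else []) else perturbed_mults \<sigma> r z (partial_mults L z))"
   if ev: "pencil_eigenvalue L z" for z
  proof (cases z)
   case (Fin \<mu>)
   show ?thesis
   proof (cases "\<mu> = 0")
    case True
    show ?thesis unfolding Fin True using partial_mults_at_zero[OF L Mp d r at0] by (cases \<sigma>) auto
   next
    case False
    have "poly (det L) \<mu> = 0" using ev unfolding Fin by simp
    from partial_mults_away_from_zero[OF Lp L(2) Mp d atmu[OF this False]] show ?thesis
     using False unfolding Fin by (cases \<sigma>) auto
   qed
  next
   case Infty
   show ?thesis unfolding Infty using partial_mults_at_zero[OF rL rM r atinf] by (cases \<sigma>) auto
  qed
  have c2: "\<not> pencil_eigenvalue ?M z" if ev: "pencil_eigenvalue L z" "length (partial_mults L z) <= r" "\<not> (z = skew_point \<sigma> \<and> odd n)" for z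
  proof (cases z)
   case (Fin \<mu>)
   show ?thesis
   proof (cases "\<mu> = 0")
    case True
    have "blocks_ge L 0 1 <= r" using ev(2) blocks_ge_1[OF Lp L(2), of 0] unfolding Fin True by simp
    moreover have "\<sigma> = T_odd ==> even n" using ev(3) unfolding Fin True by auto
    ultimately have "blocks_ge ?M 0 1 = 0" using at0[of 1] target_first_0[of "blocks_ge L 0" r \<sigma> n] by simp
    from no_eigenvalue[OF Mp d this] show ?thesis unfolding Fin True by simp
   next
    case False
    have "blocks_ge L \<mu> 1 <= r" using ev(2) blocks_ge_1[OF Lp L(2), of \<mu>] unfolding Fin by simp
    hence "blocks_ge ?M \<mu> 1 = 0" using atmu[of \<mu> 1] False ev(1) unfolding Fin by simp
    from no_eigenvalue[OF Mp d this] show ?thesis unfolding Fin by simp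
   qed
  next
   case Infty
   have "blocks_ge (rev_pencil L) 0 1 <= r"
    using ev(2) blocks_ge_1[OF alt_pencilD(1)[OF rL(1)] rL(2), of 0] unfolding Infty by simp
   moreover have "dual \<sigma> = T_odd ==> even n" using ev(3) unfolding Infty by (cases \<sigma>) auto
   ultimately have "blocks_ge (rev_pencil ?M) 0 1 = 0"
    using atinf[of 1] target_first_0[of "blocks_ge (rev_pencil L) 0" r "dual \<sigma>" n] by simp
   from no_eigenvalue[OF rM this] show ?thesis unfolding Infty by simp
  qed
  have empty_parity: "\<sigma>' = T_odd ==> even n" if "alt_pencil \<sigma>' n N" "det N ~= 0" "blocks_ge N 0 1 = 0" for \<sigma>' N
   using admissible_first[of n "blocks_ge N 0"] admissible_blocks[OF that(1,2)] that(3) by (cases \<sigma>') auto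
  have c3: "simple_eigenvalue ?M z" if ev: "pencil_eigenvalue ?M z" "\<not> pencil_eigenvalue L z" for z
  proof (cases z)
   case (Fin \<mu>)
   have nr: "poly (det L) \<mu> ~= 0" using ev(2) unfolding Fin by simp
   have rt: "poly (det ?M) \<mu> = 0" using ev(1) unfolding Fin by simp
   have "\<mu> ~= 0"
   proof
    assume z: "\<mu> = 0"
    have b: "blocks_ge L 0 1 = 0" using blocks_ge_1[OF Lp L(2), of 0] no_partial_mults[OF Lp L(2) nr] unfolding z by simp
    hence "blocks_ge ?M 0 1 = 0" using at0[of 1] target_first_0[of "blocks_ge L 0" r \<sigma> n] empty_parity[OF L b] by simp
    from no_eigenvalue[OF Mp d this] show False using rt z by simp
   qed
   hence "order \<mu> (det ?M) <= 1" using g nr unfolding good_def S_def by blast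
   moreover have "order \<mu> (det ?M) ~= 0" using rt d by (simp add: order_root)
   ultimately have "sum_list (finite_partial_mults ?M \<mu>) = 1" using finite_partial_mults_props(3)[OF Mp d, of \<mu>] by simp
   thus ?thesis using ev(1) unfolding simple_eigenvalue_def Fin by simp
  next
   case Infty
   have nr: "poly (det (rev_pencil L)) 0 ~= 0" using ev(2) unfolding Infty by simp
   have b: "blocks_ge (rev_pencil L) 0 1 = 0"
    using blocks_ge_1[OF alt_pencilD(1)[OF rL(1)] rL(2), of 0] no_partial_mults[OF alt_pencilD(1)[OF rL(1)] rL(2) nr] by simp
   hence "blocks_ge (rev_pencil ?M) 0 1 = 0"
    using atinf[of 1] target_first_0[of "blocks_ge (rev_pencil L) 0" r "dual \<sigma>" n] empty_parity[OF rL b] by simp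
   from no_eigenvalue[OF rM this] show ?thesis using ev(1) unfolding Infty by simp
  qed
  have reg: "regular_pencil ?M" unfolding regular_pencil_def by (rule d)
  have C2: "\<forall>z. pencil_eigenvalue L z \<and> r \<ge> length (partial_mults L z) \<and>
    \<not> (z = skew_point \<sigma> \<and> odd n) \<longrightarrow> \<not> pencil_eigenvalue ?M z"
   using c2 by blast
  have C3: "\<forall>z. pencil_eigenvalue ?M z \<and> \<not> pencil_eigenvalue L z \<longrightarrow> simple_eigenvalue ?M z"
   using c3 by blast
  show ?thesis by (rule conjI[OF reg conjI[OF _ conjI[OF C2 C3]]]) (intro allI impI c1)
 qed
 show ?thesis by (rule exI[of _ G]) (use G(1) main in blast)
qed

end
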